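(* Let $Y$ be an infinite-dimensional separable Hilbert space and let $B:D(B)\to Y$ be a positive self-adjoint operator with dense domain and compact resolvent. Consider in $X=L^2_{\mathrm{ul-s}}(\mathbb{R},Y)$ the operator $A=-\partial_{xx}^2+B$ with domain $D(A)=H^2_{\mathrm{ul-s}}(\mathbb{R},Y)\cap L^2_{\mathrm{ul-s}}(\mathbb{R},D(B))$. Then $A$ is a closed operator satisfying sectorial-like resolvent estimates, that is: there exist $\omega\in\mathbb{R}$, $\phi\in(0,\pi/2)$ and $M>0$ such that the sector $S_{\omega,\phi}=\{z\in\mathbb{C}\setminus\{\omega\}:\ \phi\le|\arg(z-\omega)|\le\pi\}$ is contained in the resolvent set of $A$ and $\|(z\,\mathrm{id}-A)^{-1}\|_{\mathcal{L}(X)}\le\frac{M}{|z-\omega|}$ for all $z\in S_{\omega,\phi}$. However, the domain $D(A)$ is not dense in $X$. Moreover, there exist functions $u_0\in L^2_{\mathrm{ul-s}}(\mathbb{R},Y)$ such that the associated semigroup trajectory $t\mapsto e^{-At}u_0$ is not continuous at $t=0$ in $L^2_{\mathrm{ul-s}}(\mathbb{R},Y)$ (i.e. $e^{-At}u_0$ does not converge to $u_0$ in $L^2_{\mathrm{ul-s}}(\mathbb{R},Y)$ as $t\to0^+$).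
   Context: Positive means $\langle Bu|u\rangle_Y\ge0$ for all $u\in D(B)$; $D(B)$ carries its graph norm. For a Banach space $E$, $\|u\|_{L^2_{\mathrm{ul}}(\mathbb{R},E)}=\sup_{a\in\mathbb{R}}\big(\int_a^{a+1}|u(x)|_E^2\,dx\big)^{1/2}$; $L^2_{\mathrm{ul-w}}(\mathbb{R},E)$ is the space of $u\in L^2_{\mathrm{loc}}(\mathbb{R},E)$ with finite norm, and $L^2_{\mathrm{ul-s}}(\mathbb{R},E)$ is the subspace of those $u\in L^2_{\mathrm{ul-w}}(\mathbb{R},E)$ such that $\|u-u(\cdot-\xi)\|_{L^2_{\mathrm{ul}}(\mathbb{R},E)}\to0$ as $\xi\to0$. $H^2_{\mathrm{ul-s}}(\mathbb{R},E)$ is the space of $u$ whose weak derivatives of order $\le2$ belong to $L^2_{\mathrm{ul-s}}(\mathbb{R},E)$. If $Y$ is real, resolvents are understood after complexification. For a closed operator $A$ with resolvent estimates as in the claim, the semigroup is defined for $t>0$ by $e^{-At}=\frac{1}{2i\pi}\int_\Gamma(\lambda+A)^{-1}e^{\lambda t}\,d\lambda$, where $\Gamma$ is a contour in the resolvent set of $-A$, running from $\infty e^{-i\psi}$ to $\infty e^{i\psi}$ with $\psi\in(\pi/2,\pi-\phi)$ and passing to the right of $-\omega$; at $t=0$ it is the identity. *)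

theory Defs
  imports "HOL-Analysis.Analysis"
begin

section \<open>Complex normed and inner product spaces\<close>

text \<open>
  A complex Hilbert space is a type of sort \<open>{complex_inner, banach}\<close>: the underlying real
  inner product is the real part of the complex one, so both induce the same norm.
\<close>

class scaleC =
  fixes scaleC :: "complex \<Rightarrow> 'a \<Rightarrow> 'a" (infixr "*\<^sub>C" 75)

class complex_vector = scaleC + real_vector +
  assumes scaleC_add_right: "a *\<^sub>C (x + y) = a *\<^sub>C x + a *\<^sub>C y"
    and scaleC_add_left: "(a + b) *\<^sub>C x = a *\<^sub>C x + b *\<^sub>C x"
    and scaleC_scaleC: "a *\<^sub>C b *\<^sub>C x = (a * b) *\<^sub>C x"
    and scaleC_of_real: "complex_of_real r *\<^sub>C x = r *\<^sub>R x"

class complex_normed_vector = complex_vector + real_normed_vector +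
  assumes norm_scaleC: "norm (a *\<^sub>C x) = cmod a * norm x"

class complex_inner = complex_vector + real_inner +
  fixes cinner :: "'a \<Rightarrow> 'a \<Rightarrow> complex"
  assumes cinner_commute: "cinner x y = cnj (cinner y x)"
    and cinner_add_left: "cinner (x + y) z = cinner x z + cinner y z"
    and cinner_scaleC_left: "cinner (a *\<^sub>C x) y = a * cinner x y"
    and inner_eq_Re_cinner: "inner x y = Re (cinner x y)"

lemma cinner_self: "cinner x x = complex_of_real (inner x x)"
proof -
  have "Im (cinner x x) = - Im (cinner x x)"
    by (subst cinner_commute) simp
  then show ?thesis
    by (simp add: complex_eq_iff inner_eq_Re_cinner)
qed

instance complex_inner \<subseteq> complex_normed_vector
proof
  fix a :: complex and x :: 'a
  have "cinner (a *\<^sub>C x) (a *\<^sub>C x) = a * cnj (a * cinner x x)"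
    by (metis cinner_scaleC_left cinner_commute)
  also have "\<dots> = of_real ((cmod a)\<^sup>2 * inner x x)"
    using complex_norm_square[of a] by (simp add: cinner_self)
  finally have "inner (a *\<^sub>C x) (a *\<^sub>C x) = (cmod a)\<^sup>2 * inner x x"
    by (simp add: inner_eq_Re_cinner)
  then show "norm (a *\<^sub>C x) = cmod a * norm x"
    by (simp add: norm_eq_sqrt_inner real_sqrt_mult)
qed

lemma bounded_linear_scaleC: "bounded_linear (\<lambda>x::'a::complex_normed_vector. a *\<^sub>C x)"
proof (rule bounded_linear_intro[where K = "cmod a"])
  fix r :: real and x :: 'a
  show "a *\<^sub>C (r *\<^sub>R x) = r *\<^sub>R (a *\<^sub>C x)"
    by (metis scaleC_of_real scaleC_scaleC mult.commute)
qed (simp_all add: scaleC_add_right norm_scaleC)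

section \<open>Complexification of a real Hilbert space\<close>

datatype 'a complexification = Cx (re_part: 'a) (im_part: 'a)

instantiation complexification :: (real_inner) real_inner
begin

definition "0 = Cx 0 0"
definition "z + w = Cx (re_part z + re_part w) (im_part z + im_part w)"
definition "z - w = Cx (re_part z - re_part w) (im_part z - im_part w)"
definition "- z = Cx (- re_part z) (- im_part z)"
definition "r *\<^sub>R z = Cx (r *\<^sub>R re_part z) (r *\<^sub>R im_part z)"
definition "inner z w = inner (re_part z) (re_part w) + inner (im_part z) (im_part w)"
definition norm_complexification_def: "norm (z :: 'a complexification) = sqrt (inner z z)"
definition sgn_complexification_def: "sgn (z :: 'a complexification) = inverse (norm z) *\<^sub>R z"
definition dist_complexification_def: "dist (z :: 'a complexification) w = norm (z - w)"
definition
  "(uniformity :: ('a complexification \<times> 'a complexification) filter)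
     = (INF e\<in>{0 <..}. principal {(x, y). dist x y < e})"
definition
  "open (U :: 'a complexification set)
     \<longleftrightarrow> (\<forall>x\<in>U. eventually (\<lambda>(x', y). x' = x \<longrightarrow> y \<in> U) uniformity)"

instance
proof
  fix x :: "'a complexification"
  show "0 \<le> inner x x" by (simp add: inner_complexification_def)
  show "(inner x x = 0) = (x = 0)"
    by (cases x) (simp add: inner_complexification_def zero_complexification_def
        add_nonneg_eq_0_iff)
qed (simp_all add: zero_complexification_def plus_complexification_def
    minus_complexification_def uminus_complexification_def scaleR_complexification_def
    inner_complexification_def norm_complexification_def sgn_complexification_def
    dist_complexification_def uniformity_complexification_def open_complexification_def
    algebra_simps inner_commute)

end

instantiation complexification :: (real_inner) complex_inner
begin

definition "a *\<^sub>C z = Cx (Re a *\<^sub>R re_part z - Im a *\<^sub>R im_part z) (Im a *\<^sub>R re_part z + Re a *\<^sub>R im_part z)"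
definition "cinner z w = Complex (inner (re_part z) (re_part w) + inner (im_part z) (im_part w))
    (inner (im_part z) (re_part w) - inner (re_part z) (im_part w))"

instance
  by standard (simp_all add: scaleC_complexification_def plus_complexification_def
      scaleR_complexification_def cinner_complexification_def inner_complexification_def
      complex_eq_iff algebra_simps inner_commute)

end

lemma dist_complexification:
  "dist z w = dist (re_part z, im_part z) (re_part w, im_part w)"
  for z w :: "'a::real_inner complexification"
  by (simp add: dist_complexification_def dist_norm norm_eq_sqrt_inner minus_complexification_def
      inner_complexification_def inner_Pair)

instance complexification :: ("{real_inner, complete_space}") complete_space
proof
  fix X :: "nat \<Rightarrow> 'a complexification"
  assume X: "Cauchy X"
  then have "Cauchy (\<lambda>n. (re_part (X n), im_part (X n)))"
    by (simp add: Cauchy_def dist_complexification)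
  then obtain p where p: "(\<lambda>n. (re_part (X n), im_part (X n))) \<longlonglongrightarrow> p"
    by (auto simp: Cauchy_convergent_iff convergent_def)
  then have "X \<longlonglongrightarrow> Cx (fst p) (snd p)"
    by (simp add: tendsto_iff dist_complexification)
  then show "convergent X"
    by (auto simp: convergent_def)
qed

instance complexification :: ("{real_inner, banach}") banach ..

instance complexification :: ("{real_inner, second_countable_topology}") second_countable_topology
proof
  let ?h = "\<lambda>z :: 'a complexification. (re_part z, im_part z)"
  let ?g = "\<lambda>p :: 'a \<times> 'a. Cx (fst p) (snd p)"
  have ch: "continuous_on UNIV ?h" and cg: "continuous_on UNIV ?g"
    by (auto simp: continuous_on_iff dist_complexification)
  obtain S :: "('a \<times> 'a) set set" where S: "countable S" "topological_basis S"
    using ex_countable_basis by blast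
  have "topological_basis ((\<lambda>U. ?h -` U) ` S)"
    unfolding topological_basis_def
  proof (intro conjI ballI allI impI)
    fix U assume "U \<in> (\<lambda>U. ?h -` U) ` S"
    then show "open U"
      using S(2) ch by (auto simp: topological_basis_open intro: open_vimage)
  next
    fix U :: "'a complexification set" assume "open U"
    then have "open (?g -` U)" using cg by (rule open_vimage)
    then obtain T where T: "T \<subseteq> S" "\<Union>T = ?g -` U"
      using S(2) by (auto simp: topological_basis_def)
    have "\<Union>((\<lambda>U. ?h -` U) ` T) = ?h -` (\<Union>T)" by auto
    also have "\<dots> = U" by (auto simp: T(2))
    finally show "\<exists>B'\<subseteq>(\<lambda>U. ?h -` U) ` S. \<Union>B' = U"
      using T(1) by (intro exI[of _ "(\<lambda>U. ?h -` U) ` T"]) auto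
  qed
  then have "open = generate_topology ((\<lambda>U. ?h -` U) ` S)"
    by (rule topological_basis_imp_subbasis)
  moreover have "countable ((\<lambda>U. ?h -` U) ` S)"
    using S(1) by (rule countable_image)
  ultimately show "\<exists>B :: 'a complexification set set. countable B \<and> open = generate_topology B"
    by blast
qed

section \<open>Uniformly local spaces\<close>

definition L2_loc :: "(real \<Rightarrow> 'e::{banach, second_countable_topology}) set" where
  "L2_loc = {u. u \<in> borel_measurable lebesgue \<and>
     (\<forall>a b. set_integrable lebesgue {a..b} (\<lambda>x. (norm (u x))\<^sup>2))}"

definition unit_norm :: "real \<Rightarrow> (real \<Rightarrow> 'e::{banach, second_countable_topology}) \<Rightarrow> real" where
  "unit_norm a u = sqrt (LINT x:{a..a+1}|lebesgue. (norm (u x))\<^sup>2)"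

definition ul_norm :: "(real \<Rightarrow> 'e::{banach, second_countable_topology}) \<Rightarrow> real" where
  "ul_norm u = (SUP a. unit_norm a u)"

definition L2_ul_w :: "(real \<Rightarrow> 'e::{banach, second_countable_topology}) set" where
  "L2_ul_w = {u \<in> L2_loc. bdd_above (range (\<lambda>a. unit_norm a u))}"

definition L2_ul_s :: "(real \<Rightarrow> 'e::{banach, second_countable_topology}) set" where
  "L2_ul_s = {u \<in> L2_ul_w. ((\<lambda>\<xi>. ul_norm (\<lambda>x. u x - u (x - \<xi>))) \<longlongrightarrow> 0) (at 0)}"

lemma unit_norm_nonneg: "0 \<le> unit_norm a u"
  by (simp add: unit_norm_def set_lebesgue_integral_def)

lemma unit_norm_power2: "(unit_norm a u)\<^sup>2 = (LINT x:{a..a+1}|lebesgue. (norm (u x))\<^sup>2)"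
  by (simp add: unit_norm_def set_lebesgue_integral_def)

lemma L2_loc_measurable: "u \<in> L2_loc \<Longrightarrow> u \<in> borel_measurable lebesgue"
  by (simp add: L2_loc_def)

lemma L2_loc_integrable: "u \<in> L2_loc \<Longrightarrow> set_integrable lebesgue {a..b} (\<lambda>x. (norm (u x))\<^sup>2)"
  by (simp add: L2_loc_def)

lemma borel_measurable_indicator_norm_square:
  fixes u :: "real \<Rightarrow> 'e::{banach, second_countable_topology}"
  assumes "u \<in> borel_measurable lebesgue"
  shows "(\<lambda>x. indicat_real {a..b::real} x *\<^sub>R (norm (u x))\<^sup>2) \<in> borel_measurable lebesgue"
  by (intro borel_measurable_scaleR borel_measurable_indicator borel_measurable_power
      measurable_compose[OF assms borel_measurable_norm]) simp

lemma L2_loc_dominated: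
  assumes u: "u \<in> borel_measurable lebesgue"
    and g: "\<And>a b. set_integrable lebesgue {a..b} g"
    and le: "\<And>x. (norm (u x))\<^sup>2 \<le> g x"
  shows "u \<in> L2_loc"
  unfolding L2_loc_def mem_Collect_eq
proof (intro conjI allI u)
  fix a b :: real
  show "set_integrable lebesgue {a..b} (\<lambda>x. (norm (u x))\<^sup>2)"
  proof (rule set_integrable_bound[OF g])
    show "set_borel_measurable lebesgue {a..b} (\<lambda>x. (norm (u x))\<^sup>2)"
      unfolding set_borel_measurable_def by (rule borel_measurable_indicator_norm_square[OF u])
    show "AE x in lebesgue. x \<in> {a..b} \<longrightarrow> norm ((norm (u x))\<^sup>2) \<le> norm (g x)"
      by (simp add: order_trans[OF le abs_ge_self])
  qed
qed

lemma norm_add_square_le: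
  fixes x y :: "'a::real_normed_vector"
  assumes "s > 0"
  shows "(norm (x + y))\<^sup>2 \<le> (1 + s) * (norm x)\<^sup>2 + (1 + 1 / s) * (norm y)\<^sup>2"
proof -
  have "(norm (x + y))\<^sup>2 \<le> (norm x + norm y)\<^sup>2"
    by (intro power_mono norm_triangle_ineq norm_ge_zero)
  also have "\<dots> \<le> (1 + s) * (norm x)\<^sup>2 + (1 + 1 / s) * (norm y)\<^sup>2"
  proof -
    have "0 \<le> (sqrt s * norm x - norm y / sqrt s)\<^sup>2" by simp
    also have "\<dots> = s * (norm x)\<^sup>2 - 2 * norm x * norm y + (norm y)\<^sup>2 / s"
      using assms by (simp add: power2_diff power_mult_distrib power_divide)
    finally show ?thesis by (simp add: power2_sum algebra_simps)
  qed
  finally show ?thesis .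
qed

lemma L2_loc_add:
  assumes "u \<in> L2_loc" "v \<in> L2_loc"
  shows "(\<lambda>x. u x + v x) \<in> L2_loc"
proof (rule L2_loc_dominated)
  show "(\<lambda>x. u x + v x) \<in> borel_measurable lebesgue"
    using assms[THEN L2_loc_measurable] by measurable
  show "(norm (u x + v x))\<^sup>2 \<le> (1 + 1) * (norm (u x))\<^sup>2 + (1 + 1/1) * (norm (v x))\<^sup>2" for x
    by (rule norm_add_square_le) simp
  show "set_integrable lebesgue {a..b} (\<lambda>x. (1 + 1) * (norm (u x))\<^sup>2 + (1 + 1/1) * (norm (v x))\<^sup>2)" for a b
    using assms[THEN L2_loc_integrable] by (intro set_integral_add set_integrable_mult_right) auto
qed

lemma unit_norm_add:
  assumes u: "u \<in> L2_loc" and v: "v \<in> L2_loc"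
  shows "unit_norm a (\<lambda>x. u x + v x) \<le> unit_norm a u + unit_norm a v"
proof (rule field_le_epsilon)
  fix e :: real assume e: "e > 0"
  define A where "A = unit_norm a u + e / 2"
  define B where "B = unit_norm a v + e / 2"
  have AB: "A > 0" "B > 0" using e unit_norm_nonneg[of a u] unit_norm_nonneg[of a v]
    by (auto simp: A_def B_def)
  define s where "s = B / A"
  have s: "s > 0" using AB by (simp add: s_def)
  have iu: "set_integrable lebesgue {a..a+1} (\<lambda>x. (norm (u x))\<^sup>2)"
    and iv: "set_integrable lebesgue {a..a+1} (\<lambda>x. (norm (v x))\<^sup>2)"
    using u v by (auto intro: L2_loc_integrable)
  have "(unit_norm a (\<lambda>x. u x + v x))\<^sup>2
      \<le> (LINT x:{a..a+1}|lebesgue. (1 + s) * (norm (u x))\<^sup>2 + (1 + 1 / s) * (norm (v x))\<^sup>2)"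
    unfolding unit_norm_power2
    using iu iv by (intro set_integral_mono L2_loc_integrable[OF L2_loc_add[OF u v]]
        norm_add_square_le[OF s] set_integral_add set_integrable_mult_right) auto
  also have "\<dots> = (1 + s) * (unit_norm a u)\<^sup>2 + (1 + 1 / s) * (unit_norm a v)\<^sup>2"
    unfolding unit_norm_power2 using iu iv
    by (subst set_integral_add) (auto intro: set_integrable_mult_right)
  also have "\<dots> \<le> (1 + s) * A\<^sup>2 + (1 + 1 / s) * B\<^sup>2"
    using s e unit_norm_nonneg[of a u] unit_norm_nonneg[of a v]
    by (intro add_mono mult_left_mono power_mono) (auto simp: A_def B_def)
  also have "\<dots> = (A + B)\<^sup>2"
    using AB by (simp add: s_def field_simps power2_eq_square)
  finally have "unit_norm a (\<lambda>x. u x + v x) \<le> A + B"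
    by (rule power2_le_imp_le) (use AB in simp)
  then show "unit_norm a (\<lambda>x. u x + v x) \<le> unit_norm a u + unit_norm a v + e"
    by (simp add: A_def B_def)
qed

lemma bounded_linear_L2_loc:
  assumes T: "bounded_linear T" and u: "u \<in> L2_loc"
  shows "(\<lambda>x. T (u x)) \<in> L2_loc"
proof (rule L2_loc_dominated)
  interpret bounded_linear T by (rule T)
  show "(\<lambda>x. T (u x)) \<in> borel_measurable lebesgue"
    by (rule borel_measurable_continuous_on[OF linear_continuous_on[OF T] L2_loc_measurable[OF u]])
  show "(norm (T (u x)))\<^sup>2 \<le> (onorm T)\<^sup>2 * (norm (u x))\<^sup>2" for x
    by (simp flip: power_mult_distrib add: power_mono onorm[OF T])
  show "set_integrable lebesgue {a..b} (\<lambda>x. (onorm T)\<^sup>2 * (norm (u x))\<^sup>2)" for a b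
    using u by (intro set_integrable_mult_right) (auto intro: L2_loc_integrable)
qed

lemma bounded_linear_unit_norm:
  assumes T: "bounded_linear T" and u: "u \<in> L2_loc"
  shows "unit_norm a (\<lambda>x. T (u x)) \<le> onorm T * unit_norm a u"
proof (rule power2_le_imp_le)
  have "(unit_norm a (\<lambda>x. T (u x)))\<^sup>2 \<le> (LINT x:{a..a+1}|lebesgue. (onorm T)\<^sup>2 * (norm (u x))\<^sup>2)"
    unfolding unit_norm_power2
    using L2_loc_integrable[OF bounded_linear_L2_loc[OF T u]] L2_loc_integrable[OF u]
    by (intro set_integral_mono set_integrable_mult_right)
      (auto simp flip: power_mult_distrib simp: power_mono onorm[OF T])
  then show "(unit_norm a (\<lambda>x. T (u x)))\<^sup>2 \<le> (onorm T * unit_norm a u)\<^sup>2"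
    by (simp add: power_mult_distrib unit_norm_power2)
  show "0 \<le> onorm T * unit_norm a u"
    by (simp add: onorm_pos_le[OF T] unit_norm_nonneg)
qed

lemma unit_norm_cong_AE:
  assumes "u \<in> borel_measurable lebesgue" "v \<in> borel_measurable lebesgue" "AE x in lebesgue. u x = v x"
  shows "unit_norm a u = unit_norm a v"
proof -
  have "(LINT x:{a..a+1}|lebesgue. (norm (u x))\<^sup>2) = (LINT x:{a..a+1}|lebesgue. (norm (v x))\<^sup>2)"
    unfolding set_lebesgue_integral_def
  proof (rule integral_cong_AE)
    show "AE x in lebesgue. indicat_real {a..a + 1} x *\<^sub>R (norm (u x))\<^sup>2
        = indicat_real {a..a + 1} x *\<^sub>R (norm (v x))\<^sup>2"
      using assms(3) by eventually_elim simp
  qed (intro borel_measurable_indicator_norm_square assms)+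
  then show ?thesis by (simp add: unit_norm_def)
qed

lemma measurable_shift: "(\<lambda>x::real. x - \<xi>) \<in> lebesgue \<rightarrow>\<^sub>M lebesgue"
  using lebesgue_affine_measurable[where 'a = real and c = "\<lambda>_. 1" and t = "- \<xi>"] by simp

lemma borel_measurable_shift:
  "u \<in> borel_measurable lebesgue \<Longrightarrow> (\<lambda>x::real. u (x - \<xi>)) \<in> borel_measurable lebesgue"
  using measurable_comp[OF measurable_shift] by (simp add: o_def)

lemma AE_shift:
  assumes "AE x in lebesgue. P (x::real)"
  shows "AE x in lebesgue. P (x - \<xi>)"
proof -
  have "{x. \<not> P x} \<in> null_sets lebesgue"
    using assms by (simp add: completion.AE_iff_null_sets)
  then have "negligible {x. \<not> P x}" by (simp add: negligible_iff_null_sets)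
  then have "negligible ((+) \<xi> ` {x. \<not> P x})" by (rule negligible_translation)
  moreover have "(+) \<xi> ` {x. \<not> P x} = {x. \<not> P (x - \<xi>)}"
  proof (intro subset_antisym subsetI)
    fix x assume "x \<in> {x. \<not> P (x - \<xi>)}"
    then have "x = \<xi> + (x - \<xi>)" "x - \<xi> \<in> {x. \<not> P x}" by auto
    then show "x \<in> (+) \<xi> ` {x. \<not> P x}" by (rule image_eqI)
  qed auto
  ultimately show ?thesis
    by (simp add: completion.AE_iff_null_sets negligible_iff_null_sets)
qed

lemma shift_integrable:
  fixes g :: "real \<Rightarrow> real"
  assumes "set_integrable lebesgue {a - \<xi>..b - \<xi>} g"
  shows "set_integrable lebesgue {a..b} (\<lambda>x. g (x - \<xi>))"
proof -
  have "integrable lebesgue (\<lambda>x. indicat_real {a - \<xi>..b - \<xi>} (- \<xi> + 1 * x) *\<^sub>R g (- \<xi> + 1 * x))"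
    using assms unfolding set_integrable_def by (rule lebesgue_integrable_real_affine) simp
  then show ?thesis
    unfolding set_integrable_def by (simp add: indicator_def algebra_simps)
qed

lemma shift_L2_loc:
  assumes "u \<in> L2_loc"
  shows "(\<lambda>x. u (x - \<xi>)) \<in> L2_loc"
  using assms unfolding L2_loc_def
  by (auto intro!: borel_measurable_shift shift_integrable[of _ \<xi> _ "\<lambda>x. (norm (u x))\<^sup>2"])

lemma shift_unit_norm: "unit_norm a (\<lambda>x. u (x - \<xi>)) = unit_norm (a - \<xi>) u"
proof -
  have "(LINT x:{a - \<xi>..a - \<xi> + 1}|lebesgue. (norm (u x))\<^sup>2)
      = (LINT x|lebesgue. indicat_real {a - \<xi>..a - \<xi> + 1} (- \<xi> + 1 * x) *\<^sub>R (norm (u (- \<xi> + 1 * x)))\<^sup>2)"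
    unfolding set_lebesgue_integral_def by (subst lebesgue_integral_real_affine[of 1 _ "- \<xi>"]) simp_all
  also have "\<dots> = (LINT x:{a..a + 1}|lebesgue. (norm (u (x - \<xi>)))\<^sup>2)"
    unfolding set_lebesgue_integral_def by (simp add: indicator_def algebra_simps)
  finally show ?thesis by (simp add: unit_norm_def)
qed

lemma L2_ul_wD: "u \<in> L2_ul_w \<Longrightarrow> u \<in> L2_loc"
  by (simp add: L2_ul_w_def)

lemma L2_ul_sD: "u \<in> L2_ul_s \<Longrightarrow> u \<in> L2_ul_w" "u \<in> L2_ul_s \<Longrightarrow> u \<in> L2_loc"
  by (simp_all add: L2_ul_s_def L2_ul_w_def)

lemma unit_norm_le_ul_norm: "u \<in> L2_ul_w \<Longrightarrow> unit_norm a u \<le> ul_norm u"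
  by (auto simp: L2_ul_w_def ul_norm_def intro: cSUP_upper)

lemma ul_norm_nonneg: "u \<in> L2_ul_w \<Longrightarrow> 0 \<le> ul_norm u"
  by (rule order_trans[OF unit_norm_nonneg unit_norm_le_ul_norm[of _ 0]])

lemma L2_ul_wI:
  assumes "u \<in> L2_loc" "\<And>a. unit_norm a u \<le> K"
  shows "u \<in> L2_ul_w"
  using assms by (auto simp: L2_ul_w_def bdd_above_def)

lemma ul_norm_le: "(\<And>a. unit_norm a u \<le> K) \<Longrightarrow> ul_norm u \<le> K"
  unfolding ul_norm_def by (rule cSUP_least) auto

lemma L2_ul_w_add:
  assumes "u \<in> L2_ul_w" "v \<in> L2_ul_w"
  shows "(\<lambda>x. u x + v x) \<in> L2_ul_w" "ul_norm (\<lambda>x. u x + v x) \<le> ul_norm u + ul_norm v"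
proof -
  have *: "unit_norm a (\<lambda>x. u x + v x) \<le> ul_norm u + ul_norm v" for a
    using unit_norm_add[OF assms[THEN L2_ul_wD], of a] assms[THEN unit_norm_le_ul_norm, of a] by simp
  show "(\<lambda>x. u x + v x) \<in> L2_ul_w"
    using * by (rule L2_ul_wI[OF L2_loc_add[OF assms[THEN L2_ul_wD]]])
  show "ul_norm (\<lambda>x. u x + v x) \<le> ul_norm u + ul_norm v"
    using * by (rule ul_norm_le)
qed

lemma L2_ul_w_bounded_linear:
  assumes T: "bounded_linear T" and u: "u \<in> L2_ul_w"
  shows "(\<lambda>x. T (u x)) \<in> L2_ul_w" "ul_norm (\<lambda>x. T (u x)) \<le> onorm T * ul_norm u"
proof -
  have *: "unit_norm a (\<lambda>x. T (u x)) \<le> onorm T * ul_norm u" for a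
    using bounded_linear_unit_norm[OF T L2_ul_wD[OF u], of a]
      mult_left_mono[OF unit_norm_le_ul_norm[OF u, of a] onorm_pos_le[OF T]] by simp
  show "(\<lambda>x. T (u x)) \<in> L2_ul_w"
    using * by (rule L2_ul_wI[OF bounded_linear_L2_loc[OF T L2_ul_wD[OF u]]])
  show "ul_norm (\<lambda>x. T (u x)) \<le> onorm T * ul_norm u"
    using * by (rule ul_norm_le)
qed

lemma L2_ul_w_diff: "u \<in> L2_ul_w \<Longrightarrow> v \<in> L2_ul_w \<Longrightarrow> (\<lambda>x. u x - v x) \<in> L2_ul_w"
  using L2_ul_w_add(1)[OF _ L2_ul_w_bounded_linear(1)[OF bounded_linear_minus[OF bounded_linear_ident]], of u v]
  by simp

lemma L2_ul_w_shift:
  assumes "u \<in> L2_ul_w"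
  shows "(\<lambda>x. u (x - \<xi>)) \<in> L2_ul_w"
  by (rule L2_ul_wI[OF shift_L2_loc[OF L2_ul_wD[OF assms]], of _ "ul_norm u"])
    (simp add: shift_unit_norm unit_norm_le_ul_norm[OF assms])

lemma L2_ul_s_0: "(\<lambda>_. 0) \<in> L2_ul_s"
proof -
  have "(\<lambda>_. 0) \<in> L2_ul_w"
    by (rule L2_ul_wI[where K = 0]) (auto simp: L2_loc_def unit_norm_def set_integrable_def)
  then show ?thesis
    by (simp add: L2_ul_s_def ul_norm_def unit_norm_def)
qed

lemma L2_ul_s_dominated:
  assumes u: "u \<in> L2_ul_w" and g: "(g \<longlongrightarrow> 0) (at 0)"
    and le: "\<And>\<xi>. ul_norm (\<lambda>x. u x - u (x - \<xi>)) \<le> g \<xi>"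
  shows "u \<in> L2_ul_s"
  unfolding L2_ul_s_def mem_Collect_eq
proof (intro conjI u)
  show "((\<lambda>\<xi>. ul_norm (\<lambda>x. u x - u (x - \<xi>))) \<longlongrightarrow> 0) (at 0)"
    by (rule tendsto_sandwich[OF _ _ tendsto_const g])
      (use ul_norm_nonneg[OF L2_ul_w_diff[OF u L2_ul_w_shift[OF u]]] le in auto)
qed

lemma L2_ul_s_add:
  assumes "u \<in> L2_ul_s" "v \<in> L2_ul_s"
  shows "(\<lambda>x. u x + v x) \<in> L2_ul_s"
proof (rule L2_ul_s_dominated)
  note [intro] = assms[THEN L2_ul_sD(1)]
  show "(\<lambda>x. u x + v x) \<in> L2_ul_w" by (intro L2_ul_w_add) auto
  show "((\<lambda>\<xi>. ul_norm (\<lambda>x. u x - u (x - \<xi>)) + ul_norm (\<lambda>x. v x - v (x - \<xi>))) \<longlongrightarrow> 0) (at 0)"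
    using assms by (intro tendsto_add_zero) (auto simp: L2_ul_s_def)
  have eq: "(\<lambda>x. u x + v x - (u (x - \<xi>) + v (x - \<xi>)))
     = (\<lambda>x. (u x - u (x - \<xi>)) + (v x - v (x - \<xi>)))" for \<xi>
    by (simp add: fun_eq_iff)
  show "ul_norm (\<lambda>x. u x + v x - (u (x - \<xi>) + v (x - \<xi>)))
      \<le> ul_norm (\<lambda>x. u x - u (x - \<xi>)) + ul_norm (\<lambda>x. v x - v (x - \<xi>))" for \<xi>
    unfolding eq by (intro L2_ul_w_add(2) L2_ul_w_diff L2_ul_w_shift) auto
qed

lemma L2_ul_s_bounded_linear:
  assumes T: "bounded_linear T" and u: "u \<in> L2_ul_s"
  shows "(\<lambda>x. T (u x)) \<in> L2_ul_s"
proof (rule L2_ul_s_dominated)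
  interpret bounded_linear T by (rule T)
  note [intro] = L2_ul_sD(1)[OF u]
  show "(\<lambda>x. T (u x)) \<in> L2_ul_w"
    by (rule L2_ul_w_bounded_linear(1)[OF T L2_ul_sD(1)[OF u]])
  show "((\<lambda>\<xi>. onorm T * ul_norm (\<lambda>x. u x - u (x - \<xi>))) \<longlongrightarrow> 0) (at 0)"
    using u by (intro tendsto_mult_right_zero) (auto simp: L2_ul_s_def)
  show "ul_norm (\<lambda>x. T (u x) - T (u (x - \<xi>))) \<le> onorm T * ul_norm (\<lambda>x. u x - u (x - \<xi>))" for \<xi>
    unfolding diff[symmetric]
    by (rule L2_ul_w_bounded_linear(2)[OF T], intro L2_ul_w_diff L2_ul_w_shift L2_ul_sD(1)[OF u])
qed

lemma L2_ul_s_minus: "u \<in> L2_ul_s \<Longrightarrow> (\<lambda>x. - u x) \<in> L2_ul_s"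
  by (rule L2_ul_s_bounded_linear[OF bounded_linear_minus[OF bounded_linear_ident]])

lemma L2_ul_s_diff: "u \<in> L2_ul_s \<Longrightarrow> v \<in> L2_ul_s \<Longrightarrow> (\<lambda>x. u x - v x) \<in> L2_ul_s"
  using L2_ul_s_add[OF _ L2_ul_s_minus, of u v] by simp

lemma ul_norm_eq_0_imp_AE:
  assumes u: "u \<in> L2_ul_w" and 0: "ul_norm u = 0"
  shows "AE x in lebesgue. u x = 0"
proof -
  have "AE x in lebesgue. x \<in> {a..a+1} \<longrightarrow> u x = 0" for a
  proof -
    have "unit_norm a u = 0"
      using unit_norm_le_ul_norm[OF u, of a] unit_norm_nonneg[of a u] 0 by simp
    then have "(LINT x|lebesgue. indicat_real {a..a+1} x *\<^sub>R (norm (u x))\<^sup>2) = 0"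
      by (simp add: unit_norm_def set_lebesgue_integral_def)
    then have "AE x in lebesgue. indicat_real {a..a+1} x *\<^sub>R (norm (u x))\<^sup>2 = 0"
      using L2_loc_integrable[OF L2_ul_wD[OF u], of a "a+1"]
      by (subst (asm) integral_nonneg_eq_0_iff_AE) (auto simp: set_integrable_def)
    then show ?thesis by eventually_elim auto
  qed
  then have "AE x in lebesgue. \<forall>n::int. x \<in> {of_int n..of_int n + 1} \<longrightarrow> u x = 0"
    by (subst AE_all_countable) auto
  then show ?thesis
  proof eventually_elim
    case (elim x)
    then show ?case
      using spec[OF elim, of "\<lfloor>x\<rfloor>"] by (simp add: real_of_int_floor_add_one_ge)
  qed
qed

section \<open>The normed spaces L^2_ul-s as quotients modulo null functions\<close>

quotient_type (overloaded) 'e l2uls = "real \<Rightarrow> 'e::{banach, second_countable_topology}"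
  / partial: "\<lambda>u v. u \<in> L2_ul_s \<and> v \<in> L2_ul_s \<and> (AE x in lebesgue. u x = v x)"
  morphisms rep_l2uls abs_l2uls
proof (rule part_equivpI)
  show "\<exists>u::real \<Rightarrow> 'e. u \<in> L2_ul_s \<and> u \<in> L2_ul_s \<and> (AE x in lebesgue. u x = u x)"
    using L2_ul_s_0 by blast
  show "symp (\<lambda>u v::real \<Rightarrow> 'e. u \<in> L2_ul_s \<and> v \<in> L2_ul_s \<and> (AE x in lebesgue. u x = v x))"
    by (simp add: symp_def eq_commute conj_commute)
  show "transp (\<lambda>u v::real \<Rightarrow> 'e. u \<in> L2_ul_s \<and> v \<in> L2_ul_s \<and> (AE x in lebesgue. u x = v x))"
  proof (intro transpI conjI; elim conjE)
    fix u v w :: "real \<Rightarrow> 'e"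
    assume "AE x in lebesgue. u x = v x" "AE x in lebesgue. v x = w x"
    then show "AE x in lebesgue. u x = w x" by eventually_elim simp
  qed assumption+
qed

lemma ul_norm_scale:
  assumes u: "u \<in> L2_ul_w" and c: "c \<ge> 0" and T: "\<And>x. norm (T x) = c * norm x"
  shows "ul_norm (\<lambda>x. T (u x)) = c * ul_norm u"
proof -
  have eq: "unit_norm a (\<lambda>x. T (u x)) = c * unit_norm a u" for a
    using c by (simp add: unit_norm_def T power_mult_distrib real_sqrt_mult)
  have le: "c * unit_norm a u \<le> c * ul_norm u" for a
    using unit_norm_le_ul_norm[OF u] c by (rule mult_left_mono)
  then have "ul_norm (\<lambda>x. T (u x)) \<le> c * ul_norm u"
    by (intro ul_norm_le) (simp add: eq)
  moreover have "c * ul_norm u \<le> ul_norm (\<lambda>x. T (u x))"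
  proof (cases "c = 0")
    case True
    then show ?thesis unfolding ul_norm_def eq by simp
  next
    case False
    with c have "c > 0" by simp
    have "unit_norm a u \<le> ul_norm (\<lambda>x. T (u x)) / c" for a
    proof -
      have "unit_norm a (\<lambda>x. T (u x)) \<le> ul_norm (\<lambda>x. T (u x))"
        unfolding ul_norm_def by (rule cSUP_upper) (use le in \<open>auto simp: eq bdd_above_def\<close>)
      then show ?thesis using \<open>c > 0\<close> by (simp add: eq field_simps)
    qed
    then have "ul_norm u \<le> ul_norm (\<lambda>x. T (u x)) / c" by (rule ul_norm_le)
    then show ?thesis using \<open>c > 0\<close> by (simp add: field_simps)
  qed
  ultimately show ?thesis by simp
qed

lemma ul_norm_cong_AE:
  assumes "u \<in> L2_loc" "v \<in> L2_loc" "AE x in lebesgue. u x = v x"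
  shows "ul_norm u = ul_norm v"
  using unit_norm_cong_AE[OF assms(1,2)[THEN L2_loc_measurable] assms(3)] by (simp add: ul_norm_def)

instantiation l2uls :: ("{banach, second_countable_topology}") real_normed_vector
begin

lift_definition zero_l2uls :: "'a l2uls" is "\<lambda>_. 0"
  by (simp add: L2_ul_s_0)

lift_definition plus_l2uls :: "'a l2uls \<Rightarrow> 'a l2uls \<Rightarrow> 'a l2uls" is "\<lambda>u v x. u x + v x"
  by (auto simp: L2_ul_s_add)

lift_definition minus_l2uls :: "'a l2uls \<Rightarrow> 'a l2uls \<Rightarrow> 'a l2uls" is "\<lambda>u v x. u x - v x"
  by (auto simp: L2_ul_s_diff)

lift_definition uminus_l2uls :: "'a l2uls \<Rightarrow> 'a l2uls" is "\<lambda>u x. - u x"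
  by (auto simp: L2_ul_s_minus)

lift_definition scaleR_l2uls :: "real \<Rightarrow> 'a l2uls \<Rightarrow> 'a l2uls" is "\<lambda>r u x. r *\<^sub>R u x"
  by (auto simp: L2_ul_s_bounded_linear[OF bounded_linear_scaleR_right])

lift_definition norm_l2uls :: "'a l2uls \<Rightarrow> real" is ul_norm
  by (auto intro: ul_norm_cong_AE L2_ul_sD)

definition sgn_l2uls_def: "sgn (u :: 'a l2uls) = inverse (norm u) *\<^sub>R u"
definition dist_l2uls_def: "dist (u :: 'a l2uls) v = norm (u - v)"
definition
  "(uniformity :: ('a l2uls \<times> 'a l2uls) filter) = (INF e\<in>{0 <..}. principal {(x, y). dist x y < e})"
definition
  "open (U :: 'a l2uls set) \<longleftrightarrow> (\<forall>x\<in>U. eventually (\<lambda>(x', y). x' = x \<longrightarrow> y \<in> U) uniformity)"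

instance
proof
  fix u v w :: "'a l2uls" and r s :: real
  show "u + v + w = u + (v + w)"
    by transfer (auto simp: L2_ul_s_add add.assoc)
  show "u + v = v + u"
    by transfer (auto simp: L2_ul_s_add add.commute)
  show "0 + u = u"
    by transfer auto
  show "- u + u = 0"
    by transfer (auto simp: L2_ul_s_0)
  show "u - v = u + - v"
    by transfer (auto simp: L2_ul_s_diff)
  show "r *\<^sub>R (u + v) = r *\<^sub>R u + r *\<^sub>R v"
    by transfer (auto simp: scaleR_add_right L2_ul_s_add L2_ul_s_bounded_linear[OF bounded_linear_scaleR_right])
  show "(r + s) *\<^sub>R u = r *\<^sub>R u + s *\<^sub>R u"
    by transfer (auto simp: scaleR_add_left L2_ul_s_add
        L2_ul_s_bounded_linear[OF bounded_linear_scaleR_right] simp flip: scaleR_add_left)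
  show "r *\<^sub>R s *\<^sub>R u = (r * s) *\<^sub>R u"
    by transfer (auto simp: L2_ul_s_bounded_linear[OF bounded_linear_scaleR_right])
  show "1 *\<^sub>R u = u"
    by transfer auto
  show "(norm u = 0) = (u = 0)"
  proof transfer
    fix u :: "real \<Rightarrow> 'a"
    assume "u \<in> L2_ul_s \<and> u \<in> L2_ul_s \<and> (AE x in lebesgue. u x = u x)"
    then have u: "u \<in> L2_ul_s" by simp
    have "AE x in lebesgue. u x = 0" if "ul_norm u = 0"
      using ul_norm_eq_0_imp_AE[OF L2_ul_sD(1)[OF u] that] .
    moreover have "ul_norm u = 0" if "AE x in lebesgue. u x = 0"
      using ul_norm_cong_AE[OF L2_ul_sD(2)[OF u] L2_ul_sD(2)[OF L2_ul_s_0] that]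
      by (simp add: ul_norm_def unit_norm_def)
    ultimately show "(ul_norm u = 0) = (u \<in> L2_ul_s \<and> (\<lambda>_. 0) \<in> (L2_ul_s :: (real \<Rightarrow> 'a) set)
        \<and> (AE x in lebesgue. u x = 0))"
      using u L2_ul_s_0 by blast
  qed
  show "norm (u + v) \<le> norm u + norm v"
    by transfer (auto intro: L2_ul_w_add L2_ul_sD)
  show "norm (r *\<^sub>R u) = \<bar>r\<bar> * norm u"
    by transfer (auto intro!: ul_norm_scale L2_ul_sD)
qed (simp_all add: sgn_l2uls_def dist_l2uls_def uniformity_l2uls_def open_l2uls_def)

end

instantiation l2uls :: ("{complex_normed_vector, banach, second_countable_topology}") complex_normed_vector
begin

lift_definition scaleC_l2uls :: "complex \<Rightarrow> 'a l2uls \<Rightarrow> 'a l2uls" is "\<lambda>c u x. c *\<^sub>C u x"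
  by (auto simp: L2_ul_s_bounded_linear[OF bounded_linear_scaleC])

instance
proof
  fix u v :: "'a l2uls" and a b :: complex and r :: real
  note [simp] = L2_ul_s_bounded_linear[OF bounded_linear_scaleC] L2_ul_s_add
    L2_ul_s_bounded_linear[OF bounded_linear_scaleR_right]
  show "a *\<^sub>C (u + v) = a *\<^sub>C u + a *\<^sub>C v"
    by transfer (auto simp: scaleC_add_right)
  show "(a + b) *\<^sub>C u = a *\<^sub>C u + b *\<^sub>C u"
    by transfer (auto simp: scaleC_add_left simp flip: scaleC_add_left)
  show "a *\<^sub>C b *\<^sub>C u = (a * b) *\<^sub>C u"
    by transfer (auto simp: scaleC_scaleC)
  show "complex_of_real r *\<^sub>C u = r *\<^sub>R u"
    by transfer (auto simp: scaleC_of_real)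
  show "norm (a *\<^sub>C u) = cmod a * norm u"
    by transfer (auto intro!: ul_norm_scale L2_ul_sD simp: norm_scaleC)
qed

end

section \<open>Unbounded operators\<close>

text \<open>
  An unbounded operator is given by its domain \<open>D\<close> and a function whose values outside \<open>D\<close> are
  irrelevant. The scalar multiplication (\<^const>\<open>scaleR\<close> or \<^const>\<open>scaleC\<close>) and the inner product
  (\<^const>\<open>inner\<close> or \<^const>\<open>cinner\<close>) are parameters, so that the notions apply to real and
  to complex spaces.
\<close>

definition linear_operator ::
    "('k \<Rightarrow> 'x \<Rightarrow> 'x) \<Rightarrow> 'x::real_vector set \<Rightarrow> ('x \<Rightarrow> 'x) \<Rightarrow> bool" where
  "linear_operator scl D T \<longleftrightarrow>
     0 \<in> D \<and>
     (\<forall>u\<in>D. \<forall>v\<in>D. u + v \<in> D \<and> T (u + v) = T u + T v) \<and>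
     (\<forall>c. \<forall>u\<in>D. scl c u \<in> D \<and> T (scl c u) = scl c (T u))"

definition operator_graph :: "'x set \<Rightarrow> ('x \<Rightarrow> 'x) \<Rightarrow> ('x \<times> 'x) set" where
  "operator_graph D T = (\<lambda>u. (u, T u)) ` D"

definition closed_operator ::
    "('k \<Rightarrow> 'x \<Rightarrow> 'x) \<Rightarrow> 'x::real_normed_vector set \<Rightarrow> ('x \<Rightarrow> 'x) \<Rightarrow> bool" where
  "closed_operator scl D T \<longleftrightarrow> linear_operator scl D T \<and> closed (operator_graph D T)"

definition adjoint_graph ::
    "('x \<Rightarrow> 'x \<Rightarrow> 'k) \<Rightarrow> 'x set \<Rightarrow> ('x \<Rightarrow> 'x) \<Rightarrow> ('x \<times> 'x) set" where
  "adjoint_graph ip D T = {(v, w). \<forall>u\<in>D. ip (T u) v = ip u w}"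

definition self_adjoint_operator ::
    "('k \<Rightarrow> 'x \<Rightarrow> 'x) \<Rightarrow> ('x \<Rightarrow> 'x \<Rightarrow> 'k) \<Rightarrow> 'x::real_normed_vector set \<Rightarrow> ('x \<Rightarrow> 'x) \<Rightarrow> bool" where
  "self_adjoint_operator scl ip D T \<longleftrightarrow>
     linear_operator scl D T \<and> closure D = UNIV \<and> adjoint_graph ip D T = operator_graph D T"

definition positive_operator ::
    "('x \<Rightarrow> 'x \<Rightarrow> 'k::real_algebra_1) \<Rightarrow> 'x set \<Rightarrow> ('x \<Rightarrow> 'x) \<Rightarrow> bool" where
  "positive_operator ip D T \<longleftrightarrow> (\<forall>u\<in>D. ip (T u) u \<in> \<real>\<^sub>\<ge>\<^sub>0)"

definition resolvent ::
    "'x::complex_normed_vector set \<Rightarrow> ('x \<Rightarrow> 'x) \<Rightarrow> complex \<Rightarrow> 'x \<Rightarrow> 'x" where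
  "resolvent D T z = inv_into D (\<lambda>u. z *\<^sub>C u - T u)"

definition resolvent_set ::
    "'x::complex_normed_vector set \<Rightarrow> ('x \<Rightarrow> 'x) \<Rightarrow> complex set" where
  "resolvent_set D T =
     {z. bij_betw (\<lambda>u. z *\<^sub>C u - T u) D UNIV \<and> bounded_linear (resolvent D T z)}"

definition compact_operator :: "('x::metric_space \<Rightarrow> 'x) \<Rightarrow> bool" where
  "compact_operator K \<longleftrightarrow> (\<forall>S. bounded S \<longrightarrow> compact (closure (K ` S)))"

text \<open>By the resolvent identity it does not matter for which \<open>z\<close> the resolvent is compact.\<close>

definition compact_resolvent ::
    "'x::complex_normed_vector set \<Rightarrow> ('x \<Rightarrow> 'x) \<Rightarrow> bool" where
  "compact_resolvent D T \<longleftrightarrow> (\<exists>z\<in>resolvent_set D T. compact_operator (resolvent D T z))"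

text \<open>
  Resolvents of an operator on a real space are those of its complexification. The complexification
  of L^2_ul-s with values in a real Hilbert space is L^2_ul-s with values in the complexified one.
\<close>

definition complexified_domain :: "'y set \<Rightarrow> 'y complexification set" where
  "complexified_domain D = {z. re_part z \<in> D \<and> im_part z \<in> D}"

definition complexified_operator ::
    "('y \<Rightarrow> 'y) \<Rightarrow> 'y complexification \<Rightarrow> 'y complexification" where
  "complexified_operator T z = Cx (T (re_part z)) (T (im_part z))"

definition complexify_l2uls ::
    "'y::{real_inner, banach, second_countable_topology} l2uls \<Rightarrow> 'y complexification l2uls" where
  "complexify_l2uls u = abs_l2uls (\<lambda>x. Cx (rep_l2uls u x) 0)"

section \<open>Sectorial-like resolvent estimates and the associated semigroup\<close>

definition sector :: "real \<Rightarrow> real \<Rightarrow> complex set" where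
  "sector \<omega> \<phi> =
     {z. z \<noteq> complex_of_real \<omega> \<and>
         \<phi> \<le> \<bar>Arg (z - complex_of_real \<omega>)\<bar> \<and> \<bar>Arg (z - complex_of_real \<omega>)\<bar> \<le> pi}"

definition sectorial_estimates ::
    "'x::complex_normed_vector set \<Rightarrow> ('x \<Rightarrow> 'x) \<Rightarrow> real \<Rightarrow> real \<Rightarrow> real \<Rightarrow> bool" where
  "sectorial_estimates D A \<omega> \<phi> M \<longleftrightarrow>
     0 < \<phi> \<and> \<phi> < pi / 2 \<and> 0 < M \<and>
     sector \<omega> \<phi> \<subseteq> resolvent_set D A \<and>
     (\<forall>z\<in>sector \<omega> \<phi>. onorm (resolvent D A z) \<le> M / cmod (z - complex_of_real \<omega>))"

text \<open>
  Contours are parametrised with bounded speed and coincide with rays of direction \<open>- \<psi>\<close> and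
  \<open>\<psi>\<close> near \<open>- \<infinity>\<close> and \<open>\<infinity>\<close>; passing to the right of \<open>- \<omega>\<close> means that the contour crosses the
  real axis only there.
\<close>

definition semigroup_contour ::
    "'x::complex_normed_vector set \<Rightarrow> ('x \<Rightarrow> 'x) \<Rightarrow> real \<Rightarrow> real \<Rightarrow> (real \<Rightarrow> complex) \<Rightarrow> bool" where
  "semigroup_contour D A \<omega> \<phi> \<gamma> \<longleftrightarrow>
     \<gamma> piecewise_C1_differentiable_on UNIV \<and>
     (\<exists>L. L-lipschitz_on UNIV \<gamma>) \<and>
     range \<gamma> \<subseteq> resolvent_set D (\<lambda>u. - A u) \<and>
     (\<forall>s. \<gamma> s \<in> \<real> \<longrightarrow> - \<omega> < Re (\<gamma> s)) \<and>
     (\<exists>\<psi>\<in>{pi / 2<..<pi - \<phi>}. \<exists>p q s\<^sub>0.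
        (\<forall>s\<ge>s\<^sub>0. \<gamma> s = p + complex_of_real s * cis \<psi>) \<and>
        (\<forall>s\<le>- s\<^sub>0. \<gamma> s = q + complex_of_real (- s) * cis (- \<psi>)))"

text \<open>
  The contour integral is an improper integral of operator-valued functions with respect to the
  operator norm. The resolvent of \<open>- A\<close> at \<open>\<lambda>\<close> is the inverse of \<open>\<lambda> + A\<close>.
\<close>

definition semigroup_integrand ::
    "'x::complex_normed_vector set \<Rightarrow> ('x \<Rightarrow> 'x) \<Rightarrow> (real \<Rightarrow> complex) \<Rightarrow> real \<Rightarrow> real \<Rightarrow> 'x \<Rightarrow>\<^sub>L 'x" where
  "semigroup_integrand D A \<gamma> t s = Blinfun (\<lambda>u.
     (exp (\<gamma> s * complex_of_real t) * vector_derivative \<gamma> (at s) / (2 * \<i> * complex_of_real pi))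
       *\<^sub>C resolvent D (\<lambda>v. - A v) (\<gamma> s) u)"

definition operator_semigroup ::
    "'x::complex_normed_vector set \<Rightarrow> ('x \<Rightarrow> 'x) \<Rightarrow> (real \<Rightarrow> complex) \<Rightarrow> real \<Rightarrow> 'x \<Rightarrow>\<^sub>L 'x" where
  "operator_semigroup D A \<gamma> t =
     (if t = 0 then id_blinfun else integral UNIV (semigroup_integrand D A \<gamma> t))"

text \<open>Contours as above exist: a wedge with vertex \<open>1 - \<omega>\<close> is one.\<close>

lemma minus_in_sector:
  assumes \<phi>: "0 < \<phi>" "\<phi> < pi / 2" and \<psi>: "pi / 2 < \<psi>" "\<psi> < pi - \<phi>" and r: "0 \<le> r"
    and w: "w = complex_of_real (1 - \<omega>) + complex_of_real r * cis \<psi> \<or>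
            w = complex_of_real (1 - \<omega>) + complex_of_real r * cis (- \<psi>)"
  shows "- w \<in> sector \<omega> \<phi>"
proof -
  define z where "z = - w - complex_of_real \<omega>"
  have z: "z = - 1 - complex_of_real r * cis \<psi> \<or> z = - 1 - complex_of_real r * cis (- \<psi>)"
    using w by (auto simp: z_def algebra_simps)
  have sin_pos: "0 < sin \<phi>" using \<phi> by (intro sin_gt_zero) auto
  have neg: "r * sin (\<psi> + \<phi>) \<ge> 0"
    using \<phi> \<psi> r by (intro mult_nonneg_nonneg sin_ge_zero) auto
  have sin\<psi>: "0 < sin \<psi>" using \<phi> \<psi> by (intro sin_gt_zero) auto
  have "z \<noteq> 0"
  proof
    assume "z = 0"
    with z have "1 + r * cos \<psi> = 0" "r * sin \<psi> = 0" by (auto simp: complex_eq_iff)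
    with sin\<psi> show False by auto
  qed
  moreover have "\<phi> \<le> \<bar>Arg z\<bar>"
  proof (rule ccontr)
    assume "\<not> \<phi> \<le> \<bar>Arg z\<bar>"
    then have a: "- \<phi> < Arg z" "Arg z < \<phi>" by auto
    have zeq: "z = complex_of_real (cmod z) * cis (Arg z)"
      using rcis_cmod_Arg[of z] by (simp add: rcis_def)
    have "0 < cmod z * sin (Arg z + \<phi>)" "0 < cmod z * sin (\<phi> - Arg z)"
      using a \<phi> \<open>z \<noteq> 0\<close> by (auto intro!: mult_pos_pos sin_gt_zero)
    moreover have "Im (z * cis \<phi>) = cmod z * sin (Arg z + \<phi>)"
      by (subst zeq) (simp add: sin_add algebra_simps)
    moreover have "Im (z * cis (- \<phi>)) = - (cmod z * sin (\<phi> - Arg z))"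
      by (subst zeq) (simp add: sin_diff algebra_simps)
    moreover have "Im (z * cis \<phi>) = - sin \<phi> - r * sin (\<psi> + \<phi>)
        \<or> Im (z * cis (- \<phi>)) = sin \<phi> + r * sin (\<psi> + \<phi>)"
      using z
    proof
      assume *: "z = - 1 - complex_of_real r * cis \<psi>"
      have "Im (z * cis \<phi>) = - sin \<phi> - r * sin (\<psi> + \<phi>)"
        unfolding * by (simp add: sin_add algebra_simps)
      then show ?thesis ..
    next
      assume *: "z = - 1 - complex_of_real r * cis (- \<psi>)"
      have "Im (z * cis (- \<phi>)) = sin \<phi> + r * sin (\<psi> + \<phi>)"
        unfolding * by (simp add: sin_add algebra_simps)
      then show ?thesis ..
    qed
    ultimately show False using sin_pos neg by linarith
  qed
  moreover have "\<bar>Arg z\<bar> \<le> pi"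
    using Arg_bounded[of z] by linarith
  ultimately show ?thesis
    by (auto simp: sector_def z_def)
qed

lemma resolvent_set_uminus:
  assumes "- z \<in> resolvent_set D A"
  shows "z \<in> resolvent_set D (\<lambda>u. - A u)"
proof -
  have m: "(- z) *\<^sub>C u = - (z *\<^sub>C u)" for u :: 'a
    using scaleC_scaleC[of "-1" z u] scaleC_of_real[of "-1" "z *\<^sub>C u"] by simp
  have bij: "bij_betw (\<lambda>u. (- z) *\<^sub>C u - A u) D UNIV" and bl: "bounded_linear (resolvent D A (- z))"
    using assms by (auto simp: resolvent_set_def)
  have eq: "(\<lambda>u. z *\<^sub>C u - (- A u)) = uminus \<circ> (\<lambda>u. (- z) *\<^sub>C u - A u)"
    by (simp add: fun_eq_iff m)
  have bij': "bij_betw (\<lambda>u. z *\<^sub>C u - (- A u)) D UNIV"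
    unfolding eq by (rule bij_betw_trans[OF bij]) (simp add: bij_uminus)
  have "resolvent D (\<lambda>u. - A u) z v = resolvent D A (- z) (- v)" for v
  proof -
    let ?u = "resolvent D A (- z) (- v)"
    have "- v \<in> (\<lambda>u. (- z) *\<^sub>C u - A u) ` D"
      using bij by (simp add: bij_betw_def)
    then have u: "?u \<in> D" "(- z) *\<^sub>C ?u - A ?u = - v"
      by (auto simp: resolvent_def intro: inv_into_into f_inv_into_f)
    from u(2) have "- (z *\<^sub>C ?u - (- A ?u)) = - v"
      unfolding m by (simp add: algebra_simps)
    then have "z *\<^sub>C ?u - (- A ?u) = v"
      by (rule neg_equal_iff_equal[THEN iffD1])
    then show ?thesis
      unfolding resolvent_def[of D "\<lambda>u. - A u"]
      using inv_into_f_f[OF bij_betw_imp_inj_on[OF bij'] u(1)] by simp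
  qed
  then have "resolvent D (\<lambda>u. - A u) z = (\<lambda>v. resolvent D A (- z) (- v))" by auto
  then have "bounded_linear (resolvent D (\<lambda>u. - A u) z)"
    using bounded_linear_compose[OF bl bounded_linear_minus[OF bounded_linear_ident]] by simp
  with bij' show ?thesis by (simp add: resolvent_set_def)
qed

lemma semigroup_contour_exists:
  assumes "sectorial_estimates D A \<omega> \<phi> M"
  shows "\<exists>\<gamma>. semigroup_contour D A \<omega> \<phi> \<gamma>"
proof -
  have \<phi>: "0 < \<phi>" "\<phi> < pi / 2" and sub: "sector \<omega> \<phi> \<subseteq> resolvent_set D A"
    using assms by (auto simp: sectorial_estimates_def)
  obtain \<psi> where \<psi>: "pi / 2 < \<psi>" "\<psi> < pi - \<phi>"
    using dense[of "pi / 2" "pi - \<phi>"] \<phi> by auto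
  have sin\<psi>: "0 < sin \<psi>" using \<phi> \<psi> by (intro sin_gt_zero) auto
  define \<gamma> where "\<gamma> = (\<lambda>s. complex_of_real (1 - \<omega>) + complex_of_real \<bar>s\<bar> * cos \<psi> + complex_of_real s * (\<i> * sin \<psi>))"
  have \<gamma>1: "\<gamma> s = complex_of_real (1 - \<omega>) + complex_of_real s * cis \<psi>" if "s \<ge> 0" for s
    using that by (simp add: \<gamma>_def complex_eq_iff)
  have \<gamma>2: "\<gamma> s = complex_of_real (1 - \<omega>) + complex_of_real (- s) * cis (- \<psi>)" if "s \<le> 0" for s
    using that by (simp add: \<gamma>_def complex_eq_iff)
  have lip: "2-lipschitz_on UNIV \<gamma>"
  proof (rule lipschitz_onI)
    fix x y :: real
    have "\<gamma> x - \<gamma> y = complex_of_real (\<bar>x\<bar> - \<bar>y\<bar>) * cos \<psi> + complex_of_real (x - y) * (\<i> * sin \<psi>)"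
      by (simp add: \<gamma>_def algebra_simps)
    also have "cmod \<dots> \<le> \<bar>\<bar>x\<bar> - \<bar>y\<bar>\<bar> * \<bar>cos \<psi>\<bar> + \<bar>x - y\<bar> * \<bar>sin \<psi>\<bar>"
      by (rule order_trans[OF norm_triangle_ineq]) (simp only: norm_mult norm_of_real, simp)
    also have "\<dots> \<le> \<bar>x - y\<bar> * 1 + \<bar>x - y\<bar> * 1"
      by (intro add_mono mult_mono) auto
    finally show "dist (\<gamma> x) (\<gamma> y) \<le> 2 * dist x y"
      by (simp add: dist_norm)
  qed simp
  have "\<gamma> C1_differentiable_on UNIV - {0}"
  proof -
    have "\<exists>D. (\<forall>x\<in>UNIV - {0}. (\<gamma> has_vector_derivative D x) (at x)) \<and> continuous_on (UNIV - {0}) D"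
    proof (intro exI conjI ballI)
      let ?D = "\<lambda>x. complex_of_real (sgn x) * cos \<psi> + \<i> * sin \<psi>"
      have "continuous_on (UNIV - {0::real}) sgn"
        by (intro continuous_on_sgn continuous_on_id) auto
      then show "continuous_on (UNIV - {0}) ?D"
        by (intro continuous_intros) auto
      fix x :: real assume x: "x \<in> UNIV - {0}"
      show "(\<gamma> has_vector_derivative ?D x) (at x)"
      proof (cases "x > 0")
        case True
        have "((\<lambda>s. complex_of_real (1 - \<omega>) + complex_of_real s * cis \<psi>) has_vector_derivative ?D x) (at x)"
          using True by (auto intro!: derivative_eq_intros simp: complex_eq_iff)
        then show ?thesis
          by (rule has_vector_derivative_transform_within_open[of _ _ _ "{0<..}"])
            (use True in \<open>auto simp: \<gamma>1\<close>)
      next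
        case False
        have "((\<lambda>s. complex_of_real (1 - \<omega>) + complex_of_real (- s) * cis (- \<psi>)) has_vector_derivative ?D x) (at x)"
          using False x by (auto intro!: derivative_eq_intros simp: complex_eq_iff)
        then show ?thesis
          by (rule has_vector_derivative_transform_within_open[of _ _ _ "{..<0}"])
            (use False x in \<open>auto simp: \<gamma>2\<close>)
      qed
    qed
    then show ?thesis by (simp add: C1_differentiable_on_def)
  qed
  then have "\<gamma> piecewise_C1_differentiable_on UNIV"
    using lipschitz_on_continuous_on[OF lip] by (auto simp: piecewise_C1_differentiable_on_def)
  moreover have "range \<gamma> \<subseteq> resolvent_set D (\<lambda>u. - A u)"
  proof (intro image_subsetI resolvent_set_uminus subsetD[OF sub])
    fix s :: real
    show "- \<gamma> s \<in> sector \<omega> \<phi>"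
      by (rule minus_in_sector[OF \<phi> \<psi>, of "\<bar>s\<bar>"]) (cases "s \<ge> 0"; simp add: \<gamma>1 \<gamma>2)+
  qed
  moreover have "- \<omega> < Re (\<gamma> s)" if "\<gamma> s \<in> \<real>" for s
  proof -
    have "s * sin \<psi> = 0" using that by (simp add: \<gamma>_def complex_is_Real_iff)
    then have "s = 0" using sin\<psi> by simp
    then show ?thesis by (simp add: \<gamma>_def)
  qed
  moreover have "\<exists>p q s\<^sub>0. (\<forall>s\<ge>s\<^sub>0. \<gamma> s = p + complex_of_real s * cis \<psi>) \<and>
        (\<forall>s\<le>- s\<^sub>0. \<gamma> s = q + complex_of_real (- s) * cis (- \<psi>))"
    by (intro exI[of _ "complex_of_real (1 - \<omega>)"] exI[of _ 0] conjI allI impI \<gamma>1 \<gamma>2) auto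
  ultimately show ?thesis
    using lip \<psi> unfolding semigroup_contour_def
    by (intro exI[of _ \<gamma>] conjI bexI[of _ \<psi>]) auto
qed

section \<open>The operator A\<close>

definition test_functions :: "(real \<Rightarrow> real) set" where
  "test_functions =
     {\<theta>. (\<forall>k x. (deriv ^^ k) \<theta> differentiable (at x)) \<and> compact (closure {x. \<theta> x \<noteq> 0})}"

definition has_weak_derivative ::
    "nat \<Rightarrow> 'e::{banach, second_countable_topology} l2uls \<Rightarrow> 'e l2uls \<Rightarrow> bool" where
  "has_weak_derivative k u w \<longleftrightarrow>
     (\<forall>\<theta>\<in>test_functions.
        (LINT x|lebesgue. (deriv ^^ k) \<theta> x *\<^sub>R rep_l2uls u x)
          = (- 1) ^ k *\<^sub>R (LINT x|lebesgue. \<theta> x *\<^sub>R rep_l2uls w x))"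

definition weak_derivative ::
    "nat \<Rightarrow> 'e::{banach, second_countable_topology} l2uls \<Rightarrow> 'e l2uls" where
  "weak_derivative k u = (THE w. has_weak_derivative k u w)"

definition H2_ul_s :: "'e::{banach, second_countable_topology} l2uls set" where
  "H2_ul_s = {u. \<forall>k\<le>2. \<exists>w. has_weak_derivative k u w}"

text \<open>
  The domain \<open>D\<close> with its graph norm is identified with the graph of \<open>B\<close> in the product space, so
  \<open>u\<close> belongs to L^2_ul-s with values in \<open>D\<close> if \<open>x \<mapsto> (u x, B (u x))\<close> is in L^2_ul-s with values in
  the product. As Lebesgue measurability is insensitive to null sets, the choice of the
  representative is irrelevant.
\<close>

definition l2uls_domain ::
    "'y::{banach, second_countable_topology} set \<Rightarrow> ('y \<Rightarrow> 'y) \<Rightarrow> 'y l2uls set" where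
  "l2uls_domain D B =
     {u. (AE x in lebesgue. rep_l2uls u x \<in> D) \<and>
         (\<lambda>x. (rep_l2uls u x, B (rep_l2uls u x))) \<in> L2_ul_s}"

definition A_domain ::
    "'y::{banach, second_countable_topology} set \<Rightarrow> ('y \<Rightarrow> 'y) \<Rightarrow> 'y l2uls set" where
  "A_domain D B = H2_ul_s \<inter> l2uls_domain D B"

definition A_operator ::
    "('y::{banach, second_countable_topology} \<Rightarrow> 'y) \<Rightarrow> 'y l2uls \<Rightarrow> 'y l2uls" where
  "A_operator B u = - weak_derivative 2 u + abs_l2uls (\<lambda>x. B (rep_l2uls u x))"

end

theory Submission
  imports Defs
begin

text \<open>
  Write \<open>X\<close> for the space \<open>L2_ul_s\<close> with values in the Hilbert space, \<open>\<tau>\<^sub>h\<close> for the translation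
  \<open>u \<mapsto> u(\<cdot> + h)\<close> and \<open>lap h u = (\<tau>\<^sub>h u - 2 u + \<tau>\<^sub>-\<^sub>h u) / h\<^sup>2\<close>. The difficulty is that \<open>X\<close> is not a
  Hilbert space and that functions with values in the domain of \<open>B\<close> are not dense in it. In the
  variable \<open>x\<close>, however, the translations form a strongly continuous group of isometries of the
  Banach space \<open>X\<close>, and its generator is the weak derivative (\<open>weak_derivative_1_iff_gen\<close>). So for
  \<open>u\<close> in the domain of \<open>A\<close> the difference quotients converge in norm, \<open>lap h u \<longlonglongrightarrow> u''\<close>
  (\<open>lap_tendsto\<close>), and estimates for the discretised operators \<open>- lap h + B\<close>, which involve no
  derivatives, pass to \<open>A\<close>.

  Energy estimates use the inner products \<open>wform a\<close> with weight \<open>exp (- |x - a|)\<close>. Their supremum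
  over \<open>a\<close> controls the norm of \<open>X\<close>, and summation by parts (\<open>wform_lap\<close>) costs only a commutator of
  lower order, which a shift of the operator absorbs. Testing the equation with \<open>u\<close> and with
  \<open>- lap h u\<close> yields maximal regularity (\<open>discrete_maximal_regularity\<close>), testing it with \<open>\<sigma> u\<close> for a
  suitable complex unit \<open>\<sigma>\<close> yields the resolvent estimate in a sector (\<open>sector_energy\<close>).

  Solutions are obtained without any spectral decomposition of \<open>B\<close>. The discretised equation is
  solved by a contraction whatever \<open>h\<close> is (\<open>discrete_exists\<close>). For data that are smooth in \<open>x\<close> its
  solutions converge as \<open>h \<rightarrow> 0\<close>, and maximal regularity extends solvability to all data
  (\<open>solution_exists\<close>). Hence \<open>A + 13\<close> is bijective with bounded inverse and \<open>A\<close> is closed; the method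
  of continuity (\<open>surj_continuation\<close>) carries surjectivity from \<open>- 13\<close> to the whole sector with
  vertex \<open>- 12\<close> (\<open>sectorial_A\<close>).

  For the failure of density, compactness of the resolvent and infinite dimension supply unit vectors
  \<open>y\<^sub>n\<close> with \<open>|\<langle>v, y\<^sub>n\<rangle>| \<le> (|v| + |B v|) / (n + 1)\<close> for \<open>v\<close> in the domain of \<open>B\<close>. The function with
  value \<open>y\<^sub>n\<close> on \<open>[n, n + 1)\<close> belongs to \<open>X\<close>, but an element \<open>u\<close> of the domain of \<open>A\<close> is almost
  orthogonal to it on distant intervals, as \<open>u\<close> and \<open>B u\<close> are uniformly locally square integrable
  (\<open>staircase_notin_closure\<close>). Finally, \<open>e\<^sup>-\<^sup>A\<^sup>t u\<close> is for \<open>t > 0\<close> a limit of linear combinations of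
  values of resolvents, so it lies in the closure of the domain; a trajectory that starts outside this
  closure jumps at \<open>t = 0\<close> (\<open>semigroup_not_continuous\<close>).

  Most of the argument takes place in a real Hilbert space, for operators with the two properties
  collected in the locale \<open>m_accretive\<close>. It thus applies to an operator in a real space, to its
  complexification, and to an operator in a complex space regarded as a real one.
\<close>

section \<open>Operators in Hilbert spaces\<close>

text \<open>
  The vector from a point outside of the subspace to the nearest point of the subspace, which exists
  by completeness.
\<close>

lemma exists_orthogonal_to_closed_subspace:
  fixes S :: "'a::{real_inner, complete_space} set"
  assumes S: "subspace S" "closed S" "S \<noteq> UNIV"
  shows "\<exists>v. v \<noteq> 0 \<and> (\<forall>s\<in>S. inner s v = 0)"
proof -
  obtain y where y: "y \<notin> S" using S(3) by auto
  define d where "d = infdist y S"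
  have S0: "S \<noteq> {}" using subspace_0[OF S(1)] by auto
  have d_le: "d \<le> norm (y - s)" if "s \<in> S" for s
    unfolding d_def using infdist_le[OF that, of y] by (simp add: dist_norm)
  have "\<exists>s\<in>S. norm (y - s) < d + 1 / real (Suc n)" for n
  proof -
    have "infdist y S < d + 1 / real (Suc n)" by (simp add: d_def)
    then show ?thesis
      unfolding infdist_notempty[OF S0] by (subst (asm) cINF_less_iff) (auto simp: S0 dist_norm intro!: bdd_belowI2[of _ 0])
  qed
  then obtain s where s: "\<And>n. s n \<in> S" "\<And>n. norm (y - s n) < d + 1 / real (Suc n)" by metis
  have d0: "d \<ge> 0" by (simp add: d_def infdist_nonneg)
  \<comment> \<open>midpoints stay in the subspace, so the parallelogram identity makes minimising sequences Cauchy\<close>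
  have par: "(norm (s m - s n))\<^sup>2 \<le> 2 * (norm (y - s m))\<^sup>2 + 2 * (norm (y - s n))\<^sup>2 - 4 * d\<^sup>2" for m n
  proof -
    have "(1/2) *\<^sub>R (s m + s n) \<in> S" using s S(1) by (simp add: subspace_add subspace_scale)
    then have "d\<^sup>2 \<le> (norm (y - (1/2) *\<^sub>R (s m + s n)))\<^sup>2"
      by (intro power_mono d_le d0)
    moreover have "(norm (s m - s n))\<^sup>2 = 2 * (norm (y - s m))\<^sup>2 + 2 * (norm (y - s n))\<^sup>2
       - 4 * (norm (y - (1/2) *\<^sub>R (s m + s n)))\<^sup>2"
      by (simp add: power2_norm_eq_inner inner_simps inner_commute algebra_simps)
    ultimately show ?thesis by simp
  qed
  have "Cauchy s"
  proof (rule metric_CauchyI)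
    fix e :: real assume e: "e > 0"
    have "(\<lambda>n. 4 * (d + 1 / real (Suc n))\<^sup>2 - 4 * d\<^sup>2) \<longlonglongrightarrow> 4 * (d + 0)\<^sup>2 - 4 * d\<^sup>2"
      by (intro tendsto_intros LIMSEQ_inverse_real_of_nat[unfolded inverse_eq_divide])
    then have "\<forall>\<^sub>F n in sequentially. 4 * (d + 1 / real (Suc n))\<^sup>2 - 4 * d\<^sup>2 < e\<^sup>2"
      by (rule order_tendstoD) (use e in simp)
    then obtain N where N: "4 * (d + 1 / real (Suc N))\<^sup>2 - 4 * d\<^sup>2 < e\<^sup>2"
      by (auto simp: eventually_sequentially)
    have b: "(norm (y - s n))\<^sup>2 \<le> (d + 1 / real (Suc N))\<^sup>2" if "n \<ge> N" for n
    proof (rule power_mono)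
      have "1 / real (Suc n) \<le> 1 / real (Suc N)" using that by (simp add: field_simps)
      then show "norm (y - s n) \<le> d + 1 / real (Suc N)" using s(2)[of n] by linarith
    qed simp
    have "dist (s m) (s n) < e" if "m \<ge> N" "n \<ge> N" for m n
    proof -
      have "(norm (s m - s n))\<^sup>2 < e\<^sup>2"
        using par[of m n] b[OF that(1)] b[OF that(2)] N by linarith
      then show ?thesis using e by (simp add: dist_norm power2_less_imp_less)
    qed
    then show "\<exists>M. \<forall>m\<ge>M. \<forall>n\<ge>M. dist (s m) (s n) < e" by blast
  qed
  then obtain p where p: "s \<longlonglongrightarrow> p" by (auto simp: Cauchy_convergent_iff convergent_def)
  have pS: "p \<in> S" using closed_sequentially[OF S(2) s(1) p] by simp
  have "norm (y - p) \<le> d + 0"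
  proof (rule LIMSEQ_le)
    show "(\<lambda>n. norm (y - s n)) \<longlonglongrightarrow> norm (y - p)" by (intro tendsto_intros p)
    show "(\<lambda>n. d + 1 / real (Suc n)) \<longlonglongrightarrow> d + 0"
      by (intro tendsto_intros LIMSEQ_inverse_real_of_nat[unfolded inverse_eq_divide])
    show "\<exists>N. \<forall>n\<ge>N. norm (y - s n) \<le> d + 1 / real (Suc n)" using s(2) less_imp_le by blast
  qed
  then have min: "norm (y - p) \<le> norm (y - s)" if "s \<in> S" for s using d_le[OF that] by simp
  \<comment> \<open>otherwise a step of size \<open>t\<close> from \<open>p\<close> in the direction of \<open>s\<close> would come closer to \<open>y\<close>\<close>
  have "inner s (y - p) = 0" if sS: "s \<in> S" for s
  proof (cases "s = 0")
    case False
    define t where "t = inner s (y - p) / inner s s"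
    have "p + t *\<^sub>R s \<in> S" using pS sS S(1) by (simp add: subspace_add subspace_scale)
    then have "(norm (y - p))\<^sup>2 \<le> (norm (y - (p + t *\<^sub>R s)))\<^sup>2" by (intro power_mono min) auto
    also have "\<dots> = (norm (y - p))\<^sup>2 - 2 * t * inner s (y - p) + t\<^sup>2 * inner s s"
      unfolding power2_norm_eq_inner
      by (simp add: inner_simps inner_commute algebra_simps power2_eq_square)
    also have "\<dots> = (norm (y - p))\<^sup>2 - (inner s (y - p))\<^sup>2 / inner s s"
      using False by (simp add: t_def power2_eq_square field_simps)
    finally have "(inner s (y - p))\<^sup>2 / inner s s \<le> 0" by simp
    moreover have "inner s s > 0" using False by simp
    ultimately show ?thesis by (simp add: divide_le_0_iff)
  qed simp
  moreover have "y - p \<noteq> 0" using y pS by auto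
  ultimately show ?thesis by blast
qed

text \<open>
  The error of the orthogonal projection of any vector outside of the span; the projection is built
  by Gram-Schmidt steps.
\<close>

lemma exists_unit_vector_orthogonal_to_finite:
  fixes S :: "'a::real_inner set"
  assumes fin: "finite S" and inf: "\<And>S :: 'a set. finite S \<Longrightarrow> span S \<noteq> UNIV"
  shows "\<exists>y. norm y = 1 \<and> (\<forall>s\<in>S. inner s y = 0)"
proof -
  have proj: "\<exists>p\<in>span S. \<forall>s\<in>S. inner s (v - p) = 0" for v
    using fin
  proof (induction S arbitrary: v)
    case empty
    show ?case by (auto simp: span_zero)
  next
    case (insert a S)
    obtain p where p: "p \<in> span S" "\<forall>s\<in>S. inner s (v - p) = 0" using insert.IH by blast
    obtain q where q: "q \<in> span S" "\<forall>s\<in>S. inner s (a - q) = 0" using insert.IH by blast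
    define b where "b = a - q"
    define t where "t = inner b (v - p) / inner b b"
    have span: "x \<in> span (insert a S)" if "x \<in> span S" for x
      using that span_mono[of S "insert a S"] by blast
    have bspan: "b \<in> span (insert a S)"
      unfolding b_def by (intro span_diff span q(1) span_base) auto
    have orth: "inner x w = 0" if "x \<in> span S" "\<forall>s\<in>S. inner s w = 0" for x w
      using that(1)
      by (induction rule: span_induct_alt) (use that(2) in \<open>auto simp: inner_simps\<close>)
    have S0: "\<forall>s\<in>S. inner s (v - (p + t *\<^sub>R b)) = 0"
    proof
      fix s assume "s \<in> S"
      then have "inner s (v - p) = 0" "inner s b = 0" using p(2) q(2) by (auto simp: b_def)
      then show "inner s (v - (p + t *\<^sub>R b)) = 0" by (simp add: inner_simps)
    qed
    have b0: "inner b (v - (p + t *\<^sub>R b)) = 0"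
      by (cases "b = 0") (auto simp: inner_simps t_def)
    have "inner a (v - (p + t *\<^sub>R b)) = inner b (v - (p + t *\<^sub>R b)) + inner q (v - (p + t *\<^sub>R b))"
      unfolding inner_add_left[symmetric] by (simp add: b_def)
    also have "\<dots> = 0" using b0 orth[OF q(1) S0] by simp
    finally have "\<forall>s\<in>insert a S. inner s (v - (p + t *\<^sub>R b)) = 0" using S0 by simp
    moreover have "p + t *\<^sub>R b \<in> span (insert a S)"
      by (intro span_add span p(1) span_scale bspan)
    ultimately show ?case by blast
  qed
  obtain v where v: "v \<notin> span S" using inf[OF fin] by auto
  obtain p where p: "p \<in> span S" "\<forall>s\<in>S. inner s (v - p) = 0" using proj by blast
  then have "v - p \<noteq> 0" using v by auto
  then show ?thesis using p(2) by (intro exI[of _ "sgn (v - p)"]) (auto simp: norm_sgn sgn_div_norm)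
qed

text \<open>
  Positivity and solvability of \<open>B u + \<kappa> u = y\<close> for all \<open>\<kappa> > 0\<close> are what positive self-adjoint operators,
  on real spaces, on complex spaces and on complexifications, have in common.
\<close>

locale m_accretive =
  fixes D :: "'y::{real_inner, banach, second_countable_topology} set" and B :: "'y \<Rightarrow> 'y"
  assumes lin: "linear_operator scaleR D B"
    and accretive: "u \<in> D \<Longrightarrow> 0 \<le> inner (B u) u"
    and onto: "0 < \<kappa> \<Longrightarrow> \<exists>u\<in>D. B u + \<kappa> *\<^sub>R u = y"

lemma linear_operatorD:
  assumes "linear_operator scaleR D T"
  shows "0 \<in> D" "T 0 = 0"
    and "u \<in> D \<Longrightarrow> v \<in> D \<Longrightarrow> u + v \<in> D" "u \<in> D \<Longrightarrow> v \<in> D \<Longrightarrow> T (u + v) = T u + T v"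
    and "u \<in> D \<Longrightarrow> c *\<^sub>R u \<in> D" "u \<in> D \<Longrightarrow> T (c *\<^sub>R u) = c *\<^sub>R T u"
    and "u \<in> D \<Longrightarrow> v \<in> D \<Longrightarrow> u - v \<in> D" "u \<in> D \<Longrightarrow> v \<in> D \<Longrightarrow> T (u - v) = T u - T v"
proof -
  have 1: "\<And>u v. u \<in> D \<Longrightarrow> v \<in> D \<Longrightarrow> u + v \<in> D \<and> T (u + v) = T u + T v"
    and 2: "\<And>u c. u \<in> D \<Longrightarrow> c *\<^sub>R u \<in> D \<and> T (c *\<^sub>R u) = c *\<^sub>R T u" and 3: "0 \<in> D"
    using assms by (auto simp: linear_operator_def)
  show "0 \<in> D" "T 0 = 0" using 3 2[OF 3, of 0] by auto
  show "u \<in> D \<Longrightarrow> v \<in> D \<Longrightarrow> u + v \<in> D" "u \<in> D \<Longrightarrow> v \<in> D \<Longrightarrow> T (u + v) = T u + T v"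
    using 1 by auto
  show "u \<in> D \<Longrightarrow> c *\<^sub>R u \<in> D" "u \<in> D \<Longrightarrow> T (c *\<^sub>R u) = c *\<^sub>R T u"
    using 2 by auto
  show "u \<in> D \<Longrightarrow> v \<in> D \<Longrightarrow> u - v \<in> D" "u \<in> D \<Longrightarrow> v \<in> D \<Longrightarrow> T (u - v) = T u - T v"
    using 1[of u "(-1) *\<^sub>R v"] 2[of v "-1"] by auto
qed

text \<open>
  The inner product of \<open>y + \<kappa> x\<close> with \<open>x\<close> is at least \<open>\<kappa> |x|\<^sup>2\<close>.
\<close>

lemma accretive_norm_bound:
  fixes x y :: "'a::real_inner"
  assumes "0 \<le> inner y x" "0 < \<kappa>"
  shows "\<kappa> * norm x \<le> norm (y + \<kappa> *\<^sub>R x)"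
proof (cases "x = 0")
  case False
  have "\<kappa> * norm x * norm x = \<kappa> * inner x x" by (simp add: power2_norm_eq_inner[symmetric] power2_eq_square)
  also have "\<dots> \<le> inner (y + \<kappa> *\<^sub>R x) x" using assms by (simp add: inner_simps)
  also have "\<dots> \<le> norm (y + \<kappa> *\<^sub>R x) * norm x" by (rule norm_cauchy_schwarz)
  finally show ?thesis using False by simp
qed simp

text \<open>
  A vector orthogonal to the range of \<open>B + \<kappa>\<close> would be an eigenvector of \<open>B\<^sup>* = B\<close> for the
  negative eigenvalue \<open>- \<kappa>\<close>.
\<close>

lemma self_adjoint_imp_m_accretive:
  fixes D :: "'y::{real_inner, banach, second_countable_topology} set"
  assumes sa: "self_adjoint_operator scaleR inner D B" and pos: "\<And>u. u \<in> D \<Longrightarrow> 0 \<le> inner (B u) u"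
  shows "m_accretive D B"
proof
  show lin: "linear_operator scaleR D B" using sa by (simp add: self_adjoint_operator_def)
  note L = linear_operatorD[OF lin]
  have adj: "adjoint_graph inner D B = operator_graph D B"
    using sa by (simp add: self_adjoint_operator_def)
  have graphI: "v \<in> D \<and> B v = w" if "\<And>u. u \<in> D \<Longrightarrow> inner (B u) v = inner u w" for v w
  proof -
    have "(v, w) \<in> adjoint_graph inner D B" using that by (simp add: adjoint_graph_def)
    then show ?thesis unfolding adj by (auto simp: operator_graph_def)
  qed
  have sym: "inner (B u) v = inner u (B v)" if "u \<in> D" "v \<in> D" for u v
  proof -
    have "(v, B v) \<in> adjoint_graph inner D B" unfolding adj using that by (auto simp: operator_graph_def)
    then show ?thesis using that by (simp add: adjoint_graph_def)
  qed
  show "0 \<le> inner (B u) u" if "u \<in> D" for u using pos that .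
  fix \<kappa> :: real and y :: 'y assume \<kappa>: "0 < \<kappa>"
  define S where "S = (\<lambda>u. B u + \<kappa> *\<^sub>R u) ` D"
  have subS: "subspace S"
  proof (rule subspaceI)
    show "0 \<in> S" unfolding S_def using L(1,2) by force
    show "x + y \<in> S" if xy: "x \<in> S" "y \<in> S" for x y
    proof -
      obtain u v where "u \<in> D" "v \<in> D" "x = B u + \<kappa> *\<^sub>R u" "y = B v + \<kappa> *\<^sub>R v"
        using xy by (auto simp: S_def)
      then show ?thesis unfolding S_def
        by (intro image_eqI[of _ _ "u + v"]) (auto simp: L algebra_simps)
    qed
    show "c *\<^sub>R x \<in> S" if x: "x \<in> S" for x c
    proof -
      obtain u where "u \<in> D" "x = B u + \<kappa> *\<^sub>R u" using x by (auto simp: S_def)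
      then show ?thesis unfolding S_def
        by (intro image_eqI[of _ _ "c *\<^sub>R u"]) (auto simp: L algebra_simps)
    qed
  qed
  have "closed S"
    unfolding closed_sequential_limits
  proof (intro allI impI, elim conjE)
    fix x l assume xS: "\<forall>n. x n \<in> S" and xl: "x \<longlonglongrightarrow> l"
    have "\<forall>n. \<exists>u. u \<in> D \<and> x n = B u + \<kappa> *\<^sub>R u" using xS unfolding S_def by blast
    then obtain u where u: "\<And>n. u n \<in> D" "\<And>n. x n = B (u n) + \<kappa> *\<^sub>R u n" by metis
    have bd: "\<kappa> * norm (u m - u n) \<le> norm (x m - x n)" for m n
    proof -
      have "x m - x n = B (u m - u n) + \<kappa> *\<^sub>R (u m - u n)" using u by (simp add: L algebra_simps)
      then show ?thesis using accretive_norm_bound[OF pos \<kappa>, of "u m - u n"] L(7) u(1) by simp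
    qed
    have "Cauchy u"
    proof (rule metric_CauchyI)
      fix e :: real assume "e > 0"
      then have "\<kappa> * e > 0" using \<kappa> by simp
      then obtain M where M: "\<And>m n. m \<ge> M \<Longrightarrow> n \<ge> M \<Longrightarrow> dist (x m) (x n) < \<kappa> * e"
        using LIMSEQ_imp_Cauchy[OF xl] unfolding Cauchy_def by blast
      then have "dist (u m) (u n) < e" if "m \<ge> M" "n \<ge> M" for m n
        using order_le_less_trans[OF bd M[OF that, unfolded dist_norm]] \<kappa> by (simp add: dist_norm)
      then show "\<exists>M. \<forall>m\<ge>M. \<forall>n\<ge>M. dist (u m) (u n) < e" by blast
    qed
    then obtain v where v: "u \<longlonglongrightarrow> v" by (auto simp: Cauchy_convergent_iff convergent_def)
    have Bu: "(\<lambda>n. B (u n)) \<longlonglongrightarrow> l - \<kappa> *\<^sub>R v"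
    proof -
      have "(\<lambda>n. x n - \<kappa> *\<^sub>R u n) \<longlonglongrightarrow> l - \<kappa> *\<^sub>R v" by (intro tendsto_intros xl v)
      then show ?thesis by (simp add: u(2))
    qed
    have "v \<in> D \<and> B v = l - \<kappa> *\<^sub>R v"
    proof (rule graphI)
      fix w assume w: "w \<in> D"
      have "(\<lambda>n. inner (B w) (u n)) \<longlonglongrightarrow> inner (B w) v" by (intro tendsto_intros v)
      moreover have "(\<lambda>n. inner w (B (u n))) \<longlonglongrightarrow> inner w (l - \<kappa> *\<^sub>R v)" by (intro tendsto_intros Bu)
      ultimately show "inner (B w) v = inner w (l - \<kappa> *\<^sub>R v)"
        using sym[OF w u(1)] LIMSEQ_unique by simp
    qed
    then show "l \<in> S" unfolding S_def by force
  qed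
  have "S = UNIV"
  proof (rule ccontr)
    assume "S \<noteq> UNIV"
    then obtain v where v: "v \<noteq> 0" "\<And>s. s \<in> S \<Longrightarrow> inner s v = 0"
      using exists_orthogonal_to_closed_subspace[OF subS \<open>closed S\<close>] by blast
    have "v \<in> D \<and> B v = - \<kappa> *\<^sub>R v"
    proof (rule graphI)
      fix u assume "u \<in> D"
      then have "inner (B u + \<kappa> *\<^sub>R u) v = 0" by (intro v(2)) (auto simp: S_def)
      then show "inner (B u) v = inner u (- \<kappa> *\<^sub>R v)" by (simp add: inner_simps)
    qed
    then have "0 \<le> - \<kappa> * inner v v" using pos[of v] by simp
    moreover have "0 < \<kappa> * inner v v" using \<kappa> v(1) by simp
    ultimately show False by simp
  qed
  then have "y \<in> S" by simp
  then show "\<exists>u\<in>D. B u + \<kappa> *\<^sub>R u = y" unfolding S_def by force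
qed

text \<open>
  Method of continuity: surjectivity of \<open>z - T\<close> propagates along a segment on which \<open>z - T\<close> is
  uniformly bounded from below, by steps that are shorter than the lower bound.
\<close>

lemma surj_continuation:
  fixes D :: "'e::{complex_normed_vector, complete_space} set"
  assumes lin: "linear_operator scaleR D T" and c: "c > 0"
    and bd: "\<And>t u. 0 \<le> t \<Longrightarrow> t \<le> 1 \<Longrightarrow> u \<in> D \<Longrightarrow>
      c * norm u \<le> norm ((z0 + of_real t * (z1 - z0)) *\<^sub>C u - T u)"
    and surj: "\<And>f. \<exists>u\<in>D. z0 *\<^sub>C u - T u = f"
  shows "\<exists>u\<in>D. z1 *\<^sub>C u - T u = f"
proof -
  note L = linear_operatorD[OF lin]
  have cdiff: "a *\<^sub>C (x - y) = a *\<^sub>C x - a *\<^sub>C y" for a and x y :: 'e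
    using scaleC_add_right[of a "x - y" y] by (simp add: algebra_simps)
  have cldiff: "(a - b) *\<^sub>C x = a *\<^sub>C x - b *\<^sub>C x" for a b and x :: 'e
    using scaleC_add_left[of "a - b" b x] by (simp add: algebra_simps)
  have step: "\<forall>f. \<exists>u\<in>D. w' *\<^sub>C u - T u = f"
    if w: "\<forall>f. \<exists>u\<in>D. w *\<^sub>C u - T u = f" "\<And>u. u \<in> D \<Longrightarrow> c * norm u \<le> norm (w *\<^sub>C u - T u)"
      and close: "cmod (w' - w) < c" for w w'
  proof
    fix f
    obtain S where S: "\<And>g. S g \<in> D" "\<And>g. w *\<^sub>C S g - T (S g) = g" using w(1) by metis
    have Sl: "c * norm (S g - S g') \<le> norm (g - g')" for g g'
    proof -
      have "w *\<^sub>C (S g - S g') - T (S g - S g') = g - g'"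
        using S by (simp add: L cdiff algebra_simps)
      then show ?thesis using w(2)[OF L(7)[OF S(1) S(1)], of g g'] by simp
    qed
    have "\<exists>!u. S (f - (w' - w) *\<^sub>C u) = u"
    proof (rule banach_fix_type)
      show "0 \<le> cmod (w' - w) / c" "cmod (w' - w) / c < 1" using c close by auto
      show "\<forall>x y. dist (S (f - (w' - w) *\<^sub>C x)) (S (f - (w' - w) *\<^sub>C y)) \<le> cmod (w' - w) / c * dist x y"
      proof (intro allI)
        fix x y
        have "c * norm (S (f - (w' - w) *\<^sub>C x) - S (f - (w' - w) *\<^sub>C y)) \<le> norm ((w' - w) *\<^sub>C (y - x))"
          using Sl[of "f - (w' - w) *\<^sub>C x" "f - (w' - w) *\<^sub>C y"] by (simp add: cdiff)
        then show "dist (S (f - (w' - w) *\<^sub>C x)) (S (f - (w' - w) *\<^sub>C y)) \<le> cmod (w' - w) / c * dist x y"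
          using c by (simp add: norm_scaleC dist_norm norm_minus_commute field_simps)
      qed
    qed
    then obtain u where "S (f - (w' - w) *\<^sub>C u) = u" by auto
    then have "u \<in> D" "w *\<^sub>C u - T u = f - (w' - w) *\<^sub>C u" using S by metis+
    then have "u \<in> D" "w' *\<^sub>C u - T u = f" by (auto simp: cldiff algebra_simps)
    then show "\<exists>u\<in>D. w' *\<^sub>C u - T u = f" by blast
  qed
  obtain N :: nat where N: "cmod (z1 - z0) / c < real N" using reals_Archimedean2 by blast
  have N0: "N > 0" using N c by (cases N) (auto simp: divide_less_0_iff not_less)
  have "k \<le> N \<Longrightarrow> \<forall>f. \<exists>u\<in>D. (z0 + of_real (real k / real N) * (z1 - z0)) *\<^sub>C u - T u = f" for k
  proof (induction k)
    case 0
    then show ?case using surj by simp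
  next
    case (Suc k)
    show ?case
    proof (rule step)
      show "\<forall>f. \<exists>u\<in>D. (z0 + of_real (real k / real N) * (z1 - z0)) *\<^sub>C u - T u = f" using Suc by simp
      show "c * norm u \<le> norm ((z0 + of_real (real k / real N) * (z1 - z0)) *\<^sub>C u - T u)" if "u \<in> D" for u
        using Suc.prems N0 by (intro bd that) auto
      have "(z0 + of_real (real (Suc k) / real N) * (z1 - z0)) - (z0 + of_real (real k / real N) * (z1 - z0))
          = (of_real (real (Suc k) / real N) - of_real (real k / real N)) * (z1 - z0)"
        by (simp only: ring_distribs) simp
      also have "(of_real (real (Suc k) / real N) - of_real (real k / real N) :: complex) = of_real (1 / real N)"
        by (simp add: diff_divide_distrib[symmetric])
      finally have "cmod (z0 + of_real (real (Suc k) / real N) * (z1 - z0) - (z0 + of_real (real k / real N) * (z1 - z0)))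
          = cmod (z1 - z0) / real N"
        by (simp add: norm_mult norm_divide)
      also have "\<dots> < c" using N N0 c by (simp add: field_simps)
      finally show "cmod (z0 + of_real (real (Suc k) / real N) * (z1 - z0) - (z0 + of_real (real k / real N) * (z1 - z0))) < c" .
    qed
  qed
  from this[of N] N0 show ?thesis by simp
qed


section \<open>Completeness of the uniformly local space\<close>

lemma borel_measurable_lebesgue_cong_AE:
  fixes u v :: "real \<Rightarrow> 'e::topological_space"
  assumes u: "u \<in> borel_measurable lebesgue" and eq: "AE x in lebesgue. u x = v x"
  shows "v \<in> borel_measurable lebesgue"
proof (rule measurableI)
  fix A :: "'e set" assume A: "A \<in> sets borel"
  have "Measurable.pred lebesgue (\<lambda>x. u x \<noteq> v x)" "Measurable.pred lebesgue (\<lambda>x. v x \<in> A \<and> u x \<noteq> v x)"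
    using eq by (auto intro!: sets_completion_AE simp: AE_completion_iff)
  then have S: "{x. u x \<noteq> v x} \<in> sets lebesgue" "{x. v x \<in> A \<and> u x \<noteq> v x} \<in> sets lebesgue"
    by (simp_all add: pred_def)
  have "u -` A \<in> sets lebesgue" using measurable_sets[OF u A] by simp
  then have "(u -` A - {x. u x \<noteq> v x}) \<union> {x. v x \<in> A \<and> u x \<noteq> v x} \<in> sets lebesgue" using S by blast
  also have "(u -` A - {x. u x \<noteq> v x}) \<union> {x. v x \<in> A \<and> u x \<noteq> v x} = v -` A \<inter> space lebesgue" by auto
  finally show "v -` A \<inter> space lebesgue \<in> sets lebesgue" .
qed simp

lemma L2_ul_s_cong_AE:
  assumes u: "u \<in> L2_ul_s" and eq: "AE x in lebesgue. u x = v x"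
  shows "v \<in> L2_ul_s"
proof -
  have vm: "v \<in> borel_measurable lebesgue"
    by (rule borel_measurable_lebesgue_cong_AE[OF L2_loc_measurable[OF L2_ul_sD(2)[OF u]] eq])
  have vloc: "v \<in> L2_loc"
    unfolding L2_loc_def mem_Collect_eq
  proof (intro conjI vm allI)
    fix a b :: real
    have "AE x in lebesgue. indicat_real {a..b} x *\<^sub>R (norm (u x))\<^sup>2 = indicat_real {a..b} x *\<^sub>R (norm (v x))\<^sup>2"
      using eq by eventually_elim simp
    then show "set_integrable lebesgue {a..b} (\<lambda>x. (norm (v x))\<^sup>2)"
      using L2_loc_integrable[OF L2_ul_sD(2)[OF u], of a b] unfolding set_integrable_def
      by (subst (asm) integrable_cong_AE[OF borel_measurable_indicator_norm_square
            borel_measurable_indicator_norm_square[OF vm]])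
        (auto intro: L2_loc_measurable L2_ul_sD u)
  qed
  have un: "unit_norm a v = unit_norm a u" for a
    using unit_norm_cong_AE[OF L2_loc_measurable[OF L2_ul_sD(2)[OF u]] vm eq] by simp
  have vw: "v \<in> L2_ul_w"
    using vloc L2_ul_sD(1)[OF u] by (simp add: L2_ul_w_def un)
  have "ul_norm (\<lambda>x. v x - v (x - \<xi>)) = ul_norm (\<lambda>x. u x - u (x - \<xi>))" for \<xi>
  proof (rule ul_norm_cong_AE)
    show "(\<lambda>x. v x - v (x - \<xi>)) \<in> L2_loc" "(\<lambda>x. u x - u (x - \<xi>)) \<in> L2_loc"
      using vw L2_ul_sD(1)[OF u] by (auto intro!: L2_ul_w_diff L2_ul_w_shift L2_ul_wD)
    show "AE x in lebesgue. v x - v (x - \<xi>) = u x - u (x - \<xi>)"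
      using eq AE_shift[OF eq, of \<xi>] by eventually_elim simp
  qed
  then show ?thesis using u vw by (simp add: L2_ul_s_def)
qed

lemma unit_norm_nn_integral:
  assumes "u \<in> L2_loc"
  shows "(\<integral>\<^sup>+x. ennreal (indicat_real {a..a+1} x * (norm (u x))\<^sup>2) \<partial>lebesgue) = ennreal ((unit_norm a u)\<^sup>2)"
  using L2_loc_integrable[OF assms, of a "a + 1"] unfolding unit_norm_power2 set_integrable_def set_lebesgue_integral_def
  by (subst nn_integral_eq_integral) auto

lemma L2_ul_w_nn_integralI:
  fixes u :: "real \<Rightarrow> 'e::{banach, second_countable_topology}"
  assumes u: "u \<in> borel_measurable lebesgue" and K: "0 \<le> K"
    and le: "\<And>a. (\<integral>\<^sup>+x. ennreal (indicat_real {a..a+1} x * (norm (u x))\<^sup>2) \<partial>lebesgue) \<le> ennreal (K\<^sup>2)"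
  shows "u \<in> L2_ul_w" "ul_norm u \<le> K"
proof -
  note m = borel_measurable_indicator_norm_square[OF u, unfolded real_scaleR_def]
  have "integrable lebesgue (\<lambda>x. indicat_real {a..b} x * (norm (u x))\<^sup>2)" for a b
  proof (rule integrableI_nonneg)
    obtain N :: nat where N: "b - a < real N" using reals_Archimedean2 by blast
    have "(\<integral>\<^sup>+x. ennreal (indicat_real {a..b} x * (norm (u x))\<^sup>2) \<partial>lebesgue)
        \<le> (\<integral>\<^sup>+x. (\<Sum>k<N. ennreal (indicat_real {a + real k..a + real k + 1} x * (norm (u x))\<^sup>2)) \<partial>lebesgue)"
    proof (intro nn_integral_mono)
      fix x
      show "ennreal (indicat_real {a..b} x * (norm (u x))\<^sup>2)
        \<le> (\<Sum>k<N. ennreal (indicat_real {a + real k..a + real k + 1} x * (norm (u x))\<^sup>2))"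
      proof (cases "x \<in> {a..b}")
        case True
        define k where "k = nat \<lfloor>x - a\<rfloor>"
        have k: "real k \<le> x - a" "x - a < real k + 1" using True by (auto simp: k_def)
        then have "k < N" using True N by simp
        have "ennreal (indicat_real {a..b} x * (norm (u x))\<^sup>2)
           = ennreal (indicat_real {a + real k..a + real k + 1} x * (norm (u x))\<^sup>2)"
          using True k by (simp add: indicator_def)
        also have "\<dots> \<le> (\<Sum>k<N. ennreal (indicat_real {a + real k..a + real k + 1} x * (norm (u x))\<^sup>2))"
          using \<open>k < N\<close> by (intro member_le_sum) auto
        finally show ?thesis .
      qed simp
    qed
    also have "\<dots> = (\<Sum>k<N. (\<integral>\<^sup>+x. ennreal (indicat_real {a + real k..a + real k + 1} x * (norm (u x))\<^sup>2) \<partial>lebesgue))"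
      by (rule nn_integral_sum[OF measurable_compose[OF m measurable_ennreal]])
    also have "\<dots> \<le> (\<Sum>k<N. ennreal (K\<^sup>2))" by (intro sum_mono le)
    also have "\<dots> = ennreal (\<Sum>k<N. K\<^sup>2)" by (rule sum_ennreal) simp
    also have "\<dots> < \<infinity>" by simp
    finally show "(\<integral>\<^sup>+x. ennreal (indicat_real {a..b} x * (norm (u x))\<^sup>2) \<partial>lebesgue) < \<infinity>" .
  qed (simp_all add: m)
  then have loc: "u \<in> L2_loc" using u unfolding L2_loc_def set_integrable_def real_scaleR_def by blast
  have *: "unit_norm a u \<le> K" for a
  proof (rule power2_le_imp_le[OF _ K])
    have "ennreal ((unit_norm a u)\<^sup>2) \<le> ennreal (K\<^sup>2)"
      using le[of a] unfolding unit_norm_nn_integral[OF loc] .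
    then show "(unit_norm a u)\<^sup>2 \<le> K\<^sup>2" by (subst (asm) ennreal_le_iff) simp_all
  qed
  show "u \<in> L2_ul_w" using loc * by (rule L2_ul_wI)
  show "ul_norm u \<le> K" using * by (rule ul_norm_le)
qed

text \<open>
  The Cauchy-Schwarz inequality on an interval of length \<open>1\<close>, by integration of
  \<open>|u| \<le> |u|\<^sup>2 / (2 K) + K / 2\<close>.
\<close>

lemma L2_ul_w_nn_integral_norm:
  fixes u :: "real \<Rightarrow> 'e::{banach, second_countable_topology}"
  assumes u: "u \<in> L2_ul_w" and K: "0 < K" "ul_norm u \<le> K"
  shows "(\<integral>\<^sup>+x. ennreal (indicat_real {a..a+1} x * norm (u x)) \<partial>lebesgue) \<le> ennreal K"
proof -
  have um: "u \<in> borel_measurable lebesgue" using u by (intro L2_loc_measurable L2_ul_wD)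
  have uK: "(unit_norm a u)\<^sup>2 \<le> K\<^sup>2"
    using unit_norm_le_ul_norm[OF u, of a] K unit_norm_nonneg[of a u] by (intro power_mono) auto
  have "(\<integral>\<^sup>+x. ennreal (indicat_real {a..a+1} x * norm (u x)) \<partial>lebesgue)
    \<le> (\<integral>\<^sup>+x. ennreal (1 / (2 * K)) * ennreal (indicat_real {a..a+1} x * (norm (u x))\<^sup>2) + ennreal (K/2) * indicator {a..a+1} x \<partial>lebesgue)"
  proof (intro nn_integral_mono)
    fix x
    have "0 \<le> (norm (u x) - K)\<^sup>2" by simp
    then have "norm (u x) \<le> 1 / (2 * K) * (norm (u x))\<^sup>2 + K/2"
      using K by (simp add: power2_eq_square field_simps)
    then show "ennreal (indicat_real {a..a+1} x * norm (u x)) \<le>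
       ennreal (1 / (2 * K)) * ennreal (indicat_real {a..a+1} x * (norm (u x))\<^sup>2) + ennreal (K/2) * indicator {a..a+1} x"
      using K by (auto simp: indicator_def simp flip: ennreal_mult ennreal_plus)
  qed
  also have "\<dots> = ennreal (1 / (2 * K)) * ennreal ((unit_norm a u)\<^sup>2) + ennreal (K/2)"
  proof -
    have 1: "(\<lambda>x. ennreal (indicat_real {a..a+1} x * (norm (u x))\<^sup>2)) \<in> borel_measurable lebesgue"
      using borel_measurable_indicator_norm_square[OF um, of a "a+1"]
      by (intro measurable_compose[OF _ measurable_ennreal]) simp
    have 2: "(\<lambda>x. ennreal (K/2) * indicator {a..a+1} x) \<in> borel_measurable lebesgue"
      by (rule borel_measurable_times_ennreal[OF borel_measurable_const borel_measurable_indicator]) simp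
    have 3: "(\<integral>\<^sup>+x. ennreal (K/2) * indicator {a..a+1} x \<partial>lebesgue) = ennreal (K/2)"
      by (subst nn_integral_cmult_indicator) auto
    show ?thesis
      by (subst nn_integral_add[OF borel_measurable_times_ennreal[OF borel_measurable_const 1] 2])
        (simp add: nn_integral_cmult[OF 1] unit_norm_nn_integral[OF L2_ul_wD[OF u]] 3)
  qed
  also have "\<dots> = ennreal (1 / (2 * K) * (unit_norm a u)\<^sup>2 + K/2)"
    using K by (simp flip: ennreal_mult ennreal_plus)
  also have "\<dots> \<le> ennreal K"
    using K uK by (intro ennreal_leI) (simp add: power2_eq_square field_simps)
  finally show ?thesis .
qed

text \<open>
  The classical proof of completeness of \<open>L\<^sup>2\<close>, with integrals over unit intervals: a sequence with
  geometrically decaying increments converges almost everywhere, and Fatou's lemma bounds the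
  distance to the limit.
\<close>

lemma L2_ul_s_fast_Cauchy_limit:
  fixes f :: "nat \<Rightarrow> real \<Rightarrow> 'e::{banach, second_countable_topology}"
  assumes f: "\<And>n. f n \<in> L2_ul_s" and fast: "\<And>n. ul_norm (\<lambda>x. f (Suc n) x - f n x) \<le> (1/2)^n"
  shows "\<exists>g\<in>L2_ul_s. \<forall>n. ul_norm (\<lambda>x. g x - f n x) \<le> 2 * (1/2)^n"
proof -
  have fm: "f n \<in> borel_measurable lebesgue" for n by (intro L2_loc_measurable L2_ul_sD f)
  have fw: "f n \<in> L2_ul_w" for n by (intro L2_ul_sD f)
  define d where "d = (\<lambda>n x. f (Suc n) x - f n x)"
  have dw: "d n \<in> L2_ul_w" for n unfolding d_def by (rule L2_ul_w_diff[OF fw fw])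
  have dm: "d n \<in> borel_measurable lebesgue" for n by (intro L2_loc_measurable L2_ul_wD dw)
  have dist: "ul_norm (\<lambda>x. f (n + k) x - f n x) \<le> 2 * (1/2)^n - (1/2)^(n + k) * 2" for n k
  proof (induction k)
    case (Suc k)
    have "ul_norm (\<lambda>x. f (n + Suc k) x - f n x) = ul_norm (\<lambda>x. d (n + k) x + (f (n + k) x - f n x))"
      by (simp add: d_def)
    also have "\<dots> \<le> ul_norm (d (n + k)) + ul_norm (\<lambda>x. f (n + k) x - f n x)"
      by (rule L2_ul_w_add(2)[OF dw L2_ul_w_diff[OF fw fw]])
    finally show ?case using fast[of "n + k"] Suc by (simp add: d_def)
  qed (simp add: ul_norm_def unit_norm_def)
  have ae1: "AE x in lebesgue. x \<in> {a..a+1} \<longrightarrow> convergent (\<lambda>n. f n x)" for a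
  proof -
    have m: "(\<lambda>x. ennreal (indicat_real {a..a+1} x * norm (d n x))) \<in> borel_measurable lebesgue" for n
      by (rule measurable_compose[OF borel_measurable_times[OF borel_measurable_indicator
            measurable_compose[OF dm borel_measurable_norm]] measurable_ennreal]) simp
    have "(\<integral>\<^sup>+x. (\<Sum>n. ennreal (indicat_real {a..a+1} x * norm (d n x))) \<partial>lebesgue)
        = (\<Sum>n. \<integral>\<^sup>+x. ennreal (indicat_real {a..a+1} x * norm (d n x)) \<partial>lebesgue)"
      by (rule nn_integral_suminf[OF m])
    also have "\<dots> \<le> (\<Sum>n. ennreal ((1/2)^n))"
    proof (rule suminf_le)
      show "(\<integral>\<^sup>+x. ennreal (indicat_real {a..a+1} x * norm (d n x)) \<partial>lebesgue) \<le> ennreal ((1/2)^n)" for n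
        by (rule L2_ul_w_nn_integral_norm[OF dw]) (use fast[of n] in \<open>simp_all add: d_def\<close>)
    qed simp_all
    also have "\<dots> = ennreal (\<Sum>n. (1/2)^n)"
      by (rule suminf_ennreal2[OF _ summable_geometric]) simp_all
    also have "\<dots> < \<infinity>" by (simp del: suminf_geometric)
    finally have "(\<integral>\<^sup>+x. (\<Sum>n. ennreal (indicat_real {a..a+1} x * norm (d n x))) \<partial>lebesgue) \<noteq> \<infinity>"
      by (rule less_imp_neq)
    then have "AE x in lebesgue. (\<Sum>n. ennreal (indicat_real {a..a+1} x * norm (d n x))) \<noteq> \<infinity>"
      by (rule nn_integral_PInf_AE[OF borel_measurable_suminf_order[OF m]])
    then show ?thesis
    proof eventually_elim
      case (elim x)
      show ?case
      proof
        assume "x \<in> {a..a+1}"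
        then have "(\<Sum>n. ennreal (norm (d n x))) \<noteq> \<infinity>" using elim by simp
        then have "summable (\<lambda>n. norm (d n x))" by (intro summable_suminf_not_top) auto
        then have "summable (\<lambda>n. f (Suc n) x - f n x)" unfolding d_def by (rule summable_norm_cancel)
        then have "convergent (\<lambda>n. \<Sum>k<n. f (Suc k) x - f k x)"
          by (simp add: summable_iff_convergent)
        then have "convergent (\<lambda>n. f n x - f 0 x)" by (simp add: sum_lessThan_telescope[of "\<lambda>n. f n x"])
        then have "convergent (\<lambda>n. (f n x - f 0 x) + f 0 x)" by (intro convergent_add convergent_const)
        then show "convergent (\<lambda>n. f n x)" by simp
      qed
    qed
  qed
  then have "AE x in lebesgue. \<forall>a::int. x \<in> {of_int a..of_int a + 1} \<longrightarrow> convergent (\<lambda>n. f n x)"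
    by (subst AE_all_countable) auto
  then have conv: "AE x in lebesgue. convergent (\<lambda>n. f n x)"
  proof eventually_elim
    case (elim x)
    then show ?case using spec[OF elim, of "\<lfloor>x\<rfloor>"] by (simp add: real_of_int_floor_add_one_ge)
  qed
  define g where "g = (\<lambda>x. lim (\<lambda>n. f n x))"
  have gm: "g \<in> borel_measurable lebesgue"
    unfolding g_def using fm by (rule borel_measurable_lim_metric)
  have gf: "(\<lambda>x. g x - f n x) \<in> L2_ul_w \<and> ul_norm (\<lambda>x. g x - f n x) \<le> 2 * (1/2)^n" for n
  proof -
    have m: "(\<lambda>x. g x - f n x) \<in> borel_measurable lebesgue" by (rule borel_measurable_diff[OF gm fm])
    have "(\<integral>\<^sup>+x. ennreal (indicat_real {a..a+1} x * (norm (g x - f n x))\<^sup>2) \<partial>lebesgue) \<le> ennreal ((2 * (1/2)^n)\<^sup>2)" for a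
    proof -
      have m': "(\<lambda>x. ennreal (indicat_real {a..a+1} x * (norm (f k x - f n x))\<^sup>2)) \<in> borel_measurable lebesgue" for k
        by (rule measurable_compose[OF borel_measurable_indicator_norm_square[unfolded real_scaleR_def,
              OF borel_measurable_diff[OF fm fm]] measurable_ennreal])
      have "(\<integral>\<^sup>+x. ennreal (indicat_real {a..a+1} x * (norm (g x - f n x))\<^sup>2) \<partial>lebesgue)
         = (\<integral>\<^sup>+x. liminf (\<lambda>k. ennreal (indicat_real {a..a+1} x * (norm (f k x - f n x))\<^sup>2)) \<partial>lebesgue)"
      proof (rule nn_integral_cong_AE)
        show "AE x in lebesgue. ennreal (indicat_real {a..a+1} x * (norm (g x - f n x))\<^sup>2)
           = liminf (\<lambda>k. ennreal (indicat_real {a..a+1} x * (norm (f k x - f n x))\<^sup>2))"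
          using conv
        proof eventually_elim
          case (elim x)
          then have "(\<lambda>k. f k x) \<longlonglongrightarrow> g x" by (simp add: g_def convergent_LIMSEQ_iff)
          then have "(\<lambda>k. ennreal (indicat_real {a..a+1} x * (norm (f k x - f n x))\<^sup>2))
             \<longlonglongrightarrow> ennreal (indicat_real {a..a+1} x * (norm (g x - f n x))\<^sup>2)"
            by (intro tendsto_intros)
          then show ?case using lim_imp_Liminf[OF sequentially_bot] by metis
        qed
      qed
      also have "\<dots> \<le> liminf (\<lambda>k. \<integral>\<^sup>+x. ennreal (indicat_real {a..a+1} x * (norm (f k x - f n x))\<^sup>2) \<partial>lebesgue)"
        by (rule nn_integral_liminf) (rule m')
      also have "\<dots> \<le> liminf (\<lambda>k::nat. ennreal ((2 * (1/2)^n)\<^sup>2))"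
      proof (rule Liminf_mono)
        have "(\<integral>\<^sup>+x. ennreal (indicat_real {a..a+1} x * (norm (f k x - f n x))\<^sup>2) \<partial>lebesgue) \<le> ennreal ((2 * (1/2)^n)\<^sup>2)"
          if kn: "k \<ge> n" for k
        proof -
          obtain j where k: "k = n + j" using le_Suc_ex[OF kn] by blast
          have w: "(\<lambda>x. f k x - f n x) \<in> L2_ul_w" by (rule L2_ul_w_diff[OF fw fw])
          have "unit_norm a (\<lambda>x. f k x - f n x) \<le> 2 * (1/2)^n - (1/2)^(n + j) * 2"
            unfolding k by (rule order_trans[OF unit_norm_le_ul_norm[OF w[unfolded k]] dist])
          also have "\<dots> \<le> 2 * (1/2)^n" by simp
          finally show ?thesis
            unfolding unit_norm_nn_integral[OF L2_ul_wD[OF w]]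
            by (intro ennreal_leI power_mono unit_norm_nonneg) 
        qed
        then show "\<forall>\<^sub>F k in sequentially. (\<integral>\<^sup>+x. ennreal (indicat_real {a..a+1} x * (norm (f k x - f n x))\<^sup>2) \<partial>lebesgue) \<le> ennreal ((2 * (1/2)^n)\<^sup>2)"
          unfolding eventually_sequentially by blast
      qed
      also have "\<dots> = ennreal ((2 * (1/2)^n)\<^sup>2)" by (simp add: Liminf_const)
      finally show ?thesis .
    qed
    from L2_ul_w_nn_integralI[OF m _ this] show ?thesis by simp
  qed
  have gw: "g \<in> L2_ul_w"
    using L2_ul_w_add(1)[OF conjunct1[OF gf[of 0]] fw[of 0]] by simp
  have "((\<lambda>\<xi>. ul_norm (\<lambda>x. g x - g (x - \<xi>))) \<longlongrightarrow> 0) (at 0)"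
  proof (rule tendstoI)
    fix e :: real assume e: "e > 0"
    obtain n where n: "(1/2)^n < e/8" using real_arch_pow_inv[of "e/8" "1/2"] e by auto
    have "((\<lambda>\<xi>. ul_norm (\<lambda>x. f n x - f n (x - \<xi>))) \<longlongrightarrow> 0) (at 0)" using f[of n] by (simp add: L2_ul_s_def)
    then have "\<forall>\<^sub>F \<xi> in at 0. ul_norm (\<lambda>x. f n x - f n (x - \<xi>)) < e/2"
      by (rule order_tendstoD) (use e in simp)
    then show "\<forall>\<^sub>F \<xi> in at 0. dist (ul_norm (\<lambda>x. g x - g (x - \<xi>))) 0 < e"
    proof eventually_elim
      case (elim \<xi>)
      define r where "r = (\<lambda>x. g x - f n x)"
      have r: "r \<in> L2_ul_w" "ul_norm r \<le> 2 * (1/2)^n" using gf[of n] by (auto simp: r_def)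
      have sr: "ul_norm (\<lambda>x. r (x - \<xi>)) \<le> 2 * (1/2)^n"
        unfolding shift_unit_norm ul_norm_def
        by (rule cSUP_least) (auto intro: order_trans[OF unit_norm_le_ul_norm[OF r(1)] r(2)] simp: shift_unit_norm)
      have nr: "(\<lambda>x. - r (x - \<xi>)) \<in> L2_ul_w" "ul_norm (\<lambda>x. - r (x - \<xi>)) \<le> 2 * (1/2)^n"
        using L2_ul_w_bounded_linear(1)[OF bounded_linear_minus[OF bounded_linear_ident] L2_ul_w_shift[OF r(1), of \<xi>]]
          ul_norm_scale[OF L2_ul_w_shift[OF r(1), of \<xi>], of 1 uminus] sr by auto
      have fd: "(\<lambda>x. f n x - f n (x - \<xi>)) \<in> L2_ul_w"
        by (rule L2_ul_w_diff[OF fw L2_ul_w_shift[OF fw]])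
      have "ul_norm (\<lambda>x. g x - g (x - \<xi>)) = ul_norm (\<lambda>x. (r x + (f n x - f n (x - \<xi>))) + - r (x - \<xi>))"
        by (simp add: r_def algebra_simps)
      also have "\<dots> \<le> ul_norm (\<lambda>x. r x + (f n x - f n (x - \<xi>))) + ul_norm (\<lambda>x. - r (x - \<xi>))"
        by (rule L2_ul_w_add(2)[OF L2_ul_w_add(1)[OF r(1) fd] nr(1)])
      also have "\<dots> \<le> (ul_norm r + ul_norm (\<lambda>x. f n x - f n (x - \<xi>))) + ul_norm (\<lambda>x. - r (x - \<xi>))"
        by (rule add_right_mono[OF L2_ul_w_add(2)[OF r(1) fd]])
      also have "\<dots> < e" using elim r(2) nr(2) n by linarith
      finally have "ul_norm (\<lambda>x. g x - g (x - \<xi>)) < e" .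
      moreover have "0 \<le> ul_norm (\<lambda>x. g x - g (x - \<xi>))"
        by (rule ul_norm_nonneg[OF L2_ul_w_diff[OF gw L2_ul_w_shift[OF gw]]])
      ultimately show ?case by simp
    qed
  qed
  then have "g \<in> L2_ul_s" using gw by (simp add: L2_ul_s_def)
  then show ?thesis using gf by blast
qed

lemma rep_l2uls_mem: "rep_l2uls u \<in> L2_ul_s"
  using Quotient_rep_reflp[OF Quotient_l2uls, of u] by simp

lemma abs_rep_l2uls [simp]: "abs_l2uls (rep_l2uls u) = u"
  by (rule Quotient_abs_rep[OF Quotient_l2uls])

lemma abs_l2uls_eq_iff:
  assumes "f \<in> L2_ul_s" "g \<in> L2_ul_s"
  shows "abs_l2uls f = abs_l2uls g \<longleftrightarrow> (AE x in lebesgue. f x = g x)"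
  using Quotient_rel[OF Quotient_l2uls, of f g] assms by simp

lemma rep_abs_l2uls: "f \<in> L2_ul_s \<Longrightarrow> AE x in lebesgue. rep_l2uls (abs_l2uls f) x = f x"
  using abs_l2uls_eq_iff[OF rep_l2uls_mem[of "abs_l2uls f"], of f] by simp

lemma l2uls_eq_iff: "u = v \<longleftrightarrow> (AE x in lebesgue. rep_l2uls u x = rep_l2uls v x)"
  using abs_l2uls_eq_iff[OF rep_l2uls_mem rep_l2uls_mem, of u v] by simp

lemma abs_l2uls_eqI: "f \<in> L2_ul_s \<Longrightarrow> AE x in lebesgue. f x = rep_l2uls u x \<Longrightarrow> abs_l2uls f = u"
  using abs_l2uls_eq_iff[OF _ rep_l2uls_mem[of u], of f] by simp

lemma norm_abs_l2uls: "f \<in> L2_ul_s \<Longrightarrow> norm (abs_l2uls f) = ul_norm f"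
  by (simp add: norm_l2uls.abs_eq)

lemma norm_rep_l2uls: "norm u = ul_norm (rep_l2uls u)"
  using norm_abs_l2uls[OF rep_l2uls_mem, of u] by simp

lemma rep_l2uls_zero: "AE x in lebesgue. rep_l2uls 0 x = 0"
  unfolding zero_l2uls_def by (rule rep_abs_l2uls[OF L2_ul_s_0, simplified])

lemma rep_l2uls_add: "AE x in lebesgue. rep_l2uls (u + v) x = rep_l2uls u x + rep_l2uls v x"
  using plus_l2uls.abs_eq[of "rep_l2uls u" "rep_l2uls v"] rep_l2uls_mem[of u] rep_l2uls_mem[of v]
    rep_abs_l2uls[OF L2_ul_s_add[OF rep_l2uls_mem rep_l2uls_mem], of u v] by simp

lemma rep_l2uls_diff: "AE x in lebesgue. rep_l2uls (u - v) x = rep_l2uls u x - rep_l2uls v x"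
  using minus_l2uls.abs_eq[of "rep_l2uls u" "rep_l2uls v"] rep_l2uls_mem[of u] rep_l2uls_mem[of v]
    rep_abs_l2uls[OF L2_ul_s_diff[OF rep_l2uls_mem rep_l2uls_mem], of u v] by simp

lemma rep_l2uls_scaleR: "AE x in lebesgue. rep_l2uls (c *\<^sub>R u) x = c *\<^sub>R rep_l2uls u x"
  using scaleR_l2uls.abs_eq[of "rep_l2uls u" c] rep_l2uls_mem[of u]
    rep_abs_l2uls[OF L2_ul_s_bounded_linear[OF bounded_linear_scaleR_right rep_l2uls_mem], of c u] by simp

lemma rep_l2uls_scaleC: "AE x in lebesgue. rep_l2uls (c *\<^sub>C u) x = c *\<^sub>C rep_l2uls u x"
  using scaleC_l2uls.abs_eq[of "rep_l2uls u" c] rep_l2uls_mem[of u]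
    rep_abs_l2uls[OF L2_ul_s_bounded_linear[OF bounded_linear_scaleC rep_l2uls_mem], of c u] by simp

instance l2uls :: ("{banach, second_countable_topology}") banach
proof
  fix X :: "nat \<Rightarrow> 'a l2uls"
  assume X: "Cauchy X"
  have "\<exists>M. \<forall>m\<ge>M. \<forall>n\<ge>M. dist (X m) (X n) < (1/2)^k" for k
    using X unfolding Cauchy_def by simp
  then obtain M where M: "\<And>k m n. m \<ge> M k \<Longrightarrow> n \<ge> M k \<Longrightarrow> dist (X m) (X n) < (1/2)^k" by metis
  \<comment> \<open>partial sums give a strictly increasing sequence above \<open>M\<close>\<close>
  define r where "r = (\<lambda>k. \<Sum>j\<le>k. M j + 1)"
  have rM: "r k \<ge> M k" for k
    using member_le_sum[of k "{..k}" "\<lambda>j. M j + 1"] by (simp add: r_def)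
  have rS: "r (Suc k) \<ge> M k" for k using rM[of k] by (simp add: r_def)
  have rmono: "strict_mono r" by (rule strict_monoI_Suc) (simp add: r_def)
  define f where "f = (\<lambda>k. rep_l2uls (X (r k)))"
  have fs: "f k \<in> L2_ul_s" for k by (simp add: f_def rep_l2uls_mem)
  have nf: "norm (abs_l2uls h - X (r k)) = ul_norm (\<lambda>x. h x - f k x)" if "h \<in> L2_ul_s" for h k
  proof -
    have "abs_l2uls h - X (r k) = abs_l2uls (\<lambda>x. h x - f k x)"
      using minus_l2uls.abs_eq[of h "f k"] that fs[of k] by (simp add: f_def)
    then show ?thesis using norm_abs_l2uls[OF L2_ul_s_diff[OF that fs]] by simp
  qed
  have "ul_norm (\<lambda>x. f (Suc k) x - f k x) \<le> (1/2)^k" for k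
    using M[OF rS rM, of k] nf[OF fs, of "Suc k" k] by (simp add: dist_norm f_def)
  then obtain g where g: "g \<in> L2_ul_s" "\<And>n. ul_norm (\<lambda>x. g x - f n x) \<le> 2 * (1/2)^n"
    using L2_ul_s_fast_Cauchy_limit[of f, OF fs] by blast
  have "(X \<circ> r) \<longlonglongrightarrow> abs_l2uls g"
  proof (rule LIMSEQ_I)
    fix e :: real assume "e > 0"
    then obtain N where N: "(1/2)^N < e/2" using real_arch_pow_inv[of "e/2" "1/2"] by auto
    have "norm ((X \<circ> r) n - abs_l2uls g) < e" if "n \<ge> N" for n
    proof -
      have "(1/2::real)^n \<le> (1/2)^N" using that by (intro power_decreasing) auto
      then have "ul_norm (\<lambda>x. g x - f n x) < e" using g(2)[of n] N by linarith
      then show ?thesis using nf[OF g(1), of n] by (simp add: norm_minus_commute)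
    qed
    then show "\<exists>no. \<forall>n\<ge>no. norm ((X \<circ> r) n - abs_l2uls g) < e" by blast
  qed
  then show "convergent X"
    using Cauchy_converges_subseq[OF X rmono] by (auto simp: convergent_def)
qed

section \<open>Translations and pointwise operators\<close>

lemma shift_L2_ul_s:
  assumes u: "u \<in> L2_ul_s"
  shows "(\<lambda>x. u (x - h)) \<in> L2_ul_s" "ul_norm (\<lambda>x. u (x - h)) = ul_norm u"
proof -
  have n: "ul_norm (\<lambda>x. v (x - h)) = ul_norm v" for v :: "real \<Rightarrow> 'a"
  proof -
    have "range ((\<lambda>a. unit_norm a v) \<circ> (\<lambda>a. a - h)) = range (\<lambda>a. unit_norm a v)"
      unfolding image_comp[symmetric] by (simp add: surj_diff_right)
    then show ?thesis by (simp add: ul_norm_def shift_unit_norm o_def)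
  qed
  show "ul_norm (\<lambda>x. u (x - h)) = ul_norm u" by (rule n)
  have "ul_norm (\<lambda>x. u (x - h) - u (x - \<xi> - h)) = ul_norm (\<lambda>x. u x - u (x - \<xi>))" for \<xi>
    using n[of "\<lambda>x. u x - u (x - \<xi>)"] by (simp add: algebra_simps)
  then show "(\<lambda>x. u (x - h)) \<in> L2_ul_s"
    using u L2_ul_w_shift[OF L2_ul_sD(1)[OF u], of h] by (simp add: L2_ul_s_def algebra_simps)
qed

lift_definition translate :: "real \<Rightarrow> 'e::{banach, second_countable_topology} l2uls \<Rightarrow> 'e l2uls"
  is "\<lambda>h u x. u (x - (- h))"
  using shift_L2_ul_s(1) AE_shift by blast

lemma rep_translate: "AE x in lebesgue. rep_l2uls (translate h u) x = rep_l2uls u (x + h)"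
  using translate.abs_eq[of "rep_l2uls u" h] rep_l2uls_mem[of u]
    rep_abs_l2uls[OF shift_L2_ul_s(1)[OF rep_l2uls_mem], of u "- h"] by simp

lemma AE_shift_plus: "AE x in lebesgue. P (x::real) \<Longrightarrow> AE x in lebesgue. P (x + h)"
  using AE_shift[of P "- h"] by simp

lemma translate_translate: "translate h (translate k u) = translate (h + k) u"
  unfolding l2uls_eq_iff
  using rep_translate[of h "translate k u"] AE_shift_plus[OF rep_translate[of k u], of h] rep_translate[of "h + k" u]
  by eventually_elim (simp add: algebra_simps)

lemma translate_0 [simp]: "translate 0 u = u"
  unfolding l2uls_eq_iff using rep_translate[of 0 u] by eventually_elim simp

lemma translate_add: "translate h (u + v) = translate h u + translate h v"
  unfolding l2uls_eq_iff
  using rep_translate[of h "u + v"] AE_shift_plus[OF rep_l2uls_add[of u v], of h] rep_translate[of h u]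
    rep_translate[of h v] rep_l2uls_add[of "translate h u" "translate h v"]
  by eventually_elim simp

lemma translate_scaleR: "translate h (c *\<^sub>R u) = c *\<^sub>R translate h u"
  unfolding l2uls_eq_iff
  using rep_translate[of h "c *\<^sub>R u"] AE_shift_plus[OF rep_l2uls_scaleR[of c u], of h] rep_translate[of h u]
    rep_l2uls_scaleR[of c "translate h u"]
  by eventually_elim simp

lemma translate_scaleC: "translate h (c *\<^sub>C u) = c *\<^sub>C translate h u"
  unfolding l2uls_eq_iff
  using rep_translate[of h "c *\<^sub>C u"] AE_shift_plus[OF rep_l2uls_scaleC[of c u], of h] rep_translate[of h u]
    rep_l2uls_scaleC[of c "translate h u"]
  by eventually_elim simp

lemma norm_translate [simp]: "norm (translate h u) = norm u"
  using shift_L2_ul_s[OF rep_l2uls_mem, of u "- h"] translate.abs_eq[of "rep_l2uls u" h] rep_l2uls_mem[of u]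
  by (simp add: norm_abs_l2uls norm_rep_l2uls[of u])

lemma bounded_linear_translate: "bounded_linear (translate h)"
  by (rule bounded_linear_intro[where K = 1]) (auto simp: translate_add translate_scaleR)

lemma translate_diff: "translate h (u - v) = translate h u - translate h v"
  using linear_diff[OF bounded_linear.linear[OF bounded_linear_translate]] .

text \<open>
  Strong continuity of the translation group is what distinguishes \<open>L2_ul_s\<close> inside \<open>L2_ul_w\<close>.
\<close>

lemma translate_tendsto_0: "((\<lambda>h. translate h u) \<longlongrightarrow> u) (at 0)"
proof -
  have "norm (u - translate (- \<xi>) u) = ul_norm (\<lambda>x. rep_l2uls u x - rep_l2uls u (x - \<xi>))" for \<xi>
  proof -
    have "u - translate (- \<xi>) u = abs_l2uls (\<lambda>x. rep_l2uls u x - rep_l2uls u (x - \<xi>))"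
      using translate.abs_eq[of "rep_l2uls u" "- \<xi>"] rep_l2uls_mem[of u]
        minus_l2uls.abs_eq[of "rep_l2uls u" "\<lambda>x. rep_l2uls u (x - \<xi>)"] shift_L2_ul_s(1)[OF rep_l2uls_mem, of u \<xi>]
      by simp
    then show ?thesis
      by (simp add: norm_abs_l2uls L2_ul_s_diff rep_l2uls_mem shift_L2_ul_s)
  qed
  then have "((\<lambda>\<xi>. norm (u - translate (- \<xi>) u)) \<longlongrightarrow> 0) (at 0)"
    using rep_l2uls_mem[of u] by (simp add: L2_ul_s_def)
  then have "((\<lambda>\<xi>. norm (translate (- \<xi>) u - u)) \<longlongrightarrow> 0) (at 0)"
    by (simp add: norm_minus_commute)
  then have "((\<lambda>\<xi>. translate (- \<xi>) u) \<longlongrightarrow> u) (at 0)"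
    using Lim_null tendsto_norm_zero_iff by blast
  moreover have "filterlim uminus (at 0) (at (0::real))"
    unfolding filterlim_def using filtermap_at_minus[of "0::real"] by simp
  ultimately have "((\<lambda>h. translate (- (- h)) u) \<longlongrightarrow> u) (at 0)" by (rule filterlim_compose)
  then show ?thesis by simp
qed

lemma continuous_on_translate: "continuous_on A (\<lambda>h. translate h u)"
proof (rule continuous_at_imp_continuous_on, intro ballI)
  fix s
  have "((\<lambda>h. translate s (translate h u)) \<longlongrightarrow> translate s u) (at 0)"
    by (rule bounded_linear.tendsto[OF bounded_linear_translate translate_tendsto_0])
  then have "((\<lambda>h. translate (s + h) u) \<longlongrightarrow> translate s u) (at 0)" by (simp add: translate_translate)
  then show "isCont (\<lambda>h. translate h u) s" by (simp add: isCont_iff)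
qed

definition pointwise ::
    "('a \<Rightarrow> 'b) \<Rightarrow> 'a::{banach, second_countable_topology} l2uls \<Rightarrow> 'b::{banach, second_countable_topology} l2uls" where
  "pointwise T u = abs_l2uls (\<lambda>x. T (rep_l2uls u x))"

lemma rep_pointwise:
  assumes "bounded_linear T"
  shows "AE x in lebesgue. rep_l2uls (pointwise T u) x = T (rep_l2uls u x)"
  unfolding pointwise_def by (rule rep_abs_l2uls[OF L2_ul_s_bounded_linear[OF assms rep_l2uls_mem]])

lemma norm_pointwise_le:
  assumes "bounded_linear T"
  shows "norm (pointwise T u) \<le> onorm T * norm u"
  using L2_ul_w_bounded_linear(2)[OF assms L2_ul_sD(1)[OF rep_l2uls_mem], of u]
  by (simp add: pointwise_def norm_abs_l2uls[OF L2_ul_s_bounded_linear[OF assms rep_l2uls_mem]] norm_rep_l2uls[of u])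

lemma bounded_linear_pointwise:
  assumes T: "bounded_linear T"
  shows "bounded_linear (pointwise T)"
proof (rule bounded_linear_intro[where K = "onorm T"])
  interpret bounded_linear T by (rule T)
  fix u v :: "'a l2uls" and c :: real
  show "pointwise T (u + v) = pointwise T u + pointwise T v"
    unfolding l2uls_eq_iff
    using rep_pointwise[OF T, of "u + v"] rep_l2uls_add[of u v] rep_pointwise[OF T, of u] rep_pointwise[OF T, of v]
      rep_l2uls_add[of "pointwise T u" "pointwise T v"]
    by eventually_elim (simp add: add)
  show "pointwise T (c *\<^sub>R u) = c *\<^sub>R pointwise T u"
    unfolding l2uls_eq_iff
    using rep_pointwise[OF T, of "c *\<^sub>R u"] rep_l2uls_scaleR[of c u] rep_pointwise[OF T, of u]
      rep_l2uls_scaleR[of c "pointwise T u"]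
    by eventually_elim (simp add: scaleR)
  show "norm (pointwise T u) \<le> norm u * onorm T"
    using norm_pointwise_le[OF T, of u] by (simp add: mult.commute)
qed


section \<open>Exponentially weighted inner products\<close>

text \<open>
  The weight is at most \<open>2\<^sup>-\<^sup>k\<close> on the two unit intervals at distance \<open>k\<close> from the centre; the constant is
  \<open>4 = 2 (1 + 1/2 + 1/4 + \<dots>)\<close>.
\<close>

lemma integrable_exp_weight_norm_square:
  fixes u :: "real \<Rightarrow> 'e::{banach, second_countable_topology}"
  assumes u: "u \<in> L2_ul_w"
  shows "integrable lebesgue (\<lambda>x. exp (- \<bar>x - a\<bar>) * (norm (u x))\<^sup>2)"
    and "(LINT x|lebesgue. exp (- \<bar>x - a\<bar>) * (norm (u x))\<^sup>2) \<le> 4 * (ul_norm u)\<^sup>2"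
proof -
  note loc = L2_ul_wD[OF u]
  have um: "u \<in> borel_measurable lebesgue" by (rule L2_loc_measurable[OF loc])
  define K where "K = ul_norm u"
  define I where "I = (\<lambda>b x. ennreal (indicat_real {b..b+1} x * (norm (u x))\<^sup>2))"
  have Im: "I b \<in> borel_measurable lebesgue" for b
    unfolding I_def by (rule measurable_compose[OF borel_measurable_indicator_norm_square[unfolded real_scaleR_def, OF um] measurable_ennreal])
  have Ile: "(\<integral>\<^sup>+x. I b x \<partial>lebesgue) \<le> ennreal (K\<^sup>2)" for b
    unfolding I_def unit_norm_nn_integral[OF loc] K_def
    by (intro ennreal_leI power_mono unit_norm_nonneg unit_norm_le_ul_norm[OF u])
  have em: "exp (- real k) \<le> (1/2)^k" for k
  proof -
    have "exp (- real k) = exp (- 1) ^ k" using exp_of_nat_mult[of k "- 1::real"] by simp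
    also have "exp (- 1 :: real) \<le> 1/2"
      using exp_ge_add_one_self[of 1] by (simp add: exp_minus field_simps)
    then have "exp (- 1 :: real) ^ k \<le> (1/2)^k" by (intro power_mono) auto
    finally show ?thesis .
  qed
  have wm: "(\<lambda>x. exp (- \<bar>x - a\<bar>) * (norm (u x))\<^sup>2) \<in> borel_measurable lebesgue"
    by (intro borel_measurable_times borel_measurable_power measurable_compose[OF um borel_measurable_norm]
        measurable_completion) measurable
  have "(\<integral>\<^sup>+x. ennreal (exp (- \<bar>x - a\<bar>) * (norm (u x))\<^sup>2) \<partial>lebesgue)
     \<le> (\<integral>\<^sup>+x. (\<Sum>k. ennreal ((1/2)^k) * (I (a + real k) x + I (a - real k - 1) x)) \<partial>lebesgue)"
  proof (rule nn_integral_mono)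
    fix x
    define k where "k = nat \<lfloor>\<bar>x - a\<bar>\<rfloor>"
    have k: "real k \<le> \<bar>x - a\<bar>" "\<bar>x - a\<bar> < real k + 1" by (auto simp: k_def)
    have "exp (- \<bar>x - a\<bar>) \<le> (1/2)^k" using em[of k] k by (smt (verit) exp_le_cancel_iff)
    then have "ennreal (exp (- \<bar>x - a\<bar>) * (norm (u x))\<^sup>2) \<le> ennreal ((1/2)^k) * ennreal ((norm (u x))\<^sup>2)"
      by (simp add: mult_right_mono ennreal_leI flip: ennreal_mult)
    also have "\<dots> \<le> ennreal ((1/2)^k) * (I (a + real k) x + I (a - real k - 1) x)"
    proof (rule mult_left_mono)
      show "ennreal ((norm (u x))\<^sup>2) \<le> I (a + real k) x + I (a - real k - 1) x"
      proof (cases "x \<ge> a")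
        case True
        then have "I (a + real k) x = ennreal ((norm (u x))\<^sup>2)" using k by (simp add: I_def)
        then show ?thesis by simp
      next
        case False
        then have "I (a - real k - 1) x = ennreal ((norm (u x))\<^sup>2)" using k by (simp add: I_def)
        then show ?thesis by simp
      qed
    qed simp
    also have "\<dots> \<le> (\<Sum>k. ennreal ((1/2)^k) * (I (a + real k) x + I (a - real k - 1) x))"
      using sum_le_suminf[of "\<lambda>k. ennreal ((1/2)^k) * (I (a + real k) x + I (a - real k - 1) x)" "{k}"] by simp
    finally show "ennreal (exp (- \<bar>x - a\<bar>) * (norm (u x))\<^sup>2)
        \<le> (\<Sum>k. ennreal ((1/2)^k) * (I (a + real k) x + I (a - real k - 1) x))" .
  qed
  also have "\<dots> = (\<Sum>k. \<integral>\<^sup>+x. ennreal ((1/2)^k) * (I (a + real k) x + I (a - real k - 1) x) \<partial>lebesgue)"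
    by (rule nn_integral_suminf[OF borel_measurable_times_ennreal[OF borel_measurable_const borel_measurable_add[OF Im Im]]])
  also have "\<dots> \<le> (\<Sum>k. ennreal ((1/2)^k * (2 * K\<^sup>2)))"
  proof (rule suminf_le)
    fix k
    have "(\<integral>\<^sup>+x. ennreal ((1/2)^k) * (I (a + real k) x + I (a - real k - 1) x) \<partial>lebesgue)
       = ennreal ((1/2)^k) * ((\<integral>\<^sup>+x. I (a + real k) x \<partial>lebesgue) + (\<integral>\<^sup>+x. I (a - real k - 1) x \<partial>lebesgue))"
      by (simp only: nn_integral_cmult[OF borel_measurable_add[OF Im Im]] nn_integral_add[OF Im Im])
    also have "\<dots> \<le> ennreal ((1/2)^k) * (ennreal (K\<^sup>2) + ennreal (K\<^sup>2))"
      by (intro mult_left_mono add_mono Ile) auto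
    also have "\<dots> = ennreal ((1/2)^k * (2 * K\<^sup>2))"
      by (simp flip: ennreal_plus ennreal_mult)
    finally show "(\<integral>\<^sup>+x. ennreal ((1/2)^k) * (I (a + real k) x + I (a - real k - 1) x) \<partial>lebesgue)
       \<le> ennreal ((1/2)^k * (2 * K\<^sup>2))" .
  qed simp_all
  also have "\<dots> = ennreal (\<Sum>k. (1/2)^k * (2 * K\<^sup>2))"
    by (rule suminf_ennreal2[OF _ summable_mult2[OF summable_geometric]]) simp_all
  also have "(\<Sum>k. (1/2::real)^k * (2 * K\<^sup>2)) = 4 * K\<^sup>2"
    using suminf_mult2[OF summable_geometric[of "1/2::real"], of "2 * K\<^sup>2"] suminf_geometric[of "1/2::real"] by simp
  finally have le: "(\<integral>\<^sup>+x. ennreal (exp (- \<bar>x - a\<bar>) * (norm (u x))\<^sup>2) \<partial>lebesgue) \<le> ennreal (4 * K\<^sup>2)" .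
  show int: "integrable lebesgue (\<lambda>x. exp (- \<bar>x - a\<bar>) * (norm (u x))\<^sup>2)"
    by (rule integrableI_nonneg[OF wm]) (simp_all add: le_less_trans[OF le])
  have "ennreal (LINT x|lebesgue. exp (- \<bar>x - a\<bar>) * (norm (u x))\<^sup>2) \<le> ennreal (4 * K\<^sup>2)"
    using le by (subst (asm) nn_integral_eq_integral[OF int]) simp_all
  then show "(LINT x|lebesgue. exp (- \<bar>x - a\<bar>) * (norm (u x))\<^sup>2) \<le> 4 * (ul_norm u)\<^sup>2"
    by (subst (asm) ennreal_le_iff) (simp_all add: K_def)
qed

lemma abs_inner_le_norm_squares: "\<bar>inner x y\<bar> \<le> (norm x)\<^sup>2 + (norm y)\<^sup>2"
proof -
  have "0 \<le> (norm x - norm y)\<^sup>2" by simp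
  then have "norm x * norm y * 2 \<le> (norm x)\<^sup>2 + (norm y)\<^sup>2" by (simp add: power2_diff algebra_simps)
  moreover have "0 \<le> (norm x)\<^sup>2 + (norm y)\<^sup>2" by simp
  ultimately show ?thesis using Cauchy_Schwarz_ineq2[of x y] by linarith
qed

lemma borel_measurable_exp_weight: "(\<lambda>x. exp (- \<bar>x - a\<bar>)) \<in> borel_measurable lebesgue" for a :: real
  by (intro measurable_completion) measurable

lemma integrable_exp_weight_inner:
  fixes u v :: "real \<Rightarrow> 'y::{real_inner, banach, second_countable_topology}"
  assumes u: "u \<in> L2_ul_w" and v: "v \<in> L2_ul_w"
  shows "integrable lebesgue (\<lambda>x. exp (- \<bar>x - a\<bar>) * inner (u x) (v x))"
proof (rule Bochner_Integration.integrable_bound)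
  show "integrable lebesgue (\<lambda>x. exp (- \<bar>x - a\<bar>) * (norm (u x))\<^sup>2 + exp (- \<bar>x - a\<bar>) * (norm (v x))\<^sup>2)"
    by (intro Bochner_Integration.integrable_add integrable_exp_weight_norm_square u v)
  show "(\<lambda>x. exp (- \<bar>x - a\<bar>) * inner (u x) (v x)) \<in> borel_measurable lebesgue"
    by (intro borel_measurable_times borel_measurable_exp_weight borel_measurable_inner
        L2_loc_measurable L2_ul_wD u v)
  show "AE x in lebesgue. norm (exp (- \<bar>x - a\<bar>) * inner (u x) (v x))
      \<le> norm (exp (- \<bar>x - a\<bar>) * (norm (u x))\<^sup>2 + exp (- \<bar>x - a\<bar>) * (norm (v x))\<^sup>2)"
  proof (rule AE_I2)
    fix x
    have "norm (exp (- \<bar>x - a\<bar>) * inner (u x) (v x)) = exp (- \<bar>x - a\<bar>) * \<bar>inner (u x) (v x)\<bar>"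
      by (simp add: abs_mult)
    also have "\<dots> \<le> exp (- \<bar>x - a\<bar>) * ((norm (u x))\<^sup>2 + (norm (v x))\<^sup>2)"
      by (intro mult_left_mono abs_inner_le_norm_squares) simp
    finally show "norm (exp (- \<bar>x - a\<bar>) * inner (u x) (v x))
      \<le> norm (exp (- \<bar>x - a\<bar>) * (norm (u x))\<^sup>2 + exp (- \<bar>x - a\<bar>) * (norm (v x))\<^sup>2)"
      by (simp add: distrib_left)
  qed
qed

text \<open>
  Unlike the norm of \<open>X\<close>, these forms are inner products, which makes energy estimates possible; their
  supremum over all centres \<open>a\<close> is nevertheless equivalent to the squared norm.
\<close>

definition wform ::
    "real \<Rightarrow> 'y::{real_inner, banach, second_countable_topology} l2uls \<Rightarrow> 'y l2uls \<Rightarrow> real" where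
  "wform a u v = (LINT x|lebesgue. exp (- \<bar>x - a\<bar>) * inner (rep_l2uls u x) (rep_l2uls v x))"

lemma rep_l2uls_mem_w: "rep_l2uls u \<in> L2_ul_w"
  by (rule L2_ul_sD(1)[OF rep_l2uls_mem])

lemma integrable_wform:
  "integrable lebesgue (\<lambda>x. exp (- \<bar>x - a\<bar>) * inner (rep_l2uls u x) (rep_l2uls v x))"
  by (rule integrable_exp_weight_inner[OF rep_l2uls_mem_w rep_l2uls_mem_w])

lemma wform_eqI:
  assumes "f \<in> borel_measurable lebesgue"
    and "AE x in lebesgue. exp (- \<bar>x - a\<bar>) * inner (rep_l2uls u x) (rep_l2uls v x) = f x"
  shows "wform a u v = (LINT x|lebesgue. f x)"
  unfolding wform_def by (rule integral_cong_AE[OF borel_measurable_integrable[OF integrable_wform] assms])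

lemma wform_commute: "wform a u v = wform a v u"
  by (simp add: wform_def inner_commute)

lemma wform_add_left: "wform a (u + v) w = wform a u w + wform a v w"
proof -
  have "wform a (u + v) w = (LINT x|lebesgue. exp (- \<bar>x - a\<bar>) * inner (rep_l2uls u x) (rep_l2uls w x)
      + exp (- \<bar>x - a\<bar>) * inner (rep_l2uls v x) (rep_l2uls w x))"
  proof (rule wform_eqI)
    show "AE x in lebesgue. exp (- \<bar>x - a\<bar>) * inner (rep_l2uls (u + v) x) (rep_l2uls w x)
      = exp (- \<bar>x - a\<bar>) * inner (rep_l2uls u x) (rep_l2uls w x)
      + exp (- \<bar>x - a\<bar>) * inner (rep_l2uls v x) (rep_l2uls w x)"
      using rep_l2uls_add[of u v] by eventually_elim (simp add: inner_add_left distrib_left)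
  qed (intro borel_measurable_add borel_measurable_integrable[OF integrable_wform])
  then show ?thesis by (simp add: wform_def Bochner_Integration.integral_add[OF integrable_wform integrable_wform])
qed

lemma wform_scaleR_left: "wform a (c *\<^sub>R u) w = c * wform a u w"
proof -
  have "wform a (c *\<^sub>R u) w = (LINT x|lebesgue. c * (exp (- \<bar>x - a\<bar>) * inner (rep_l2uls u x) (rep_l2uls w x)))"
  proof (rule wform_eqI)
    show "AE x in lebesgue. exp (- \<bar>x - a\<bar>) * inner (rep_l2uls (c *\<^sub>R u) x) (rep_l2uls w x)
      = c * (exp (- \<bar>x - a\<bar>) * inner (rep_l2uls u x) (rep_l2uls w x))"
      using rep_l2uls_scaleR[of c u] by eventually_elim simp
  qed (intro borel_measurable_times borel_measurable_const borel_measurable_integrable[OF integrable_wform])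
  then show ?thesis by (simp add: wform_def)
qed

lemma wform_minus_left: "wform a (- u) w = - wform a u w"
  using wform_scaleR_left[of a "-1" u w] by simp

lemma wform_diff_left: "wform a (u - v) w = wform a u w - wform a v w"
  using wform_add_left[of a u "- v" w] by (simp add: wform_minus_left)

lemma wform_right:
  "wform a w (u + v) = wform a w u + wform a w v"
  "wform a w (c *\<^sub>R u) = c * wform a w u"
  "wform a w (- u) = - wform a w u"
  "wform a w (u - v) = wform a w u - wform a w v"
  unfolding wform_commute[of a w] by (rule wform_add_left wform_scaleR_left wform_minus_left wform_diff_left)+

lemmas wform_simps = wform_add_left wform_scaleR_left wform_minus_left wform_diff_left wform_right

lemma wform_nonnegI:
  assumes "AE x in lebesgue. 0 \<le> inner (rep_l2uls u x) (rep_l2uls v x)"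
  shows "0 \<le> wform a u v"
  unfolding wform_def by (rule integral_nonneg_AE) (use assms in eventually_elim, simp)

lemma wform_self_nonneg: "0 \<le> wform a u u"
  by (rule wform_nonnegI) simp

lemma wform_self_eq: "wform a u u = (LINT x|lebesgue. exp (- \<bar>x - a\<bar>) * (norm (rep_l2uls u x))\<^sup>2)"
  by (simp add: wform_def power2_norm_eq_inner)

lemma wform_self_le: "wform a u u \<le> 4 * (norm u)\<^sup>2"
  using integrable_exp_weight_norm_square(2)[OF rep_l2uls_mem_w, of a u]
  by (simp add: wform_self_eq norm_rep_l2uls)

text \<open>
  On \<open>[a, a + 1]\<close> the weight is at least \<open>1 / e \<ge> 1 / 3\<close>.
\<close>

lemma norm_le_wform:
  assumes K: "\<And>a. wform a u u \<le> K"
  shows "(norm u)\<^sup>2 \<le> 3 * K"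
proof -
  have K0: "0 \<le> K" using order_trans[OF wform_self_nonneg K] .
  have "unit_norm a (rep_l2uls u) \<le> sqrt (3 * K)" for a
  proof -
    have "(unit_norm a (rep_l2uls u))\<^sup>2 \<le> (LINT x|lebesgue. 3 * (exp (- \<bar>x - a\<bar>) * (norm (rep_l2uls u x))\<^sup>2))"
      unfolding unit_norm_power2 set_lebesgue_integral_def
    proof (rule integral_mono)
      show "integrable lebesgue (\<lambda>x. indicat_real {a..a + 1} x *\<^sub>R (norm (rep_l2uls u x))\<^sup>2)"
        using L2_loc_integrable[OF L2_ul_sD(2)[OF rep_l2uls_mem]] by (simp add: set_integrable_def)
      show "integrable lebesgue (\<lambda>x. 3 * (exp (- \<bar>x - a\<bar>) * (norm (rep_l2uls u x))\<^sup>2))"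
        by (intro integrable_mult_right integrable_exp_weight_norm_square rep_l2uls_mem_w)
      fix x
      have "1 \<le> 3 * exp (- \<bar>x - a\<bar>)" if "x \<in> {a..a+1}"
      proof -
        have "exp (- 1) \<le> exp (- \<bar>x - a\<bar>)" using that by simp
        moreover have "1 \<le> 3 * exp (- 1 :: real)" using exp_le by (simp add: exp_minus field_simps)
        ultimately show ?thesis by linarith
      qed
      then show "indicat_real {a..a + 1} x *\<^sub>R (norm (rep_l2uls u x))\<^sup>2
          \<le> 3 * (exp (- \<bar>x - a\<bar>) * (norm (rep_l2uls u x))\<^sup>2)"
        using mult_right_mono[of 1 "3 * exp (- \<bar>x - a\<bar>)" "(norm (rep_l2uls u x))\<^sup>2"]
        by (cases "x \<in> {a..a+1}") auto
    qed
    also have "\<dots> = 3 * wform a u u" by (simp add: wform_self_eq)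
    finally have "(unit_norm a (rep_l2uls u))\<^sup>2 \<le> 3 * K" using K[of a] by linarith
    then show ?thesis by (rule real_le_rsqrt)
  qed
  then have "norm u \<le> sqrt (3 * K)" unfolding norm_rep_l2uls by (rule ul_norm_le)
  then have "(norm u)\<^sup>2 \<le> (sqrt (3 * K))\<^sup>2" by (intro power_mono) auto
  then show ?thesis using K0 by simp
qed

lemma wform_change_centre:
  assumes "\<bar>b - a\<bar> \<le> 1"
  shows "wform b v v \<le> 3 * wform a v v"
proof -
  have "wform b v v \<le> (LINT x|lebesgue. 3 * (exp (- \<bar>x - a\<bar>) * (norm (rep_l2uls v x))\<^sup>2))"
    unfolding wform_self_eq
  proof (rule integral_mono)
    show "integrable lebesgue (\<lambda>x. exp (- \<bar>x - b\<bar>) * (norm (rep_l2uls v x))\<^sup>2)"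
      "integrable lebesgue (\<lambda>x. 3 * (exp (- \<bar>x - a\<bar>) * (norm (rep_l2uls v x))\<^sup>2))"
      by (intro integrable_mult_right integrable_exp_weight_norm_square rep_l2uls_mem_w)+
    fix x
    have "exp (- \<bar>x - b\<bar>) \<le> exp (1 + - \<bar>x - a\<bar>)" using assms by simp
    also have "\<dots> = exp 1 * exp (- \<bar>x - a\<bar>)" by (rule exp_add)
    also have "\<dots> \<le> 3 * exp (- \<bar>x - a\<bar>)" by (intro mult_right_mono exp_le) auto
    finally have "exp (- \<bar>x - b\<bar>) * (norm (rep_l2uls v x))\<^sup>2 \<le> 3 * exp (- \<bar>x - a\<bar>) * (norm (rep_l2uls v x))\<^sup>2"
      by (intro mult_right_mono) auto
    then show "exp (- \<bar>x - b\<bar>) * (norm (rep_l2uls v x))\<^sup>2 \<le> 3 * (exp (- \<bar>x - a\<bar>) * (norm (rep_l2uls v x))\<^sup>2)"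
      by (simp add: mult.assoc)
  qed
  then show ?thesis by (simp add: wform_self_eq)
qed

lemma exp_weight_diff_le:
  fixes x :: real
  assumes "\<bar>b - a\<bar> \<le> h" "h \<le> 1"
  shows "\<bar>exp (- \<bar>x - b\<bar>) - exp (- \<bar>x - a\<bar>)\<bar> \<le> 2 * h * exp (- \<bar>x - b\<bar>)"
proof -
  define t where "t = \<bar>x - b\<bar> - \<bar>x - a\<bar>"
  have t: "\<bar>t\<bar> \<le> h" using assms by (auto simp: t_def)
  have h0: "0 \<le> h" using t by auto
  have "exp t \<le> exp h" using t by simp
  also have "\<dots> \<le> 1 + h + h\<^sup>2" using exp_bound[of h] h0 assms(2) by simp
  also have "h\<^sup>2 \<le> h" using h0 assms(2) by (simp add: power2_eq_square mult_left_le)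
  finally have "exp t - 1 \<le> 2 * h" by simp
  moreover have "- (2 * h) \<le> exp t - 1" using exp_ge_add_one_self[of t] t h0 by linarith
  ultimately have "\<bar>exp t - 1\<bar> \<le> 2 * h" by linarith
  then have "exp (- \<bar>x - b\<bar>) * \<bar>1 - exp t\<bar> \<le> exp (- \<bar>x - b\<bar>) * (2 * h)"
    by (intro mult_left_mono) auto
  also have "exp (- \<bar>x - b\<bar>) * \<bar>1 - exp t\<bar> = \<bar>exp (- \<bar>x - b\<bar>) * (1 - exp t)\<bar>" by (simp add: abs_mult)
  also have "exp (- \<bar>x - b\<bar>) * (1 - exp t) = exp (- \<bar>x - b\<bar>) - exp (- \<bar>x - a\<bar>)"
    by (simp add: t_def right_diff_distrib flip: exp_add)
  finally show ?thesis by (simp add: mult.commute)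
qed

text \<open>
  The weight varies slowly, \<open>|\<rho>\<^sub>b - \<rho>\<^sub>a| \<le> 2 h \<rho>\<^sub>b\<close>; the rest is Young's inequality.
\<close>

lemma wform_weight_diff:
  assumes ab: "\<bar>b - a\<bar> \<le> h" "h \<le> 1" and \<epsilon>: "\<epsilon> > 0"
  shows "\<bar>wform b v d - wform a v d\<bar> \<le> 2 * h * (\<epsilon> * wform b d d + wform b v v / (4 * \<epsilon>))"
proof -
  let ?v = "rep_l2uls v" and ?d = "rep_l2uls d"
  have h0: "0 \<le> h" using ab by auto
  have "\<bar>wform b v d - wform a v d\<bar> = \<bar>LINT x|lebesgue. exp (- \<bar>x - b\<bar>) * inner (?v x) (?d x) - exp (- \<bar>x - a\<bar>) * inner (?v x) (?d x)\<bar>"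
    unfolding wform_def by (subst Bochner_Integration.integral_diff[OF integrable_wform integrable_wform]) simp
  also have "\<dots> \<le> (LINT x|lebesgue. \<bar>exp (- \<bar>x - b\<bar>) * inner (?v x) (?d x) - exp (- \<bar>x - a\<bar>) * inner (?v x) (?d x)\<bar>)"
    by (rule integral_abs_bound)
  also have "\<dots> \<le> (LINT x|lebesgue. 2 * h * (\<epsilon> * (exp (- \<bar>x - b\<bar>) * (norm (?d x))\<^sup>2) + (exp (- \<bar>x - b\<bar>) * (norm (?v x))\<^sup>2) / (4 * \<epsilon>)))"
  proof (rule integral_mono)
    show "integrable lebesgue (\<lambda>x. \<bar>exp (- \<bar>x - b\<bar>) * inner (?v x) (?d x) - exp (- \<bar>x - a\<bar>) * inner (?v x) (?d x)\<bar>)"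
      by (intro integrable_abs Bochner_Integration.integrable_diff integrable_wform)
    show "integrable lebesgue (\<lambda>x. 2 * h * (\<epsilon> * (exp (- \<bar>x - b\<bar>) * (norm (?d x))\<^sup>2) + (exp (- \<bar>x - b\<bar>) * (norm (?v x))\<^sup>2) / (4 * \<epsilon>)))"
      by (intro integrable_mult_right Bochner_Integration.integrable_add integrable_divide integrable_exp_weight_norm_square rep_l2uls_mem_w)
    fix x
    have "0 \<le> (2 * \<epsilon> * norm (?d x) - norm (?v x))\<^sup>2" by simp
    then have "norm (?v x) * norm (?d x) \<le> \<epsilon> * (norm (?d x))\<^sup>2 + (norm (?v x))\<^sup>2 / (4 * \<epsilon>)"
      using \<epsilon> by (simp add: power2_eq_square field_simps)
    then have i: "\<bar>inner (?v x) (?d x)\<bar> \<le> \<epsilon> * (norm (?d x))\<^sup>2 + (norm (?v x))\<^sup>2 / (4 * \<epsilon>)"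
      by (rule order_trans[OF Cauchy_Schwarz_ineq2])
    have "\<bar>exp (- \<bar>x - b\<bar>) * inner (?v x) (?d x) - exp (- \<bar>x - a\<bar>) * inner (?v x) (?d x)\<bar>
       = \<bar>exp (- \<bar>x - b\<bar>) - exp (- \<bar>x - a\<bar>)\<bar> * \<bar>inner (?v x) (?d x)\<bar>"
      by (simp add: abs_mult flip: left_diff_distrib)
    also have "\<dots> \<le> (2 * h * exp (- \<bar>x - b\<bar>)) * (\<epsilon> * (norm (?d x))\<^sup>2 + (norm (?v x))\<^sup>2 / (4 * \<epsilon>))"
      by (intro mult_mono exp_weight_diff_le ab i) (use h0 in auto)
    finally show "\<bar>exp (- \<bar>x - b\<bar>) * inner (?v x) (?d x) - exp (- \<bar>x - a\<bar>) * inner (?v x) (?d x)\<bar>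
      \<le> 2 * h * (\<epsilon> * (exp (- \<bar>x - b\<bar>) * (norm (?d x))\<^sup>2) + (exp (- \<bar>x - b\<bar>) * (norm (?v x))\<^sup>2) / (4 * \<epsilon>))"
      by (simp add: algebra_simps)
  qed
  also have "\<dots> = 2 * h * (\<epsilon> * wform b d d + wform b v v / (4 * \<epsilon>))"
    unfolding wform_self_eq
    by (simp only: integral_mult_right_zero Bochner_Integration.integral_add integral_divide_zero
        integrable_mult_right integrable_divide integrable_exp_weight_norm_square[OF rep_l2uls_mem_w])
  finally show ?thesis .
qed

lemma wform_young:
  assumes s: "s > 0"
  shows "wform a u v \<le> s * wform a u u + wform a v v / (4 * s)"
proof -
  have "0 \<le> wform a ((2 * s) *\<^sub>R u - v) ((2 * s) *\<^sub>R u - v)" by (rule wform_self_nonneg)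
  also have "\<dots> = 4 * s * (s * wform a u u) + wform a v v - 4 * s * wform a u v"
    using wform_commute[of a v u] by (simp add: wform_simps algebra_simps)
  finally show ?thesis using s by (simp add: field_simps)
qed

lemma wform_translate: "wform a (translate h u) (translate h v) = wform (a + h) u v"
proof -
  let ?f = "\<lambda>x. exp (- \<bar>x - (a + h)\<bar>) * inner (rep_l2uls u x) (rep_l2uls v x)"
  have "wform a (translate h u) (translate h v) = (LINT x|lebesgue. ?f (h + 1 * x))"
  proof (rule wform_eqI)
    have "integrable lebesgue (\<lambda>x. ?f (h + 1 * x))"
      by (rule lebesgue_integrable_real_affine[OF integrable_wform]) simp
    then show "(\<lambda>x. ?f (h + 1 * x)) \<in> borel_measurable lebesgue" by (rule borel_measurable_integrable)
    show "AE x in lebesgue. exp (- \<bar>x - a\<bar>) * inner (rep_l2uls (translate h u) x) (rep_l2uls (translate h v) x) = ?f (h + 1 * x)"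
      using rep_translate[of h u] rep_translate[of h v] by eventually_elim (simp add: add.commute)
  qed
  also have "\<dots> = (LINT x|lebesgue. ?f x)"
    by (subst (2) lebesgue_integral_real_affine[of 1 _ h]) simp_all
  finally show ?thesis by (simp add: wform_def)
qed

section \<open>Difference quotients and energy identities\<close>

lemma has_vector_derivative_at_iff_tendsto:
  "(f has_vector_derivative d) (at x) \<longleftrightarrow> ((\<lambda>h. (1 / h) *\<^sub>R (f (x + h) - f x)) \<longlongrightarrow> d) (at 0)"
proof -
  have "(f has_vector_derivative d) (at x) \<longleftrightarrow> ((\<lambda>h. norm (f (x + h) - f x - h *\<^sub>R d) / norm h) \<longlongrightarrow> 0) (at 0)"
    unfolding has_vector_derivative_def has_derivative_at by (simp add: bounded_linear_scaleR_left)
  also have "\<dots> \<longleftrightarrow> ((\<lambda>h. norm ((1 / h) *\<^sub>R (f (x + h) - f x) - d)) \<longlongrightarrow> 0) (at 0)"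
  proof (rule filterlim_cong[OF refl refl])
    have "norm (f (x + h) - f x - h *\<^sub>R d) / norm h = norm ((1 / h) *\<^sub>R (f (x + h) - f x) - d)" if "h \<noteq> 0" for h
    proof -
      have "(1 / h) *\<^sub>R (f (x + h) - f x) - d = (1 / h) *\<^sub>R (f (x + h) - f x - h *\<^sub>R d)"
        using that by (simp add: scaleR_diff_right)
      then show ?thesis by (simp add: divide_inverse mult.commute)
    qed
    then show "\<forall>\<^sub>F h in at 0. norm (f (x + h) - f x - h *\<^sub>R d) / norm h = norm ((1 / h) *\<^sub>R (f (x + h) - f x) - d)"
      by (simp add: eventually_at_filter)
  qed
  also have "\<dots> \<longleftrightarrow> ((\<lambda>h. (1 / h) *\<^sub>R (f (x + h) - f x)) \<longlongrightarrow> d) (at 0)"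
    unfolding tendsto_norm_zero_iff by (rule Lim_null[symmetric])
  finally show ?thesis .
qed

definition dquot :: "real \<Rightarrow> 'e::{banach, second_countable_topology} l2uls \<Rightarrow> 'e l2uls" where
  "dquot h u = (1 / h) *\<^sub>R (translate h u - u)"

definition lap :: "real \<Rightarrow> 'e::{banach, second_countable_topology} l2uls \<Rightarrow> 'e l2uls" where
  "lap h u = (1 / h\<^sup>2) *\<^sub>R (translate h u + translate (- h) u - 2 *\<^sub>R u)"

text \<open>
  Discrete integration by parts. The second summand is the commutator with the weight.
\<close>

lemma wform_lap:
  assumes h: "h \<noteq> 0"
  shows "wform a v (- lap h u) = wform (a - h) (dquot h v) (dquot h u)
    + (1 / h) * (wform (a - h) v (dquot h u) - wform a v (dquot h u))"
proof -
  define d where "d = translate h u - u"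
  have 1: "wform a v (u - translate (- h) u) = wform (a - h) (translate h v) d"
  proof -
    have "wform a (translate (- h) (translate h v)) (translate (- h) d) = wform (a + - h) (translate h v) d"
      by (rule wform_translate)
    then show ?thesis by (simp add: translate_translate translate_diff d_def)
  qed
  have "- lap h u = (1 / h\<^sup>2) *\<^sub>R ((u - translate (- h) u) - d)"
    by (simp add: lap_def d_def algebra_simps flip: scaleR_minus_right) (simp add: scaleR_2[symmetric] algebra_simps)
  then have "wform a v (- lap h u) = (1 / h\<^sup>2) * (wform (a - h) (translate h v) d - wform a v d)"
    by (simp only: wform_right(2) wform_right(4)[of a v "u - translate (- h) u" d] 1)
  also have "\<dots> = (1 / h\<^sup>2) * (wform (a - h) (translate h v - v) d + (wform (a - h) v d - wform a v d))"
    by (simp add: wform_simps)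
  also have "\<dots> = wform (a - h) (dquot h v) (dquot h u) + (1 / h) * (wform (a - h) v (dquot h u) - wform a v (dquot h u))"
    unfolding dquot_def d_def[symmetric] using h by (simp add: wform_simps power2_eq_square field_simps)
  finally show ?thesis .
qed

text \<open>
  The commutator is of lower order: it is bounded by a small multiple of the energy of the difference
  quotient and a multiple of \<open>wform a v v\<close>, with constants that do not depend on \<open>h\<close>.
\<close>

lemma wform_lap_commutator:
  assumes h: "0 < h" "h \<le> 1" and \<epsilon>: "\<epsilon> > 0"
  shows "\<bar>(1 / h) * (wform (a - h) v (dquot h u) - wform a v (dquot h u))\<bar>
    \<le> 2 * \<epsilon> * wform (a - h) (dquot h u) (dquot h u) + 3 / (2 * \<epsilon>) * wform a v v"
proof -
  let ?d = "dquot h u"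
  have "\<bar>wform (a - h) v ?d - wform a v ?d\<bar> \<le> 2 * h * (\<epsilon> * wform (a - h) ?d ?d + wform (a - h) v v / (4 * \<epsilon>))"
    by (rule wform_weight_diff) (use h \<epsilon> in auto)
  then have "(1 / h) * \<bar>wform (a - h) v ?d - wform a v ?d\<bar> \<le> (1 / h) * (2 * h * (\<epsilon> * wform (a - h) ?d ?d + wform (a - h) v v / (4 * \<epsilon>)))"
    using h by (intro mult_left_mono) auto
  also have "\<dots> = 2 * \<epsilon> * wform (a - h) ?d ?d + 1 / (2 * \<epsilon>) * wform (a - h) v v"
    using h by (simp add: field_simps)
  also have "\<dots> \<le> 2 * \<epsilon> * wform (a - h) ?d ?d + 1 / (2 * \<epsilon>) * (3 * wform a v v)"
    using h \<epsilon> by (intro add_left_mono mult_left_mono wform_change_centre) auto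
  finally show ?thesis using h by (simp add: abs_mult)
qed


section \<open>The generator of the translation group\<close>

text \<open>
  \<open>gen u v\<close> means that \<open>u\<close> is in the domain of the generator of the group of translations, which maps it
  to \<open>v\<close>; it turns out to be the relation of having the weak derivative \<open>v\<close>.
\<close>

definition gen :: "'e::{banach, second_countable_topology} l2uls \<Rightarrow> 'e l2uls \<Rightarrow> bool" where
  "gen u v \<longleftrightarrow> ((\<lambda>s. translate s u) has_vector_derivative v) (at 0)"

lemma gen_imp_has_vector_derivative:
  assumes "gen u v"
  shows "((\<lambda>s. translate s u) has_vector_derivative translate s v) (at s)"
proof -
  have "((\<lambda>h. translate s ((1 / h) *\<^sub>R (translate (0 + h) u - translate 0 u))) \<longlongrightarrow> translate s v) (at 0)"
    using assms unfolding gen_def has_vector_derivative_at_iff_tendsto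
    by (rule bounded_linear.tendsto[OF bounded_linear_translate])
  then show ?thesis
    unfolding has_vector_derivative_at_iff_tendsto
    by (simp add: translate_scaleR translate_diff translate_translate)
qed

lemma gen_commuting:
  assumes S: "bounded_linear S" and comm: "\<And>h u. S (translate h u) = translate h (S u)" and g: "gen u v"
  shows "gen (S u) (S v)"
  using bounded_linear.has_vector_derivative[OF S, of "\<lambda>s. translate s u" v "at 0"] g
  by (simp add: gen_def comm)

lemma gen_linear:
  "gen u v \<Longrightarrow> gen u' v' \<Longrightarrow> gen (u + u') (v + v')"
  "gen u v \<Longrightarrow> gen u' v' \<Longrightarrow> gen (u - u') (v - v')"
  "gen u v \<Longrightarrow> gen (c *\<^sub>R u) (c *\<^sub>R v)"
  unfolding gen_def translate_add translate_diff translate_scaleR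
  by (auto intro!: has_vector_derivative_add has_vector_derivative_diff
      bounded_linear.has_vector_derivative[OF bounded_linear_scaleR_right])

lemma gen_scaleC: "gen u v \<Longrightarrow> gen (c *\<^sub>C u) (c *\<^sub>C v)"
  by (rule gen_commuting[OF bounded_linear_scaleC]) (simp add: translate_scaleC)

lemma gen_dquot: "gen u v \<Longrightarrow> gen (dquot h u) (dquot h v)"
  unfolding dquot_def
  by (intro gen_linear gen_commuting[OF bounded_linear_translate[of h]]) (simp_all add: translate_translate add.commute)

lemma dquot_tendsto: "gen u v \<Longrightarrow> ((\<lambda>h. dquot h u) \<longlongrightarrow> v) (at 0)"
  unfolding gen_def has_vector_derivative_at_iff_tendsto dquot_def by simp

text \<open>
  The function \<open>q(s) = \<tau>\<^sub>s u + \<tau>\<^sub>-\<^sub>s u - 2 u - s\<^sup>2 w\<close> vanishes at \<open>0\<close>, and its derivative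
  \<open>\<tau>\<^sub>s v - \<tau>\<^sub>-\<^sub>s v - 2 s w\<close> is \<open>o(s)\<close>, so \<open>q(h) = o(h\<^sup>2)\<close>.
\<close>

lemma lap_tendsto:
  assumes uv: "gen u v" and vw: "gen v w"
  shows "((\<lambda>h. lap h u) \<longlongrightarrow> w) (at_right 0)"
proof (rule tendstoI)
  fix e :: real assume e: "e > 0"
  have "((\<lambda>h. (1 / h) *\<^sub>R (translate h v - v)) \<longlongrightarrow> w) (at 0)"
    using dquot_tendsto[OF vw] by (simp add: dquot_def)
  then have "\<forall>\<^sub>F h in at 0. dist ((1 / h) *\<^sub>R (translate h v - v)) w < e / 4"
    by (rule tendstoD) (use e in simp)
  then obtain \<delta> where \<delta>: "\<delta> > 0" "\<And>h. h \<noteq> 0 \<Longrightarrow> \<bar>h\<bar> < \<delta> \<Longrightarrow> norm ((1 / h) *\<^sub>R (translate h v - v) - w) < e / 4"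
    unfolding eventually_at by (auto simp: dist_norm)
  have small: "norm (translate s v - v - s *\<^sub>R w) \<le> e / 4 * \<bar>s\<bar>" if "\<bar>s\<bar> < \<delta>" for s
  proof (cases "s = 0")
    case False
    have "translate s v - v - s *\<^sub>R w = s *\<^sub>R ((1 / s) *\<^sub>R (translate s v - v) - w)"
      using False by (simp add: scaleR_diff_right)
    then have "norm (translate s v - v - s *\<^sub>R w) = \<bar>s\<bar> * norm ((1 / s) *\<^sub>R (translate s v - v) - w)" by simp
    also have "\<dots> \<le> \<bar>s\<bar> * (e / 4)" using \<delta>(2)[OF False that] by (intro mult_left_mono) auto
    finally show ?thesis by (simp add: mult.commute)
  qed simp
  have "dist (lap h u) w < e" if h: "0 < h" "h < \<delta>" for h
  proof -
    define q where "q = (\<lambda>s. translate s u + translate (- s) u - 2 *\<^sub>R u - s\<^sup>2 *\<^sub>R w)"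
    have "norm (q h - q 0) \<le> (e / 2 * h) * norm (h - 0)"
    proof (rule differentiable_bound[of "{0..h}"])
      fix s assume s: "s \<in> {0..h}"
      have 2: "((\<lambda>s. translate (- s) u) has_vector_derivative - translate (- s) v) (at s)"
      proof -
        have "((\<lambda>s. translate s u) \<circ> uminus has_vector_derivative (- 1) *\<^sub>R translate (- s) v) (at s)"
          by (rule vector_diff_chain_at[OF _ gen_imp_has_vector_derivative[OF uv]]) (auto intro!: derivative_eq_intros)
        then show ?thesis by (simp add: o_def)
      qed
      have 3: "((\<lambda>s. s\<^sup>2 *\<^sub>R w) has_vector_derivative (2 * s) *\<^sub>R w) (at s)"
        using has_vector_derivative_scaleR[of "\<lambda>s. s\<^sup>2" "2 * s" s UNIV "\<lambda>_. w" 0]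
        by (auto intro!: derivative_eq_intros)
      have "(q has_vector_derivative translate s v + - translate (- s) v - 0 - (2 * s) *\<^sub>R w) (at s)"
        unfolding q_def
        by (intro has_vector_derivative_add has_vector_derivative_diff gen_imp_has_vector_derivative[OF uv] 2 3
            has_vector_derivative_const)
      then show "(q has_derivative (\<lambda>r. r *\<^sub>R (translate s v + - translate (- s) v - 0 - (2 * s) *\<^sub>R w))) (at s within {0..h})"
        unfolding has_vector_derivative_def by (rule has_derivative_at_withinI)
      have eq: "translate s v + - translate (- s) v - 0 - (2 * s) *\<^sub>R w
        = (translate s v - v - s *\<^sub>R w) - (translate (- s) v - v - (- s) *\<^sub>R w)"
        by (simp add: scaleR_add_left[symmetric] algebra_simps)
      have "norm (translate s v + - translate (- s) v - 0 - (2 * s) *\<^sub>R w) \<le> e / 4 * \<bar>s\<bar> + e / 4 * \<bar>- s\<bar>"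
        unfolding eq by (rule order_trans[OF norm_triangle_ineq4 add_mono[OF small small]]) (use s h in auto)
      also have "\<dots> \<le> e / 2 * h" using s e by (simp add: mult_left_mono)
      finally have n: "norm (translate s v + - translate (- s) v - 0 - (2 * s) *\<^sub>R w) \<le> e / 2 * h" .
      show "onorm (\<lambda>r. r *\<^sub>R (translate s v + - translate (- s) v - 0 - (2 * s) *\<^sub>R w)) \<le> e / 2 * h"
      proof (rule onorm_bound)
        show "0 \<le> e / 2 * h" using e h by simp
        show "norm (r *\<^sub>R (translate s v + - translate (- s) v - 0 - (2 * s) *\<^sub>R w)) \<le> e / 2 * h * norm r" for r
          using mult_right_mono[OF n abs_ge_zero[of r]] by (simp add: mult.commute)
      qed
    qed (use h in auto)
    moreover have "q 0 = 0" by (simp add: q_def scaleR_2)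
    ultimately have nq: "norm (q h) \<le> e / 2 * h\<^sup>2" using h by (simp add: power2_eq_square)
    have "lap h u - w = (1 / h\<^sup>2) *\<^sub>R q h" using h by (simp add: lap_def q_def scaleR_diff_right)
    then have "norm (lap h u - w) = (1 / h\<^sup>2) * norm (q h)" by simp
    also have "\<dots> \<le> (1 / h\<^sup>2) * (e / 2 * h\<^sup>2)" by (intro mult_left_mono nq) simp
    also have "\<dots> < e" using h e by simp
    finally show ?thesis by (simp add: dist_norm)
  qed
  then show "\<forall>\<^sub>F h in at_right 0. dist (lap h u) w < e"
    unfolding eventually_at_right_field using \<delta>(1) by blast
qed

text \<open>
  Translating the average \<open>\<integral>\<^sub>0\<^sup>\<epsilon> \<tau>\<^sub>s g ds / \<epsilon>\<close> amounts to moving the interval of integration.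
\<close>

lemma gen_average:
  assumes "\<epsilon> > 0"
  shows "gen ((1 / \<epsilon>) *\<^sub>R integral {0..\<epsilon>} (\<lambda>s. translate s g)) (dquot \<epsilon> g)"
proof -
  \<comment> \<open>the lower limit \<open>- 1\<close> makes \<open>I\<close> differentiable on both sides of \<open>0\<close>\<close>
  define I where "I = (\<lambda>s. integral {- 1..s} (\<lambda>r. translate r g))"
  note int = integrable_continuous_real[OF continuous_on_translate[of _ g]]
  have dI: "(I has_vector_derivative translate s g) (at s)" if "- 1 < s" for s
  proof -
    have "(I has_vector_derivative translate s g) (at s within {- 1..s + 1})"
      unfolding I_def by (rule integral_has_vector_derivative[OF continuous_on_translate]) (use that in auto)
    then show ?thesis using that by (simp add: at_within_Icc_at)
  qed
  have tr: "translate h (integral {0..\<epsilon>} (\<lambda>s. translate s g)) = I (h + \<epsilon>) - I h" if "- 1 < h" for h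
  proof -
    have eq: "translate h (integral {0..\<epsilon>} (\<lambda>s. translate s g)) = integral {0..\<epsilon>} (\<lambda>s. translate (h + s) g)"
      using integral_linear[OF int bounded_linear_translate, of 0 \<epsilon> h] by (simp add: o_def translate_translate)
    have I: "((\<lambda>s. translate (h + s) g) has_integral I (h + \<epsilon>) - I (h + 0)) {0..\<epsilon>}"
    proof (rule fundamental_theorem_of_calculus)
      fix s assume s: "s \<in> {0..\<epsilon>}"
      have "(I \<circ> (\<lambda>s. h + s) has_vector_derivative 1 *\<^sub>R translate (h + s) g) (at s)"
        by (rule vector_diff_chain_at[OF _ dI]) (use that s in \<open>auto intro!: derivative_eq_intros\<close>)
      then show "((\<lambda>s. I (h + s)) has_vector_derivative translate (h + s) g) (at s within {0..\<epsilon>})"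
        by (simp add: o_def has_vector_derivative_at_within)
    qed (use assms in simp)
    show ?thesis using eq integral_unique[OF I] by simp
  qed
  have "((\<lambda>h. I (h + \<epsilon>) - I h) has_vector_derivative translate \<epsilon> g - translate 0 g) (at 0)"
  proof (rule has_vector_derivative_diff)
    show "(I has_vector_derivative translate 0 g) (at 0)" by (rule dI) simp
    have "(I \<circ> (\<lambda>h. h + \<epsilon>) has_vector_derivative 1 *\<^sub>R translate (0 + \<epsilon>) g) (at 0)"
      by (rule vector_diff_chain_at[OF _ dI]) (use assms in \<open>auto intro!: derivative_eq_intros\<close>)
    then show "((\<lambda>h. I (h + \<epsilon>)) has_vector_derivative translate \<epsilon> g) (at 0)" by (simp add: o_def)
  qed
  then have "gen (integral {0..\<epsilon>} (\<lambda>s. translate s g)) (translate \<epsilon> g - g)"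
    unfolding gen_def
    by (subst has_vector_derivative_transform_within_open[of _ _ _ "{- 1<..}"]) (auto simp: tr)
  from gen_linear(3)[OF this, of "1 / \<epsilon>"] show ?thesis by (simp add: dquot_def)
qed

lemma norm_average_diff_le:
  assumes \<epsilon>: "\<epsilon> > 0" and le: "\<And>s. 0 \<le> s \<Longrightarrow> s \<le> \<epsilon> \<Longrightarrow> norm (translate s g - g) \<le> K"
  shows "norm ((1 / \<epsilon>) *\<^sub>R integral {0..\<epsilon>} (\<lambda>s. translate s g) - g) \<le> K"
proof -
  have K0: "0 \<le> K" using le[of 0] \<epsilon> by simp
  note int = integrable_continuous_real[OF continuous_on_translate[of _ g]]
  have "((\<lambda>s. translate s g - g) has_integral (integral {0..\<epsilon>} (\<lambda>s. translate s g) - \<epsilon> *\<^sub>R g)) {0..\<epsilon>}"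
    using has_integral_diff[OF integrable_integral[OF int] has_integral_const_real[of g 0 \<epsilon>]] \<epsilon> by simp
  from has_integral_bound_real[OF K0 _ this, of "{}"]
  have "norm (integral {0..\<epsilon>} (\<lambda>s. translate s g) - \<epsilon> *\<^sub>R g) \<le> K * \<epsilon>" using le \<epsilon> by simp
  moreover have "(1 / \<epsilon>) *\<^sub>R integral {0..\<epsilon>} (\<lambda>s. translate s g) - g = (1 / \<epsilon>) *\<^sub>R (integral {0..\<epsilon>} (\<lambda>s. translate s g) - \<epsilon> *\<^sub>R g)"
    using \<epsilon> by (simp add: scaleR_diff_right)
  ultimately show ?thesis using \<epsilon> by (simp only: norm_scaleR) (simp add: field_simps)
qed

text \<open>Averages over short intervals converge by strong continuity and gain a derivative each time.\<close>

lemma smooth_dense: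
  assumes e: "e > 0"
  shows "\<exists>u v w. gen u v \<and> gen v w \<and> norm (u - f) < e"
proof -
  have approx: "\<exists>\<epsilon>>0. norm ((1 / \<epsilon>) *\<^sub>R integral {0..\<epsilon>} (\<lambda>s. translate s g) - g) < r" if r: "r > 0" for g :: "'a l2uls" and r
  proof -
    have "\<forall>\<^sub>F s in at 0. dist (translate s g) g < r / 2" using translate_tendsto_0 r by (intro tendstoD) auto
    then obtain \<delta> where \<delta>: "\<delta> > 0" "\<And>s. s \<noteq> 0 \<Longrightarrow> \<bar>s\<bar> < \<delta> \<Longrightarrow> norm (translate s g - g) < r / 2"
      unfolding eventually_at by (auto simp: dist_norm)
    have "norm (translate s g - g) \<le> r / 2" if "0 \<le> s" "s \<le> \<delta> / 2" for s
      using \<delta>(2)[of s] that \<delta>(1) r by (cases "s = 0") auto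
    then have "norm ((1 / (\<delta> / 2)) *\<^sub>R integral {0..\<delta> / 2} (\<lambda>s. translate s g) - g) \<le> r / 2"
      using \<delta>(1) by (intro norm_average_diff_le) auto
    then show ?thesis using \<delta>(1) r by (intro exI[of _ "\<delta> / 2"]) auto
  qed
  obtain \<epsilon> where \<epsilon>: "\<epsilon> > 0" "norm ((1 / \<epsilon>) *\<^sub>R integral {0..\<epsilon>} (\<lambda>s. translate s f) - f) < e / 2"
    using approx[of "e / 2" f] e by auto
  define g where "g = (1 / \<epsilon>) *\<^sub>R integral {0..\<epsilon>} (\<lambda>s. translate s f)"
  have g: "gen g (dquot \<epsilon> f)" unfolding g_def by (rule gen_average[OF \<epsilon>(1)])
  obtain \<eta> where \<eta>: "\<eta> > 0" "norm ((1 / \<eta>) *\<^sub>R integral {0..\<eta>} (\<lambda>s. translate s g) - g) < e / 2"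
    using approx[of "e / 2" g] e by auto
  define u where "u = (1 / \<eta>) *\<^sub>R integral {0..\<eta>} (\<lambda>s. translate s g)"
  have "gen u (dquot \<eta> g)" unfolding u_def by (rule gen_average[OF \<eta>(1)])
  moreover have "gen (dquot \<eta> g) (dquot \<eta> (dquot \<epsilon> f))" by (rule gen_dquot[OF g])
  moreover have "norm (u - f) < e"
    using norm_triangle_ineq[of "u - g" "g - f"] \<epsilon>(2) \<eta>(2) by (simp add: u_def[symmetric] g_def[symmetric])
  ultimately show ?thesis by blast
qed

section \<open>Test functions\<close>

lemma test_function_DERIV:
  assumes "\<theta> \<in> test_functions"
  shows "(\<theta> has_real_derivative deriv \<theta> x) (at x)"
proof -
  have "(deriv ^^ 0) \<theta> differentiable (at x)" using assms unfolding test_functions_def by blast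
  then show ?thesis by (simp add: DERIV_deriv_iff_real_differentiable)
qed

text \<open>
  Where a test function vanishes locally, so does its derivative.
\<close>

lemma deriv_test_function:
  assumes \<theta>: "\<theta> \<in> test_functions"
  shows "deriv \<theta> \<in> test_functions"
proof -
  have "(deriv ^^ k) (deriv \<theta>) differentiable (at x)" for k x
  proof -
    have "(deriv ^^ (Suc k)) \<theta> differentiable (at x)" using \<theta> unfolding test_functions_def by blast
    then show ?thesis by (simp only: funpow_Suc_right o_apply)
  qed
  moreover have "{x. deriv \<theta> x \<noteq> 0} \<subseteq> closure {x. \<theta> x \<noteq> 0}"
  proof
    fix x assume x: "x \<in> {x. deriv \<theta> x \<noteq> 0}"
    show "x \<in> closure {x. \<theta> x \<noteq> 0}"
    proof (rule ccontr)
      assume nx: "x \<notin> closure {x. \<theta> x \<noteq> 0}"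
      have "((\<lambda>_. 0) has_real_derivative 0) (at x)" by simp
      then have "(\<theta> has_real_derivative 0) (at x)"
        by (rule has_field_derivative_transform_within_open[of _ _ _ "- closure {x. \<theta> x \<noteq> 0}"])
          (use nx closure_subset[of "{x. \<theta> x \<noteq> 0}"] in auto)
      then show False using x DERIV_imp_deriv by auto
    qed
  qed
  then have "bounded {x. deriv \<theta> x \<noteq> 0}"
    using \<theta> bounded_subset[OF compact_imp_bounded] unfolding test_functions_def by blast
  then have "compact (closure {x. deriv \<theta> x \<noteq> 0})"
    by (simp add: compact_eq_bounded_closed bounded_closure)
  ultimately show ?thesis by (simp add: test_functions_def)
qed

lemma shift_test_function:
  assumes \<theta>: "\<theta> \<in> test_functions"
  shows "(\<lambda>x. \<theta> (x + s)) \<in> test_functions" "deriv (\<lambda>x. \<theta> (x + s)) = (\<lambda>x. deriv \<theta> (x + s))"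
proof -
  have d: "deriv (\<lambda>x. f (x + s)) = (\<lambda>x. deriv f (x + s))" for f :: "real \<Rightarrow> real"
    by (simp add: deriv_def fun_eq_iff DERIV_shift)
  then show "deriv (\<lambda>x. \<theta> (x + s)) = (\<lambda>x. deriv \<theta> (x + s))" .
  have dk: "(deriv ^^ k) (\<lambda>x. \<theta> (x + s)) = (\<lambda>x. (deriv ^^ k) \<theta> (x + s))" for k
    by (induction k) (simp_all add: d)
  have "(deriv ^^ k) (\<lambda>x. \<theta> (x + s)) differentiable (at x)" for k x
  proof -
    have "(deriv ^^ k) \<theta> differentiable (at (x + s))" using \<theta> unfolding test_functions_def by blast
    then have "((deriv ^^ k) \<theta> has_real_derivative deriv ((deriv ^^ k) \<theta>) (x + s)) (at (x + s))"
      by (simp add: DERIV_deriv_iff_real_differentiable)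
    then have "((\<lambda>x. (deriv ^^ k) \<theta> (x + s)) has_real_derivative deriv ((deriv ^^ k) \<theta>) (x + s)) (at x)"
      by (simp add: DERIV_shift)
    then show ?thesis unfolding dk by (auto simp: real_differentiable_def)
  qed
  moreover have "compact (closure {x. \<theta> (x + s) \<noteq> 0})"
  proof -
    have "bounded {x. \<theta> x \<noteq> 0}"
      using \<theta> bounded_subset[OF compact_imp_bounded closure_subset] unfolding test_functions_def by blast
    then have "bounded ((+) (- s) ` {x. \<theta> x \<noteq> 0})" by (rule bounded_translation)
    then have "bounded {x. \<theta> (x + s) \<noteq> 0}"
      by (rule bounded_subset) (auto intro!: image_eqI[of _ _ "_ + s"])
    then show ?thesis by (simp add: compact_eq_bounded_closed bounded_closure)
  qed
  ultimately show "(\<lambda>x. \<theta> (x + s)) \<in> test_functions" by (simp add: test_functions_def)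
qed

lemma test_function_bounds:
  assumes \<theta>: "\<theta> \<in> test_functions"
  obtains N K where "N > 0" "K > 0" "\<And>x. \<bar>x\<bar> > N \<Longrightarrow> \<theta> x = 0" "\<And>x. \<bar>\<theta> x\<bar> \<le> K"
proof -
  have "bounded {x. \<theta> x \<noteq> 0}"
    using \<theta> bounded_subset[OF compact_imp_bounded closure_subset] unfolding test_functions_def by blast
  then obtain N where N: "N > 0" "\<And>x. \<theta> x \<noteq> 0 \<Longrightarrow> \<bar>x\<bar> \<le> N" unfolding bounded_pos by auto
  have "continuous_on {- N..N} \<theta>"
    by (rule continuous_at_imp_continuous_on) (use DERIV_isCont[OF test_function_DERIV[OF \<theta>]] in blast)
  then have "bounded (\<theta> ` {- N..N})" by (intro compact_imp_bounded compact_continuous_image) auto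
  then obtain K where K: "K > 0" "\<And>x. x \<in> {- N..N} \<Longrightarrow> \<bar>\<theta> x\<bar> \<le> K" unfolding bounded_pos by auto
  show ?thesis
  proof (rule that[OF N(1) K(1)])
    show "\<bar>x\<bar> > N \<Longrightarrow> \<theta> x = 0" for x using N(2)[of x] by linarith
    show "\<bar>\<theta> x\<bar> \<le> K" for x
      using K(2)[of x] N(2)[of x] K(1) by (cases "\<theta> x = 0") (auto simp: abs_le_iff)
  qed
qed

lemma le_exp_weight:
  fixes x :: real
  assumes "\<And>x. \<bar>x\<bar> > N \<Longrightarrow> \<theta> x = 0" "\<And>x. \<bar>\<theta> x\<bar> \<le> K"
  shows "\<bar>\<theta> x\<bar> \<le> (K * exp N) * exp (- \<bar>x\<bar>)"
proof -
  have K0: "0 \<le> K" using order_trans[OF abs_ge_zero assms(2)] .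
  show ?thesis
  proof (cases "\<bar>x\<bar> > N")
    case False
    then have "1 \<le> exp N * exp (- \<bar>x\<bar>)" by (simp flip: exp_add)
    then have "K * 1 \<le> K * (exp N * exp (- \<bar>x\<bar>))" using K0 by (intro mult_left_mono)
    then show ?thesis using assms(2)[of x] by (simp add: mult.assoc)
  qed (use K0 assms(1) in simp)
qed

lemma test_function_le_exp_weight:
  assumes "\<theta> \<in> test_functions"
  obtains C where "C \<ge> 0" "\<And>x. \<bar>\<theta> x\<bar> \<le> C * exp (- \<bar>x\<bar>)"
proof -
  obtain N K where "N > 0" "K > 0" "\<And>x. \<bar>x\<bar> > N \<Longrightarrow> \<theta> x = 0" "\<And>x. \<bar>\<theta> x\<bar> \<le> K"
    using test_function_bounds[OF assms] by blast
  then show ?thesis using le_exp_weight[of N \<theta> K] by (intro that[of "K * exp N"]) auto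
qed

lemma test_function_measurable: "\<theta> \<in> test_functions \<Longrightarrow> \<theta> \<in> borel_measurable lebesgue"
  by (intro measurable_completion)
    (simp add: borel_measurable_continuous_onI continuous_at_imp_continuous_on DERIV_isCont[OF test_function_DERIV])

section \<open>Pairing with test functions\<close>

definition pairing :: "(real \<Rightarrow> real) \<Rightarrow> 'e::{banach, second_countable_topology} l2uls \<Rightarrow> 'e" where
  "pairing \<theta> u = (LINT x|lebesgue. \<theta> x *\<^sub>R rep_l2uls u x)"

text \<open>
  The weight is the weighted square of the constant function \<open>1\<close>, which is uniformly local.
\<close>

lemma integrable_exp_weight: "integrable lebesgue (\<lambda>x. exp (- \<bar>x\<bar>) :: real)"
  and integral_exp_weight_le: "(LINT x|lebesgue. exp (- \<bar>x\<bar>)) \<le> (4 :: real)"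
proof -
  have loc: "(\<lambda>_. 1 :: real) \<in> L2_loc"
    by (auto simp: L2_loc_def set_integrable_def intro!: integrable_real_indicator simp: emeasure_lborel_Icc_eq)
  have u: "unit_norm a (\<lambda>_. 1 :: real) \<le> 1" for a
    by (simp add: unit_norm_def set_lebesgue_integral_def)
  have w: "(\<lambda>_. 1 :: real) \<in> L2_ul_w" by (rule L2_ul_wI[OF loc u])
  have n: "(ul_norm (\<lambda>_. 1 :: real))\<^sup>2 \<le> 1"
    using ul_norm_le[OF u] ul_norm_nonneg[OF w] by (simp add: power_le_one)
  show "integrable lebesgue (\<lambda>x. exp (- \<bar>x\<bar>) :: real)" "(LINT x|lebesgue. exp (- \<bar>x\<bar>)) \<le> (4 :: real)"
    using integrable_exp_weight_norm_square[OF w, of 0] n by simp_all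
qed

lemma integrable_exp_weight_norm:
  "integrable lebesgue (\<lambda>x. exp (- \<bar>x\<bar>) * norm (rep_l2uls u x))"
  and integral_exp_weight_norm_le: "(LINT x|lebesgue. exp (- \<bar>x\<bar>) * norm (rep_l2uls u x)) \<le> 5 * norm u"
proof -
  let ?u = "rep_l2uls u"
  have um: "?u \<in> borel_measurable lebesgue" by (rule L2_loc_measurable[OF L2_ul_sD(2)[OF rep_l2uls_mem]])
  note I2 = integrable_exp_weight_norm_square[OF rep_l2uls_mem_w[of u], of 0, simplified]
  have m: "(\<lambda>x. exp (- \<bar>x\<bar>) * norm (?u x)) \<in> borel_measurable lebesgue"
    using borel_measurable_exp_weight[of 0]
    by (intro borel_measurable_times measurable_compose[OF um borel_measurable_norm]) simp
  have le: "exp (- \<bar>x\<bar>) * norm (?u x) \<le> s * exp (- \<bar>x\<bar>) + (1 / (4 * s)) * (exp (- \<bar>x\<bar>) * (norm (?u x))\<^sup>2)" if s: "s > 0" for s x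
  proof -
    have "0 \<le> (norm (?u x) - 2 * s)\<^sup>2" by simp
    then have "norm (?u x) \<le> s + (1 / (4 * s)) * (norm (?u x))\<^sup>2" using s by (simp add: power2_eq_square field_simps)
    then have "exp (- \<bar>x\<bar>) * norm (?u x) \<le> exp (- \<bar>x\<bar>) * (s + (1 / (4 * s)) * (norm (?u x))\<^sup>2)"
      by (intro mult_left_mono) auto
    then show ?thesis by (simp add: algebra_simps)
  qed
  have isum: "integrable lebesgue (\<lambda>x. s * exp (- \<bar>x\<bar>) + (1 / (4 * s)) * (exp (- \<bar>x\<bar>) * (norm (?u x))\<^sup>2))" for s
    by (intro Bochner_Integration.integrable_add integrable_mult_right integrable_exp_weight I2(1))
  show int: "integrable lebesgue (\<lambda>x. exp (- \<bar>x\<bar>) * norm (?u x))"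
  proof (rule Bochner_Integration.integrable_bound[OF isum[of 1] m])
    show "AE x in lebesgue. norm (exp (- \<bar>x\<bar>) * norm (?u x)) \<le> norm (1 * exp (- \<bar>x\<bar>) + (1 / (4 * 1)) * (exp (- \<bar>x\<bar>) * (norm (?u x))\<^sup>2))"
      using le[of 1] by (intro AE_I2) (simp add: abs_mult)
  qed
  show "(LINT x|lebesgue. exp (- \<bar>x\<bar>) * norm (?u x)) \<le> 5 * norm u"
  proof (cases "u = 0")
    case True
    have "(LINT x|lebesgue. exp (- \<bar>x\<bar>) * norm (?u x)) = 0"
      by (rule integral_eq_zero_AE) (use rep_l2uls_zero in \<open>eventually_elim, simp add: True\<close>)
    then show ?thesis by (simp add: True)
  next
    case False
    then have s: "norm u > 0" by simp
    have "(LINT x|lebesgue. exp (- \<bar>x\<bar>) * norm (?u x))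
      \<le> (LINT x|lebesgue. norm u * exp (- \<bar>x\<bar>) + (1 / (4 * norm u)) * (exp (- \<bar>x\<bar>) * (norm (?u x))\<^sup>2))"
      by (intro integral_mono int isum le s)
    also have "\<dots> = norm u * (LINT x|lebesgue. exp (- \<bar>x\<bar>)) + (1 / (4 * norm u)) * (LINT x|lebesgue. exp (- \<bar>x\<bar>) * (norm (?u x))\<^sup>2)"
      by (subst Bochner_Integration.integral_add) (auto intro: integrable_exp_weight I2(1))
    also have "\<dots> \<le> norm u * 4 + (1 / (4 * norm u)) * (4 * (norm u)\<^sup>2)"
      using I2(2) s by (intro add_mono mult_left_mono integral_exp_weight_le) (auto simp: norm_rep_l2uls)
    also have "\<dots> = 5 * norm u" using s by (simp add: power2_eq_square)
    finally show ?thesis .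
  qed
qed

lemma pairing_integrable:
  assumes \<theta>: "\<theta> \<in> borel_measurable lebesgue" and C: "\<And>x. \<bar>\<theta> x\<bar> \<le> C * exp (- \<bar>x\<bar>)"
  shows "integrable lebesgue (\<lambda>x. \<theta> x *\<^sub>R rep_l2uls u x)"
proof (rule Bochner_Integration.integrable_bound[OF integrable_mult_right[OF integrable_exp_weight_norm, of C u]])
  show "(\<lambda>x. \<theta> x *\<^sub>R rep_l2uls u x) \<in> borel_measurable lebesgue"
    by (intro borel_measurable_scaleR \<theta> L2_loc_measurable L2_ul_sD rep_l2uls_mem)
  show "AE x in lebesgue. norm (\<theta> x *\<^sub>R rep_l2uls u x) \<le> norm (C * (exp (- \<bar>x\<bar>) * norm (rep_l2uls u x)))"
  proof (rule AE_I2)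
    fix x
    have "\<bar>\<theta> x\<bar> * norm (rep_l2uls u x) \<le> (C * exp (- \<bar>x\<bar>)) * norm (rep_l2uls u x)"
      by (intro mult_right_mono C) simp
    also have "\<dots> \<le> norm (C * (exp (- \<bar>x\<bar>) * norm (rep_l2uls u x)))"
      by (simp add: mult.assoc abs_ge_self del: abs_mult)
    finally show "norm (\<theta> x *\<^sub>R rep_l2uls u x) \<le> norm (C * (exp (- \<bar>x\<bar>) * norm (rep_l2uls u x)))" by simp
  qed
qed

lemma norm_pairing_le:
  assumes \<theta>: "\<theta> \<in> borel_measurable lebesgue" and C: "\<And>x. \<bar>\<theta> x\<bar> \<le> C * exp (- \<bar>x\<bar>)"
  shows "norm (pairing \<theta> u) \<le> 5 * C * norm u"
proof -
  have C0: "0 \<le> C" using C[of 0] by simp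
  have "norm (pairing \<theta> u) \<le> (LINT x|lebesgue. norm (\<theta> x *\<^sub>R rep_l2uls u x))"
    unfolding pairing_def by (rule integral_norm_bound)
  also have "\<dots> \<le> (LINT x|lebesgue. C * (exp (- \<bar>x\<bar>) * norm (rep_l2uls u x)))"
  proof (rule integral_mono)
    show "integrable lebesgue (\<lambda>x. norm (\<theta> x *\<^sub>R rep_l2uls u x))" by (rule integrable_norm[OF pairing_integrable[OF \<theta> C]])
    show "integrable lebesgue (\<lambda>x. C * (exp (- \<bar>x\<bar>) * norm (rep_l2uls u x)))"
      by (intro integrable_mult_right integrable_exp_weight_norm)
    show "norm (\<theta> x *\<^sub>R rep_l2uls u x) \<le> C * (exp (- \<bar>x\<bar>) * norm (rep_l2uls u x))" for x
      using mult_right_mono[OF C norm_ge_zero] by (simp add: mult.assoc)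
  qed
  also have "\<dots> \<le> C * (5 * norm u)"
    using mult_left_mono[OF integral_exp_weight_norm_le[of u] C0] by simp
  finally show ?thesis by simp
qed

lemma bounded_linear_pairing:
  assumes \<theta>: "\<theta> \<in> borel_measurable lebesgue" and C: "\<And>x. \<bar>\<theta> x\<bar> \<le> C * exp (- \<bar>x\<bar>)"
  shows "bounded_linear (pairing \<theta> :: 'e::{banach, second_countable_topology} l2uls \<Rightarrow> 'e)"
proof (rule bounded_linear_intro[where K = "5 * C"])
  note int = pairing_integrable[OF \<theta> C]
  fix u v :: "'e l2uls" and c :: real
  have "pairing \<theta> (u + v) = (LINT x|lebesgue. \<theta> x *\<^sub>R rep_l2uls u x + \<theta> x *\<^sub>R rep_l2uls v x)"
    unfolding pairing_def
  proof (rule integral_cong_AE)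
    show "AE x in lebesgue. \<theta> x *\<^sub>R rep_l2uls (u + v) x = \<theta> x *\<^sub>R rep_l2uls u x + \<theta> x *\<^sub>R rep_l2uls v x"
      using rep_l2uls_add[of u v] by eventually_elim (simp add: scaleR_add_right)
  qed (intro borel_measurable_add borel_measurable_integrable[OF int])+
  then show "pairing \<theta> (u + v) = pairing \<theta> u + pairing \<theta> v"
    by (simp add: pairing_def Bochner_Integration.integral_add[OF int int])
  have "pairing \<theta> (c *\<^sub>R u) = (LINT x|lebesgue. c *\<^sub>R (\<theta> x *\<^sub>R rep_l2uls u x))"
    unfolding pairing_def
  proof (rule integral_cong_AE)
    show "AE x in lebesgue. \<theta> x *\<^sub>R rep_l2uls (c *\<^sub>R u) x = c *\<^sub>R (\<theta> x *\<^sub>R rep_l2uls u x)"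
      using rep_l2uls_scaleR[of c u] by eventually_elim simp
  qed (intro borel_measurable_scaleR borel_measurable_const borel_measurable_integrable[OF int])+
  then show "pairing \<theta> (c *\<^sub>R u) = c *\<^sub>R pairing \<theta> u" by (simp only: pairing_def integral_scaleR_right)
  show "norm (pairing \<theta> u) \<le> norm u * (5 * C)" using norm_pairing_le[OF \<theta> C, of u] by (simp add: mult.commute)
qed

lemma bounded_linear_pairing_test:
  assumes "\<theta> \<in> test_functions" shows "bounded_linear (pairing \<theta>)"
  using test_function_le_exp_weight[OF assms] bounded_linear_pairing[OF test_function_measurable[OF assms]] by metis

lemma integral_shift_lebesgue:
  fixes f :: "real \<Rightarrow> 'e::{banach, second_countable_topology}"
  assumes f: "f \<in> borel_measurable lebesgue"
  shows "(LINT x|lebesgue. f (x + h)) = (LINT x|lebesgue. f x)"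
proof -
  have "distr lebesgue lebesgue (\<lambda>x. x + h) = (lebesgue :: real measure)"
    using lebesgue_real_affine[of 1 h] by (simp add: density_1 add.commute)
  moreover have "(\<lambda>x::real. x + h) \<in> lebesgue \<rightarrow>\<^sub>M lebesgue" using measurable_shift[of "- h"] by simp
  ultimately show ?thesis using integral_distr[OF _ f, of "\<lambda>x. x + h" lebesgue] by simp
qed

lemma pairing_translate: "pairing \<theta> (translate h u) = pairing (\<lambda>x. \<theta> (x + (- h))) u"
  if \<theta>: "\<theta> \<in> test_functions"
proof -
  obtain C where C: "\<And>x. \<bar>\<theta> x\<bar> \<le> C * exp (- \<bar>x\<bar>)" using test_function_le_exp_weight[OF \<theta>] by metis
  let ?f = "\<lambda>x. \<theta> (x + (- h)) *\<^sub>R rep_l2uls u x"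
  have \<theta>h: "(\<lambda>x. \<theta> (x + (- h))) \<in> test_functions" by (rule shift_test_function[OF \<theta>])
  obtain C' where C': "\<And>x. \<bar>\<theta> (x + (- h))\<bar> \<le> C' * exp (- \<bar>x\<bar>)" using test_function_le_exp_weight[OF \<theta>h] by metis
  have fm: "?f \<in> borel_measurable lebesgue"
    by (rule borel_measurable_integrable[OF pairing_integrable[OF test_function_measurable[OF \<theta>h] C']])
  have "pairing \<theta> (translate h u) = (LINT x|lebesgue. ?f (x + h))"
    unfolding pairing_def
  proof (rule integral_cong_AE)
    show "(\<lambda>x. \<theta> x *\<^sub>R rep_l2uls (translate h u) x) \<in> borel_measurable lebesgue"
      by (rule borel_measurable_integrable[OF pairing_integrable[OF test_function_measurable[OF \<theta>] C]])
    show "(\<lambda>x. ?f (x + h)) \<in> borel_measurable lebesgue"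
      using borel_measurable_shift[OF fm, of "- h"] by simp
    show "AE x in lebesgue. \<theta> x *\<^sub>R rep_l2uls (translate h u) x = ?f (x + h)"
      using rep_translate[of h u] by eventually_elim simp
  qed
  also have "\<dots> = (LINT x|lebesgue. ?f x)" by (rule integral_shift_lebesgue[OF fm])
  finally show ?thesis by (simp add: pairing_def)
qed

text \<open>
  The difference quotient is moved to the test function, where it converges uniformly by Taylor's
  formula, with supports in a fixed compact interval; so the pairings converge.
\<close>

lemma pairing_translate_has_vector_derivative:
  assumes \<theta>: "\<theta> \<in> test_functions"
  shows "((\<lambda>s. pairing \<theta> (translate s u)) has_vector_derivative - pairing (deriv \<theta>) (translate s u)) (at s)"
proof -
  define w where "w = translate s u"
  have \<theta>1: "deriv \<theta> \<in> test_functions" and \<theta>2: "deriv (deriv \<theta>) \<in> test_functions"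
    by (intro deriv_test_function \<theta>)+
  obtain N0 K0 where N0: "N0 > 0" "\<And>x. \<bar>x\<bar> > N0 \<Longrightarrow> \<theta> x = 0" using test_function_bounds[OF \<theta>] by metis
  obtain N1 K1 where N1: "N1 > 0" "\<And>x. \<bar>x\<bar> > N1 \<Longrightarrow> deriv \<theta> x = 0" using test_function_bounds[OF \<theta>1] by metis
  obtain K where K: "K > 0" "\<And>x. \<bar>deriv (deriv \<theta>) x\<bar> \<le> K" using test_function_bounds[OF \<theta>2] by metis
  define N where "N = N0 + N1 + 1"
  have taylor: "\<bar>\<theta> (x - h) - \<theta> x + h * deriv \<theta> x\<bar> \<le> K * \<bar>h\<bar> * \<bar>h\<bar>" for x h
  proof -
    have lip: "\<bar>deriv \<theta> y - deriv \<theta> x\<bar> \<le> K * \<bar>y - x\<bar>" for y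
      using field_differentiable_bound[of UNIV "deriv \<theta>" "deriv (deriv \<theta>)" K y x] test_function_DERIV[OF \<theta>1] K(2)
      by simp
    have "norm ((\<theta> (x - h) - deriv \<theta> x * (x - h)) - (\<theta> x - deriv \<theta> x * x)) \<le> (K * \<bar>h\<bar>) * norm ((x - h) - x)"
    proof (rule field_differentiable_bound[of "{x - \<bar>h\<bar>..x + \<bar>h\<bar>}" _ "\<lambda>y. deriv \<theta> y - deriv \<theta> x"])
      show "((\<lambda>y. \<theta> y - deriv \<theta> x * y) has_field_derivative deriv \<theta> y - deriv \<theta> x) (at y within {x - \<bar>h\<bar>..x + \<bar>h\<bar>})" for y
        by (rule has_field_derivative_at_within) (auto intro!: derivative_eq_intros test_function_DERIV[OF \<theta>])
      show "norm (deriv \<theta> y - deriv \<theta> x) \<le> K * \<bar>h\<bar>" if "y \<in> {x - \<bar>h\<bar>..x + \<bar>h\<bar>}" for y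
      proof -
        have "K * \<bar>y - x\<bar> \<le> K * \<bar>h\<bar>" using that K(1) by (intro mult_left_mono) auto
        then show ?thesis using lip[of y] by simp
      qed
    qed auto
    then show ?thesis by (simp add: algebra_simps)
  qed
  define q where "q = (\<lambda>h x. (1 / h) * (\<theta> (x + (- h)) - \<theta> x) + deriv \<theta> x)"
  have qm: "q h \<in> borel_measurable lebesgue" for h
    unfolding q_def
    by (intro borel_measurable_add borel_measurable_times borel_measurable_diff borel_measurable_const
        test_function_measurable \<theta> \<theta>1 shift_test_function)
  have qb: "\<bar>q h x\<bar> \<le> (K * \<bar>h\<bar> * exp N) * exp (- \<bar>x\<bar>)" if h: "h \<noteq> 0" "\<bar>h\<bar> < 1" for h x
  proof (rule le_exp_weight)
    show "\<bar>x\<bar> > N \<Longrightarrow> q h x = 0" for x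
      unfolding q_def using N0(2)[of x] N0(2)[of "x + (- h)"] N1(2)[of x] N0(1) N1(1) h by (auto simp: N_def)
    show "\<bar>q h x\<bar> \<le> K * \<bar>h\<bar>" for x
    proof -
      have "q h x = (1 / h) * (\<theta> (x - h) - \<theta> x + h * deriv \<theta> x)" using h by (simp add: q_def field_simps)
      then have "\<bar>q h x\<bar> = (1 / \<bar>h\<bar>) * \<bar>\<theta> (x - h) - \<theta> x + h * deriv \<theta> x\<bar>" by (simp add: abs_mult)
      also have "\<dots> \<le> (1 / \<bar>h\<bar>) * (K * \<bar>h\<bar> * \<bar>h\<bar>)" by (intro mult_left_mono taylor) simp
      finally show ?thesis using h by simp
    qed
  qed
  have qeq: "(1 / h) *\<^sub>R (pairing \<theta> (translate h w) - pairing \<theta> w) + pairing (deriv \<theta>) w = pairing (q h) w" for h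
  proof -
    obtain C0 where C0: "\<And>x. \<bar>\<theta> x\<bar> \<le> C0 * exp (- \<bar>x\<bar>)" using test_function_le_exp_weight[OF \<theta>] by metis
    obtain C1 where C1: "\<And>x. \<bar>deriv \<theta> x\<bar> \<le> C1 * exp (- \<bar>x\<bar>)" using test_function_le_exp_weight[OF \<theta>1] by metis
    have \<theta>h: "(\<lambda>x. \<theta> (x + (- h))) \<in> test_functions" by (rule shift_test_function[OF \<theta>])
    obtain C2 where C2: "\<And>x. \<bar>\<theta> (x + (- h))\<bar> \<le> C2 * exp (- \<bar>x\<bar>)" using test_function_le_exp_weight[OF \<theta>h] by metis
    note i0 = pairing_integrable[OF test_function_measurable[OF \<theta>] C0, of w]
    note i1 = pairing_integrable[OF test_function_measurable[OF \<theta>1] C1, of w]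
    note i2 = pairing_integrable[OF test_function_measurable[OF \<theta>h] C2, of w]
    have "pairing (q h) w = (LINT x|lebesgue. (1 / h) *\<^sub>R (\<theta> (x + (- h)) *\<^sub>R rep_l2uls w x - \<theta> x *\<^sub>R rep_l2uls w x) + deriv \<theta> x *\<^sub>R rep_l2uls w x)"
      unfolding pairing_def q_def by (simp add: scaleR_add_left scaleR_diff_left scaleR_diff_right right_diff_distrib diff_divide_distrib)
    also have "\<dots> = (1 / h) *\<^sub>R (pairing (\<lambda>x. \<theta> (x + (- h))) w - pairing \<theta> w) + pairing (deriv \<theta>) w"
      unfolding pairing_def
      by (subst Bochner_Integration.integral_add[OF integrable_scaleR_right[OF Bochner_Integration.integrable_diff[OF i2 i0]] i1])
        (simp only: integral_scaleR_right Bochner_Integration.integral_diff[OF i2 i0])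
    finally show ?thesis by (simp add: pairing_translate[OF \<theta>])
  qed
  have "((\<lambda>h. (1 / h) *\<^sub>R (pairing \<theta> (translate h w) - pairing \<theta> w)) \<longlongrightarrow> - pairing (deriv \<theta>) w) (at 0)"
  proof (rule Lim_null[THEN iffD2], rule tendsto_norm_zero_iff[THEN iffD1], rule tendsto_sandwich[OF _ _ tendsto_const])
    have "norm (pairing (q h) w) \<le> 5 * (K * \<bar>h\<bar> * exp N) * norm w" if "h \<noteq> 0" "\<bar>h\<bar> < 1" for h
      by (rule norm_pairing_le[OF qm qb[OF that]])
    moreover have "\<forall>\<^sub>F h in at (0::real). \<bar>h\<bar> < 1" by (auto simp: eventually_at intro: exI[of _ 1])
    moreover have "\<forall>\<^sub>F h in at (0::real). h \<noteq> 0" by (simp add: eventually_at_filter)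
    ultimately have "\<forall>\<^sub>F h in at 0. norm (pairing (q h) w) \<le> 5 * (K * \<bar>h\<bar> * exp N) * norm w"
      by (auto elim: eventually_elim2)
    then show "\<forall>\<^sub>F h in at 0. norm ((1 / h) *\<^sub>R (pairing \<theta> (translate h w) - pairing \<theta> w) - - pairing (deriv \<theta>) w) \<le> 5 * (K * \<bar>h\<bar> * exp N) * norm w"
      by (simp add: qeq)
    have "((\<lambda>h. 5 * (K * \<bar>h\<bar> * exp N) * norm w) \<longlongrightarrow> 5 * (K * \<bar>0\<bar> * exp N) * norm w) (at 0)"
      by (intro tendsto_intros)
    then show "((\<lambda>h. 5 * (K * \<bar>h\<bar> * exp N) * norm w) \<longlongrightarrow> 0) (at 0)" by simp
  qed simp
  then show ?thesis
    unfolding has_vector_derivative_at_iff_tendsto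
    by (simp add: w_def translate_translate add.commute)
qed


section \<open>The fundamental lemma of the calculus of variations\<close>

text \<open>
  Intervals form an intersection-stable generator, so the integral vanishes on every Borel set, and, up
  to a null set, on the Lebesgue measurable set \<open>{x. 0 < h x}\<close>.
\<close>

lemma AE_nonpos_if_interval_integrals_zero:
  fixes h :: "real \<Rightarrow> real"
  assumes h: "integrable lebesgue h" and total: "(LINT x|lebesgue. h x) = 0"
    and zero: "\<And>a b. (LINT x:{a<..<b}|lebesgue. h x) = 0"
  shows "AE x in lebesgue. h x \<le> 0"
proof -
  define G :: "real set set" where "G = range (\<lambda>(a, b). {a<..<b})"
  have sG: "sets borel = sigma_sets UNIV G"
    using arg_cong[OF borel_eq_box[where 'a = real], of sets] by (simp add: G_def)
  have si: "set_integrable lebesgue A h" if "A \<in> sets lebesgue" for A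
    unfolding set_integrable_def by (rule integrable_mult_indicator[OF that h])
  have leb: "A \<in> sets lebesgue" if "A \<in> sigma_sets UNIV G" for A
    using that unfolding sG[symmetric] by simp
  have borel: "(LINT x:A|lebesgue. h x) = 0" if A: "A \<in> sigma_sets UNIV G" for A
  proof -
    have "Int_stable G"
    proof (rule Int_stableI)
      fix A B assume "A \<in> G" "B \<in> G"
      then obtain a b c d where "A = {a<..<b}" "B = {c<..<d}" by (auto simp: G_def)
      then have "A \<inter> B = {max a c<..<min b d}" by auto
      then show "A \<inter> B \<in> G" by (auto simp: G_def)
    qed
    moreover have "G \<subseteq> Pow UNIV" by simp
    ultimately show ?thesis using A
    proof (induction rule: sigma_sets_induct_disjoint)
      case (basic A)
      then show ?case using zero by (auto simp: G_def)
    next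
      case empty
      show ?case by (simp add: set_lebesgue_integral_def)
    next
      case (compl A)
      have "(LINT x:(UNIV - A) \<union> A|lebesgue. h x) = (LINT x:UNIV - A|lebesgue. h x) + (LINT x:A|lebesgue. h x)"
        by (rule set_integral_Un) (use leb[OF compl(1)] in \<open>auto intro!: si\<close>)
      then show ?case using compl(2) total by (simp add: Un_commute set_lebesgue_integral_def)
    next
      case (union A)
      have "(LINT x:(\<Union>i. A i)|lebesgue. h x) = (\<Sum>i. (LINT x:(A i)|lebesgue. h x))"
      proof (rule lebesgue_integral_countable_add)
        show "A i \<in> sets lebesgue" for i using union(2) by (intro leb) auto
        then show "set_integrable lebesgue (\<Union>i. A i) h" by (intro si) auto
        show "i \<noteq> j \<Longrightarrow> A i \<inter> A j = {}" for i j using union(1) by (auto simp: disjoint_family_on_def)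
      qed
      then show ?case using union(3) by simp
    qed
  qed
  define S where "S = {x. 0 < h x}"
  have hm: "h \<in> borel_measurable lebesgue" using h by (rule borel_measurable_integrable)
  have S: "S \<in> sets lebesgue"
    using borel_measurable_less[OF borel_measurable_const[of 0] hm] by (simp add: S_def)
  have ae: "AE x in lebesgue. (x \<in> main_part lborel S) = (x \<in> S)"
    unfolding AE_completion_iff by (rule AE_in_main_part[OF S])
  have mp: "main_part lborel S \<in> sigma_sets UNIV G"
    using main_part_sets[OF S] by (simp add: sG)
  have "(LINT x|lebesgue. indicat_real S x *\<^sub>R h x) = (LINT x|lebesgue. indicat_real (main_part lborel S) x *\<^sub>R h x)"
  proof (rule integral_cong_AE)
    show "AE x in lebesgue. indicat_real S x *\<^sub>R h x = indicat_real (main_part lborel S) x *\<^sub>R h x"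
      using ae by eventually_elim (simp add: indicator_def)
  qed (use si[OF S] si[OF leb[OF mp]] in \<open>auto simp: set_integrable_def\<close>)
  also have "\<dots> = 0" using borel[OF mp] by (simp add: set_lebesgue_integral_def)
  finally have "AE x in lebesgue. indicat_real S x *\<^sub>R h x = 0"
    using si[OF S] unfolding set_integrable_def
    by (subst (asm) integral_nonneg_eq_0_iff_AE) (auto simp: S_def indicator_def)
  then show ?thesis by eventually_elim (auto simp: S_def indicator_def split: if_splits)
qed

lemma AE_zero_if_interval_integrals_zero:
  fixes g :: "real \<Rightarrow> real"
  assumes int: "\<And>N. set_integrable lebesgue {- N<..<N} g"
    and zero: "\<And>a b. (LINT x:{a<..<b}|lebesgue. g x) = 0"
  shows "AE x in lebesgue. g x = 0"
proof -
  have "AE x in lebesgue. x \<in> {- real n<..<real n} \<longrightarrow> g x = 0" for n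
  proof -
    define h where "h = (\<lambda>x. indicat_real {- real n<..<real n} x *\<^sub>R g x)"
    have ih: "integrable lebesgue h" using int[of "real n"] by (simp add: set_integrable_def h_def)
    have total: "(LINT x|lebesgue. h x) = 0" using zero[of "- real n" "real n"] by (simp add: h_def set_lebesgue_integral_def)
    have iv: "(LINT x:{a<..<b}|lebesgue. h x) = 0" for a b
    proof -
      have "(LINT x:{a<..<b}|lebesgue. h x) = (LINT x:{max a (- real n)<..<min b (real n)}|lebesgue. g x)"
        unfolding set_lebesgue_integral_def h_def by (rule Bochner_Integration.integral_cong) (auto simp: indicator_def)
      then show ?thesis by (simp add: zero)
    qed
    have "AE x in lebesgue. h x \<le> 0" by (rule AE_nonpos_if_interval_integrals_zero[OF ih total iv])
    moreover have "AE x in lebesgue. - h x \<le> 0"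
      by (rule AE_nonpos_if_interval_integrals_zero) (use ih total iv in \<open>auto simp: set_lebesgue_integral_def\<close>)
    ultimately show ?thesis by eventually_elim (auto simp: h_def indicator_def split: if_splits)
  qed
  then have "AE x in lebesgue. \<forall>n::nat. x \<in> {- real n<..<real n} \<longrightarrow> g x = 0" by (subst AE_all_countable) auto
  then show ?thesis
  proof eventually_elim
    case (elim x)
    obtain n :: nat where "\<bar>x\<bar> < real n" using reals_Archimedean2 by blast
    then show ?case using elim by (auto simp: abs_less_iff)
  qed
qed

text \<open>The functions \<open>p (1 / x) exp (- 1 / x)\<close>, extended by \<open>0\<close>; they are closed under differentiation.\<close>

definition flat :: "real poly \<Rightarrow> real \<Rightarrow> real" where
  "flat p x = (if x > 0 then poly p (1 / x) * exp (- (1 / x)) else 0)"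

definition flat_deriv :: "real poly \<Rightarrow> real poly" where
  "flat_deriv p = [:0, 0, 1:] * (p - pderiv p)"

lemma poly_exp_minus_tendsto_0: "((\<lambda>t. poly p t * exp (- t)) \<longlongrightarrow> (0::real)) at_top"
proof -
  have "((\<lambda>t. \<Sum>i\<le>degree p. coeff p i * (t ^ i / exp t)) \<longlongrightarrow> (\<Sum>i\<le>degree p. coeff p i * 0)) at_top"
    by (intro tendsto_intros tendsto_power_div_exp_0)
  moreover have "(\<lambda>t. \<Sum>i\<le>degree p. coeff p i * (t ^ i / exp t)) = (\<lambda>t. poly p t * exp (- t))"
    by (simp add: fun_eq_iff poly_altdef sum_distrib_right exp_minus divide_inverse mult.assoc)
  ultimately show ?thesis by simp
qed

lemma flat_DERIV: "(flat p has_real_derivative flat (flat_deriv p) x) (at x)"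
proof -
  consider "x > 0" | "x < 0" | "x = 0" by linarith
  then show ?thesis
  proof cases
    case 1
    have "((\<lambda>x. poly p (1 / x) * exp (- (1 / x))) has_real_derivative flat (flat_deriv p) x) (at x)"
      using 1 by (auto intro!: derivative_eq_intros DERIV_chain2[of "poly p", OF poly_DERIV]
          simp: flat_def flat_deriv_def field_simps power2_eq_square)
    then show ?thesis
      by (rule has_field_derivative_transform_within_open[of _ _ _ "{0<..}"]) (use 1 in \<open>auto simp: flat_def\<close>)
  next
    case 2
    have "((\<lambda>_. 0) has_real_derivative flat (flat_deriv p) x) (at x)" using 2 by (simp add: flat_def)
    then show ?thesis
      by (rule has_field_derivative_transform_within_open[of _ _ _ "{..<0}"]) (use 2 in \<open>auto simp: flat_def\<close>)
  next
    case 3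
    have "((\<lambda>h. flat p h / h) \<longlongrightarrow> 0) (at_left 0)"
      by (rule tendsto_eventually) (auto simp: flat_def eventually_at_left_field intro!: exI[of _ "-1"])
    moreover have "((\<lambda>h. flat p h / h) \<longlongrightarrow> 0) (at_right 0)"
      unfolding filterlim_at_right_to_top
    proof (rule Lim_transform_eventually[OF poly_exp_minus_tendsto_0[of "[:0, 1:] * p"]])
      show "\<forall>\<^sub>F t in at_top. poly ([:0, 1:] * p) t * exp (- t) = flat p (inverse t) / inverse t"
        using eventually_gt_at_top[of 0]
        by eventually_elim (simp add: flat_def divide_inverse)
    qed
    ultimately have "((\<lambda>h. flat p h / h) \<longlongrightarrow> 0) (at 0)" by (rule filterlim_split_at)
    then show ?thesis using 3 by (simp add: DERIV_def flat_def)
  qed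
qed

text \<open>
  Products of flat functions of \<open>x - a\<close> and of \<open>b - x\<close>, with the sums that the product rule produces:
  a class of functions that is closed under differentiation and contains the bumps below.
\<close>

inductive_set bump_space :: "real \<Rightarrow> real \<Rightarrow> real \<Rightarrow> (real \<Rightarrow> real) set" for n a b where
  "(\<lambda>x. flat p (n * (x - a)) * flat q (n * (b - x))) \<in> bump_space n a b"
| "f \<in> bump_space n a b \<Longrightarrow> g \<in> bump_space n a b \<Longrightarrow> (\<lambda>x. f x + g x) \<in> bump_space n a b"

lemma bump_space_DERIV:
  assumes "f \<in> bump_space n a b"
  shows "\<exists>g\<in>bump_space n a b. \<forall>x. (f has_real_derivative g x) (at x)"
  using assms
proof induction
  case (1 p q)
  have smult: "flat (smult c p) x = c * flat p x" for c p x by (simp add: flat_def)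
  have d: "((\<lambda>x. flat p (n * (x - a)) * flat q (n * (b - x))) has_real_derivative
      flat (smult n (flat_deriv p)) (n * (x - a)) * flat q (n * (b - x))
      + flat p (n * (x - a)) * flat (smult (- n) (flat_deriv q)) (n * (b - x))) (at x)" for x
  proof -
    have "((\<lambda>x. flat p (n * (x - a))) has_real_derivative flat (flat_deriv p) (n * (x - a)) * n) (at x)"
      by (rule DERIV_chain2[OF flat_DERIV]) (auto intro!: derivative_eq_intros)
    moreover have "((\<lambda>x. flat q (n * (b - x))) has_real_derivative flat (flat_deriv q) (n * (b - x)) * (- n)) (at x)"
      by (rule DERIV_chain2[OF flat_DERIV]) (auto intro!: derivative_eq_intros)
    ultimately show ?thesis unfolding smult by (auto intro!: derivative_eq_intros)
  qed
  show ?case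
    by (rule bexI[OF _ bump_space.intros(2)[OF bump_space.intros(1) bump_space.intros(1)]]) (use d in blast)
next
  case (2 f g)
  then obtain f' g' where "f' \<in> bump_space n a b" "g' \<in> bump_space n a b"
    "\<And>x. (f has_real_derivative f' x) (at x)" "\<And>x. (g has_real_derivative g' x) (at x)" by blast
  then show ?case
    by (intro bexI[of _ "\<lambda>x. f' x + g' x"] bump_space.intros(2)) (auto intro!: derivative_eq_intros)
qed

definition bump :: "real \<Rightarrow> real \<Rightarrow> real \<Rightarrow> real \<Rightarrow> real" where
  "bump n a b x = flat 1 (n * (x - a)) * flat 1 (n * (b - x))"

lemma bump_test_function:
  assumes n: "n > 0"
  shows "bump n a b \<in> test_functions"
proof -
  have "(deriv ^^ k) (bump n a b) \<in> bump_space n a b" for k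
  proof (induction k)
    case 0
    show ?case using bump_space.intros(1)[of 1 n a 1 b] by (simp add: bump_def[abs_def])
  next
    case (Suc k)
    then obtain g where g: "g \<in> bump_space n a b" "\<And>x. ((deriv ^^ k) (bump n a b) has_real_derivative g x) (at x)"
      using bump_space_DERIV by blast
    then have "(deriv ^^ (Suc k)) (bump n a b) = g" using DERIV_imp_deriv by (auto simp: fun_eq_iff)
    then show ?case using g by simp
  qed
  then have "(deriv ^^ k) (bump n a b) differentiable (at x)" for k x
    using bump_space_DERIV[of "(deriv ^^ k) (bump n a b)"] real_differentiable_def by blast
  moreover have "{x. bump n a b x \<noteq> 0} \<subseteq> {a..b}"
    using n by (auto simp: bump_def flat_def zero_less_mult_iff split: if_splits)
  then have "bounded {x. bump n a b x \<noteq> 0}" by (rule bounded_subset[OF bounded_closed_interval])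
  then have "compact (closure {x. bump n a b x \<noteq> 0})"
    by (simp add: compact_eq_bounded_closed bounded_closure)
  ultimately show ?thesis by (simp add: test_functions_def)
qed

lemma bump_bounds:
  assumes n: "n > 0"
  shows "\<bar>x\<bar> > max \<bar>a\<bar> \<bar>b\<bar> \<Longrightarrow> bump n a b x = 0" "\<bar>bump n a b x\<bar> \<le> 1"
proof -
  assume "\<bar>x\<bar> > max \<bar>a\<bar> \<bar>b\<bar>"
  then have "x < a \<or> b < x" by auto
  then show "bump n a b x = 0" using n by (auto simp: bump_def flat_def zero_less_mult_iff)
next
  have "\<bar>flat 1 y\<bar> \<le> 1" for y by (simp add: flat_def)
  then show "\<bar>bump n a b x\<bar> \<le> 1" by (simp add: bump_def abs_mult mult_le_one)
qed

lemma bump_tendsto: "(\<lambda>n. bump (real (Suc n)) a b x) \<longlonglongrightarrow> indicat_real {a<..<b} x"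
proof -
  have f: "(\<lambda>n. flat 1 (real (Suc n) * y)) \<longlonglongrightarrow> (if y > 0 then 1 else 0)" for y :: real
  proof (cases "y > 0")
    case True
    have "(\<lambda>n. exp (- (inverse (real (Suc n)) * (1 / y)))) \<longlonglongrightarrow> exp (- (0 * (1 / y)))"
      by (intro tendsto_intros LIMSEQ_inverse_real_of_nat)
    moreover have "flat 1 (real (Suc n) * y) = exp (- (inverse (real (Suc n)) * (1 / y)))" for n
      using True by (simp add: flat_def zero_less_mult_iff divide_inverse del: of_nat_Suc)
    ultimately show ?thesis using True by simp
  next
    case False
    then have "flat 1 (real (Suc n) * y) = 0" for n
      by (simp add: flat_def zero_less_mult_iff del: of_nat_Suc)
    then show ?thesis using False by simp
  qed
  have "(\<lambda>n. bump (real (Suc n)) a b x) \<longlonglongrightarrow> (if x - a > 0 then 1 else 0) * (if b - x > 0 then 1 else 0)"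
    unfolding bump_def by (intro tendsto_mult f)
  then show ?thesis by (auto simp: indicator_def)
qed

text \<open>
  Steepening bumps converge boundedly to indicators of intervals, on which the integrals of \<open>r\<close>
  therefore vanish. Components along a countable dense set of vectors reduce the claim to real
  functions.
\<close>

lemma fundamental_lemma:
  fixes r :: "'y::{real_inner, banach, second_countable_topology} l2uls"
  assumes zero: "\<And>\<theta>. \<theta> \<in> test_functions \<Longrightarrow> pairing \<theta> r = 0"
  shows "r = 0"
proof -
  let ?r = "rep_l2uls r"
  have rm: "?r \<in> borel_measurable lebesgue" by (rule L2_loc_measurable[OF L2_ul_sD(2)[OF rep_l2uls_mem]])
  have int: "integrable lebesgue (\<lambda>x. indicat_real {a<..<b} x *\<^sub>R ?r x)" for a b
  proof (rule pairing_integrable[where C = "1 * exp (max \<bar>a\<bar> \<bar>b\<bar>)"])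
    show "indicat_real {a<..<b} \<in> borel_measurable lebesgue" by (rule borel_measurable_indicator) simp
    show "\<bar>indicat_real {a<..<b} x\<bar> \<le> (1 * exp (max \<bar>a\<bar> \<bar>b\<bar>)) * exp (- \<bar>x\<bar>)" for x
      by (rule le_exp_weight) (auto simp: indicator_def)
  qed
  have iv: "(LINT x|lebesgue. indicat_real {a<..<b} x *\<^sub>R ?r x) = 0" for a b
  proof -
    have "(\<lambda>n. LINT x|lebesgue. bump (real (Suc n)) a b x *\<^sub>R ?r x) \<longlonglongrightarrow> (LINT x|lebesgue. indicat_real {a<..<b} x *\<^sub>R ?r x)"
    proof (rule integral_dominated_convergence)
      show "(\<lambda>x. indicat_real {a<..<b} x *\<^sub>R ?r x) \<in> borel_measurable lebesgue"
        by (rule borel_measurable_integrable[OF int])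
      show "(\<lambda>x. bump (real (Suc n)) a b x *\<^sub>R ?r x) \<in> borel_measurable lebesgue" for n
        by (intro borel_measurable_scaleR rm test_function_measurable bump_test_function) simp
      show "integrable lebesgue (\<lambda>x. (1 * exp (max \<bar>a\<bar> \<bar>b\<bar>)) * (exp (- \<bar>x\<bar>) * norm (?r x)))"
        by (intro integrable_mult_right integrable_exp_weight_norm)
      show "AE x in lebesgue. (\<lambda>n. bump (real (Suc n)) a b x *\<^sub>R ?r x) \<longlonglongrightarrow> indicat_real {a<..<b} x *\<^sub>R ?r x"
        by (intro AE_I2 tendsto_scaleR bump_tendsto tendsto_const)
      show "AE x in lebesgue. norm (bump (real (Suc n)) a b x *\<^sub>R ?r x) \<le> (1 * exp (max \<bar>a\<bar> \<bar>b\<bar>)) * (exp (- \<bar>x\<bar>) * norm (?r x))" for n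
      proof (rule AE_I2)
        fix x
        have "\<bar>bump (real (Suc n)) a b x\<bar> \<le> (1 * exp (max \<bar>a\<bar> \<bar>b\<bar>)) * exp (- \<bar>x\<bar>)"
          by (rule le_exp_weight) (auto intro: bump_bounds simp del: of_nat_Suc)
        from mult_right_mono[OF this norm_ge_zero[of "?r x"]]
        show "norm (bump (real (Suc n)) a b x *\<^sub>R ?r x) \<le> (1 * exp (max \<bar>a\<bar> \<bar>b\<bar>)) * (exp (- \<bar>x\<bar>) * norm (?r x))"
          by (simp add: mult.assoc)
      qed
    qed
    moreover have "(LINT x|lebesgue. bump (real (Suc n)) a b x *\<^sub>R ?r x) = 0" for n
      using zero[OF bump_test_function, of "real (Suc n)" a b] by (simp add: pairing_def)
    ultimately show ?thesis using LIMSEQ_unique[OF _ tendsto_const] by simp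
  qed
  obtain Y :: "'y set" where Y: "countable Y" "\<And>X. open X \<Longrightarrow> X \<noteq> {} \<Longrightarrow> \<exists>d\<in>Y. d \<in> X"
    using countable_dense_exists by blast
  have "AE x in lebesgue. inner (?r x) y = 0" for y
  proof (rule AE_zero_if_interval_integrals_zero)
    have eq: "indicat_real {a<..<b} x *\<^sub>R inner (?r x) y = inner (indicat_real {a<..<b} x *\<^sub>R ?r x) y" for a b x by simp
    show "set_integrable lebesgue {- N<..<N} (\<lambda>x. inner (?r x) y)" for N
      unfolding set_integrable_def eq by (rule integrable_inner_left[OF int])
    show "(LINT x:{a<..<b}|lebesgue. inner (?r x) y) = 0" for a b
      unfolding set_lebesgue_integral_def eq using integral_inner_left[OF int, of a b y] iv[of a b] by simp
  qed
  then have "AE x in lebesgue. \<forall>y\<in>Y. inner (?r x) y = 0" using Y(1) by (simp add: AE_ball_countable)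
  moreover have "AE x in lebesgue. rep_l2uls (0 :: 'y l2uls) x = 0" by (rule rep_l2uls_zero)
  ultimately have "AE x in lebesgue. ?r x = rep_l2uls 0 x"
  proof eventually_elim
    case (elim x)
    have "?r x = 0"
    proof (rule ccontr)
      assume nz: "?r x \<noteq> 0"
      then have "open (ball (?r x) (norm (?r x)))" "ball (?r x) (norm (?r x)) \<noteq> {}" by auto
      then obtain d where d: "d \<in> Y" "d \<in> ball (?r x) (norm (?r x))" using Y(2) by blast
      have "(norm (?r x))\<^sup>2 = inner (?r x) (?r x - d)"
        using elim(1) d(1) by (simp add: inner_diff_right power2_norm_eq_inner)
      also have "\<dots> \<le> norm (?r x) * norm (?r x - d)" by (rule norm_cauchy_schwarz)
      also have "\<dots> < norm (?r x) * norm (?r x)" using d(2) nz by (simp add: dist_norm)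
      finally show False by (simp add: power2_eq_square)
    qed
    then show ?case using elim(2) by simp
  qed
  then show ?thesis by (simp add: l2uls_eq_iff)
qed

section \<open>Weak derivatives\<close>

lemma has_weak_derivative_pairing:
  "has_weak_derivative k u w \<longleftrightarrow> (\<forall>\<theta>\<in>test_functions. pairing ((deriv ^^ k) \<theta>) u = (- 1) ^ k *\<^sub>R pairing \<theta> w)"
  by (simp add: has_weak_derivative_def pairing_def)

lemma has_weak_derivative_unique:
  fixes w :: "'y::{real_inner, banach, second_countable_topology} l2uls"
  assumes "has_weak_derivative k u w" "has_weak_derivative k u w'"
  shows "w = w'"
proof -
  have "w - w' = 0"
  proof (rule fundamental_lemma)
    fix \<theta> assume \<theta>: "\<theta> \<in> test_functions"
    then have "(- 1) ^ k *\<^sub>R pairing \<theta> w = (- 1) ^ k *\<^sub>R pairing \<theta> w'"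
      using assms unfolding has_weak_derivative_pairing by metis
    then have "pairing \<theta> w = pairing \<theta> w'" by simp
    then show "pairing \<theta> (w - w') = 0"
      using linear_diff[OF bounded_linear.linear[OF bounded_linear_pairing_test[OF \<theta>]], of w w'] by simp
  qed
  then show ?thesis by simp
qed

lemma gen_imp_pairing_deriv:
  assumes "gen u v" "\<theta> \<in> test_functions"
  shows "pairing (deriv \<theta>) u = - pairing \<theta> v"
proof -
  have "((\<lambda>s. pairing \<theta> (translate s u)) has_vector_derivative pairing \<theta> v) (at 0)"
    using bounded_linear.has_vector_derivative[OF bounded_linear_pairing_test[OF assms(2)]] assms(1)
    unfolding gen_def by blast
  then have "pairing \<theta> v = - pairing (deriv \<theta>) (translate 0 u)"
    by (rule vector_derivative_unique_at[OF _ pairing_translate_has_vector_derivative[OF assms(2)]])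
  then show ?thesis by simp
qed

text \<open>
  Tested against \<open>\<theta>\<close>, the identity \<open>\<tau>\<^sub>b u - \<tau>\<^sub>a u = \<integral>\<^sub>a\<^sup>b \<tau>\<^sub>s v ds\<close> is the fundamental theorem of
  calculus for \<open>s \<mapsto> \<integral> \<theta> \<tau>\<^sub>s u\<close>, and test functions separate points.
\<close>

lemma pairing_deriv_imp_gen:
  fixes u v :: "'y::{real_inner, banach, second_countable_topology} l2uls"
  assumes weak: "\<And>\<theta>. \<theta> \<in> test_functions \<Longrightarrow> pairing (deriv \<theta>) u = - pairing \<theta> v"
  shows "gen u v"
proof -
  have weak_translate: "- pairing (deriv \<theta>) (translate s u) = pairing \<theta> (translate s v)" if \<theta>: "\<theta> \<in> test_functions" for \<theta> s
    using weak[OF shift_test_function(1)[OF \<theta>, of "- s"]]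
    unfolding pairing_translate[OF \<theta>] pairing_translate[OF deriv_test_function[OF \<theta>]] shift_test_function(2)[OF \<theta>]
    by simp
  note int = integrable_continuous_real[OF continuous_on_translate[of _ v]]
  have eq: "translate s u = translate (- 1) u + integral {- 1..s} (\<lambda>r. translate r v)" if "- 1 \<le> s" for s
  proof -
    have "translate s u - translate (- 1) u - integral {- 1..s} (\<lambda>r. translate r v) = 0"
    proof (rule fundamental_lemma)
      fix \<theta> assume \<theta>: "\<theta> \<in> test_functions"
      note bl = bounded_linear_pairing_test[OF \<theta>]
      have "((\<lambda>r. pairing \<theta> (translate r v)) has_integral (pairing \<theta> (translate s u) - pairing \<theta> (translate (- 1) u))) {- 1..s}"
      proof (rule fundamental_theorem_of_calculus[OF that])
        show "((\<lambda>s. pairing \<theta> (translate s u)) has_vector_derivative pairing \<theta> (translate r v)) (at r within {- 1..s})" for r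
          using pairing_translate_has_vector_derivative[OF \<theta>, of u r] unfolding weak_translate[OF \<theta>]
          by (rule has_vector_derivative_at_within)
      qed
      from integral_unique[OF this] integral_linear[OF int bl, of "- 1" s]
      show "pairing \<theta> (translate s u - translate (- 1) u - integral {- 1..s} (\<lambda>r. translate r v)) = 0"
        by (simp add: o_def linear_diff[OF bounded_linear.linear[OF bl]])
    qed
    then show ?thesis by (simp add: algebra_simps)
  qed
  have "((\<lambda>s. integral {- 1..s} (\<lambda>r. translate r v)) has_vector_derivative translate 0 v) (at 0 within {- 1..1})"
    by (rule integral_has_vector_derivative[OF continuous_on_translate]) simp
  then have "((\<lambda>s. integral {- 1..s} (\<lambda>r. translate r v)) has_vector_derivative v) (at 0)"
    by (simp add: at_within_Icc_at)
  then have "((\<lambda>s. translate (- 1) u + integral {- 1..s} (\<lambda>r. translate r v)) has_vector_derivative v) (at 0)"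
    by (auto intro!: derivative_eq_intros)
  then show ?thesis
    unfolding gen_def
  proof (rule has_vector_derivative_transform_within_open[of _ _ _ "{- 1<..}"])
    show "translate (- 1) u + integral {- 1..s} (\<lambda>r. translate r v) = translate s u" if "s \<in> {- 1<..}" for s
      by (rule eq[symmetric]) (use that in simp)
  qed simp_all
qed

lemma weak_derivative_1_iff_gen:
  fixes u v :: "'y::{real_inner, banach, second_countable_topology} l2uls"
  shows "has_weak_derivative 1 u v \<longleftrightarrow> gen u v"
proof -
  have "has_weak_derivative 1 u v \<longleftrightarrow> (\<forall>\<theta>\<in>test_functions. pairing (deriv \<theta>) u = - pairing \<theta> v)"
    by (simp add: has_weak_derivative_pairing)
  then show ?thesis using gen_imp_pairing_deriv pairing_deriv_imp_gen by blast
qed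

lemma weak_derivative_2_iff_gen:
  fixes u v w :: "'y::{real_inner, banach, second_countable_topology} l2uls"
  assumes uv: "gen u v"
  shows "has_weak_derivative 2 u w \<longleftrightarrow> gen v w"
proof -
  have "pairing ((deriv ^^ 2) \<theta>) u = - pairing (deriv \<theta>) v" if "\<theta> \<in> test_functions" for \<theta>
    using gen_imp_pairing_deriv[OF uv deriv_test_function[OF that]] by (simp add: numeral_2_eq_2)
  then have "has_weak_derivative 2 u w \<longleftrightarrow> (\<forall>\<theta>\<in>test_functions. pairing (deriv \<theta>) v = - pairing \<theta> w)"
    unfolding has_weak_derivative_pairing by (auto simp: minus_equation_iff)
  also have "\<dots> \<longleftrightarrow> gen v w" using gen_imp_pairing_deriv pairing_deriv_imp_gen by blast
  finally show ?thesis .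
qed

lemma H2_ul_s_iff:
  fixes u :: "'y::{real_inner, banach, second_countable_topology} l2uls"
  shows "u \<in> H2_ul_s \<longleftrightarrow> (\<exists>v w. gen u v \<and> gen v w)"
proof
  assume "u \<in> H2_ul_s"
  then have "\<exists>v. has_weak_derivative 1 u v" "\<exists>w. has_weak_derivative 2 u w" by (auto simp: H2_ul_s_def)
  then show "\<exists>v w. gen u v \<and> gen v w" using weak_derivative_1_iff_gen weak_derivative_2_iff_gen by blast
next
  assume "\<exists>v w. gen u v \<and> gen v w"
  then obtain v w where vw: "gen u v" "gen v w" by blast
  have "\<exists>w. has_weak_derivative k u w" if k: "k \<le> 2" for k
  proof -
    consider "k = 0" | "k = 1" | "k = 2" using k by linarith
    then show ?thesis
    proof cases
      case 1
      have "has_weak_derivative 0 u u" by (simp add: has_weak_derivative_pairing)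
      then show ?thesis using 1 by blast
    next
      case 2 then show ?thesis using weak_derivative_1_iff_gen vw by blast
    next
      case 3 then show ?thesis using weak_derivative_2_iff_gen vw by blast
    qed
  qed
  then show "u \<in> H2_ul_s" by (simp add: H2_ul_s_def)
qed

lemma weak_derivative_2_eq:
  fixes u :: "'y::{real_inner, banach, second_countable_topology} l2uls"
  assumes "gen u v" "gen v w"
  shows "weak_derivative 2 u = w"
  unfolding weak_derivative_def
  using weak_derivative_2_iff_gen[OF assms(1)] assms(2) has_weak_derivative_unique by blast

lemma gen_closed:
  fixes u v :: "'y::{real_inner, banach, second_countable_topology} l2uls"
  assumes g: "\<And>n. gen (U n) (V n)" and U: "U \<longlonglongrightarrow> u" and V: "V \<longlonglongrightarrow> v"
  shows "gen u v"
proof (rule pairing_deriv_imp_gen)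
  fix \<theta> assume \<theta>: "\<theta> \<in> test_functions"
  have "(\<lambda>n. pairing (deriv \<theta>) (U n)) \<longlonglongrightarrow> pairing (deriv \<theta>) u"
    by (rule bounded_linear.tendsto[OF bounded_linear_pairing_test[OF deriv_test_function[OF \<theta>]] U])
  moreover have "(\<lambda>n. pairing (deriv \<theta>) (U n)) \<longlonglongrightarrow> - pairing \<theta> v"
    unfolding gen_imp_pairing_deriv[OF g \<theta>]
    by (rule tendsto_minus[OF bounded_linear.tendsto[OF bounded_linear_pairing_test[OF \<theta>] V]])
  ultimately show "pairing (deriv \<theta>) u = - pairing \<theta> v" by (rule LIMSEQ_unique)
qed


section \<open>Pointwise action of an m-accretive operator\<close>

lemma lap_commuting:
  assumes S: "bounded_linear S" and comm: "\<And>h u. S (translate h u) = translate h (S u)"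
  shows "lap h (S u) = S (lap h u)"
  unfolding lap_def comm[symmetric]
  by (simp add: linear_add[OF bounded_linear.linear[OF S]] linear_diff[OF bounded_linear.linear[OF S]]
      linear_scale[OF bounded_linear.linear[OF S]])

lemma lap_linear:
  "lap h (u + v) = lap h u + lap h v" "lap h (u - v) = lap h u - lap h v" "lap h (c *\<^sub>R u) = c *\<^sub>R lap h u"
  by (simp_all add: lap_def translate_add translate_diff translate_scaleR algebra_simps)

lemma lap_translate: "lap h (translate s u) = translate s (lap h u)"
  by (rule lap_commuting[OF bounded_linear_translate]) (simp add: translate_translate add.commute)

context m_accretive
begin

lemma accretive_bound:
  assumes "0 < \<kappa>" "u \<in> D"
  shows "\<kappa> * norm u \<le> norm (B u + \<kappa> *\<^sub>R u)"
  by (rule accretive_norm_bound[OF accretive[OF assms(2)] assms(1)])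

definition Binv :: "real \<Rightarrow> 'y \<Rightarrow> 'y" where
  "Binv \<kappa> y = (SOME u. u \<in> D \<and> B u + \<kappa> *\<^sub>R u = y)"

lemma Binv:
  assumes "0 < \<kappa>"
  shows "Binv \<kappa> y \<in> D" "B (Binv \<kappa> y) + \<kappa> *\<^sub>R Binv \<kappa> y = y"
proof -
  have "\<exists>u. u \<in> D \<and> B u + \<kappa> *\<^sub>R u = y" using onto[OF assms, of y] by blast
  from someI_ex[OF this] show "Binv \<kappa> y \<in> D" "B (Binv \<kappa> y) + \<kappa> *\<^sub>R Binv \<kappa> y = y"
    unfolding Binv_def by blast+
qed

lemma Binv_eqI:
  assumes \<kappa>: "0 < \<kappa>" and u: "u \<in> D" "B u + \<kappa> *\<^sub>R u = y"
  shows "Binv \<kappa> y = u"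
proof -
  note L = linear_operatorD[OF lin]
  have "B (Binv \<kappa> y - u) + \<kappa> *\<^sub>R (Binv \<kappa> y - u) = (B (Binv \<kappa> y) + \<kappa> *\<^sub>R Binv \<kappa> y) - (B u + \<kappa> *\<^sub>R u)"
    using u(1) Binv(1)[OF \<kappa>, of y] by (simp add: L(8) algebra_simps)
  then have "\<kappa> * norm (Binv \<kappa> y - u) \<le> 0"
    using accretive_bound[OF \<kappa> L(7)[OF Binv(1)[OF \<kappa>] u(1)], of y] u(2) Binv(2)[OF \<kappa>, of y] by simp
  then show ?thesis using \<kappa> by (simp add: mult_le_0_iff)
qed

lemma norm_Binv_le: "0 < \<kappa> \<Longrightarrow> norm (Binv \<kappa> y) \<le> (1 / \<kappa>) * norm y"
  using accretive_bound[OF _ Binv(1), of \<kappa> \<kappa> y] Binv(2)[of \<kappa> y] by (simp add: field_simps)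

lemma bounded_linear_Binv:
  assumes \<kappa>: "0 < \<kappa>"
  shows "bounded_linear (Binv \<kappa>)"
proof (rule bounded_linear_intro[where K = "1 / \<kappa>"])
  note L = linear_operatorD[OF lin] and M = Binv[OF \<kappa>]
  show "Binv \<kappa> (x + y) = Binv \<kappa> x + Binv \<kappa> y" for x y
  proof (rule Binv_eqI[OF \<kappa> L(3)[OF M(1) M(1)]])
    have "B (Binv \<kappa> x + Binv \<kappa> y) + \<kappa> *\<^sub>R (Binv \<kappa> x + Binv \<kappa> y)
      = (B (Binv \<kappa> x) + \<kappa> *\<^sub>R Binv \<kappa> x) + (B (Binv \<kappa> y) + \<kappa> *\<^sub>R Binv \<kappa> y)"
      by (simp add: L(4)[OF M(1) M(1)] algebra_simps)
    then show "B (Binv \<kappa> x + Binv \<kappa> y) + \<kappa> *\<^sub>R (Binv \<kappa> x + Binv \<kappa> y) = x + y" by (simp only: M(2))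
  qed
  show "Binv \<kappa> (c *\<^sub>R x) = c *\<^sub>R Binv \<kappa> x" for c x
  proof (rule Binv_eqI[OF \<kappa> L(5)[OF M(1)]])
    have "B (c *\<^sub>R Binv \<kappa> x) + \<kappa> *\<^sub>R c *\<^sub>R Binv \<kappa> x = c *\<^sub>R (B (Binv \<kappa> x) + \<kappa> *\<^sub>R Binv \<kappa> x)"
      by (simp add: L(6)[OF M(1)] algebra_simps)
    then show "B (c *\<^sub>R Binv \<kappa> x) + \<kappa> *\<^sub>R c *\<^sub>R Binv \<kappa> x = c *\<^sub>R x" by (simp only: M(2))
  qed
  show "norm (Binv \<kappa> y) \<le> norm y * (1 / \<kappa>)" for y
    using norm_Binv_le[OF \<kappa>, of y] by (simp add: mult.commute)
qed

lemma norm_pointwise_Binv_le: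
  assumes \<kappa>: "0 < \<kappa>"
  shows "norm (pointwise (Binv \<kappa>) u) \<le> (1 / \<kappa>) * norm u"
proof -
  have "onorm (Binv \<kappa>) \<le> 1 / \<kappa>" using \<kappa> by (intro onorm_bound norm_Binv_le) auto
  then show ?thesis
    using norm_pointwise_le[OF bounded_linear_Binv[OF \<kappa>], of u] mult_right_mono[of "onorm (Binv \<kappa>)" "1 / \<kappa>" "norm u"] by simp
qed

text \<open>
  A relation on \<open>X\<close> rather than an operator, since \<open>B u\<close> need not be uniformly locally square integrable.
\<close>

definition acts :: "'y l2uls \<Rightarrow> 'y l2uls \<Rightarrow> bool" where
  "acts u g \<longleftrightarrow> (AE x in lebesgue. rep_l2uls u x \<in> D \<and> B (rep_l2uls u x) = rep_l2uls g x)"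

text \<open>
  Through the bounded operator \<open>(B + \<kappa>)\<^sup>-\<^sup>1\<close>, the relation \<open>acts\<close> inherits measurability, closedness
  and compatibility with translations.
\<close>

lemma acts_iff_Binv:
  assumes \<kappa>: "0 < \<kappa>"
  shows "acts u g \<longleftrightarrow> pointwise (Binv \<kappa>) (g + \<kappa> *\<^sub>R u) = u"
proof
  note P = rep_pointwise[OF bounded_linear_Binv[OF \<kappa>], of "g + \<kappa> *\<^sub>R u"] rep_l2uls_add[of g "\<kappa> *\<^sub>R u"] rep_l2uls_scaleR[of \<kappa> u]
  assume "acts u g"
  then show "pointwise (Binv \<kappa>) (g + \<kappa> *\<^sub>R u) = u"
    unfolding l2uls_eq_iff acts_def using P
    by eventually_elim (simp add: Binv_eqI[OF \<kappa>])
next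
  note P = rep_pointwise[OF bounded_linear_Binv[OF \<kappa>], of "g + \<kappa> *\<^sub>R u"] rep_l2uls_add[of g "\<kappa> *\<^sub>R u"] rep_l2uls_scaleR[of \<kappa> u]
  assume "pointwise (Binv \<kappa>) (g + \<kappa> *\<^sub>R u) = u"
  then have "AE x in lebesgue. rep_l2uls (pointwise (Binv \<kappa>) (g + \<kappa> *\<^sub>R u)) x = rep_l2uls u x" by simp
  then show "acts u g"
    unfolding acts_def using P
  proof eventually_elim
    case (elim x)
    then have eq: "rep_l2uls u x = Binv \<kappa> (rep_l2uls g x + \<kappa> *\<^sub>R rep_l2uls u x)" by simp
    have "rep_l2uls u x \<in> D" by (subst eq) (rule Binv(1)[OF \<kappa>])
    moreover have "B (rep_l2uls u x) + \<kappa> *\<^sub>R rep_l2uls u x = rep_l2uls g x + \<kappa> *\<^sub>R rep_l2uls u x"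
      using Binv(2)[OF \<kappa>, of "rep_l2uls g x + \<kappa> *\<^sub>R rep_l2uls u x"] unfolding eq[symmetric] .
    ultimately show ?case by simp
  qed
qed

lemma acts_linear:
  "acts u g \<Longrightarrow> acts u' g' \<Longrightarrow> acts (u + u') (g + g')"
  "acts u g \<Longrightarrow> acts u' g' \<Longrightarrow> acts (u - u') (g - g')"
  "acts u g \<Longrightarrow> acts (c *\<^sub>R u) (c *\<^sub>R g)"
proof -
  note bl = bounded_linear.linear[OF bounded_linear_pointwise[OF bounded_linear_Binv[OF zero_less_one]]]
  note iff = acts_iff_Binv[OF zero_less_one]
  show "acts (u + u') (g + g')" if "acts u g" "acts u' g'"
    using that linear_add[OF bl, of "g + 1 *\<^sub>R u" "g' + 1 *\<^sub>R u'"] unfolding iff by (simp add: algebra_simps)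
  show "acts (u - u') (g - g')" if "acts u g" "acts u' g'"
    using that linear_diff[OF bl, of "g + 1 *\<^sub>R u" "g' + 1 *\<^sub>R u'"] unfolding iff by (simp add: algebra_simps)
  show "acts (c *\<^sub>R u) (c *\<^sub>R g)" if "acts u g"
    using that linear_scale[OF bl, of c "g + 1 *\<^sub>R u"] unfolding iff by (simp add: algebra_simps)
qed

lemma acts_translate:
  assumes "acts u g" shows "acts (translate h u) (translate h g)"
proof -
  have "AE x in lebesgue. rep_l2uls u (x + h) \<in> D \<and> B (rep_l2uls u (x + h)) = rep_l2uls g (x + h)"
    using assms unfolding acts_def by (rule AE_shift_plus)
  then show ?thesis
    unfolding acts_def using rep_translate[of h u] rep_translate[of h g] by eventually_elim simp
qed

lemma acts_dquot: "acts u g \<Longrightarrow> acts (dquot h u) (dquot h g)"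
  unfolding dquot_def by (intro acts_linear acts_translate)

lemma acts_zero: "acts 0 0"
  unfolding acts_def using rep_l2uls_zero[where 'a = 'y]
  by eventually_elim (simp add: linear_operatorD(1,2)[OF lin])

lemma acts_closed:
  assumes a: "\<And>n. acts (U n) (G n)" and U: "U \<longlonglongrightarrow> u" and G: "G \<longlonglongrightarrow> g"
  shows "acts u g"
proof -
  have "(\<lambda>n. pointwise (Binv 1) (G n + 1 *\<^sub>R U n)) \<longlonglongrightarrow> pointwise (Binv 1) (g + 1 *\<^sub>R u)"
    by (intro bounded_linear.tendsto[OF bounded_linear_pointwise[OF bounded_linear_Binv[OF zero_less_one]]] tendsto_intros U G)
  then have "U \<longlonglongrightarrow> pointwise (Binv 1) (g + 1 *\<^sub>R u)"
    using a unfolding acts_iff_Binv[OF zero_less_one] by simp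
  then show ?thesis unfolding acts_iff_Binv[OF zero_less_one] using U LIMSEQ_unique by blast
qed

lemma acts_wform_nonneg:
  assumes "acts u g" shows "0 \<le> wform a g u"
proof (rule wform_nonnegI)
  show "AE x in lebesgue. 0 \<le> inner (rep_l2uls g x) (rep_l2uls u x)"
    using assms unfolding acts_def
  proof eventually_elim
    case (elim x)
    then show ?case using accretive[of "rep_l2uls u x"] by simp
  qed
qed

lemma mem_l2uls_domain_iff: "u \<in> l2uls_domain D B \<longleftrightarrow> (\<exists>g. acts u g)"
proof
  assume u: "u \<in> l2uls_domain D B"
  have "(\<lambda>x. snd (rep_l2uls u x, B (rep_l2uls u x))) \<in> L2_ul_s"
    by (rule L2_ul_s_bounded_linear[OF bounded_linear_snd]) (use u in \<open>simp add: l2uls_domain_def\<close>)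
  then have "AE x in lebesgue. rep_l2uls (abs_l2uls (\<lambda>x. B (rep_l2uls u x))) x = B (rep_l2uls u x)"
    by (intro rep_abs_l2uls) simp
  moreover have "AE x in lebesgue. rep_l2uls u x \<in> D" using u by (simp add: l2uls_domain_def)
  ultimately have "acts u (abs_l2uls (\<lambda>x. B (rep_l2uls u x)))"
    unfolding acts_def by eventually_elim simp
  then show "\<exists>g. acts u g" by blast
next
  assume "\<exists>g. acts u g"
  then obtain g where g: "acts u g" by blast
  have "(\<lambda>x. (rep_l2uls u x, 0) + (0, rep_l2uls g x)) \<in> L2_ul_s"
    by (rule L2_ul_s_add; rule L2_ul_s_bounded_linear[OF _ rep_l2uls_mem])
      (auto intro!: bounded_linear_Pair bounded_linear_ident bounded_linear_zero)
  moreover have "AE x in lebesgue. (rep_l2uls u x, 0) + (0, rep_l2uls g x) = (rep_l2uls u x, B (rep_l2uls u x))"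
    using g unfolding acts_def by eventually_elim simp
  ultimately have "(\<lambda>x. (rep_l2uls u x, B (rep_l2uls u x))) \<in> L2_ul_s" by (rule L2_ul_s_cong_AE)
  moreover have "AE x in lebesgue. rep_l2uls u x \<in> D" using g unfolding acts_def by eventually_elim simp
  ultimately show "u \<in> l2uls_domain D B" by (simp add: l2uls_domain_def)
qed

lemma abs_l2uls_acts:
  assumes "acts u g" shows "abs_l2uls (\<lambda>x. B (rep_l2uls u x)) = g"
proof (rule abs_l2uls_eqI)
  show ae: "AE x in lebesgue. B (rep_l2uls u x) = rep_l2uls g x"
    using assms unfolding acts_def by eventually_elim simp
  show "(\<lambda>x. B (rep_l2uls u x)) \<in> L2_ul_s"
    by (rule L2_ul_s_cong_AE[OF rep_l2uls_mem[of g]]) (use ae in eventually_elim, simp)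
qed

section \<open>The discretised equation\<close>

text \<open>
  \<open>- lap h + B + \<kappa>\<close> differs from the pointwise operator \<open>B + (\<kappa> + 2 / h\<^sup>2)\<close> by two translations of total
  size \<open>2 / h\<^sup>2\<close>, so its inverse is a Neumann series, whatever \<open>h\<close>.
\<close>

lemma discrete_fixed_point:
  assumes \<kappa>: "0 < \<kappa>" and h: "h \<noteq> 0"
  shows "acts u (f + lap h u - \<kappa> *\<^sub>R u) \<longleftrightarrow>
    pointwise (Binv (\<kappa> + 2 / h\<^sup>2)) (f + (1 / h\<^sup>2) *\<^sub>R (translate h u + translate (- h) u)) = u"
proof -
  have \<mu>: "0 < \<kappa> + 2 / h\<^sup>2" using \<kappa> by (simp add: add_pos_nonneg)
  have eq: "f + lap h u - \<kappa> *\<^sub>R u + (\<kappa> + 2 / h\<^sup>2) *\<^sub>R u = f + (1 / h\<^sup>2) *\<^sub>R (translate h u + translate (- h) u)"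
    by (simp add: lap_def scaleR_add_left scaleR_diff_right)
  show ?thesis unfolding acts_iff_Binv[OF \<mu>] eq ..
qed

text \<open>
  In the fixed point equation, the translations contribute at most \<open>2 / h\<^sup>2\<close> times the norm of \<open>u\<close>,
  the same amount by which the pointwise operator was shifted.
\<close>

lemma discrete_bound:
  assumes \<kappa>: "0 < \<kappa>" and h: "h \<noteq> 0" and u: "acts u (f + lap h u - \<kappa> *\<^sub>R u)"
  shows "\<kappa> * norm u \<le> norm f"
proof -
  have \<mu>: "0 < \<kappa> + 2 / h\<^sup>2" using \<kappa> by (simp add: add_pos_nonneg)
  have "norm u = norm (pointwise (Binv (\<kappa> + 2 / h\<^sup>2)) (f + (1 / h\<^sup>2) *\<^sub>R (translate h u + translate (- h) u)))"
    using u unfolding discrete_fixed_point[OF \<kappa> h] by simp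
  also have "\<dots> \<le> (1 / (\<kappa> + 2 / h\<^sup>2)) * norm (f + (1 / h\<^sup>2) *\<^sub>R (translate h u + translate (- h) u))"
    by (rule norm_pointwise_Binv_le[OF \<mu>])
  finally have "(\<kappa> + 2 / h\<^sup>2) * norm u \<le> norm (f + (1 / h\<^sup>2) *\<^sub>R (translate h u + translate (- h) u))"
    using \<mu> by (simp add: pos_le_divide_eq mult.commute)
  also have "\<dots> \<le> norm f + (1 / h\<^sup>2) * norm (translate h u + translate (- h) u)"
    by (rule order_trans[OF norm_triangle_ineq]) simp
  also have "\<dots> \<le> norm f + (1 / h\<^sup>2) * (norm u + norm u)"
    by (intro add_left_mono mult_left_mono order_trans[OF norm_triangle_ineq]) simp_all
  finally show ?thesis by (simp add: algebra_simps)
qed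

lemma discrete_exists:
  assumes \<kappa>: "0 < \<kappa>" and h: "h \<noteq> 0"
  shows "\<exists>u. acts u (f + lap h u - \<kappa> *\<^sub>R u)"
proof -
  have \<mu>: "0 < \<kappa> + 2 / h\<^sup>2" using \<kappa> by (simp add: add_pos_nonneg)
  define \<Phi> where "\<Phi> = (\<lambda>u. pointwise (Binv (\<kappa> + 2 / h\<^sup>2)) (f + (1 / h\<^sup>2) *\<^sub>R (translate h u + translate (- h) u)))"
  have "\<exists>!u. \<Phi> u = u"
  proof (rule banach_fix_type)
    show "0 \<le> (2 / h\<^sup>2) / (\<kappa> + 2 / h\<^sup>2)" using \<mu> by simp
    show "(2 / h\<^sup>2) / (\<kappa> + 2 / h\<^sup>2) < 1" unfolding divide_less_eq_1_pos[OF \<mu>] using \<kappa> by simp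
    show "\<forall>u v. dist (\<Phi> u) (\<Phi> v) \<le> (2 / h\<^sup>2) / (\<kappa> + 2 / h\<^sup>2) * dist u v"
    proof (intro allI)
      fix u v
      have "\<Phi> u - \<Phi> v = pointwise (Binv (\<kappa> + 2 / h\<^sup>2)) ((1 / h\<^sup>2) *\<^sub>R (translate h (u - v) + translate (- h) (u - v)))"
        unfolding \<Phi>_def linear_diff[OF bounded_linear.linear[OF bounded_linear_pointwise[OF bounded_linear_Binv[OF \<mu>]]], symmetric]
        by (simp add: translate_diff algebra_simps)
      also have "norm \<dots> \<le> (1 / (\<kappa> + 2 / h\<^sup>2)) * norm ((1 / h\<^sup>2) *\<^sub>R (translate h (u - v) + translate (- h) (u - v)))"
        by (rule norm_pointwise_Binv_le[OF \<mu>])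
      also have "\<dots> \<le> (1 / (\<kappa> + 2 / h\<^sup>2)) * ((1 / h\<^sup>2) * (norm (u - v) + norm (u - v)))"
        using \<mu> norm_triangle_ineq[of "translate h (u - v)" "translate (- h) (u - v)"]
        by (intro mult_left_mono) (simp_all add: mult_left_mono divide_right_mono)
      also have "\<dots> = (2 / h\<^sup>2) / (\<kappa> + 2 / h\<^sup>2) * norm (u - v)" by simp
      finally show "dist (\<Phi> u) (\<Phi> v) \<le> (2 / h\<^sup>2) / (\<kappa> + 2 / h\<^sup>2) * dist u v" by (simp add: dist_norm)
    qed
  qed
  then show ?thesis unfolding discrete_fixed_point[OF \<kappa> h] \<Phi>_def by blast
qed

lemma discrete_diff:
  assumes "acts u (f + lap h u - \<kappa> *\<^sub>R u)" "acts v (g + lap h v - \<kappa> *\<^sub>R v)"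
  shows "acts (u - v) ((f - g) + lap h (u - v) - \<kappa> *\<^sub>R (u - v))"
  using acts_linear(2)[OF assms] by (simp add: lap_linear algebra_simps)

definition discrete_solution :: "real \<Rightarrow> real \<Rightarrow> 'y l2uls \<Rightarrow> 'y l2uls" where
  "discrete_solution \<kappa> h f = (SOME u. acts u (f + lap h u - \<kappa> *\<^sub>R u))"

lemma discrete_solution:
  assumes "0 < \<kappa>" "h \<noteq> 0"
  shows "acts (discrete_solution \<kappa> h f) (f + lap h (discrete_solution \<kappa> h f) - \<kappa> *\<^sub>R discrete_solution \<kappa> h f)"
  unfolding discrete_solution_def by (rule someI_ex[OF discrete_exists[OF assms]])

lemma discrete_solution_eqI:
  assumes "0 < \<kappa>" "h \<noteq> 0" "acts u (f + lap h u - \<kappa> *\<^sub>R u)"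
  shows "discrete_solution \<kappa> h f = u"
proof -
  have "\<kappa> * norm (discrete_solution \<kappa> h f - u) \<le> norm (f - f)"
    by (rule discrete_bound[OF assms(1,2) discrete_diff[OF discrete_solution[OF assms(1,2)] assms(3)]])
  then show ?thesis using assms(1) by (simp add: mult_le_0_iff)
qed

lemma bounded_linear_discrete_solution:
  assumes \<kappa>: "0 < \<kappa>" and h: "h \<noteq> 0"
  shows "bounded_linear (discrete_solution \<kappa> h)"
proof (rule bounded_linear_intro[where K = "1 / \<kappa>"])
  note S = discrete_solution[OF \<kappa> h]
  show "discrete_solution \<kappa> h (f + g) = discrete_solution \<kappa> h f + discrete_solution \<kappa> h g" for f g
    using acts_linear(1)[OF S S, of f g] by (intro discrete_solution_eqI[OF \<kappa> h]) (simp add: lap_linear algebra_simps)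
  show "discrete_solution \<kappa> h (c *\<^sub>R f) = c *\<^sub>R discrete_solution \<kappa> h f" for c f
    using acts_linear(3)[OF S, of c f] by (intro discrete_solution_eqI[OF \<kappa> h]) (simp add: lap_linear algebra_simps)
  show "norm (discrete_solution \<kappa> h f) \<le> norm f * (1 / \<kappa>)" for f
    using discrete_bound[OF \<kappa> h S, of f] \<kappa> by (simp add: field_simps)
qed

lemma norm_discrete_solution_le:
  assumes "0 < \<kappa>" "h \<noteq> 0"
  shows "norm (discrete_solution \<kappa> h f) \<le> (1 / \<kappa>) * norm f"
  using discrete_bound[OF assms discrete_solution[OF assms], of f] assms(1) by (simp add: field_simps)

lemma discrete_solution_translate:
  assumes "0 < \<kappa>" "h \<noteq> 0"
  shows "discrete_solution \<kappa> h (translate s f) = translate s (discrete_solution \<kappa> h f)"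
  using acts_translate[OF discrete_solution[OF assms], of s f]
  by (intro discrete_solution_eqI[OF assms]) (simp add: lap_translate translate_add translate_diff translate_scaleR)

section \<open>Energy estimates\<close>

lemma wform_sum3_le: "wform a (x + y + z) (x + y + z) \<le> 3 * (wform a x x + wform a y y + wform a z z)"
proof -
  have "0 \<le> wform a (x - y) (x - y)" "0 \<le> wform a (y - z) (y - z)" "0 \<le> wform a (x - z) (x - z)"
    by (rule wform_self_nonneg)+
  then show ?thesis
    using wform_commute[of a x y] wform_commute[of a y z] wform_commute[of a x z] by (simp add: wform_simps)
qed

text \<open>
  Testing with \<open>u\<close> bounds \<open>u\<close> and its difference quotient; testing with \<open>- lap h u\<close>, where
  \<open>\<langle>B u, - lap h u\<rangle>\<close> is nonnegative up to a commutator, yields maximal regularity.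
\<close>

lemma discrete_energy:
  fixes h a :: real
  assumes h: "0 < h" "h \<le> 1" and u: "acts u g" and f: "f = - lap h u + g + 13 *\<^sub>R u"
  shows "wform (a - h) (dquot h u) (dquot h u) \<le> wform a f f" "wform a (lap h u) (lap h u) \<le> 93 * wform a f f"
proof -
  define N where "N = wform (a - h) (dquot h u) (dquot h u)"
  define U where "U = wform a u u"
  define Z where "Z = wform a (lap h u) (lap h u)"
  define G where "G = wform a f f"
  have N0: "0 \<le> N" and U0: "0 \<le> U" and Z0: "0 \<le> Z" and G0: "0 \<le> G"
    by (auto simp: N_def U_def Z_def G_def wform_self_nonneg)
  have h0: "h \<noteq> 0" using h by simp
  \<comment> \<open>the choice \<open>\<epsilon> = 1/4\<close> keeps half of \<open>N\<close>\<close>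
  have ul: "wform a u (- lap h u) \<ge> N - (2 * (1/4) * N + 3 / (2 * (1/4)) * U)"
    unfolding N_def U_def wform_lap[OF h0, of a u u]
    using abs_le_D2[OF wform_lap_commutator[OF h, of "1/4" a u u]] by linarith
  have "wform a f u = wform a u (- lap h u) + wform a g u + 13 * U"
    unfolding f U_def by (simp add: wform_simps wform_commute[of a u "lap h u"])
  then have "N / 2 + 7 * U \<le> wform a f u"
    using ul acts_wform_nonneg[OF u, of a] by simp
  also have "\<dots> \<le> (1/2) * G + U / (4 * (1/2))" unfolding G_def U_def by (rule wform_young) simp
  finally have 1: "N + 13 * U \<le> G" by simp
  then show "wform (a - h) (dquot h u) (dquot h u) \<le> wform a f f" using U0 by (simp add: N_def G_def)
  \<comment> \<open>with \<open>\<epsilon> = 18\<close> the coefficient of \<open>wform a g g\<close> is \<open>1/12\<close>, small enough to absorb its part \<open>3 Z\<close> into \<open>Z\<close>\<close>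
  have gl: "wform a g (- lap h u) \<ge> - (2 * 18 * N + 3 / (2 * 18) * wform a g g)"
    unfolding N_def wform_lap[OF h0, of a g u]
    using abs_le_D2[OF wform_lap_commutator[OF h, of 18 a g u]] acts_wform_nonneg[OF acts_dquot[OF u, of h], of "a - h"]
    by linarith
  have "wform a f (- lap h u) = Z + wform a g (- lap h u) + 13 * wform a u (- lap h u)"
    unfolding f Z_def by (simp add: wform_simps)
  moreover have "wform a f (- lap h u) \<le> 1 * G + Z / (4 * 1)"
    using wform_young[of 1 a f "- lap h u"] by (simp add: G_def Z_def wform_simps)
  moreover have "wform a g g \<le> 3 * (G + Z + 169 * U)"
  proof -
    have g: "g = f + lap h u + (- 13) *\<^sub>R u" by (simp add: f)
    show ?thesis
      using wform_sum3_le[of a f "lap h u" "(- 13) *\<^sub>R u"] unfolding g[symmetric]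
      by (simp add: wform_simps G_def Z_def U_def)
  qed
  moreover have "wform a g (- lap h u) \<ge> - (36 * N + wform a g g / 12)" using gl by simp
  moreover have "wform a u (- lap h u) \<ge> N / 2 - 6 * U" using ul by simp
  ultimately have "Z \<le> 93 * G" using 1 N0 U0 G0 by simp
  then show "wform a (lap h u) (lap h u) \<le> 93 * wform a f f" by (simp add: Z_def G_def)
qed

lemma discrete_maximal_regularity:
  assumes h: "0 < h" "h \<le> 1" and u: "acts u g" and f: "f = - lap h u + g + 13 *\<^sub>R u"
  shows "norm (dquot h u) \<le> 4 * norm f" "norm (lap h u) \<le> 34 * norm f"
proof -
  have "(norm (dquot h u))\<^sup>2 \<le> 3 * (4 * (norm f)\<^sup>2)"
  proof (rule norm_le_wform)
    show "wform a (dquot h u) (dquot h u) \<le> 4 * (norm f)\<^sup>2" for a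
      using discrete_energy(1)[OF h u f, of "a + h"] wform_self_le[of "a + h" f] by simp
  qed
  also have "\<dots> \<le> (4 * norm f)\<^sup>2" by (simp add: power_mult_distrib)
  finally show "norm (dquot h u) \<le> 4 * norm f" by (rule power2_le_imp_le) simp
  have "(norm (lap h u))\<^sup>2 \<le> 3 * (372 * (norm f)\<^sup>2)"
  proof (rule norm_le_wform)
    show "wform a (lap h u) (lap h u) \<le> 372 * (norm f)\<^sup>2" for a
      using discrete_energy(2)[OF h u f, of a] wform_self_le[of a f] by simp
  qed
  also have "\<dots> \<le> (34 * norm f)\<^sup>2" by (simp add: power_mult_distrib)
  finally show "norm (lap h u) \<le> 34 * norm f" by (rule power2_le_imp_le) simp
qed

section \<open>Solvability of the differential equation\<close>

text \<open>
  \<open>u\<close> solves \<open>- u'' + B u + 13 u = f\<close>, with \<open>v = u'\<close>, \<open>w = u''\<close> and \<open>g = B u\<close>. The shift \<open>13\<close> dominates the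
  terms of order zero that the commutator leaves in the energy estimates, and \<open>- 13\<close> lies in the sector
  with vertex \<open>- 12\<close>.
\<close>

definition solution :: "'y l2uls \<Rightarrow> 'y l2uls \<Rightarrow> 'y l2uls \<Rightarrow> 'y l2uls \<Rightarrow> 'y l2uls \<Rightarrow> bool" where
  "solution u v w g f \<longleftrightarrow> gen u v \<and> gen v w \<and> acts u g \<and> f = - w + g + 13 *\<^sub>R u"

lemma solution_diff:
  "solution u v w g f \<Longrightarrow> solution u' v' w' g' f' \<Longrightarrow> solution (u - u') (v - v') (w - w') (g - g') (f - f')"
  unfolding solution_def by (clarify, intro conjI gen_linear acts_linear) (simp_all add: algebra_simps)

text \<open>
  \<open>u\<close> also solves the discretised equation, with a right-hand side that tends to \<open>f\<close> as \<open>h \<rightarrow> 0\<close>.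
\<close>

lemma solution_bounds:
  assumes s: "solution u v w g f"
  shows "13 * norm u \<le> norm f" "norm v \<le> 4 * norm f" "norm w \<le> 34 * norm f"
proof -
  define F where "F = (\<lambda>h. - lap h u + g + 13 *\<^sub>R u)"
  have s': "gen u v" "gen v w" "acts u g" "f = - w + g + 13 *\<^sub>R u" using s by (auto simp: solution_def)
  note lap = lap_tendsto[OF s'(1,2)]
  have F: "((\<lambda>h. norm (F h)) \<longlongrightarrow> norm f) (at_right 0)"
    unfolding F_def s'(4) by (intro tendsto_intros lap)
  have ev: "\<forall>\<^sub>F h in at_right 0. 0 < h \<and> h \<le> (1::real)"
    by (auto simp: eventually_at_right_field intro!: exI[of _ 1])
  have dq: "((\<lambda>h. dquot h u) \<longlongrightarrow> v) (at_right 0)"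
    by (rule tendsto_mono[OF _ dquot_tendsto[OF s'(1)]]) (simp add: at_le)
  show "13 * norm u \<le> norm f"
  proof (rule tendsto_lowerbound[OF F])
    show "\<forall>\<^sub>F h in at_right 0. 13 * norm u \<le> norm (F h)"
      using ev
    proof eventually_elim
      case (elim h)
      have "acts u (F h + lap h u - 13 *\<^sub>R u)" using s'(3) by (simp add: F_def)
      then show ?case using elim by (intro discrete_bound[of 13 h]) auto
    qed
  qed simp
  show "norm v \<le> 4 * norm f"
  proof (rule tendsto_le[OF _ tendsto_mult_left[OF F] tendsto_norm[OF dq]])
    show "\<forall>\<^sub>F h in at_right 0. norm (dquot h u) \<le> 4 * norm (F h)"
      using ev by eventually_elim (rule discrete_maximal_regularity(1)[OF _ _ s'(3)], auto simp: F_def)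
  qed simp
  show "norm w \<le> 34 * norm f"
  proof (rule tendsto_le[OF _ tendsto_mult_left[OF F] tendsto_norm[OF lap]])
    show "\<forall>\<^sub>F h in at_right 0. norm (lap h u) \<le> 34 * norm (F h)"
      using ev by eventually_elim (rule discrete_maximal_regularity(2)[OF _ _ s'(3)], auto simp: F_def)
  qed simp
qed

lemma filterlim_inverse_Suc: "filterlim (\<lambda>n. inverse (real (Suc n))) (at_right 0) sequentially"
  unfolding filterlim_at using LIMSEQ_inverse_real_of_nat by auto

text \<open>
  The discrete resolvents converge on smooth data by the second resolvent identity, hence everywhere by
  density, as they are uniformly bounded; as the limit commutes with translations, it maps smooth data
  to smooth functions.
\<close>

lemma solution_exists_smooth:
  assumes f1: "gen f f1" and f2: "gen f1 f2"
  shows "\<exists>u v w g. solution u v w g f"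
proof -
  define h where "h = (\<lambda>n. inverse (real (Suc n)))"
  have h0: "h n \<noteq> 0" for n by (simp add: h_def)
  define R where "R = (\<lambda>n. discrete_solution 13 (h n))"
  have \<kappa>: "(0::real) < 13" by simp
  have R: "acts (R n q) (q + lap (h n) (R n q) - 13 *\<^sub>R R n q)" for n q
    unfolding R_def by (rule discrete_solution[OF \<kappa> h0])
  have blR: "bounded_linear (R n)" for n unfolding R_def by (rule bounded_linear_discrete_solution[OF \<kappa> h0])
  note linR = bounded_linear.linear[OF blR]
  have nR: "norm (R n q) \<le> (1/13) * norm q" for n q
    unfolding R_def by (rule norm_discrete_solution_le[OF \<kappa> h0])
  have Rt: "R n (translate s q) = translate s (R n q)" for n s q
    unfolding R_def by (rule discrete_solution_translate[OF \<kappa> h0])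
  have Rlap: "lap s (R n q) = R n (lap s q)" for n s q
    by (rule lap_commuting[OF blR Rt])
  \<comment> \<open>second resolvent identity; the resolvents commute with translations, hence with \<open>lap\<close>\<close>
  have identity: "norm (R m q - R n q) \<le> norm (lap (h m) q - lap (h n) q)" for m n q
  proof -
    define d where "d = lap (h n) (R n q) - lap (h m) (R n q)"
    have "acts (R n q) ((q + d) + lap (h m) (R n q) - 13 *\<^sub>R R n q)" using R[of n q] by (simp add: d_def)
    from discrete_bound[OF \<kappa> h0 discrete_diff[OF R[of m q] this]]
    have "13 * norm (R m q - R n q) \<le> norm d" by simp
    also have "d = R n (lap (h n) q - lap (h m) q)" unfolding d_def Rlap by (simp add: linear_diff[OF linR])
    also have "norm \<dots> \<le> (1/13) * norm (lap (h n) q - lap (h m) q)" by (rule nR)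
    finally show ?thesis
      using norm_ge_zero[of "R m q - R n q"] norm_minus_commute[of "lap (h n) q" "lap (h m) q"] by linarith
  qed
  have lap_seq: "(\<lambda>n. lap (h n) q) \<longlonglongrightarrow> q2" if "gen q q1" "gen q1 q2" for q q1 q2
    unfolding h_def by (rule filterlim_compose[OF lap_tendsto[OF that] filterlim_inverse_Suc])
  have conv: "convergent (\<lambda>n. R n q)" for q
  proof -
    have "Cauchy (\<lambda>n. R n q)"
    proof (rule metric_CauchyI)
      fix e :: real assume e: "e > 0"
      obtain p p1 p2 where p: "gen p p1" "gen p1 p2" "norm (p - q) < e" using smooth_dense[OF e] by blast
      have "Cauchy (\<lambda>n. lap (h n) p)" using LIMSEQ_imp_Cauchy[OF lap_seq[OF p(1,2)]] .
      then obtain M where M: "\<And>m n. m \<ge> M \<Longrightarrow> n \<ge> M \<Longrightarrow> dist (lap (h m) p) (lap (h n) p) < e / 2"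
        using e unfolding Cauchy_def by (meson half_gt_zero)
      have "dist (R m q) (R n q) < e" if "m \<ge> M" "n \<ge> M" for m n
      proof -
        have "R m q - R n q = R m (q - p) + (R m p - R n p) + R n (p - q)"
          by (simp add: linear_diff[OF linR])
        also have "norm \<dots> \<le> norm (R m (q - p)) + norm (R m p - R n p) + norm (R n (p - q))"
          by (intro norm_triangle_le add_mono norm_triangle_ineq order_refl)
        also have "\<dots> < e"
          using nR[of m "q - p"] nR[of n "p - q"] p(3) identity[of m p n] M[OF that] e
          by (simp add: dist_norm norm_minus_commute)
        finally show ?thesis by (simp add: dist_norm)
      qed
      then show "\<exists>M. \<forall>m\<ge>M. \<forall>n\<ge>M. dist (R m q) (R n q) < e" by blast
    qed
    then show ?thesis by (rule Cauchy_convergent)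
  qed
  define L where "L = (\<lambda>q. lim (\<lambda>n. R n q))"
  have L: "(\<lambda>n. R n q) \<longlonglongrightarrow> L q" for q using conv by (simp add: L_def convergent_LIMSEQ_iff)
  have blL: "bounded_linear L"
  proof (rule bounded_linear_intro[where K = "1/13"])
    show "L (p + q) = L p + L q" for p q
      using LIMSEQ_unique[OF L[of "p + q"]] tendsto_add[OF L[of p] L[of q]] by (simp add: linear_add[OF linR])
    show "L (c *\<^sub>R q) = c *\<^sub>R L q" for c q
      using LIMSEQ_unique[OF L[of "c *\<^sub>R q"]] tendsto_scaleR[OF tendsto_const L[of q], of c] by (simp add: linear_scale[OF linR])
    show "norm (L q) \<le> norm q * (1/13)" for q
      by (rule tendsto_upperbound[OF tendsto_norm[OF L[of q]]]) (use nR[of _ q] in \<open>simp_all add: mult.commute\<close>)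
  qed
  have Lt: "L (translate s q) = translate s (L q)" for s q
    using LIMSEQ_unique[OF L[of "translate s q"]] bounded_linear.tendsto[OF bounded_linear_translate L[of q], of s] by (simp add: Rt)
  have "(\<lambda>n. R n (lap (h n) f - f2)) \<longlonglongrightarrow> 0"
  proof (rule Lim_null_comparison)
    show "\<forall>\<^sub>F n in sequentially. norm (R n (lap (h n) f - f2)) \<le> norm (lap (h n) f - f2)"
    proof (intro always_eventually allI)
      show "norm (R n (lap (h n) f - f2)) \<le> norm (lap (h n) f - f2)" for n
        using nR[of n "lap (h n) f - f2"] norm_ge_zero[of "lap (h n) f - f2"] by linarith
    qed
    show "(\<lambda>n. norm (lap (h n) f - f2)) \<longlonglongrightarrow> 0"
      using lap_seq[OF f1 f2] by (intro tendsto_norm_zero LIM_zero)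
  qed
  from tendsto_add[OF this L[of f2]]
  have lapR: "(\<lambda>n. lap (h n) (R n f)) \<longlonglongrightarrow> L f2" by (simp add: Rlap linear_diff[OF linR])
  have "acts (L f) (f + L f2 - 13 *\<^sub>R L f)"
    by (rule acts_closed[OF R L]) (intro tendsto_intros lapR L)
  then have "solution (L f) (L f1) (L f2) (f + L f2 - 13 *\<^sub>R L f) f"
    unfolding solution_def by (auto intro: gen_commuting[OF blL Lt] f1 f2)
  then show ?thesis by blast
qed

text \<open>
  Along smooth approximations of \<open>f\<close>, maximal regularity makes \<open>u\<close>, \<open>u'\<close>, \<open>u''\<close> and \<open>B u\<close> Cauchy, and
  the relations between them are closed.
\<close>

lemma solution_exists: "\<exists>u v w g. solution u v w g f"
proof -
  have "\<exists>q q1 q2. gen q q1 \<and> gen q1 q2 \<and> norm (q - f) < inverse (real (Suc n))" for n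
    by (rule smooth_dense) simp
  then obtain q q1 q2 where q: "\<And>n. gen (q n) (q1 n)" "\<And>n. gen (q1 n) (q2 n)" "\<And>n. norm (q n - f) < inverse (real (Suc n))"
    by metis
  have qf: "q \<longlonglongrightarrow> f"
  proof (rule LIM_zero_cancel, rule Lim_null_comparison[OF _ LIMSEQ_inverse_real_of_nat])
    show "\<forall>\<^sub>F n in sequentially. norm (q n - f) \<le> inverse (real (Suc n))" using q(3) less_imp_le by (intro always_eventually) blast
  qed
  have "\<forall>n. \<exists>u v w g. solution u v w g (q n)" using solution_exists_smooth[OF q(1,2)] by blast
  then obtain u v w g where s: "\<And>n. solution (u n) (v n) (w n) (g n) (q n)" by metis
  have cauchy: "Cauchy x" if x: "\<And>m n. norm (x m - x n) \<le> 34 * norm (q m - q n)" for x :: "nat \<Rightarrow> 'y l2uls"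
  proof (rule metric_CauchyI)
    fix e :: real assume "e > 0"
    then obtain M where M: "\<And>m n. m \<ge> M \<Longrightarrow> n \<ge> M \<Longrightarrow> dist (q m) (q n) < e / 34"
      using LIMSEQ_imp_Cauchy[OF qf] unfolding Cauchy_def by (meson divide_pos_pos zero_less_numeral)
    have "dist (x m) (x n) < e" if "m \<ge> M" "n \<ge> M" for m n
      using M[OF that] x[of m n] by (simp add: dist_norm)
    then show "\<exists>M. \<forall>m\<ge>M. \<forall>n\<ge>M. dist (x m) (x n) < e" by blast
  qed
  note b = solution_bounds[OF solution_diff[OF s s]]
  have "norm (u m - u n) \<le> 34 * norm (q m - q n)" for m n
    using b(1)[of m n] norm_ge_zero[of "q m - q n"] by linarith
  from cauchy[OF this] obtain u' where u': "u \<longlonglongrightarrow> u'" by (auto simp: Cauchy_convergent_iff convergent_def)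
  have "norm (v m - v n) \<le> 34 * norm (q m - q n)" for m n
    using b(2)[of m n] norm_ge_zero[of "q m - q n"] by linarith
  from cauchy[OF this] obtain v' where v': "v \<longlonglongrightarrow> v'" by (auto simp: Cauchy_convergent_iff convergent_def)
  from cauchy[OF b(3)] obtain w' where w': "w \<longlonglongrightarrow> w'" by (auto simp: Cauchy_convergent_iff convergent_def)
  have g_eq: "g n = q n + w n - 13 *\<^sub>R u n" for n using s[of n] by (simp add: solution_def)
  have g': "g \<longlonglongrightarrow> f + w' - 13 *\<^sub>R u'" unfolding g_eq[abs_def] by (intro tendsto_intros qf w' u')
  have "gen u' v'" by (rule gen_closed[OF _ u' v']) (use s in \<open>simp add: solution_def\<close>)
  moreover have "gen v' w'" by (rule gen_closed[OF _ v' w']) (use s in \<open>simp add: solution_def\<close>)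
  moreover have "acts u' (f + w' - 13 *\<^sub>R u')" by (rule acts_closed[OF _ u' g']) (use s in \<open>simp add: solution_def\<close>)
  ultimately have "solution u' v' w' (f + w' - 13 *\<^sub>R u') f" by (simp add: solution_def)
  then show ?thesis by blast
qed

section \<open>The operator A\<close>

lemma mem_A_domain_iff: "u \<in> A_domain D B \<longleftrightarrow> (\<exists>v w g. gen u v \<and> gen v w \<and> acts u g)"
  by (auto simp: A_domain_def H2_ul_s_iff mem_l2uls_domain_iff)

lemma A_operator_eq: "gen u v \<Longrightarrow> gen v w \<Longrightarrow> acts u g \<Longrightarrow> A_operator B u = - w + g"
  by (simp add: A_operator_def weak_derivative_2_eq abs_l2uls_acts)

lemma A_solution:
  assumes "u \<in> A_domain D B"
  obtains v w g where "gen u v" "gen v w" "acts u g" "A_operator B u = - w + g"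
    "solution u v w g (A_operator B u + 13 *\<^sub>R u)"
proof -
  obtain v w g where *: "gen u v" "gen v w" "acts u g" using assms unfolding mem_A_domain_iff by blast
  then show ?thesis using A_operator_eq[OF *] by (intro that[OF *]) (auto simp: solution_def)
qed

lemma A_onto: "\<exists>u\<in>A_domain D B. A_operator B u + 13 *\<^sub>R u = f"
proof -
  obtain u v w g where s: "solution u v w g f" using solution_exists by blast
  then have "u \<in> A_domain D B" unfolding mem_A_domain_iff solution_def by blast
  moreover have "A_operator B u + 13 *\<^sub>R u = f" using s A_operator_eq[of u v w g] by (simp add: solution_def)
  ultimately show ?thesis by blast
qed

lemma A_linear: "linear_operator scaleR (A_domain D B) (A_operator B)"
  unfolding linear_operator_def
proof (intro conjI ballI allI)
  have "gen (0 :: 'y l2uls) 0" using gen_average[of 1 0] gen_linear(3)[OF gen_average[of 1 "0 :: 'y l2uls"], of 0] by simp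
  then show "0 \<in> A_domain D B" unfolding mem_A_domain_iff using acts_zero by blast
  fix u assume u: "u \<in> A_domain D B"
  obtain v w g where 1: "gen u v" "gen v w" "acts u g" "A_operator B u = - w + g" using A_solution[OF u] by blast
  show "c *\<^sub>R u \<in> A_domain D B" for c
    unfolding mem_A_domain_iff using 1 gen_linear(3) acts_linear(3) by blast
  show "A_operator B (c *\<^sub>R u) = c *\<^sub>R A_operator B u" for c
    using A_operator_eq[OF gen_linear(3)[OF 1(1)] gen_linear(3)[OF 1(2)] acts_linear(3)[OF 1(3)], of c] 1(4)
    by (simp add: scaleR_diff_right)
  fix u' assume u': "u' \<in> A_domain D B"
  obtain v' w' g' where 2: "gen u' v'" "gen v' w'" "acts u' g'" "A_operator B u' = - w' + g'" using A_solution[OF u'] by blast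
  show "u + u' \<in> A_domain D B"
    unfolding mem_A_domain_iff using 1 2 gen_linear(1) acts_linear(1) by blast
  show "A_operator B (u + u') = A_operator B u + A_operator B u'"
    using A_operator_eq[OF gen_linear(1)[OF 1(1) 2(1)] gen_linear(1)[OF 1(2) 2(2)] acts_linear(1)[OF 1(3) 2(3)]] 1(4) 2(4)
    by simp
qed

text \<open>
  \<open>A + 13\<close> is onto and bounded from below.
\<close>

lemma A_graph_closed: "closed (operator_graph (A_domain D B) (A_operator B))"
  unfolding closed_sequential_limits
proof (intro allI impI, elim conjE)
  fix x l assume x: "\<forall>n. x n \<in> operator_graph (A_domain D B) (A_operator B)" and xl: "x \<longlonglongrightarrow> l"
  note L = linear_operatorD[OF A_linear]
  have mem: "fst (x n) \<in> A_domain D B" "snd (x n) = A_operator B (fst (x n))" for n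
    using spec[OF x, of n] by (auto simp: operator_graph_def)
  have U: "(\<lambda>n. fst (x n)) \<longlonglongrightarrow> fst l" and V: "(\<lambda>n. A_operator B (fst (x n))) \<longlonglongrightarrow> snd l"
    using tendsto_fst[OF xl] tendsto_snd[OF xl] by (simp_all add: mem(2))
  obtain u where u: "u \<in> A_domain D B" "A_operator B u + 13 *\<^sub>R u = snd l + 13 *\<^sub>R fst l" using A_onto by blast
  have bd: "norm (fst (x n) - u) \<le> norm ((A_operator B (fst (x n)) + 13 *\<^sub>R fst (x n)) - (snd l + 13 *\<^sub>R fst l))" for n
  proof -
    have "fst (x n) - u \<in> A_domain D B" using L(7) mem(1) u(1) by blast
    then obtain v w g where "solution (fst (x n) - u) v w g (A_operator B (fst (x n) - u) + 13 *\<^sub>R (fst (x n) - u))"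
      using A_solution by metis
    from solution_bounds(1)[OF this]
    have "13 * norm (fst (x n) - u) \<le> norm ((A_operator B (fst (x n)) + 13 *\<^sub>R fst (x n)) - (snd l + 13 *\<^sub>R fst l))"
      unfolding u(2)[symmetric] by (simp add: L(8)[OF mem(1) u(1)] algebra_simps)
    then show ?thesis using norm_ge_zero[of "fst (x n) - u"] by linarith
  qed
  have "(\<lambda>n. (A_operator B (fst (x n)) + 13 *\<^sub>R fst (x n)) - (snd l + 13 *\<^sub>R fst l)) \<longlonglongrightarrow> (snd l + 13 *\<^sub>R fst l) - (snd l + 13 *\<^sub>R fst l)"
    by (intro tendsto_intros U V)
  then have "(\<lambda>n. norm ((A_operator B (fst (x n)) + 13 *\<^sub>R fst (x n)) - (snd l + 13 *\<^sub>R fst l))) \<longlonglongrightarrow> 0"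
    by (intro tendsto_norm_zero) simp
  then have "(\<lambda>n. fst (x n) - u) \<longlonglongrightarrow> 0"
    by (rule Lim_null_comparison[rotated]) (intro always_eventually allI bd)
  then have "(\<lambda>n. fst (x n)) \<longlonglongrightarrow> u" by (rule LIM_zero_cancel)
  then have eq: "u = fst l" using U LIMSEQ_unique by blast
  then have "A_operator B u = snd l" using u(2) by simp
  then show "l \<in> operator_graph (A_domain D B) (A_operator B)"
    unfolding operator_graph_def using u(1) eq by (intro image_eqI[of _ _ u]) (auto simp: prod_eq_iff)
qed

end


section \<open>Integrals of operator-valued functions over the real line\<close>

text \<open>
  An antiderivative of \<open>F\<close> on the open interval is Lipschitz continuous as \<open>F\<close> is bounded, so it extends to
  the endpoints and the fundamental theorem of calculus applies.
\<close>

lemma integrable_bounded_continuous_interior: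
  fixes F :: "real \<Rightarrow> 'e::banach"
  assumes ab: "a < b" and cont: "continuous_on {a<..<b} F" and bd: "\<And>x. a < x \<Longrightarrow> x < b \<Longrightarrow> norm (F x) \<le> C"
  shows "F integrable_on {a..b}"
proof -
  define m where "m = (a + b) / 2"
  have m: "a < m" "m < b" using ab by (auto simp: m_def)
  \<comment> \<open>one of the two integrals is over an empty interval or a point\<close>
  define G where "G = (\<lambda>s. integral {m..s} F - integral {s..m} F)"
  have deriv: "(G has_vector_derivative F x) (at x)" if x: "a < x" "x < b" for x
  proof -
    obtain c where c: "a < c" "c < x" "c < m" using dense[of a "min x m"] x m by auto
    obtain d where d: "x < d" "m < d" "d < b" using dense[of "max x m" b] x m by auto
    have cF: "continuous_on {c..d} F" by (rule continuous_on_subset[OF cont]) (use c d in auto)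
    have int: "F integrable_on {p..q}" if "c \<le> p" "q \<le> d" for p q
      by (rule integrable_continuous_real[OF continuous_on_subset[OF cF]]) (use that in auto)
    have G_eq: "G s = integral {c..s} F - integral {c..m} F" if s: "c < s" "s < d" for s
    proof (cases "m \<le> s")
      case True
      have "integral {s..m} F = 0" using True by (cases "m = s") auto
      moreover have "integral {c..m} F + integral {m..s} F = integral {c..s} F"
        by (rule Henstock_Kurzweil_Integration.integral_combine[OF _ _ int]) (use c True s in auto)
      ultimately show ?thesis by (simp add: G_def algebra_simps)
    next
      case False
      have "integral {m..s} F = 0" using False by auto
      moreover have "integral {c..s} F + integral {s..m} F = integral {c..m} F"
        by (rule Henstock_Kurzweil_Integration.integral_combine[OF _ _ int]) (use d False s in auto)
      ultimately show ?thesis by (simp add: G_def algebra_simps)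
    qed
    have "((\<lambda>s. integral {c..s} F) has_vector_derivative F x) (at x within {c..d})"
      by (rule integral_has_vector_derivative[OF cF]) (use c d in auto)
    then have "((\<lambda>s. integral {c..s} F) has_vector_derivative F x) (at x)"
      using c d by (simp add: at_within_Icc_at)
    then have "((\<lambda>s. integral {c..s} F - integral {c..m} F) has_vector_derivative F x) (at x)"
      by (auto intro!: derivative_eq_intros)
    then show ?thesis
      by (rule has_vector_derivative_transform_within_open[of _ _ _ "{c<..<d}"]) (use c d G_eq in auto)
  qed
  have C0: "0 \<le> C" using bd[OF m] norm_ge_zero order_trans by blast
  have "C-lipschitz_on {a<..<b} G"
  proof (rule lipschitz_onI[OF _ C0])
    fix x y assume xy: "x \<in> {a<..<b}" "y \<in> {a<..<b}"
    have "norm (G x - G y) \<le> C * norm (x - y)"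
    proof (rule differentiable_bound)
      show "convex {a<..<b}" by simp
      show "(G has_derivative (\<lambda>r. r *\<^sub>R F z)) (at z within {a<..<b})" if "z \<in> {a<..<b}" for z
        using has_vector_derivative_at_within[OF deriv] that by (auto simp: has_vector_derivative_def)
      show "onorm (\<lambda>r. r *\<^sub>R F z) \<le> C" if "z \<in> {a<..<b}" for z
      proof (rule onorm_bound)
        show "0 \<le> C" by (rule C0)
        show "norm (r *\<^sub>R F z) \<le> C * norm r" for r
          using mult_right_mono[OF bd[of z] abs_ge_zero[of r]] that by (simp add: mult.commute)
      qed
    qed (use xy in auto)
    then show "dist (G x) (G y) \<le> C * dist x y" by (simp add: dist_norm)
  qed
  then have "uniformly_continuous_on {a<..<b} G" by (rule lipschitz_on_uniformly_continuous)
  then obtain g where g: "uniformly_continuous_on (closure {a<..<b}) g" "\<And>x. x \<in> {a<..<b} \<Longrightarrow> G x = g x"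
    by (rule uniformly_continuous_on_extension_on_closure) blast
  have "(F has_integral (g b - g a)) {a..b}"
  proof (rule fundamental_theorem_of_calculus_interior)
    show "continuous_on {a..b} g"
      using uniformly_continuous_imp_continuous[OF g(1)] ab by simp
    show "(g has_vector_derivative F x) (at x)" if "x \<in> {a<..<b}" for x
      by (rule has_vector_derivative_transform_within_open[OF deriv, of x "{a<..<b}"]) (use that g(2) in auto)
  qed (use ab in simp)
  then show ?thesis by blast
qed

lemma integrable_bounded_continuous_off_finite:
  fixes F :: "real \<Rightarrow> 'e::banach"
  assumes "finite S" "continuous_on ({a<..<b} - S) F" "\<And>x. a < x \<Longrightarrow> x < b \<Longrightarrow> norm (F x) \<le> C"
  shows "F integrable_on {a..b}"
  using assms
proof (induction S arbitrary: a b)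
  case empty
  show ?case
  proof (cases "a < b")
    case True
    then show ?thesis using empty by (intro integrable_bounded_continuous_interior[of a b F C]) auto
  next
    case False
    then have "F integrable_on cbox a b" by (intro integrable_on_null) simp
    then show ?thesis by simp
  qed
next
  case (insert k S)
  show ?case
  proof (cases "a < k \<and> k < b")
    case True
    have 1: "F integrable_on {a..k}"
      by (rule insert.IH[OF continuous_on_subset[OF insert.prems(1)] insert.prems(2)]) (use True in auto)
    have 2: "F integrable_on {k..b}"
      by (rule insert.IH[OF continuous_on_subset[OF insert.prems(1)] insert.prems(2)]) (use True in auto)
    show ?thesis
      by (rule Henstock_Kurzweil_Integration.integrable_combine[OF _ _ 1 2]) (use True in auto)
  next
    case False
    then have "{a<..<b} - S = {a<..<b} - insert k S" by auto
    then show ?thesis using insert by metis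
  qed
qed

text \<open>
  Integrals over large intervals are Cauchy, as the tails are dominated by those of an exponential.
\<close>

lemma integrable_on_UNIV_exp_decay:
  fixes F :: "real \<Rightarrow> 'e::banach"
  assumes int: "\<And>a b. F integrable_on {a..b}" and \<delta>: "\<delta> > 0" and C: "C \<ge> 0"
    and decay: "\<And>s. \<bar>s\<bar> \<ge> R \<Longrightarrow> norm (F s) \<le> C * exp (- \<delta> * \<bar>s\<bar>)"
  shows "F integrable_on UNIV"
  unfolding integrable_alt[of F UNIV]
proof (intro conjI allI impI)
  show "(\<lambda>x. if x \<in> UNIV then F x else 0) integrable_on cbox a b" for a b using int by simp
  fix e :: real assume e: "e > 0"
  have right: "norm (integral {B..b} F) \<le> C / \<delta> * exp (- \<delta> * B)" if "B \<ge> R" "B \<ge> 0" "B \<le> b" for B b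
  proof -
    have I: "((\<lambda>s. C * exp (- \<delta> * s)) has_integral (- (C / \<delta>) * exp (- \<delta> * b)) - (- (C / \<delta>) * exp (- \<delta> * B))) {B..b}"
      by (rule fundamental_theorem_of_calculus[OF \<open>B \<le> b\<close>])
        (use \<delta> in \<open>auto intro!: derivative_eq_intros simp flip: has_real_derivative_iff_has_vector_derivative\<close>)
    have "norm (integral {B..b} F) \<le> integral {B..b} (\<lambda>s. C * exp (- \<delta> * s))"
    proof (rule integral_norm_bound_integral[OF int])
      show "norm (F s) \<le> C * exp (- \<delta> * s)" if "s \<in> {B..b}" for s
        using decay[of s] that \<open>B \<ge> R\<close> \<open>B \<ge> 0\<close> by simp
    qed (use I in blast)
    also have "\<dots> = (- (C / \<delta>) * exp (- \<delta> * b)) - (- (C / \<delta>) * exp (- \<delta> * B))" by (rule integral_unique[OF I])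
    also have "\<dots> \<le> C / \<delta> * exp (- \<delta> * B)" using C \<delta> by simp
    finally show ?thesis .
  qed
  have left: "norm (integral {a..- B} F) \<le> C / \<delta> * exp (- \<delta> * B)" if "B \<ge> R" "B \<ge> 0" "a \<le> - B" for B a
  proof -
    have I: "((\<lambda>s. C * exp (\<delta> * s)) has_integral ((C / \<delta>) * exp (\<delta> * (- B))) - ((C / \<delta>) * exp (\<delta> * a))) {a..- B}"
      by (rule fundamental_theorem_of_calculus[OF \<open>a \<le> - B\<close>])
        (use \<delta> in \<open>auto intro!: derivative_eq_intros simp flip: has_real_derivative_iff_has_vector_derivative\<close>)
    have "norm (integral {a..- B} F) \<le> integral {a..- B} (\<lambda>s. C * exp (\<delta> * s))"
    proof (rule integral_norm_bound_integral[OF int])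
      show "norm (F s) \<le> C * exp (\<delta> * s)" if "s \<in> {a..- B}" for s
        using decay[of s] that \<open>B \<ge> R\<close> \<open>B \<ge> 0\<close> by simp
    qed (use I in blast)
    also have "\<dots> = ((C / \<delta>) * exp (\<delta> * (- B))) - ((C / \<delta>) * exp (\<delta> * a))" by (rule integral_unique[OF I])
    also have "\<dots> \<le> C / \<delta> * exp (- \<delta> * B)" using C \<delta> by simp
    finally show ?thesis .
  qed
  have "((\<lambda>B. 4 * (C / \<delta> * exp (- (\<delta> * B)))) \<longlongrightarrow> 4 * (C / \<delta> * 0)) at_top"
    by (intro tendsto_mult tendsto_const filterlim_compose[OF exp_at_bot] filterlim_uminus_at_bot_at_top
        filterlim_compose[OF filterlim_uminus_at_bot_at_top] filterlim_tendsto_pos_mult_at_top[OF tendsto_const \<delta>] filterlim_ident)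
  then have "\<forall>\<^sub>F B in at_top. 4 * (C / \<delta> * exp (- (\<delta> * B))) < e"
    by (rule order_tendstoD) (use e in simp)
  then have "\<forall>\<^sub>F B in at_top. 4 * (C / \<delta> * exp (- (\<delta> * B))) < e \<and> B \<ge> R \<and> B \<ge> 1"
    by (intro eventually_conj eventually_ge_at_top)
  then obtain B where B: "4 * (C / \<delta> * exp (- (\<delta> * B))) < e" "B \<ge> R" "B \<ge> 1"
    using eventually_happens'[OF trivial_limit_at_top_linorder] by blast
  have near: "norm (integral {a..b} F - integral {- B..B} F) \<le> 2 * (C / \<delta> * exp (- \<delta> * B))" if "ball 0 B \<subseteq> cbox a b" for a b
  proof -
    have "closure {- B<..<B} \<subseteq> {a..b}"
      using that by (intro closure_minimal) (auto simp: subset_iff dist_real_def abs_less_iff)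
    then have ab: "a \<le> - B" "B \<le> b" using B(3) by auto
    have e1: "integral {a..- B} F + integral {- B..b} F = integral {a..b} F"
      by (rule Henstock_Kurzweil_Integration.integral_combine[OF _ _ int]) (use ab B in auto)
    have e2: "integral {- B..B} F + integral {B..b} F = integral {- B..b} F"
      by (rule Henstock_Kurzweil_Integration.integral_combine[OF _ _ int]) (use ab B in auto)
    have "integral {a..b} F - integral {- B..B} F = integral {a..- B} F + integral {B..b} F"
      unfolding e1[symmetric] e2[symmetric] by simp
    also have "norm \<dots> \<le> C / \<delta> * exp (- \<delta> * B) + C / \<delta> * exp (- \<delta> * B)"
      by (intro norm_triangle_le add_mono left right) (use ab B in auto)
    finally show ?thesis by simp
  qed
  show "\<exists>B>0. \<forall>a b c d. ball 0 B \<subseteq> cbox a b \<and> ball 0 B \<subseteq> cbox c d \<longrightarrow>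
      norm (integral (cbox a b) (\<lambda>x. if x \<in> UNIV then F x else 0) - integral (cbox c d) (\<lambda>x. if x \<in> UNIV then F x else 0)) < e"
  proof (intro exI[of _ B] conjI allI impI; (elim conjE)?)
    show "B > 0" using B by simp
    fix a b c d :: real assume "ball 0 B \<subseteq> cbox a b" "ball 0 B \<subseteq> cbox c d"
    from near[OF this(1)] near[OF this(2)]
    have "norm ((integral {a..b} F - integral {- B..B} F) - (integral {c..d} F - integral {- B..B} F)) \<le> 4 * (C / \<delta> * exp (- \<delta> * B))"
      using norm_triangle_ineq4[of "integral {a..b} F - integral {- B..B} F" "integral {c..d} F - integral {- B..B} F"] by linarith
    then show "norm (integral (cbox a b) (\<lambda>x. if x \<in> UNIV then F x else 0) - integral (cbox c d) (\<lambda>x. if x \<in> UNIV then F x else 0)) < e"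
      using B(1) by simp
  qed
qed

text \<open>Riemann sums stay in the subspace.\<close>

lemma has_integral_in_closed_subspace:
  fixes F :: "real \<Rightarrow> 'e::real_normed_vector"
  assumes I: "(F has_integral I) UNIV" and F: "\<And>s. F s \<in> S" and S: "subspace S" "closed S"
  shows "I \<in> S"
proof -
  have "\<exists>y\<in>S. dist y I < e" if e: "e > 0" for e
  proof -
    have e2: "e / 2 > 0" using e by simp
    have "\<not> (\<exists>a b. UNIV = cbox a (b::real))"
      using not_bounded_UNIV bounded_cbox by metis
    from has_integral_altD[OF I this e2]
    obtain B where "B > 0" and B: "\<And>a b. ball 0 B \<subseteq> cbox a b \<Longrightarrow>
       \<exists>z. ((\<lambda>x. if x \<in> UNIV then F x else 0) has_integral z) (cbox a b) \<and> norm (z - I) < e / 2" by blast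
    have "ball 0 B \<subseteq> cbox (- B) B" by (auto simp: dist_real_def)
    from B[OF this] obtain z where z: "(F has_integral z) (cbox (- B) B)" "norm (z - I) < e / 2" by auto
    obtain \<gamma> where g: "gauge \<gamma>" "\<And>P. P tagged_division_of cbox (- B) B \<Longrightarrow> \<gamma> fine P \<Longrightarrow>
        norm ((\<Sum>(x, k)\<in>P. measure lborel k *\<^sub>R F x) - z) < e / 2"
      using z(1)[unfolded has_integral, rule_format, OF e2] by metis
    obtain P where P: "P tagged_division_of cbox (- B) B" "\<gamma> fine P"
      by (rule fine_division_exists[OF g(1)])
    have "(\<Sum>(x, k)\<in>P. measure lborel k *\<^sub>R F x) \<in> S"
      by (rule subspace_sum[OF S(1)]) (auto intro: subspace_scale[OF S(1)] F)
    moreover have "norm ((\<Sum>(x, k)\<in>P. measure lborel k *\<^sub>R F x) - I) < e"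
      using norm_triangle_lt[of "(\<Sum>(x, k)\<in>P. measure lborel k *\<^sub>R F x) - z" "z - I" e] g(2)[OF P] z(2) by simp
    ultimately show ?thesis by (auto simp: dist_norm)
  qed
  then have "I \<in> closure S" by (simp add: closure_approachable)
  then show ?thesis using S(2) by simp
qed

lemma subspace_closure_normed:
  fixes S :: "'e::real_normed_vector set"
  assumes "subspace S" shows "subspace (closure S)"
proof (rule subspaceI)
  show "0 \<in> closure S" using subspace_0[OF assms] closure_subset by blast
  fix x y :: 'e and c :: real
  assume x: "x \<in> closure S"
  obtain f where f: "\<And>n. f n \<in> S" "f \<longlonglongrightarrow> x" using x by (auto simp: closure_sequential)
  show "c *\<^sub>R x \<in> closure S"
    unfolding closure_sequential
    by (rule exI[of _ "\<lambda>n. c *\<^sub>R f n"]) (use f in \<open>auto intro: subspace_scale[OF assms] tendsto_intros\<close>)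
  assume y: "y \<in> closure S"
  obtain g where g: "\<And>n. g n \<in> S" "g \<longlonglongrightarrow> y" using y by (auto simp: closure_sequential)
  show "x + y \<in> closure S"
    unfolding closure_sequential
    by (rule exI[of _ "\<lambda>n. f n + g n"]) (use f g in \<open>auto intro: subspace_add[OF assms] tendsto_intros\<close>)
qed

section \<open>The semigroup given by the contour integral\<close>

lemma norm_vector_derivative_le_lipschitz:
  assumes L: "L-lipschitz_on UNIV f" and d: "(f has_vector_derivative d) (at x)"
  shows "norm d \<le> L"
proof (rule tendsto_upperbound)
  show "((\<lambda>h. norm ((1 / h) *\<^sub>R (f (x + h) - f x))) \<longlongrightarrow> norm d) (at 0)"
    using d unfolding has_vector_derivative_at_iff_tendsto by (rule tendsto_norm)
  have "norm ((1 / h) *\<^sub>R (f (x + h) - f x)) \<le> L" if "h \<noteq> 0" for h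
    using lipschitz_onD[OF L, of "x + h" x] that by (simp add: dist_norm divide_simps mult.commute)
  then show "\<forall>\<^sub>F h in at 0. norm ((1 / h) *\<^sub>R (f (x + h) - f x)) \<le> L"
    by (simp add: eventually_at_filter)
qed simp

lemma scaleC_diff_right: "a *\<^sub>C (x - y) = a *\<^sub>C x - a *\<^sub>C y" for x y :: "'a::complex_vector"
  using scaleC_add_right[of a "x - y" y] by (simp add: algebra_simps)

lemma scaleC_diff_left: "(a - b) *\<^sub>C x = a *\<^sub>C x - b *\<^sub>C x" for x :: "'a::complex_vector"
  using scaleC_add_left[of "a - b" b x] by (simp add: algebra_simps)

lemma scaleC_minus_right: "a *\<^sub>C (- x) = - (a *\<^sub>C x)" for x :: "'a::complex_vector"
  using scaleC_diff_right[of a 0 x] scaleC_diff_right[of a 0 0] by simp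

lemma scaleC_minus_left: "(- a) *\<^sub>C x = - (a *\<^sub>C x)" for x :: "'a::complex_vector"
  using scaleC_diff_left[of 0 a x] scaleC_diff_left[of 0 0 x] by simp

lemma scaleC_Re_Im: "c *\<^sub>C x = Re c *\<^sub>R x + Im c *\<^sub>R (\<i> *\<^sub>C x)" for x :: "'a::complex_vector"
proof -
  have "c *\<^sub>C x = (of_real (Re c) + of_real (Im c) * \<i>) *\<^sub>C x" by (metis complex_eq mult.commute)
  then show ?thesis by (simp only: scaleC_add_left scaleC_of_real flip: scaleC_scaleC)
qed

lemma linear_operator_scaleC_imp_scaleR:
  fixes D :: "'a::complex_vector set"
  assumes "linear_operator scaleC D T" shows "linear_operator scaleR D T"
  using assms unfolding linear_operator_def scaleC_of_real[symmetric] by blast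

lemma resolvent_mem:
  assumes "z \<in> resolvent_set D T"
  shows "resolvent D T z v \<in> D" "z *\<^sub>C resolvent D T z v - T (resolvent D T z v) = v"
proof -
  have "v \<in> (\<lambda>u. z *\<^sub>C u - T u) ` D" using assms by (simp add: resolvent_set_def bij_betw_def)
  then show "resolvent D T z v \<in> D" "z *\<^sub>C resolvent D T z v - T (resolvent D T z v) = v"
    by (auto simp: resolvent_def intro: inv_into_into f_inv_into_f)
qed

lemma resolvent_eqI:
  assumes "z \<in> resolvent_set D T" "u \<in> D" "z *\<^sub>C u - T u = v"
  shows "resolvent D T z v = u"
proof -
  have "inj_on (\<lambda>u. z *\<^sub>C u - T u) D" using assms(1) by (simp add: resolvent_set_def bij_betw_def)
  from inv_into_f_f[OF this assms(2)] show ?thesis by (simp add: resolvent_def assms(3))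
qed

lemma resolvent_scaleC:
  assumes lin: "linear_operator scaleC D T" and z: "z \<in> resolvent_set D T"
  shows "resolvent D T z (c *\<^sub>C v) = c *\<^sub>C resolvent D T z v"
proof (rule resolvent_eqI[OF z])
  note R = resolvent_mem[OF z, of v]
  show "c *\<^sub>C resolvent D T z v \<in> D" using lin R by (auto simp: linear_operator_def)
  have "T (c *\<^sub>C resolvent D T z v) = c *\<^sub>C T (resolvent D T z v)"
    using lin R(1) by (simp add: linear_operator_def)
  moreover have "c *\<^sub>C v = c *\<^sub>C (z *\<^sub>C resolvent D T z v - T (resolvent D T z v))" by (simp only: R(2))
  ultimately show "z *\<^sub>C c *\<^sub>C resolvent D T z v - T (c *\<^sub>C resolvent D T z v) = c *\<^sub>C v"
    by (simp only: scaleC_diff_right scaleC_scaleC mult.commute)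
qed

lemma resolvent_bounded_linear: "z \<in> resolvent_set D T \<Longrightarrow> bounded_linear (resolvent D T z)"
  by (simp add: resolvent_set_def)

text \<open>
  The second resolvent identity \<open>R(w) - R(z) = (z - w) R(z) R(w)\<close> bounds the norm of \<open>R(w)\<close> for \<open>w\<close> near \<open>z\<close>
  by twice that of \<open>R(z)\<close>, and then it bounds the difference.
\<close>

lemma continuous_on_resolvent:
  fixes D :: "'x::complex_normed_vector set"
  assumes lin: "linear_operator scaleC D T"
  shows "continuous_on (resolvent_set D T) (\<lambda>z. Blinfun (resolvent D T z))"
proof -
  define R where "R = (\<lambda>z. Blinfun (resolvent D T z))"
  have R: "blinfun_apply (R z) v = resolvent D T z v" if "z \<in> resolvent_set D T" for z v
    using resolvent_bounded_linear[OF that] by (simp add: R_def bounded_linear_Blinfun_apply)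
  have id: "R w v - R z v = (z - w) *\<^sub>C R z (R w v)" if z: "z \<in> resolvent_set D T" and w: "w \<in> resolvent_set D T" for z w v
  proof -
    define x where "x = resolvent D T w v"
    have "resolvent D T z ((z - w) *\<^sub>C x + v) = x"
    proof (rule resolvent_eqI[OF z])
      show "x \<in> D" using resolvent_mem[OF w] by (simp add: x_def)
      show "z *\<^sub>C x - T x = (z - w) *\<^sub>C x + v"
        using resolvent_mem(2)[OF w, of v] by (simp add: x_def scaleC_diff_left algebra_simps)
    qed
    then show ?thesis
      using resolvent_bounded_linear[OF z] by (simp add: R z w x_def resolvent_scaleC[OF lin z]
          bounded_linear.linear linear_add algebra_simps)
  qed
  have diff: "norm (R w - R z) \<le> cmod (z - w) * norm (R z) * norm (R w)"
    if z: "z \<in> resolvent_set D T" and w: "w \<in> resolvent_set D T" for z w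
  proof (rule norm_blinfun_bound)
    fix v
    have "norm ((R w - R z) v) = cmod (z - w) * norm (R z (R w v))"
      using id[OF z w] by (simp add: blinfun.diff_left norm_scaleC)
    also have "\<dots> \<le> cmod (z - w) * (norm (R z) * (norm (R w) * norm v))"
      by (intro mult_left_mono order_trans[OF norm_blinfun] norm_blinfun) auto
    finally show "norm ((R w - R z) v) \<le> cmod (z - w) * norm (R z) * norm (R w) * norm v"
      by (simp add: mult.assoc)
  qed auto
  have "(R \<longlongrightarrow> R z) (at z within resolvent_set D T)" if z: "z \<in> resolvent_set D T" for z
  proof -
    have ev: "\<forall>\<^sub>F w in at z within resolvent_set D T. w \<in> resolvent_set D T \<and> cmod (z - w) * norm (R z) \<le> 1/2"
    proof (rule eventually_conj)
      show "\<forall>\<^sub>F w in at z within resolvent_set D T. w \<in> resolvent_set D T"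
        by (simp add: eventually_at_filter)
      have "((\<lambda>w. cmod (z - w) * norm (R z)) \<longlongrightarrow> cmod (z - z) * norm (R z)) (at z within resolvent_set D T)"
        by (intro tendsto_intros)
      then have "\<forall>\<^sub>F w in at z within resolvent_set D T. cmod (z - w) * norm (R z) < 1/2"
        by (rule order_tendstoD) simp
      then show "\<forall>\<^sub>F w in at z within resolvent_set D T. cmod (z - w) * norm (R z) \<le> 1/2"
        by eventually_elim simp
    qed
    have bd: "norm (R w - R z) \<le> cmod (z - w) * (2 * norm (R z) * norm (R z))"
      if w: "w \<in> resolvent_set D T" "cmod (z - w) * norm (R z) \<le> 1/2" for w
    proof -
      have "norm (R w) \<le> norm (R w - R z) + norm (R z)" using norm_triangle_ineq[of "R w - R z" "R z"] by simp
      also have "norm (R w - R z) \<le> (1/2) * norm (R w)"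
        using diff[OF z w(1)] mult_right_mono[OF w(2) norm_ge_zero[of "R w"]] by linarith
      finally have "norm (R w) \<le> 2 * norm (R z)" by simp
      then have "cmod (z - w) * norm (R z) * norm (R w) \<le> cmod (z - w) * norm (R z) * (2 * norm (R z))"
        by (intro mult_left_mono) auto
      then show ?thesis using diff[OF z w(1)] by (simp add: mult_ac)
    qed
    have "((\<lambda>w. norm (R w - R z)) \<longlongrightarrow> 0) (at z within resolvent_set D T)"
    proof (rule tendsto_sandwich[OF _ _ tendsto_const])
      show "\<forall>\<^sub>F w in at z within resolvent_set D T. norm (R w - R z) \<le> cmod (z - w) * (2 * norm (R z) * norm (R z))"
        using ev by eventually_elim (use bd in blast)
      have "((\<lambda>w. cmod (z - w) * (2 * norm (R z) * norm (R z))) \<longlongrightarrow> cmod (z - z) * (2 * norm (R z) * norm (R z))) (at z within resolvent_set D T)"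
        by (intro tendsto_intros)
      then show "((\<lambda>w. cmod (z - w) * (2 * norm (R z) * norm (R z))) \<longlongrightarrow> 0) (at z within resolvent_set D T)" by simp
    qed simp
    then show ?thesis unfolding tendsto_norm_zero_iff Lim_null[symmetric] .
  qed
  then show ?thesis by (simp add: continuous_on R_def)
qed

text \<open>
  After the reflection \<open>z \<mapsto> - z\<close>, the ray points asymptotically into the direction \<open>\<psi> \<plusminus> \<pi>\<close>, which makes with the
  positive axis an angle greater than \<open>\<phi>\<close>.
\<close>

lemma eventually_ray_in_sector:
  assumes \<phi>: "0 < \<phi>" "\<phi> < pi / 2" and \<psi>: "pi / 2 < \<bar>\<psi>\<bar>" "\<bar>\<psi>\<bar> < pi - \<phi>"
  shows "\<forall>\<^sub>F r in at_top. - (p + complex_of_real r * cis \<psi>) \<in> sector \<omega> \<phi>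
     \<and> 1 \<le> cmod (- (p + complex_of_real r * cis \<psi>) - complex_of_real \<omega>)"
proof -
  define \<zeta> where "\<zeta> = - cis \<psi>"
  define f where "f = (\<lambda>r::real. \<zeta> - (p + complex_of_real \<omega>) / complex_of_real r)"
  have lim: "(f \<longlongrightarrow> \<zeta>) at_top"
  proof -
    have "((\<lambda>r::real. complex_of_real (inverse r)) \<longlongrightarrow> complex_of_real 0) at_top"
      by (intro tendsto_of_real tendsto_inverse_0_at_top filterlim_ident)
    then have "((\<lambda>r::real. \<zeta> - (p + complex_of_real \<omega>) * complex_of_real (inverse r)) \<longlongrightarrow> \<zeta> - (p + complex_of_real \<omega>) * 0) at_top"
      by (intro tendsto_intros) simp
    then show ?thesis by (simp add: f_def divide_inverse)
  qed
  have cz: "cmod \<zeta> = 1" by (simp add: \<zeta>_def)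
  have arg: "\<phi> < \<bar>Arg \<zeta>\<bar>" and nr: "\<zeta> \<notin> \<real>\<^sub>\<le>\<^sub>0"
  proof -
    have s: "sin \<bar>\<psi>\<bar> > 0" by (rule sin_gt_zero) (use \<psi> \<phi> in linarith)+
    then have "sin \<psi> \<noteq> 0" by (cases "\<psi> \<ge> 0") auto
    then show "\<zeta> \<notin> \<real>\<^sub>\<le>\<^sub>0" by (auto simp: \<zeta>_def complex_nonpos_Reals_iff)
    show "\<phi> < \<bar>Arg \<zeta>\<bar>"
    proof (cases "\<psi> \<ge> 0")
      case True
      have "\<zeta> = cis (\<psi> - pi)" by (simp add: \<zeta>_def cis.ctr complex_eq_iff)
      then have "Arg \<zeta> = \<psi> - pi" using True \<psi> \<phi> by (simp add: Arg_cis)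
      then show ?thesis using True \<psi> by simp
    next
      case False
      have "\<zeta> = cis (\<psi> + pi)" by (simp add: \<zeta>_def cis.ctr complex_eq_iff)
      then have "Arg \<zeta> = \<psi> + pi" using False \<psi> \<phi> by (simp add: Arg_cis)
      then show ?thesis using False \<psi> by simp
    qed
  qed
  have "((\<lambda>r. \<bar>Arg (f r)\<bar>) \<longlongrightarrow> \<bar>Arg \<zeta>\<bar>) at_top"
    by (intro tendsto_rabs isCont_tendsto_compose[OF _ lim] continuous_at_Arg nr)
  then have 1: "\<forall>\<^sub>F r in at_top. \<phi> < \<bar>Arg (f r)\<bar>" by (rule order_tendstoD) (rule arg)
  have 2: "\<forall>\<^sub>F r in at_top. 1/2 < cmod (f r)"
    by (rule order_tendstoD[OF tendsto_norm[OF lim]]) (simp add: cz)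
  show ?thesis
    using 1 2 eventually_ge_at_top[of "2::real"]
  proof eventually_elim
    case (elim r)
    have eq: "- (p + complex_of_real r * cis \<psi>) - complex_of_real \<omega> = complex_of_real r * f r"
      using elim by (simp add: f_def \<zeta>_def field_simps)
    have "1 = 2 * (1/2::real)" by simp
    also have "\<dots> \<le> r * cmod (f r)" using elim by (intro mult_mono) auto
    finally have c: "1 \<le> cmod (- (p + complex_of_real r * cis \<psi>) - complex_of_real \<omega>)"
      unfolding eq using elim by (simp add: norm_mult)
    have "Arg (complex_of_real r * f r) = Arg (f r)" using elim by (simp add: Arg_times_of_real)
    then have "\<phi> \<le> \<bar>Arg (- (p + complex_of_real r * cis \<psi>) - complex_of_real \<omega>)\<bar>" unfolding eq using elim by simp
    moreover have "\<bar>Arg (- (p + complex_of_real r * cis \<psi>) - complex_of_real \<omega>)\<bar> \<le> pi"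
      using Arg_bounded by (simp add: abs_le_iff) (meson Arg_le_pi less_imp_le mpi_less_Arg neg_le_iff_le minus_le_iff)
    moreover have "- (p + complex_of_real r * cis \<psi>) \<noteq> complex_of_real \<omega>" using c by auto
    ultimately show ?case using c by (simp add: sector_def)
  qed
qed

lemma resolvent_uminus_eq:
  assumes z: "- z \<in> resolvent_set D A"
  shows "resolvent D (\<lambda>u. - A u) z v = resolvent D A (- z) (- v)"
proof (rule resolvent_eqI[OF resolvent_set_uminus[OF z]])
  note R = resolvent_mem[OF z, of "- v"]
  show "resolvent D A (- z) (- v) \<in> D" by (rule R)
  have "- ((- z) *\<^sub>C resolvent D A (- z) (- v) - A (resolvent D A (- z) (- v))) = v" using R(2) by simp
  then show "z *\<^sub>C resolvent D A (- z) (- v) - - A (resolvent D A (- z) (- v)) = v"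
    by (simp add: scaleC_minus_left add.commute)
qed

text \<open>
  The resolvent depends continuously on its argument in operator norm, so the integrand is continuous
  off the corners of the contour; it is bounded on bounded intervals, and along the rays it decays
  exponentially because of \<open>cos \<psi> < 0\<close>, the resolvent being bounded there.
\<close>

lemma semigroup_integrand_integrable:
  fixes D :: "'x::{complex_normed_vector, banach} set"
  assumes lin: "linear_operator scaleC D A" and sec: "sectorial_estimates D A \<omega> \<phi> M"
    and con: "semigroup_contour D A \<omega> \<phi> \<gamma>" and t: "t > 0"
  shows "semigroup_integrand D A \<gamma> t integrable_on UNIV"
proof -
  define T where "T = (\<lambda>u. - A u)"
  have linT: "linear_operator scaleC D T"
    using lin by (simp add: linear_operator_def T_def scaleC_minus_right)
  have \<phi>: "0 < \<phi>" "\<phi> < pi / 2" and M: "0 < M" and secsub: "sector \<omega> \<phi> \<subseteq> resolvent_set D A"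
    and est: "\<And>z. z \<in> sector \<omega> \<phi> \<Longrightarrow> onorm (resolvent D A z) \<le> M / cmod (z - complex_of_real \<omega>)"
    using sec by (auto simp: sectorial_estimates_def)
  obtain L \<psi> p q s0 where pc: "\<gamma> piecewise_C1_differentiable_on UNIV" and L: "L-lipschitz_on UNIV \<gamma>"
    and ran: "range \<gamma> \<subseteq> resolvent_set D T"
    and \<psi>0: "\<psi> \<in> {pi / 2<..<pi - \<phi>}"
    and ray1: "\<And>s. s \<ge> s0 \<Longrightarrow> \<gamma> s = p + complex_of_real s * cis \<psi>"
    and ray2: "\<And>s. s \<le> - s0 \<Longrightarrow> \<gamma> s = q + complex_of_real (- s) * cis (- \<psi>)"
    using con unfolding semigroup_contour_def T_def by blast
  have \<psi>: "pi / 2 < \<psi>" "\<psi> < pi - \<phi>" using \<psi>0 by auto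
  obtain S where S: "finite S" "\<gamma> C1_differentiable_on (UNIV - S)" and c\<gamma>: "continuous_on UNIV \<gamma>"
    using pc unfolding piecewise_C1_differentiable_on_def by blast
  obtain d where d: "\<And>x. x \<in> UNIV - S \<Longrightarrow> (\<gamma> has_vector_derivative d x) (at x)" and cd: "continuous_on (UNIV - S) d"
    using S(2) unfolding C1_differentiable_on_def by blast
  have vd: "vector_derivative \<gamma> (at x) = d x" if "x \<in> UNIV - S" for x
    using vector_derivative_at[OF d[OF that]] .
  have cvd: "continuous_on (UNIV - S) (\<lambda>x. vector_derivative \<gamma> (at x))"
    using cd by (subst continuous_on_cong[OF refl vd]) auto
  have L0: "0 \<le> L" using L lipschitz_on_nonneg by blast
  obtain L' where L': "L' \<ge> 0" "\<And>x. norm (vector_derivative \<gamma> (at x)) \<le> L'"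
  proof
    \<comment> \<open>at the corners \<open>vector_derivative\<close> has arbitrary values, finitely many\<close>
    let ?L = "L + (\<Sum>x\<in>S. norm (vector_derivative \<gamma> (at x)))"
    show "?L \<ge> 0" using L0 by (simp add: sum_nonneg)
    show "norm (vector_derivative \<gamma> (at x)) \<le> ?L" for x
    proof (cases "x \<in> S")
      case True
      then show ?thesis using member_le_sum[of x S "\<lambda>x. norm (vector_derivative \<gamma> (at x))"] S(1) L0 by simp
    next
      case False
      then have "norm (vector_derivative \<gamma> (at x)) \<le> L"
        using norm_vector_derivative_le_lipschitz[OF L d, of x] vd[of x] by simp
      then show ?thesis using sum_nonneg[of S "\<lambda>x. norm (vector_derivative \<gamma> (at x))"] by simp
    qed
  qed
  define R where "R = (\<lambda>s. Blinfun (resolvent D T (\<gamma> s)))"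
  have R: "blinfun_apply (R s) v = resolvent D T (\<gamma> s) v" for s v
    by (simp add: R_def bounded_linear_Blinfun_apply[OF resolvent_bounded_linear[OF subsetD[OF ran rangeI]]])
  have cR: "continuous_on UNIV R"
    unfolding R_def by (rule continuous_on_compose2[OF continuous_on_resolvent[OF linT] c\<gamma> ran])
  define c where "c = (\<lambda>s. exp (\<gamma> s * complex_of_real t) * vector_derivative \<gamma> (at s) / (2 * \<i> * complex_of_real pi))"
  have cc: "continuous_on (UNIV - S) c"
    unfolding c_def by (intro continuous_intros cvd continuous_on_subset[OF c\<gamma>]) auto
  define J :: "'x \<Rightarrow>\<^sub>L 'x" where "J = Blinfun (scaleC \<i>)"
  have J: "blinfun_apply J v = \<i> *\<^sub>C v" for v
    by (simp add: J_def bounded_linear_Blinfun_apply bounded_linear_scaleC)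
  define F where "F = semigroup_integrand D A \<gamma> t"
  have F_eq: "F s = Re (c s) *\<^sub>R R s + Im (c s) *\<^sub>R (J o\<^sub>L R s)" for s
  proof -
    have "(\<lambda>u. c s *\<^sub>C resolvent D T (\<gamma> s) u) = blinfun_apply (Re (c s) *\<^sub>R R s + Im (c s) *\<^sub>R (J o\<^sub>L R s))"
    proof
      show "c s *\<^sub>C resolvent D T (\<gamma> s) u = blinfun_apply (Re (c s) *\<^sub>R R s + Im (c s) *\<^sub>R (J o\<^sub>L R s)) u" for u
        by (simp add: blinfun.add_left blinfun.scaleR_left R J scaleC_Re_Im[of "c s"])
    qed
    then show ?thesis
      unfolding F_def semigroup_integrand_def c_def T_def by (metis blinfun_apply_inverse)
  qed
  have Fapply: "F s v = c s *\<^sub>C resolvent D T (\<gamma> s) v" for s v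
    unfolding F_eq by (simp add: blinfun.add_left blinfun.scaleR_left R J scaleC_Re_Im[of "c s"])
  have cF: "continuous_on (UNIV - S) F"
  proof -
    have "continuous_on (UNIV - S) R" by (rule continuous_on_subset[OF cR]) simp
    then have "continuous_on (UNIV - S) (\<lambda>s. Re (c s) *\<^sub>R R s + Im (c s) *\<^sub>R (J o\<^sub>L R s))"
      by (intro continuous_intros cc bounded_bilinear.continuous_on[OF bounded_bilinear_blinfun_compose])
    then show ?thesis unfolding F_eq[abs_def] .
  qed
  have nF: "norm (F s) \<le> cmod (c s) * K" if "norm (R s) \<le> K" for s K
  proof (rule norm_blinfun_bound)
    have "0 \<le> K" using that norm_ge_zero order_trans by blast
    then show "0 \<le> cmod (c s) * K" by simp
    have "norm (resolvent D T (\<gamma> s) v) \<le> K * norm v" for v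
      using norm_blinfun[of "R s" v] mult_right_mono[OF that norm_ge_zero[of v]] by (simp add: R)
    then show "norm (F s v) \<le> cmod (c s) * K * norm v" for v
      by (simp add: Fapply norm_scaleC mult.assoc mult_left_mono)
  qed
  have nc: "cmod (c s) \<le> exp (Re (\<gamma> s) * t) * L'" for s
  proof -
    have "cmod (c s) = exp (Re (\<gamma> s) * t) * (norm (vector_derivative \<gamma> (at s)) / (2 * pi))"
      by (simp add: c_def norm_mult norm_divide)
    also have "\<dots> \<le> exp (Re (\<gamma> s) * t) * (L' / 1)"
      using L' pi_gt3 by (intro mult_left_mono frac_le) auto
    finally show ?thesis by simp
  qed
  have int: "F integrable_on {a..b}" for a b
  proof -
    have "compact (R ` {a..b})" "compact ((\<lambda>s. Re (\<gamma> s)) ` {a..b})"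
      by (intro compact_continuous_image continuous_intros continuous_on_subset[OF cR] continuous_on_subset[OF c\<gamma>]; simp)+
    then have "bounded (R ` {a..b})" "bounded ((\<lambda>s. Re (\<gamma> s)) ` {a..b})"
      by (simp_all add: compact_imp_bounded)
    then obtain K1 K2 where "\<forall>x\<in>R ` {a..b}. norm x \<le> K1" "\<forall>x\<in>(\<lambda>s. Re (\<gamma> s)) ` {a..b}. norm x \<le> K2"
      unfolding bounded_iff by blast
    then have K: "\<And>s. s \<in> {a..b} \<Longrightarrow> norm (R s) \<le> K1" "\<And>s. s \<in> {a..b} \<Longrightarrow> norm (Re (\<gamma> s)) \<le> K2"
      by auto
    show ?thesis
    proof (rule integrable_bounded_continuous_off_finite[OF S(1)])
      show "continuous_on ({a<..<b} - S) F" by (rule continuous_on_subset[OF cF]) auto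
      fix x assume "a < x" "x < b"
      then have x: "x \<in> {a..b}" by simp
      have "norm (F x) \<le> cmod (c x) * K1" by (rule nF[OF K(1)[OF x]])
      also have "\<dots> \<le> (exp (K2 * t) * L') * K1"
      proof (rule mult_right_mono)
        have "exp (Re (\<gamma> x) * t) \<le> exp (K2 * t)" using K(2)[OF x] t by simp
        then show "cmod (c x) \<le> exp (K2 * t) * L'"
          by (rule order_trans[OF nc mult_right_mono[OF _ L'(1)]])
        show "0 \<le> K1" using K(1)[OF x] norm_ge_zero order_trans by blast
      qed
      finally show "norm (F x) \<le> (exp (K2 * t) * L') * K1" .
    qed
  qed
  have RM: "norm (R s) \<le> M" if "- \<gamma> s \<in> sector \<omega> \<phi>" "1 \<le> cmod (- \<gamma> s - complex_of_real \<omega>)" for s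
  proof (rule norm_blinfun_bound)
    show "0 \<le> M" using M by simp
    fix v
    have rs: "- \<gamma> s \<in> resolvent_set D A" using that secsub by blast
    have "norm (R s v) = norm (resolvent D A (- \<gamma> s) (- v))"
      by (simp add: R T_def resolvent_uminus_eq[OF rs])
    also have "\<dots> \<le> onorm (resolvent D A (- \<gamma> s)) * norm (- v)"
      by (rule onorm[OF resolvent_bounded_linear[OF rs]])
    also have "\<dots> \<le> (M / cmod (- \<gamma> s - complex_of_real \<omega>)) * norm v"
      using mult_right_mono[OF est[OF that(1)] norm_ge_zero[of v]] by simp
    also have "\<dots> \<le> (M / 1) * norm v"
      by (intro mult_right_mono divide_left_mono) (use M that in \<open>auto intro: less_le_trans[OF zero_less_one]\<close>)
    finally show "norm (R s v) \<le> M * norm v" by simp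
  qed
  have ev1: "\<forall>\<^sub>F r in at_top. - (p + complex_of_real r * cis \<psi>) \<in> sector \<omega> \<phi> \<and> 1 \<le> cmod (- (p + complex_of_real r * cis \<psi>) - complex_of_real \<omega>)"
    by (rule eventually_ray_in_sector[OF \<phi>]) (use \<psi> pi_gt_zero in linarith)+
  have ev2: "\<forall>\<^sub>F r in at_top. - (q + complex_of_real r * cis (- \<psi>)) \<in> sector \<omega> \<phi> \<and> 1 \<le> cmod (- (q + complex_of_real r * cis (- \<psi>)) - complex_of_real \<omega>)"
    by (rule eventually_ray_in_sector[OF \<phi>]) (use \<psi> pi_gt_zero in linarith)+
  obtain R1 where R1: "\<And>r. r \<ge> R1 \<Longrightarrow> - (p + complex_of_real r * cis \<psi>) \<in> sector \<omega> \<phi> \<and> 1 \<le> cmod (- (p + complex_of_real r * cis \<psi>) - complex_of_real \<omega>)"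
    using ev1 unfolding eventually_at_top_linorder by blast
  obtain R2 where R2: "\<And>r. r \<ge> R2 \<Longrightarrow> - (q + complex_of_real r * cis (- \<psi>)) \<in> sector \<omega> \<phi> \<and> 1 \<le> cmod (- (q + complex_of_real r * cis (- \<psi>)) - complex_of_real \<omega>)"
    using ev2 unfolding eventually_at_top_linorder by blast
  have cosneg: "cos \<psi> < 0" using \<psi> \<phi> cos_monotone_0_pi[of "pi/2" \<psi>] by simp
  define \<delta> where "\<delta> = - cos \<psi> * t"
  have \<delta>: "\<delta> > 0" using cosneg t by (simp add: \<delta>_def mult_neg_pos)
  define C where "C = (exp (\<bar>Re p\<bar> * t) + exp (\<bar>Re q\<bar> * t)) * L' * M"
  have "F integrable_on UNIV"
  proof (rule integrable_on_UNIV_exp_decay[OF int \<delta>])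
    show "0 \<le> C" using L' M by (simp add: C_def)
    fix s :: real assume s: "max (max R1 R2) (max s0 0) \<le> \<bar>s\<bar>"
    have fin: "norm (F s) \<le> C * exp (- \<delta> * \<bar>s\<bar>)"
      if "- \<gamma> s \<in> sector \<omega> \<phi>" "1 \<le> cmod (- \<gamma> s - complex_of_real \<omega>)" and Re: "Re (\<gamma> s) = x + \<bar>s\<bar> * cos \<psi>" and x: "x = Re p \<or> x = Re q" for x
    proof -
      have "norm (F s) \<le> cmod (c s) * M" by (rule nF[OF RM[OF that(1,2)]])
      also have "\<dots> \<le> (exp (Re (\<gamma> s) * t) * L') * M" using nc M by (intro mult_right_mono) auto
      also have "exp (Re (\<gamma> s) * t) = exp (x * t) * exp (- \<delta> * \<bar>s\<bar>)"
        by (simp add: Re \<delta>_def algebra_simps flip: exp_add)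
      also have "\<dots> * L' * M = exp (x * t) * (exp (- \<delta> * \<bar>s\<bar>) * L' * M)" by simp
      also have "\<dots> \<le> (exp (\<bar>Re p\<bar> * t) + exp (\<bar>Re q\<bar> * t)) * (exp (- \<delta> * \<bar>s\<bar>) * L' * M)"
      proof (rule mult_right_mono)
        have 1: "exp (Re p * t) \<le> exp (\<bar>Re p\<bar> * t)" "exp (Re q * t) \<le> exp (\<bar>Re q\<bar> * t)"
          using t by (simp_all add: mult_right_mono)
        show "exp (x * t) \<le> exp (\<bar>Re p\<bar> * t) + exp (\<bar>Re q\<bar> * t)"
          using x
        proof
          assume "x = Re p"
          then show ?thesis using add_increasing2[OF exp_ge_zero 1(1)] by simp
        next
          assume "x = Re q"
          then show ?thesis using add_increasing[OF exp_ge_zero 1(2)] by simp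
        qed
        show "0 \<le> exp (- \<delta> * \<bar>s\<bar>) * L' * M" using L' M by simp
      qed
      finally show ?thesis by (simp add: C_def mult_ac)
    qed
    show "norm (F s) \<le> C * exp (- \<delta> * \<bar>s\<bar>)"
    proof (cases "s \<ge> 0")
      case True
      then have g: "\<gamma> s = p + complex_of_real s * cis \<psi>" using s by (intro ray1) auto
      show ?thesis by (rule fin[of "Re p"]) (use R1[of s] s True in \<open>auto simp: g\<close>)
    next
      case False
      then have g: "\<gamma> s = q + complex_of_real (- s) * cis (- \<psi>)" using s by (intro ray2) auto
      show ?thesis by (rule fin[of "Re q"]) (use R2[of "- s"] s False in \<open>auto simp: g\<close>)
    qed
  qed
  then show ?thesis by (simp add: F_def)
qed

text \<open>
  The values of the integral lie in the closure of the domain, as the values of the resolvent do; so a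
  trajectory that starts outside this closure jumps at \<open>t = 0\<close>.
\<close>

lemma semigroup_not_continuous:
  fixes D :: "'x::{complex_normed_vector, banach} set"
  assumes lin: "linear_operator scaleC D A" and sec: "sectorial_estimates D A \<omega> \<phi> M"
    and con: "semigroup_contour D A \<omega> \<phi> \<gamma>" and u0: "u0 \<notin> closure D"
  shows "\<not> continuous (at 0 within {0..}) (\<lambda>t. blinfun_apply (operator_semigroup D A \<gamma> t) u0)"
proof
  assume cont: "continuous (at 0 within {0..}) (\<lambda>t. blinfun_apply (operator_semigroup D A \<gamma> t) u0)"
  define T where "T = (\<lambda>u. - A u)"
  note LR = linear_operatorD[OF linear_operator_scaleC_imp_scaleR[OF lin]]
  have subD: "subspace D" by (rule subspaceI) (use LR in auto)
  have ran: "range \<gamma> \<subseteq> resolvent_set D T"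
    using con unfolding semigroup_contour_def T_def by blast
  have mem: "blinfun_apply (operator_semigroup D A \<gamma> t) u0 \<in> closure D" if t: "t > 0" for t
  proof -
    let ?F = "semigroup_integrand D A \<gamma> t"
    have "(?F has_integral integral UNIV ?F) UNIV"
      using semigroup_integrand_integrable[OF lin sec con t] by (rule integrable_integral)
    from has_integral_linear[OF this blinfun.bounded_linear_left[of u0]]
    have "((\<lambda>s. ?F s u0) has_integral blinfun_apply (integral UNIV ?F) u0) UNIV" by (simp add: o_def)
    then have "blinfun_apply (integral UNIV ?F) u0 \<in> closure D"
    proof (rule has_integral_in_closed_subspace[OF _ _ subspace_closure_normed[OF subD] closed_closure])
      fix s
      have z: "\<gamma> s \<in> resolvent_set D T" using ran by blast
      have "?F s u0 = (exp (\<gamma> s * complex_of_real t) * vector_derivative \<gamma> (at s) / (2 * \<i> * complex_of_real pi)) *\<^sub>C resolvent D T (\<gamma> s) u0"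
        unfolding semigroup_integrand_def T_def[symmetric]
        by (subst bounded_linear_Blinfun_apply) (auto intro: bounded_linear_compose[OF bounded_linear_scaleC resolvent_bounded_linear[OF z]])
      also have "\<dots> \<in> D" using lin resolvent_mem(1)[OF z] by (simp add: linear_operator_def)
      finally show "?F s u0 \<in> closure D" using closure_subset by blast
    qed
    then show ?thesis using t by (simp add: operator_semigroup_def)
  qed
  have "((\<lambda>t. blinfun_apply (operator_semigroup D A \<gamma> t) u0) \<longlongrightarrow> u0) (at 0 within {0..})"
    using cont by (simp add: continuous_within operator_semigroup_def)
  then have "u0 \<in> closure D"
  proof (rule Lim_in_closed_set[OF closed_closure, rotated 2])
    show "\<forall>\<^sub>F t in at 0 within {0..}. blinfun_apply (operator_semigroup D A \<gamma> t) u0 \<in> closure D"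
      using mem by (auto simp: eventually_at_filter)
    show "at (0::real) within {0..} \<noteq> bot"
      by (simp add: at_within_eq_bot_iff)
        (metis at_within_Ici_at_right trivial_limit_at_right_real at_within_eq_bot_iff)
  qed
  then show False using u0 by simp
qed


section \<open>Resolvent estimates in a sector\<close>

lemma cinner_scaleC_right: "cinner x (a *\<^sub>C y) = cnj a * cinner x y"
proof -
  have "cinner x (a *\<^sub>C y) = cnj (cinner (a *\<^sub>C y) x)" by (rule cinner_commute)
  also have "\<dots> = cnj a * cnj (cinner y x)" by (simp add: cinner_scaleC_left)
  also have "cnj (cinner y x) = cinner x y" by (rule cinner_commute[symmetric])
  finally show ?thesis .
qed

lemma inner_scaleC_scaleC: "inner (a *\<^sub>C x) (b *\<^sub>C x) = Re (a * cnj b) * (inner x x)" for x :: "'a::complex_inner"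
  unfolding inner_eq_Re_cinner[of "a *\<^sub>C x"] by (simp add: cinner_scaleC_left cinner_scaleC_right cinner_self algebra_simps)

lemma wform_scaleC_scaleC: "wform r (a *\<^sub>C u) (b *\<^sub>C u) = Re (a * cnj b) * wform r u u"
  for u :: "'z::{complex_inner, banach, second_countable_topology} l2uls"
proof -
  have "wform r (a *\<^sub>C u) (b *\<^sub>C u) = (LINT x|lebesgue. Re (a * cnj b) * (exp (- \<bar>x - r\<bar>) * inner (rep_l2uls u x) (rep_l2uls u x)))"
  proof (rule wform_eqI)
    show "AE x in lebesgue. exp (- \<bar>x - r\<bar>) * inner (rep_l2uls (a *\<^sub>C u) x) (rep_l2uls (b *\<^sub>C u) x)
      = Re (a * cnj b) * (exp (- \<bar>x - r\<bar>) * inner (rep_l2uls u x) (rep_l2uls u x))"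
      using rep_l2uls_scaleC[of a u] rep_l2uls_scaleC[of b u]
      by eventually_elim (simp only: inner_scaleC_scaleC mult.left_commute)
  qed (intro borel_measurable_times borel_measurable_const borel_measurable_integrable[OF integrable_wform])
  then show ?thesis by (simp only: integral_mult_right_zero wform_def)
qed

lemma complex_one_scaleC: "1 *\<^sub>C x = (x :: 'a::complex_vector)"
  using scaleC_of_real[of 1 x] by simp

lemma dquot_scaleC: "dquot h (c *\<^sub>C u) = c *\<^sub>C dquot h u"
  by (simp add: dquot_def translate_scaleC scaleC_diff_right scaleC_scaleC mult.commute flip: scaleC_of_real)

lemma scaleC_minus_12_add: "(- 12 + c) *\<^sub>C u = c *\<^sub>C u - 12 *\<^sub>R u" for u :: "'a::complex_vector"
proof -
  have "(- 12) *\<^sub>C u = - (12 *\<^sub>R u)" using scaleC_of_real[of "- 12" u] by simp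
  then show ?thesis using scaleC_add_left[of "- 12" c u] by (simp only: diff_conv_add_uminus add.commute)
qed

locale complex_m_accretive = m_accretive D B
  for D :: "'z::{complex_inner, banach, second_countable_topology} set" and B +
  assumes clin: "linear_operator scaleC D B" and real: "u \<in> D \<Longrightarrow> cinner (B u) u \<in> \<real>"
begin

text \<open>
  \<open>\<langle>B u, u\<rangle>\<close> is real, so only the real part of \<open>c\<close> matters.
\<close>

lemma wform_acts_scaleC:
  assumes "acts u g"
  shows "wform r g (c *\<^sub>C u) = Re c * wform r g u"
proof -
  have "wform r g (c *\<^sub>C u) = (LINT x|lebesgue. Re c * (exp (- \<bar>x - r\<bar>) * inner (rep_l2uls g x) (rep_l2uls u x)))"
  proof (rule wform_eqI)
    show "AE x in lebesgue. exp (- \<bar>x - r\<bar>) * inner (rep_l2uls g x) (rep_l2uls (c *\<^sub>C u) x)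
      = Re c * (exp (- \<bar>x - r\<bar>) * inner (rep_l2uls g x) (rep_l2uls u x))"
      using assms rep_l2uls_scaleC[of c u] unfolding acts_def
    proof eventually_elim
      case (elim x)
      then have "cinner (rep_l2uls g x) (rep_l2uls u x) \<in> \<real>" using real[of "rep_l2uls u x"] by simp
      then have "Im (cinner (rep_l2uls g x) (rep_l2uls u x)) = 0" by (simp add: complex_is_Real_iff)
      then show ?case by (simp add: elim inner_eq_Re_cinner cinner_scaleC_right)
    qed
  qed (intro borel_measurable_times borel_measurable_const borel_measurable_integrable[OF integrable_wform])
  then show ?thesis by (simp only: integral_mult_right_zero wform_def)
qed

text \<open>
  The equation is tested with \<open>\<sigma> u\<close>, where \<open>\<sigma>\<close> is the unit complex number whose direction is halfway
  between those of \<open>1\<close> and \<open>- \<zeta>\<close>: then both \<open>- lap h + B\<close> and \<open>- \<zeta>\<close> contribute with a positive real part.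
\<close>

lemma sector_energy:
  fixes h r :: real
  assumes h: "0 < h" "h \<le> 1" and u: "acts u g" and \<zeta>: "\<zeta> \<noteq> 0" "Re \<zeta> \<le> cmod \<zeta> / 2"
    and f: "f = - lap h u + g + 12 *\<^sub>R u - \<zeta> *\<^sub>C u"
  shows "(cmod \<zeta>)\<^sup>2 * wform r u u \<le> 4 * wform r f f"
proof -
  define m where "m = cmod \<zeta>"
  have m: "m > 0" using \<zeta>(1) by (simp add: m_def)
  define \<eta> where "\<eta> = - \<zeta> / complex_of_real m"
  define \<sigma> where "\<sigma> = csqrt \<eta>"
  have c\<eta>: "cmod \<eta> = 1" using m by (simp add: \<eta>_def norm_divide m_def)
  have \<zeta>\<eta>: "\<zeta> = - (complex_of_real m * \<eta>)" using m by (simp add: \<eta>_def)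
  have "Re \<zeta> / m \<le> 1/2" using \<zeta>(2) m by (simp add: m_def[symmetric] field_simps)
  then have Re\<eta>: "Re \<eta> \<ge> - (1/2)" by (simp add: \<eta>_def)
  have \<sigma>2: "\<sigma> * \<sigma> = \<eta>" using power2_csqrt[of \<eta>] by (simp add: \<sigma>_def power2_eq_square)
  have "cmod \<sigma> * cmod \<sigma> = 1" unfolding norm_mult[symmetric] \<sigma>2 by (rule c\<eta>)
  then have c\<sigma>: "cmod \<sigma> = 1" using norm_ge_zero[of \<sigma>] by (simp add: square_eq_1_iff)
  then have \<sigma>c: "\<sigma> * cnj \<sigma> = 1" by (simp add: complex_norm_square[symmetric])
  have Re\<sigma>: "Re \<sigma> \<ge> 1/2"
  proof -
    have "Re \<sigma> = sqrt ((1 + Re \<eta>) / 2)" by (simp add: \<sigma>_def c\<eta>)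
    moreover have "(1/2::real) \<le> sqrt ((1 + Re \<eta>) / 2)"
      by (rule real_le_rsqrt) (use Re\<eta> in \<open>simp add: power2_eq_square\<close>)
    ultimately show ?thesis by simp
  qed
  have \<zeta>\<sigma>: "Re (\<zeta> * cnj \<sigma>) = - (m * Re \<sigma>)"
  proof -
    have "\<zeta> * cnj \<sigma> = - (complex_of_real m * \<sigma> * (\<sigma> * cnj \<sigma>))" by (simp add: \<zeta>\<eta> \<sigma>2[symmetric] mult_ac)
    then show ?thesis by (simp add: \<sigma>c)
  qed
  define v where "v = \<sigma> *\<^sub>C u"
  define U where "U = wform r u u"
  define N where "N = wform (r - h) (dquot h u) (dquot h u)"
  have U0: "0 \<le> U" and N0: "0 \<le> N" by (auto simp: U_def N_def wform_self_nonneg)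
  have vv: "wform r v v = U"
    unfolding v_def wform_scaleC_scaleC by (simp add: \<sigma>c U_def)
  have uv: "wform r u v = Re \<sigma> * U"
    using wform_scaleC_scaleC[of r 1 u \<sigma>] by (simp add: v_def U_def complex_one_scaleC)
  have dv: "wform (r - h) (dquot h v) (dquot h u) = Re \<sigma> * N"
    using wform_scaleC_scaleC[of "r - h" \<sigma> "dquot h u" 1] by (simp add: v_def N_def complex_one_scaleC dquot_scaleC)
  have lv: "wform r v (- lap h u) \<ge> Re \<sigma> * N - (2 * (1/4) * N + 3 / (2 * (1/4)) * U)"
    unfolding wform_lap[of h r v u, OF less_imp_neq[OF h(1), symmetric]] dv
    using abs_le_D2[OF wform_lap_commutator[OF h, of "1/4" r v u]] unfolding vv N_def by linarith
  have "wform r f v = wform r v (- lap h u) + Re \<sigma> * wform r g u + 12 * (Re \<sigma> * U) + m * Re \<sigma> * U"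
  proof -
    have "wform r f v = wform r (- lap h u) v + wform r g v + 12 * wform r u v - wform r (\<zeta> *\<^sub>C u) v"
      unfolding f by (simp only: wform_add_left wform_diff_left wform_scaleR_left)
    moreover have "wform r (\<zeta> *\<^sub>C u) v = - (m * Re \<sigma> * U)"
      unfolding v_def wform_scaleC_scaleC \<zeta>\<sigma> U_def by simp
    moreover have "wform r g v = Re \<sigma> * wform r g u" unfolding v_def by (rule wform_acts_scaleC[OF u])
    ultimately show ?thesis using uv wform_commute[of r v "- lap h u"] by simp
  qed
  moreover have "Re \<sigma> * wform r g u \<ge> 0" using Re\<sigma> acts_wform_nonneg[OF u, of r] by simp
  moreover have "Re \<sigma> * N \<ge> (1/2) * N" "Re \<sigma> * U \<ge> (1/2) * U" "m * Re \<sigma> * U \<ge> m * (1/2) * U"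
    by (intro mult_right_mono mult_left_mono Re\<sigma> N0 U0 less_imp_le[OF m])+
  ultimately have "m * (1/2) * U \<le> wform r f v" using lv by simp
  also have "\<dots> \<le> (1 / m) * wform r f f + wform r v v / (4 * (1 / m))" by (rule wform_young) (use m in simp)
  finally have "m * U / 2 \<le> wform r f f / m + m * U / 4" by (simp add: vv mult.commute)
  then have "m * U / 4 \<le> wform r f f / m" by linarith
  then have "m * (m * U / 4) \<le> m * (wform r f f / m)" using m by (intro mult_left_mono) auto
  then show ?thesis using m by (simp add: m_def[symmetric] U_def power2_eq_square)
qed

lemma A_sector_bound:
  assumes u: "u \<in> A_domain D B" and \<zeta>: "\<zeta> \<noteq> 0" "Re \<zeta> \<le> cmod \<zeta> / 2"
  shows "cmod \<zeta> * norm u \<le> 7 * norm (A_operator B u + 12 *\<^sub>R u - \<zeta> *\<^sub>C u)"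
proof -
  obtain v w g where s: "gen u v" "gen v w" "acts u g" "A_operator B u = - w + g" using A_solution[OF u] by metis
  define F where "F = (\<lambda>h. - lap h u + g + 12 *\<^sub>R u - \<zeta> *\<^sub>C u)"
  have "((\<lambda>h. 7 * norm (F h)) \<longlongrightarrow> 7 * norm (A_operator B u + 12 *\<^sub>R u - \<zeta> *\<^sub>C u)) (at_right 0)"
    unfolding F_def s(4) by (intro tendsto_intros lap_tendsto[OF s(1,2)])
  moreover have "\<forall>\<^sub>F h in at_right 0. 0 < h \<and> h \<le> (1::real)"
    by (auto simp: eventually_at_right_field intro!: exI[of _ 1])
  then have "\<forall>\<^sub>F h in at_right 0. cmod \<zeta> * norm u \<le> 7 * norm (F h)"
  proof eventually_elim
    case (elim h)
    have "(norm (complex_of_real (cmod \<zeta>) *\<^sub>C u))\<^sup>2 \<le> 3 * (16 * (norm (F h))\<^sup>2)"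
    proof (rule norm_le_wform)
      fix r
      have "wform r (complex_of_real (cmod \<zeta>) *\<^sub>C u) (complex_of_real (cmod \<zeta>) *\<^sub>C u) = (cmod \<zeta>)\<^sup>2 * wform r u u"
        unfolding wform_scaleC_scaleC by (simp add: power2_eq_square)
      also have "\<dots> \<le> 4 * wform r (F h) (F h)" using elim by (intro sector_energy[OF _ _ s(3) \<zeta>]) (auto simp: F_def)
      also have "\<dots> \<le> 16 * (norm (F h))\<^sup>2" using wform_self_le[of r "F h"] by simp
      finally show "wform r (complex_of_real (cmod \<zeta>) *\<^sub>C u) (complex_of_real (cmod \<zeta>) *\<^sub>C u) \<le> 16 * (norm (F h))\<^sup>2" .
    qed
    also have "\<dots> \<le> (7 * norm (F h))\<^sup>2" by (simp add: power_mult_distrib)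
    finally have "norm (complex_of_real (cmod \<zeta>) *\<^sub>C u) \<le> 7 * norm (F h)" by (rule power2_le_imp_le) simp
    then show ?case by (simp add: norm_scaleC)
  qed
  ultimately show ?thesis by (rule tendsto_lowerbound) simp
qed

lemma A_linear_scaleC: "linear_operator scaleC (A_domain D B) (A_operator B)"
proof -
  have acts: "acts (c *\<^sub>C u) (c *\<^sub>C g)" if "acts u g" for c u g
    using that rep_l2uls_scaleC[of c u] rep_l2uls_scaleC[of c g] unfolding acts_def
    by eventually_elim (use clin in \<open>auto simp: linear_operator_def\<close>)
  have "c *\<^sub>C u \<in> A_domain D B \<and> A_operator B (c *\<^sub>C u) = c *\<^sub>C A_operator B u" if u: "u \<in> A_domain D B" for c u
  proof -
    obtain v w g where 1: "gen u v" "gen v w" "acts u g" "A_operator B u = - w + g" using A_solution[OF u] by metis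
    note 2 = gen_scaleC[OF 1(1), of c] gen_scaleC[OF 1(2), of c] acts[OF 1(3), of c]
    have "c *\<^sub>C u \<in> A_domain D B" unfolding mem_A_domain_iff using 2 by blast
    moreover have "A_operator B (c *\<^sub>C u) = c *\<^sub>C A_operator B u"
      using A_operator_eq[OF 2] 1(4) scaleC_add_right[of c "- w" g] scaleC_minus_right[of c w] by simp
    ultimately show ?thesis ..
  qed
  then show ?thesis using A_linear unfolding linear_operator_def by blast
qed

text \<open>
  In terms of \<open>\<zeta> = z + 12\<close> the sector is the complement of an open convex cone around the positive axis,
  so it is star-shaped with respect to \<open>\<zeta> = - 1\<close>.
\<close>

lemma segment_in_sector:
  assumes \<zeta>: "\<zeta> \<noteq> 0" "Re \<zeta> \<le> cmod \<zeta> / 2" and t: "0 \<le> t" "t \<le> (1::real)"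
  defines "\<xi> \<equiv> - 1 + complex_of_real t * (\<zeta> + 1)"
  shows "(1/2) * min 1 (cmod \<zeta>) \<le> cmod \<xi>" "\<xi> \<noteq> 0" "Re \<xi> \<le> cmod \<xi> / 2"
proof -
  \<comment> \<open>two sides of a triangle whose third side is \<open>\<xi>\<close>; the angle between them is at least \<open>\<pi> / 3\<close>\<close>
  define p q where "p = t * cmod \<zeta>" and "q = 1 - t"
  have pq: "0 \<le> p" "0 \<le> q" using t by (auto simp: p_def q_def)
  have Re: "Re \<xi> = t * Re \<zeta> - q" and Im: "Im \<xi> = t * Im \<zeta>" by (simp_all add: \<xi>_def q_def algebra_simps)
  have tRe: "t * Re \<zeta> \<le> p / 2" using mult_left_mono[OF \<zeta>(2) t(1)] by (simp add: p_def)
  have "(cmod \<xi>)\<^sup>2 = t\<^sup>2 * (cmod \<zeta>)\<^sup>2 + q\<^sup>2 - 2 * q * (t * Re \<zeta>)"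
    unfolding cmod_power2 Re Im by (simp add: power2_eq_square algebra_simps)
  also have "\<dots> \<ge> p\<^sup>2 + q\<^sup>2 - 2 * q * (p / 2)"
    using mult_left_mono[OF tRe pq(2)] by (simp add: p_def power_mult_distrib)
  finally have 1: "p\<^sup>2 + q\<^sup>2 - q * p \<le> (cmod \<xi>)\<^sup>2" by simp
  have "0 \<le> 3 * (p - q)\<^sup>2" by simp
  then have "((p + q) / 2)\<^sup>2 \<le> p\<^sup>2 + q\<^sup>2 - q * p" by (simp add: power2_eq_square field_simps)
  with 1 have "((p + q) / 2)\<^sup>2 \<le> (cmod \<xi>)\<^sup>2" by simp
  then have 2: "(p + q) / 2 \<le> cmod \<xi>" by (rule power2_le_imp_le) simp
  have "min 1 (cmod \<zeta>) = t * min 1 (cmod \<zeta>) + (1 - t) * min 1 (cmod \<zeta>)" by (simp add: algebra_simps)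
  also have "\<dots> \<le> t * cmod \<zeta> + (1 - t) * 1" using t by (intro add_mono mult_left_mono) auto
  finally show 3: "(1/2) * min 1 (cmod \<zeta>) \<le> cmod \<xi>" using 2 by (simp add: p_def q_def)
  moreover have "0 < (1/2) * min 1 (cmod \<zeta>)" using \<zeta>(1) by simp
  ultimately have "0 < cmod \<xi>" by linarith
  then show "\<xi> \<noteq> 0" by simp
  have "p = cmod (\<xi> + complex_of_real q)"
    using t by (simp add: \<xi>_def q_def p_def algebra_simps norm_mult)
  also have "\<dots> \<le> cmod \<xi> + q" using norm_triangle_ineq[of \<xi> "complex_of_real q"] pq by simp
  finally show "Re \<xi> \<le> cmod \<xi> / 2" unfolding Re using tRe pq by linarith
qed

text \<open>
  Continuation along the segment from \<open>- 13\<close>, that is \<open>\<zeta> = - 1\<close>.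
\<close>

lemma A_surj:
  assumes \<zeta>: "\<zeta> \<noteq> 0" "Re \<zeta> \<le> cmod \<zeta> / 2"
  shows "\<exists>u\<in>A_domain D B. (- 12 + \<zeta>) *\<^sub>C u - A_operator B u = f"
proof (rule surj_continuation[OF A_linear, of "(1/14) * min 1 (cmod \<zeta>)" "- 13"])
  show "0 < (1/14) * min 1 (cmod \<zeta>)" using \<zeta>(1) by simp
  show "\<exists>u\<in>A_domain D B. (- 13) *\<^sub>C u - A_operator B u = f" for f
  proof -
    obtain u where u: "u \<in> A_domain D B" "A_operator B u + 13 *\<^sub>R u = - f" using A_onto by blast
    have "(- 13) *\<^sub>C u = - (13 *\<^sub>R u)" using scaleC_of_real[of "- 13" u] by simp
    then have "(- 13) *\<^sub>C u - A_operator B u = - (A_operator B u + 13 *\<^sub>R u)" by simp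
    then have "(- 13) *\<^sub>C u - A_operator B u = f" using u(2) by simp
    then show ?thesis using u(1) by blast
  qed
  fix t :: real and u assume t: "0 \<le> t" "t \<le> 1" and u: "u \<in> A_domain D B"
  define \<xi> where "\<xi> = - 1 + complex_of_real t * (\<zeta> + 1)"
  note \<xi> = segment_in_sector[OF \<zeta> t, folded \<xi>_def]
  have "(- 13 + complex_of_real t * ((- 12 + \<zeta>) - (- 13))) = - 12 + \<xi>" by (simp add: \<xi>_def algebra_simps)
  moreover have "(- 12 + \<xi>) *\<^sub>C u - A_operator B u = - (A_operator B u + 12 *\<^sub>R u - \<xi> *\<^sub>C u)"
    by (simp only: scaleC_minus_12_add) simp
  ultimately have "norm ((- 13 + complex_of_real t * ((- 12 + \<zeta>) - (- 13))) *\<^sub>C u - A_operator B u) = norm (A_operator B u + 12 *\<^sub>R u - \<xi> *\<^sub>C u)"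
    by (metis norm_minus_cancel)
  moreover have "((1/2) * min 1 (cmod \<zeta>)) * norm u \<le> cmod \<xi> * norm u" by (intro mult_right_mono \<xi>(1)) simp
  ultimately show "(1/14) * min 1 (cmod \<zeta>) * norm u \<le> norm ((- 13 + complex_of_real t * ((- 12 + \<zeta>) - (- 13))) *\<^sub>C u - A_operator B u)"
    using A_sector_bound[OF u \<xi>(2,3)] by simp
qed

lemma A_resolvent_bound:
  assumes "u \<in> A_domain D B" "\<zeta> \<noteq> 0" "Re \<zeta> \<le> cmod \<zeta> / 2"
  shows "cmod \<zeta> * norm u \<le> 7 * norm ((- 12 + \<zeta>) *\<^sub>C u - A_operator B u)"
proof -
  have "(- 12 + \<zeta>) *\<^sub>C u - A_operator B u = - (A_operator B u + 12 *\<^sub>R u - \<zeta> *\<^sub>C u)"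
    by (simp only: scaleC_minus_12_add) simp
  then show ?thesis using A_sector_bound[OF assms] by (metis norm_minus_cancel)
qed

text \<open>
  The angle \<open>\<pi> / 3\<close> corresponds to the condition \<open>Re \<zeta> \<le> |\<zeta>| / 2\<close> on \<open>\<zeta> = z + 12\<close>.
\<close>

lemma sectorial_A: "sectorial_estimates (A_domain D B) (A_operator B) (- 12) (pi / 3) 7"
proof -
  have *: "z \<in> resolvent_set (A_domain D B) (A_operator B) \<and>
      onorm (resolvent (A_domain D B) (A_operator B) z) \<le> 7 / cmod (z - complex_of_real (- 12))"
    if z: "z \<in> sector (- 12) (pi / 3)" for z
  proof -
    define \<zeta> where "\<zeta> = z - complex_of_real (- 12)"
    have zz: "z = - 12 + \<zeta>" by (simp add: \<zeta>_def)
    have "z \<noteq> complex_of_real (- 12)" and a: "pi / 3 \<le> \<bar>Arg \<zeta>\<bar>" "\<bar>Arg \<zeta>\<bar> \<le> pi"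
      using z by (auto simp: sector_def \<zeta>_def)
    then have \<zeta>0: "\<zeta> \<noteq> 0" unfolding \<zeta>_def right_minus_eq by simp
    have "\<zeta> = rcis (cmod \<zeta>) (Arg \<zeta>)" by (simp add: rcis_cmod_Arg)
    then have "Re \<zeta> = cmod \<zeta> * cos (Arg \<zeta>)" by (metis Re_rcis)
    also have "cos (Arg \<zeta>) = cos \<bar>Arg \<zeta>\<bar>" by (simp add: abs_if)
    also have "\<dots> \<le> cos (pi / 3)" using a by (intro cos_monotone_0_pi_le) auto
    then have "cmod \<zeta> * cos \<bar>Arg \<zeta>\<bar> \<le> cmod \<zeta> * cos (pi / 3)" by (intro mult_left_mono) auto
    finally have \<zeta>1: "Re \<zeta> \<le> cmod \<zeta> / 2" by (simp add: cos_60)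
    define T where "T = (\<lambda>u. z *\<^sub>C u - A_operator B u)"
    note L = linear_operatorD[OF A_linear]
    have bd: "cmod \<zeta> * norm u \<le> 7 * norm (T u)" if "u \<in> A_domain D B" for u
      unfolding T_def zz by (rule A_resolvent_bound[OF that \<zeta>0 \<zeta>1])
    have Tadd: "T (u + v) = T u + T v" if "u \<in> A_domain D B" "v \<in> A_domain D B" for u v
      using that by (simp add: T_def L(4) scaleC_add_right)
    have Tscale: "T (c *\<^sub>R u) = c *\<^sub>R T u" if "u \<in> A_domain D B" for c u
      using that by (simp add: T_def L(6) scaleR_diff_right linear_scale[OF bounded_linear.linear[OF bounded_linear_scaleC]])
    have inj: "inj_on T (A_domain D B)"
    proof (rule inj_onI)
      fix u v assume uv: "u \<in> A_domain D B" "v \<in> A_domain D B" "T u = T v"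
      have "T (u - v) = 0"
        using Tadd[OF uv(1) L(5)[OF uv(2), of "-1"]] Tscale[OF uv(2), of "-1"] uv(3) by simp
      then have "cmod \<zeta> * norm (u - v) \<le> 0" using bd[OF L(7)[OF uv(1,2)]] by simp
      then show "u = v" using \<zeta>0 by (simp add: mult_le_0_iff)
    qed
    have surj: "T ` A_domain D B = UNIV"
      using A_surj[OF \<zeta>0 \<zeta>1] unfolding T_def zz by (auto simp: image_iff) metis
    define R where "R = resolvent (A_domain D B) (A_operator B) z"
    have R: "R f \<in> A_domain D B" "T (R f) = f" for f
      using surj unfolding R_def resolvent_def T_def[symmetric] by (auto intro: inv_into_into f_inv_into_f)
    have RI: "R f = u" if "u \<in> A_domain D B" "T u = f" for f u
      using inj_onD[OF inj _ R(1) that(1)] R(2) that(2) by metis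
    have Rb: "norm (R f) \<le> (7 / cmod \<zeta>) * norm f" for f
      using bd[OF R(1), of f] \<zeta>0 by (simp add: R(2) field_simps)
    have bl: "bounded_linear R"
    proof (rule bounded_linear_intro[where K = "7 / cmod \<zeta>"])
      show "R (f + g) = R f + R g" for f g by (rule RI) (simp_all add: L(3) R Tadd)
      show "R (c *\<^sub>R f) = c *\<^sub>R R f" for c f by (rule RI) (simp_all add: L(5) R Tscale)
      show "norm (R f) \<le> norm f * (7 / cmod \<zeta>)" for f using Rb[of f] by (simp add: mult.commute)
    qed
    have "onorm R \<le> 7 / cmod \<zeta>" by (rule onorm_bound[OF _ Rb]) simp
    moreover have "z \<in> resolvent_set (A_domain D B) (A_operator B)"
      using inj surj bl unfolding resolvent_set_def R_def T_def bij_betw_def by simp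
    ultimately show ?thesis by (simp add: R_def \<zeta>_def)
  qed
  then show ?thesis unfolding sectorial_estimates_def using pi_gt_zero by auto
qed

end


section \<open>The domain is not dense\<close>

text \<open>
  A unit vector that is orthogonal to a finite \<open>\<epsilon>\<close>-net of the unit ball of the graph norm has small inner
  products with all elements of this ball.
\<close>

lemma exists_almost_orthogonal:
  fixes D :: "'y::real_inner set"
  assumes lin: "linear_operator scaleR D B"
    and inf: "\<And>S :: 'y set. finite S \<Longrightarrow> span S \<noteq> UNIV"
    and net: "\<exists>F. finite F \<and> (\<forall>v\<in>D. norm v \<le> 1 \<and> norm (B v) \<le> 1 \<longrightarrow> (\<exists>k\<in>F. norm (v - k) < \<epsilon>))"
  shows "\<exists>y. norm y = 1 \<and> (\<forall>v\<in>D. \<bar>inner v y\<bar> \<le> \<epsilon> * (norm v + norm (B v)))"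
proof -
  note L = linear_operatorD[OF lin]
  obtain F where F: "finite F" "\<And>v. v \<in> D \<Longrightarrow> norm v \<le> 1 \<Longrightarrow> norm (B v) \<le> 1 \<Longrightarrow> \<exists>k\<in>F. norm (v - k) < \<epsilon>"
    using net by blast
  obtain y where y: "norm y = 1" "\<And>s. s \<in> F \<Longrightarrow> inner s y = 0"
    using exists_unit_vector_orthogonal_to_finite[OF F(1) inf] by blast
  have "\<bar>inner v y\<bar> \<le> \<epsilon> * (norm v + norm (B v))" if v: "v \<in> D" for v
  proof (cases "v = 0")
    case True
    then show ?thesis using L(2) by simp
  next
    case False
    define t where "t = norm v + norm (B v)"
    have t: "t > 0" using False by (simp add: t_def add_pos_nonneg)
    define w where "w = (1 / t) *\<^sub>R v"
    have w: "w \<in> D" "norm w \<le> 1" "norm (B w) \<le> 1"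
      using v t by (auto simp: w_def L(5,6) t_def divide_simps)
    obtain k where k: "k \<in> F" "norm (w - k) < \<epsilon>" using F(2)[OF w] by blast
    have "\<bar>inner w y\<bar> = \<bar>inner (w - k) y\<bar>" using y(2)[OF k(1)] by (simp add: inner_diff_left)
    also have "\<dots> \<le> norm (w - k) * norm y" by (rule Cauchy_Schwarz_ineq2)
    also have "\<dots> \<le> \<epsilon>" using k(2) y(1) by simp
    finally have "t * \<bar>inner w y\<bar> \<le> t * \<epsilon>" using t by (intro mult_left_mono) auto
    moreover have "t * \<bar>inner w y\<bar> = \<bar>inner v y\<bar>" using t by (simp add: w_def abs_mult)
    ultimately show ?thesis by (simp add: t_def mult.commute)
  qed
  then show ?thesis using y(1) by blast
qed

text \<open>
  The unit ball of the graph norm is contained in the image of a bounded set under the resolvent,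
  which is totally bounded.
\<close>

lemma compact_resolvent_net:
  fixes D :: "'z::complex_normed_vector set"
  assumes comp: "compact_resolvent D T" and \<epsilon>: "\<epsilon> > 0"
  shows "\<exists>F. finite F \<and> (\<forall>v\<in>D. norm v \<le> 1 \<and> norm (T v) \<le> 1 \<longrightarrow> (\<exists>k\<in>F. norm (v - k) < \<epsilon>))"
proof -
  obtain z where z: "z \<in> resolvent_set D T" and K: "compact_operator (resolvent D T z)"
    using comp unfolding compact_resolvent_def by blast
  have "compact (closure (resolvent D T z ` cball 0 (cmod z + 1)))"
    using K bounded_cball unfolding compact_operator_def by blast
  then obtain F where F: "finite F" "closure (resolvent D T z ` cball 0 (cmod z + 1)) \<subseteq> (\<Union>x\<in>F. ball x \<epsilon>)"
    using \<epsilon> unfolding compact_eq_totally_bounded by blast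
  have "\<exists>k\<in>F. norm (v - k) < \<epsilon>" if v: "v \<in> D" "norm v \<le> 1" "norm (T v) \<le> 1" for v
  proof -
    have "norm (z *\<^sub>C v - T v) \<le> norm (z *\<^sub>C v) + norm (T v)" by (rule norm_triangle_ineq4)
    also have "\<dots> \<le> cmod z * 1 + 1" unfolding norm_scaleC by (intro add_mono mult_left_mono v) simp
    finally have "z *\<^sub>C v - T v \<in> cball 0 (cmod z + 1)" by simp
    moreover have "resolvent D T z (z *\<^sub>C v - T v) = v" by (rule resolvent_eqI[OF z v(1) refl])
    ultimately have "v \<in> closure (resolvent D T z ` cball 0 (cmod z + 1))"
      by (metis closure_subset imageI subsetD)
    then obtain k where "k \<in> F" "v \<in> ball k \<epsilon>" using F(2) by blast
    then show ?thesis by (auto simp: dist_norm norm_minus_commute)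
  qed
  then show ?thesis using F(1) by blast
qed

definition staircase :: "(nat \<Rightarrow> 'y) \<Rightarrow> real \<Rightarrow> 'y" where
  "staircase y x = y (nat \<lfloor>x\<rfloor>)"

text \<open>
  A small translation changes a staircase only near the integers, where it changes it by at most \<open>2\<close>,
  however different the values on adjacent intervals are.
\<close>

lemma staircase_L2_ul_s:
  fixes y :: "nat \<Rightarrow> 'y::{banach, second_countable_topology}"
  assumes y: "\<And>n. norm (y n) = 1"
  shows "staircase y \<in> L2_ul_s"
proof -
  have "staircase y \<in> borel_measurable borel"
  proof -
    have "(\<lambda>k. y (nat k)) \<in> measurable (count_space UNIV) borel" by simp
    from measurable_compose[OF measurable_real_floor this] show ?thesis by (simp add: staircase_def[abs_def])
  qed
  then have m: "staircase y \<in> borel_measurable lebesgue" by (intro measurable_completion) simp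
  have Icc: "integrable lebesgue (indicat_real {a..b})" for a b :: real
    by (intro integrable_real_indicator) (simp_all add: emeasure_lborel_Icc_eq)
  have loc: "staircase y \<in> L2_loc"
    by (rule L2_loc_dominated[OF m, of "\<lambda>_. 1"]) (simp_all add: staircase_def y set_integrable_def Icc)
  have w: "staircase y \<in> L2_ul_w"
  proof (rule L2_ul_wI[OF loc, of 1])
    show "unit_norm a (staircase y) \<le> 1" for a
      by (simp add: unit_norm_def staircase_def y set_lebesgue_integral_def)
  qed
  have small: "ul_norm (\<lambda>x. staircase y x - staircase y (x - \<xi>)) \<le> sqrt (24 * \<bar>\<xi>\<bar>)" if \<xi>: "\<bar>\<xi>\<bar> < 1" for \<xi>
  proof (rule ul_norm_le)
    fix a
    let ?d = "\<lambda>x. staircase y x - staircase y (x - \<xi>)"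
    have d: "?d \<in> L2_loc" by (rule L2_ul_wD[OF L2_ul_w_diff[OF w L2_ul_w_shift[OF w]]])
    have "(unit_norm a ?d)\<^sup>2 \<le> (LINT x|lebesgue. (\<Sum>k\<in>{\<lfloor>a\<rfloor>..\<lfloor>a\<rfloor> + 2}. 4 * indicat_real {of_int k - \<bar>\<xi>\<bar>..of_int k + \<bar>\<xi>\<bar>} x))"
      unfolding unit_norm_power2 set_lebesgue_integral_def
    proof (rule integral_mono)
      show "integrable lebesgue (\<lambda>x. indicat_real {a..a + 1} x *\<^sub>R (norm (?d x))\<^sup>2)"
        using L2_loc_integrable[OF d] by (simp add: set_integrable_def)
      show "integrable lebesgue (\<lambda>x. \<Sum>k\<in>{\<lfloor>a\<rfloor>..\<lfloor>a\<rfloor> + 2}. 4 * indicat_real {of_int k - \<bar>\<xi>\<bar>..of_int k + \<bar>\<xi>\<bar>} x)"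
        by (intro Bochner_Integration.integrable_sum integrable_mult_right Icc)
      fix x
      show "indicat_real {a..a + 1} x *\<^sub>R (norm (?d x))\<^sup>2 \<le> (\<Sum>k\<in>{\<lfloor>a\<rfloor>..\<lfloor>a\<rfloor> + 2}. 4 * indicat_real {of_int k - \<bar>\<xi>\<bar>..of_int k + \<bar>\<xi>\<bar>} x)"
      proof (cases "x \<in> {a..a+1} \<and> \<lfloor>x\<rfloor> \<noteq> \<lfloor>x - \<xi>\<rfloor>")
        case True
        \<comment> \<open>an integer between \<open>x - \<xi>\<close> and \<open>x\<close>\<close>
        define k where "k = max \<lfloor>x\<rfloor> \<lfloor>x - \<xi>\<rfloor>"
        have ax: "a \<le> x" "x \<le> a + 1" using True by auto
        have "\<lfloor>a\<rfloor> \<le> \<lfloor>x\<rfloor>" "\<lfloor>x\<rfloor> \<le> \<lfloor>a + 2\<rfloor>" "\<lfloor>x - \<xi>\<rfloor> \<le> \<lfloor>a + 2\<rfloor>"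
          by (rule floor_mono, use ax \<xi> in linarith)+
        then have k1: "\<lfloor>a\<rfloor> \<le> k" "k \<le> \<lfloor>a\<rfloor> + 2" unfolding k_def by simp_all
        have k2: "of_int k - \<bar>\<xi>\<bar> \<le> x" "x \<le> of_int k + \<bar>\<xi>\<bar>"
          using True unfolding k_def by linarith+
        have "norm (?d x) \<le> norm (staircase y x) + norm (staircase y (x - \<xi>))" by (rule norm_triangle_ineq4)
        then have "norm (?d x) \<le> 2" by (simp add: staircase_def y)
        then have "(norm (?d x))\<^sup>2 \<le> 2\<^sup>2" by (intro power_mono) auto
        then have "indicat_real {a..a + 1} x *\<^sub>R (norm (?d x))\<^sup>2 \<le> 4 * indicat_real {of_int k - \<bar>\<xi>\<bar>..of_int k + \<bar>\<xi>\<bar>} x"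
          using True k2 by simp
        also have "\<dots> \<le> (\<Sum>k\<in>{\<lfloor>a\<rfloor>..\<lfloor>a\<rfloor> + 2}. 4 * indicat_real {of_int k - \<bar>\<xi>\<bar>..of_int k + \<bar>\<xi>\<bar>} x)"
          using k1 by (intro member_le_sum) auto
        finally show ?thesis .
      next
        case False
        then have zero: "indicat_real {a..a + 1} x *\<^sub>R (norm (?d x))\<^sup>2 = 0" by (auto simp: staircase_def indicator_def)
        show ?thesis unfolding zero by (rule sum_nonneg) simp
      qed
    qed
    also have "\<dots> = (\<Sum>k\<in>{\<lfloor>a\<rfloor>..\<lfloor>a\<rfloor> + 2}. 4 * (2 * \<bar>\<xi>\<bar>))"
      by (subst Bochner_Integration.integral_sum) (auto intro: integrable_mult_right Icc)
    also have "\<dots> = 24 * \<bar>\<xi>\<bar>" by simp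
    finally show "unit_norm a ?d \<le> sqrt (24 * \<bar>\<xi>\<bar>)" by (rule real_le_rsqrt)
  qed
  have "((\<lambda>\<xi>. ul_norm (\<lambda>x. staircase y x - staircase y (x - \<xi>))) \<longlongrightarrow> 0) (at 0)"
  proof (rule tendsto_sandwich[OF _ _ tendsto_const])
    show "\<forall>\<^sub>F \<xi> in at 0. 0 \<le> ul_norm (\<lambda>x. staircase y x - staircase y (x - \<xi>))"
      by (intro always_eventually allI ul_norm_nonneg L2_ul_w_diff[OF w L2_ul_w_shift[OF w]])
    show "\<forall>\<^sub>F \<xi> in at 0. ul_norm (\<lambda>x. staircase y x - staircase y (x - \<xi>)) \<le> sqrt (24 * \<bar>\<xi>\<bar>)"
      unfolding eventually_at using small by (intro exI[of _ 1]) auto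
    have "((\<lambda>\<xi>. sqrt (24 * \<bar>\<xi>\<bar>)) \<longlongrightarrow> sqrt (24 * \<bar>0\<bar>)) (at 0)" by (intro tendsto_intros)
    then show "((\<lambda>\<xi>. sqrt (24 * \<bar>\<xi>\<bar>)) \<longlongrightarrow> 0) (at 0)" by simp
  qed
  then show ?thesis using w by (simp add: L2_ul_s_def)
qed

text \<open>
  On \<open>[n, n + 1)\<close> the component of \<open>u \<in> D(A)\<close> along \<open>y\<^sub>n\<close> is at most \<open>(|u| + |B u|) / (n + 1)\<close>,
  which tends to \<open>0\<close> in \<open>L\<^sup>2\<close> as \<open>u\<close> and \<open>B u\<close> are uniformly locally bounded.
\<close>

lemma (in m_accretive) staircase_notin_closure:
  assumes y: "\<And>n. norm (y n) = 1"
    and orth: "\<And>n v. v \<in> D \<Longrightarrow> \<bar>inner v (y n)\<bar> \<le> (1 / real (Suc n)) * (norm v + norm (B v))"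
  shows "abs_l2uls (staircase y) \<notin> closure (A_domain D B)"
proof
  define u0 where "u0 = abs_l2uls (staircase y)"
  have rep0: "AE x in lebesgue. rep_l2uls u0 x = staircase y x"
    unfolding u0_def by (rule rep_abs_l2uls[OF staircase_L2_ul_s[OF y]])
  have far: "1 \<le> 2 * (norm (u0 - u))\<^sup>2" if ug: "acts u g" for u g
  proof -
    have bound: "1 \<le> 2 * (norm (u0 - u))\<^sup>2 + 4 * (1 / real (Suc n))\<^sup>2 * ((norm u)\<^sup>2 + (norm g)\<^sup>2)" for n
    proof -
      define \<epsilon> where "\<epsilon> = 1 / real (Suc n)"
      define S where "S = {real n..real n + 1}"
      have int: "integrable lebesgue (\<lambda>x. indicat_real S x *\<^sub>R (norm (rep_l2uls w x))\<^sup>2)" for w :: "'y l2uls"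
        using L2_loc_integrable[OF L2_ul_sD(2)[OF rep_l2uls_mem[of w]], of "real n" "real n + 1"] by (simp add: set_integrable_def S_def)
      have val: "(LINT x|lebesgue. indicat_real S x *\<^sub>R (norm (rep_l2uls w x))\<^sup>2) \<le> (norm w)\<^sup>2" for w :: "'y l2uls"
      proof -
        have "(LINT x|lebesgue. indicat_real S x *\<^sub>R (norm (rep_l2uls w x))\<^sup>2) = (unit_norm (real n) (rep_l2uls w))\<^sup>2"
          unfolding unit_norm_power2 by (simp add: set_lebesgue_integral_def S_def)
        also have "\<dots> \<le> (norm w)\<^sup>2"
          unfolding norm_rep_l2uls by (intro power_mono unit_norm_le_ul_norm[OF rep_l2uls_mem_w] unit_norm_nonneg)
        finally show ?thesis .
      qed
      have iS: "integrable lebesgue (indicat_real S)"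
        unfolding S_def by (intro integrable_real_indicator) (simp_all add: emeasure_lborel_Icc_eq)
      have "1 = (LINT x|lebesgue. indicat_real S x)" by (simp add: S_def)
      also have "\<dots> \<le> (LINT x|lebesgue. 2 * (indicat_real S x *\<^sub>R (norm (rep_l2uls (u0 - u) x))\<^sup>2)
          + 4 * \<epsilon>\<^sup>2 * (indicat_real S x *\<^sub>R (norm (rep_l2uls u x))\<^sup>2 + indicat_real S x *\<^sub>R (norm (rep_l2uls g x))\<^sup>2))"
      proof (rule integral_mono_AE[OF iS])
        show "integrable lebesgue (\<lambda>x. 2 * (indicat_real S x *\<^sub>R (norm (rep_l2uls (u0 - u) x))\<^sup>2)
          + 4 * \<epsilon>\<^sup>2 * (indicat_real S x *\<^sub>R (norm (rep_l2uls u x))\<^sup>2 + indicat_real S x *\<^sub>R (norm (rep_l2uls g x))\<^sup>2))"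
          by (intro Bochner_Integration.integrable_add integrable_mult_right int)
        have "{real n + 1} \<in> null_sets lebesgue" by (simp add: null_sets_completionI)
        then have ne: "AE x in lebesgue. x \<noteq> real n + 1" using AE_not_in by fastforce
        show "AE x in lebesgue. indicat_real S x \<le> 2 * (indicat_real S x *\<^sub>R (norm (rep_l2uls (u0 - u) x))\<^sup>2)
          + 4 * \<epsilon>\<^sup>2 * (indicat_real S x *\<^sub>R (norm (rep_l2uls u x))\<^sup>2 + indicat_real S x *\<^sub>R (norm (rep_l2uls g x))\<^sup>2)"
          using ne rep0 ug[unfolded acts_def] rep_l2uls_diff[of u0 u]
        proof eventually_elim
          case (elim x)
          show ?case
          proof (cases "x \<in> S")
            case True
            define v where "v = rep_l2uls u x"
            have "\<lfloor>x\<rfloor> = int n" using True elim(1) by (intro floor_unique) (auto simp: S_def)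
            then have u0x: "rep_l2uls u0 x = y n" using elim(2) by (simp add: staircase_def)
            define d where "d = norm (y n - v)"
            define p where "p = norm v"
            define q where "q = norm (rep_l2uls g x)"
            have d_eq: "norm (rep_l2uls (u0 - u) x) = d" using elim(4) u0x by (simp add: d_def v_def)
            have "1 = inner (y n) (y n)" using y[of n] by (simp add: power2_norm_eq_inner[symmetric])
            also have "\<dots> = inner (y n - v) (y n) + inner v (y n)" by (simp add: inner_diff_left)
            also have "inner (y n - v) (y n) \<le> d" using norm_cauchy_schwarz[of "y n - v" "y n"] y[of n] by (simp add: d_def)
            also have "inner v (y n) \<le> \<epsilon> * (p + q)"
              using orth[of v n] elim(3) by (simp add: v_def p_def q_def \<epsilon>_def abs_le_iff)
            finally have "1 \<le> d + \<epsilon> * (p + q)" by simp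
            then have "1\<^sup>2 \<le> (d + \<epsilon> * (p + q))\<^sup>2" by (intro power_mono) auto
            also have "\<dots> \<le> 2 * d\<^sup>2 + 2 * (\<epsilon> * (p + q))\<^sup>2"
              using zero_le_power2[of "d - \<epsilon> * (p + q)"] by (simp add: power2_diff power2_sum)
            also have "(\<epsilon> * (p + q))\<^sup>2 \<le> \<epsilon>\<^sup>2 * (2 * p\<^sup>2 + 2 * q\<^sup>2)"
              using zero_le_power2[of "p - q"]
              by (simp add: power_mult_distrib mult_left_mono power2_diff power2_sum)
            finally show ?thesis using True by (simp add: d_eq p_def q_def v_def algebra_simps)
          qed simp
        qed
      qed
      also have "\<dots> = 2 * (LINT x|lebesgue. indicat_real S x *\<^sub>R (norm (rep_l2uls (u0 - u) x))\<^sup>2)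
          + 4 * \<epsilon>\<^sup>2 * ((LINT x|lebesgue. indicat_real S x *\<^sub>R (norm (rep_l2uls u x))\<^sup>2) + (LINT x|lebesgue. indicat_real S x *\<^sub>R (norm (rep_l2uls g x))\<^sup>2))"
        by (simp only: integral_mult_right_zero Bochner_Integration.integral_add Bochner_Integration.integrable_add integrable_mult_right int)
      also have "\<dots> \<le> 2 * (norm (u0 - u))\<^sup>2 + 4 * \<epsilon>\<^sup>2 * ((norm u)\<^sup>2 + (norm g)\<^sup>2)"
        by (intro add_mono mult_left_mono val) auto
      finally show ?thesis by (simp add: \<epsilon>_def)
    qed
    have lim: "(\<lambda>n. 2 * (norm (u0 - u))\<^sup>2 + 4 * (1 / real (Suc n))\<^sup>2 * ((norm u)\<^sup>2 + (norm g)\<^sup>2))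
       \<longlonglongrightarrow> 2 * (norm (u0 - u))\<^sup>2 + 4 * 0\<^sup>2 * ((norm u)\<^sup>2 + (norm g)\<^sup>2)"
      by (intro tendsto_intros LIMSEQ_inverse_real_of_nat[unfolded inverse_eq_divide])
    have "1 \<le> 2 * (norm (u0 - u))\<^sup>2 + 4 * 0\<^sup>2 * ((norm u)\<^sup>2 + (norm g)\<^sup>2)"
      by (rule tendsto_lowerbound[OF lim]) (use bound in auto)
    then show ?thesis by simp
  qed
  assume "abs_l2uls (staircase y) \<in> closure (A_domain D B)"
  then obtain u where u: "u \<in> A_domain D B" "dist u u0 < 1/2"
    unfolding closure_approachable u0_def[symmetric] by (meson half_gt_zero zero_less_one)
  then obtain g where "acts u g" unfolding mem_A_domain_iff by blast
  from far[OF this] have "1 \<le> 2 * (norm (u0 - u))\<^sup>2" .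
  moreover have "(norm (u0 - u))\<^sup>2 \<le> (1/2)\<^sup>2" using u(2) by (intro power_mono) (auto simp: dist_norm norm_minus_commute)
  ultimately show False by (simp add: power2_eq_square)
qed

section \<open>Real and complex spaces\<close>

lemma complexification_simps:
  "re_part (0 :: 'a::real_inner complexification) = 0" "im_part (0 :: 'a complexification) = 0"
  "re_part (z + w) = re_part z + re_part w" "im_part (z + w) = im_part z + im_part w"
  "re_part (z - w) = re_part z - re_part w" "im_part (z - w) = im_part z - im_part w"
  "re_part (r *\<^sub>R z) = r *\<^sub>R re_part z" "im_part (r *\<^sub>R z) = r *\<^sub>R im_part z"
  for z w :: "'a::real_inner complexification"
  by (simp_all add: zero_complexification_def plus_complexification_def minus_complexification_def
      scaleR_complexification_def)

lemma norm_re_part_le: "norm (re_part z) \<le> norm z"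
  by (simp add: norm_complexification_def norm_eq_sqrt_inner inner_complexification_def)

lemma bounded_linear_Cx: "bounded_linear (\<lambda>y::'a::real_inner. Cx y 0)"
  by (rule bounded_linear_intro[where K = 1])
    (simp_all add: plus_complexification_def scaleR_complexification_def norm_complexification_def
      inner_complexification_def norm_eq_sqrt_inner)

text \<open>
  Symmetry of \<open>B\<close> makes the quadratic form of the complexification real: the mixed terms cancel.
\<close>

lemma complexification_complex_m_accretive:
  fixes D :: "'y::{real_inner, banach, second_countable_topology} set"
  assumes acc: "m_accretive D B" and sym: "\<And>u v. u \<in> D \<Longrightarrow> v \<in> D \<Longrightarrow> inner (B u) v = inner u (B v)"
  shows "complex_m_accretive (complexified_domain D) (complexified_operator B)"
proof -
  interpret m_accretive D B by (rule acc)
  note L = linear_operatorD[OF lin]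
  have clin: "linear_operator scaleC (complexified_domain D) (complexified_operator B)"
    unfolding linear_operator_def
    by (auto simp: complexified_domain_def complexified_operator_def complexification_simps
        scaleC_complexification_def plus_complexification_def L)
  show ?thesis
  proof
    show "linear_operator scaleR (complexified_domain D) (complexified_operator B)"
      by (rule linear_operator_scaleC_imp_scaleR[OF clin])
    show "linear_operator scaleC (complexified_domain D) (complexified_operator B)" by (rule clin)
    show "0 \<le> inner (complexified_operator B u) u" if "u \<in> complexified_domain D" for u
      using that accretive by (simp add: complexified_domain_def complexified_operator_def inner_complexification_def)
    show "cinner (complexified_operator B u) u \<in> \<real>" if "u \<in> complexified_domain D" for u
      using that sym[of "im_part u" "re_part u"]
      by (simp add: complexified_domain_def complexified_operator_def cinner_complexification_def complex_is_Real_iff inner_commute)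
    fix \<kappa> :: real and y :: "'y complexification" assume \<kappa>: "0 < \<kappa>"
    obtain p q where "p \<in> D" "B p + \<kappa> *\<^sub>R p = re_part y" "q \<in> D" "B q + \<kappa> *\<^sub>R q = im_part y"
      using onto[OF \<kappa>] by metis
    then show "\<exists>u\<in>complexified_domain D. complexified_operator B u + \<kappa> *\<^sub>R u = y"
      by (intro bexI[of _ "Cx p q"]) (simp_all add: complexified_domain_def complexified_operator_def
          plus_complexification_def scaleR_complexification_def)
  qed
qed

text \<open>
  The real part of the defining identity at \<open>u\<close> and at \<open>\<i> u\<close> contains the whole identity.
\<close>

lemma self_adjoint_complex_imp_real:
  fixes D :: "'z::complex_inner set"
  assumes sa: "self_adjoint_operator scaleC cinner D B"
  shows "self_adjoint_operator scaleR inner D B"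
proof -
  have clin: "linear_operator scaleC D B" and dense: "closure D = UNIV" and adj: "adjoint_graph cinner D B = operator_graph D B"
    using sa by (auto simp: self_adjoint_operator_def)
  have "adjoint_graph inner D B = adjoint_graph cinner D B"
  proof (intro set_eqI iffI; clarify)
    fix v w assume vw: "(v, w) \<in> adjoint_graph inner D B"
    have "cinner (B u) v = cinner u w" if u: "u \<in> D" for u
    proof -
      have iu: "\<i> *\<^sub>C u \<in> D" "B (\<i> *\<^sub>C u) = \<i> *\<^sub>C B u" using clin u by (auto simp: linear_operator_def)
      have "Re (cinner (B u) v) = Re (cinner u w)" using vw u by (simp add: adjoint_graph_def inner_eq_Re_cinner)
      moreover have "Re (cinner (B (\<i> *\<^sub>C u)) v) = Re (cinner (\<i> *\<^sub>C u) w)" using vw iu(1) by (simp add: adjoint_graph_def inner_eq_Re_cinner)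
      ultimately show ?thesis by (simp add: iu(2) cinner_scaleC_left complex_eq_iff)
    qed
    then show "(v, w) \<in> adjoint_graph cinner D B" by (simp add: adjoint_graph_def)
  next
    fix v w assume "(v, w) \<in> adjoint_graph cinner D B"
    then show "(v, w) \<in> adjoint_graph inner D B" by (simp add: adjoint_graph_def inner_eq_Re_cinner)
  qed
  then show ?thesis
    using linear_operator_scaleC_imp_scaleR[OF clin] dense adj by (simp add: self_adjoint_operator_def)
qed

lemma complexify_staircase:
  fixes y :: "nat \<Rightarrow> 'y::{real_inner, banach, second_countable_topology}"
  assumes y: "\<And>n. norm (y n) = 1"
  shows "complexify_l2uls (abs_l2uls (staircase y)) = abs_l2uls (staircase (\<lambda>n. Cx (y n) 0))"
proof -
  have n: "norm (Cx (y n) 0) = 1" for n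
    using y[of n] by (simp add: norm_complexification_def inner_complexification_def norm_eq_sqrt_inner)
  have "AE x in lebesgue. rep_l2uls (abs_l2uls (staircase y)) x = staircase y x"
    by (rule rep_abs_l2uls[OF staircase_L2_ul_s[OF y]])
  then have "AE x in lebesgue. Cx (rep_l2uls (abs_l2uls (staircase y)) x) 0 = staircase (\<lambda>n. Cx (y n) 0) x"
    by eventually_elim (simp add: staircase_def)
  then show ?thesis
    unfolding complexify_l2uls_def
    by (subst abs_l2uls_eq_iff[OF L2_ul_s_bounded_linear[OF bounded_linear_Cx rep_l2uls_mem] staircase_L2_ul_s[OF n]])
qed

lemma closed_operator_A:
  assumes "m_accretive D B"
  shows "closed_operator scaleR (A_domain D B) (A_operator B)"
  using m_accretive.A_linear[OF assms] m_accretive.A_graph_closed[OF assms] by (simp add: closed_operator_def)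

lemma closed_operator_A_scaleC:
  assumes "complex_m_accretive D B"
  shows "closed_operator scaleC (A_domain D B) (A_operator B)"
proof -
  interpret complex_m_accretive D B by (rule assms)
  show ?thesis using A_linear_scaleC A_graph_closed by (simp add: closed_operator_def)
qed

lemma semigroup_discontinuous:
  assumes acc: "complex_m_accretive D B" and u0: "u0 \<notin> closure (A_domain D B)"
    and "sectorial_estimates (A_domain D B) (A_operator B) \<omega> \<phi> M" "semigroup_contour (A_domain D B) (A_operator B) \<omega> \<phi> \<gamma>"
  shows "(\<forall>t>0. semigroup_integrand (A_domain D B) (A_operator B) \<gamma> t integrable_on UNIV) \<and>
    \<not> continuous (at 0 within {0..}) (\<lambda>t. blinfun_apply (operator_semigroup (A_domain D B) (A_operator B) \<gamma> t) u0)"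
proof -
  note lin = complex_m_accretive.A_linear_scaleC[OF acc]
  show ?thesis
    using semigroup_integrand_integrable[OF lin assms(3,4)] semigroup_not_continuous[OF lin assms(3,4) u0] by blast
qed

lemma A_on_real_space:
  fixes D :: "'y::{real_inner, banach, second_countable_topology} set"
  assumes inf: "\<forall>S :: 'y set. finite S \<longrightarrow> span S \<noteq> UNIV"
    and sa: "self_adjoint_operator scaleR inner D B" and pos: "positive_operator inner D B"
    and comp: "compact_resolvent (complexified_domain D) (complexified_operator B)"
  defines "AC_dom \<equiv> A_domain (complexified_domain D) (complexified_operator B)"
    and "AC \<equiv> A_operator (complexified_operator B)"
  shows "closed_operator scaleR (A_domain D B) (A_operator B)"
    and "\<exists>\<omega> \<phi> M. sectorial_estimates AC_dom AC \<omega> \<phi> M"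
    and "closure (A_domain D B) \<noteq> UNIV"
    and "\<exists>u\<^sub>0. \<forall>\<omega> \<phi> M \<gamma>. sectorial_estimates AC_dom AC \<omega> \<phi> M \<and> semigroup_contour AC_dom AC \<omega> \<phi> \<gamma> \<longrightarrow>
      (\<forall>t>0. semigroup_integrand AC_dom AC \<gamma> t integrable_on UNIV) \<and>
      \<not> continuous (at 0 within {0..}) (\<lambda>t. blinfun_apply (operator_semigroup AC_dom AC \<gamma> t) (complexify_l2uls u\<^sub>0))"
proof -
  have nonneg: "0 \<le> inner (B u) u" if "u \<in> D" for u
    using pos that by (auto simp: positive_operator_def elim!: nonneg_Reals_cases)
  have acc: "m_accretive D B" by (rule self_adjoint_imp_m_accretive[OF sa nonneg])
  interpret m_accretive D B by (rule acc)
  have sym: "inner (B u) v = inner u (B v)" if "u \<in> D" "v \<in> D" for u v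
  proof -
    have "(v, B v) \<in> adjoint_graph inner D B"
      using sa that(2) by (auto simp: self_adjoint_operator_def operator_graph_def)
    then show ?thesis using that(1) by (simp add: adjoint_graph_def)
  qed
  have cacc: "complex_m_accretive (complexified_domain D) (complexified_operator B)"
    by (rule complexification_complex_m_accretive[OF acc sym])
  have net: "\<exists>F. finite F \<and> (\<forall>v\<in>D. norm v \<le> 1 \<and> norm (B v) \<le> 1 \<longrightarrow> (\<exists>k\<in>F. norm (v - k) < \<epsilon>))" if \<epsilon>: "\<epsilon> > 0" for \<epsilon>
  proof -
    obtain F where F: "finite F" "\<And>v. v \<in> complexified_domain D \<Longrightarrow> norm v \<le> 1 \<Longrightarrow> norm (complexified_operator B v) \<le> 1
        \<Longrightarrow> \<exists>k\<in>F. norm (v - k) < \<epsilon>"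
      using compact_resolvent_net[OF comp \<epsilon>] by blast
    have "\<exists>k\<in>re_part ` F. norm (v - k) < \<epsilon>" if v: "v \<in> D" "norm v \<le> 1" "norm (B v) \<le> 1" for v
    proof -
      have "norm (Cx w 0) = norm w" for w :: 'y
        by (simp add: norm_complexification_def inner_complexification_def norm_eq_sqrt_inner)
      then obtain k where k: "k \<in> F" "norm (Cx v 0 - k) < \<epsilon>"
        using F(2)[of "Cx v 0"] v linear_operatorD(1,2)[OF lin] by (auto simp: complexified_domain_def complexified_operator_def)
      have "norm (v - re_part k) \<le> norm (Cx v 0 - k)"
        using norm_re_part_le[of "Cx v 0 - k"] by (simp add: complexification_simps)
      then show ?thesis using k by force
    qed
    then show ?thesis using F(1) by (intro exI[of _ "re_part ` F"]) auto
  qed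
  have "\<exists>y. norm y = 1 \<and> (\<forall>v\<in>D. \<bar>inner v y\<bar> \<le> (1 / real (Suc n)) * (norm v + norm (B v)))" for n
    by (rule exists_almost_orthogonal[OF lin]) (use inf net in auto)
  then obtain y where y: "\<And>n. norm (y n) = 1"
    "\<And>n v. v \<in> D \<Longrightarrow> \<bar>inner v (y n)\<bar> \<le> (1 / real (Suc n)) * (norm v + norm (B v))" by metis
  show "closed_operator scaleR (A_domain D B) (A_operator B)" by (rule closed_operator_A[OF acc])
  show "\<exists>\<omega> \<phi> M. sectorial_estimates AC_dom AC \<omega> \<phi> M"
    unfolding AC_dom_def AC_def using complex_m_accretive.sectorial_A[OF cacc] by blast
  show "closure (A_domain D B) \<noteq> UNIV" using staircase_notin_closure[OF y] by blast
  define y' where "y' = (\<lambda>n. Cx (y n) 0)"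
  interpret C: complex_m_accretive "complexified_domain D" "complexified_operator B" by (rule cacc)
  have "abs_l2uls (staircase y') \<notin> closure AC_dom"
    unfolding AC_dom_def
  proof (rule C.staircase_notin_closure)
    show "norm (y' n) = 1" for n
      using y(1)[of n] by (simp add: y'_def norm_complexification_def inner_complexification_def norm_eq_sqrt_inner)
    fix n v assume v: "v \<in> complexified_domain D"
    have "\<bar>inner v (y' n)\<bar> = \<bar>inner (re_part v) (y n)\<bar>" by (simp add: y'_def inner_complexification_def)
    also have "\<dots> \<le> (1 / real (Suc n)) * (norm (re_part v) + norm (B (re_part v)))"
      using v by (intro y(2)) (simp add: complexified_domain_def)
    also have "\<dots> \<le> (1 / real (Suc n)) * (norm v + norm (complexified_operator B v))"
      using norm_re_part_le[of v] norm_re_part_le[of "complexified_operator B v"]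
      by (intro mult_left_mono add_mono) (simp_all add: complexified_operator_def)
    finally show "\<bar>inner v (y' n)\<bar> \<le> (1 / real (Suc n)) * (norm v + norm (complexified_operator B v))" .
  qed
  then have notin: "complexify_l2uls (abs_l2uls (staircase y)) \<notin> closure AC_dom"
    unfolding complexify_staircase[OF y(1)] y'_def .
  show "\<exists>u\<^sub>0. \<forall>\<omega> \<phi> M \<gamma>. sectorial_estimates AC_dom AC \<omega> \<phi> M \<and> semigroup_contour AC_dom AC \<omega> \<phi> \<gamma> \<longrightarrow>
      (\<forall>t>0. semigroup_integrand AC_dom AC \<gamma> t integrable_on UNIV) \<and>
      \<not> continuous (at 0 within {0..}) (\<lambda>t. blinfun_apply (operator_semigroup AC_dom AC \<gamma> t) (complexify_l2uls u\<^sub>0))"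
    using semigroup_discontinuous[OF cacc, folded AC_dom_def AC_def, OF notin] by blast
qed

lemma A_on_complex_space:
  fixes D :: "'z::{complex_inner, banach, second_countable_topology} set"
  assumes inf: "\<forall>S :: 'z set. finite S \<longrightarrow> span S \<noteq> UNIV"
    and sa: "self_adjoint_operator scaleC cinner D B" and pos: "positive_operator cinner D B"
    and comp: "compact_resolvent D B"
  shows "closed_operator scaleC (A_domain D B) (A_operator B)"
    and "\<exists>\<omega> \<phi> M. sectorial_estimates (A_domain D B) (A_operator B) \<omega> \<phi> M"
    and "closure (A_domain D B) \<noteq> UNIV"
    and "\<exists>u\<^sub>0. \<forall>\<omega> \<phi> M \<gamma>. sectorial_estimates (A_domain D B) (A_operator B) \<omega> \<phi> M \<and> semigroup_contour (A_domain D B) (A_operator B) \<omega> \<phi> \<gamma> \<longrightarrow>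
      (\<forall>t>0. semigroup_integrand (A_domain D B) (A_operator B) \<gamma> t integrable_on UNIV) \<and>
      \<not> continuous (at 0 within {0..}) (\<lambda>t. blinfun_apply (operator_semigroup (A_domain D B) (A_operator B) \<gamma> t) u\<^sub>0)"
proof -
  have nn: "cinner (B u) u \<in> \<real>\<^sub>\<ge>\<^sub>0" if "u \<in> D" for u using pos that by (simp add: positive_operator_def)
  have re: "cinner (B u) u \<in> \<real>" if "u \<in> D" for u using nn[OF that] by (elim nonneg_Reals_cases) simp
  have nonneg: "0 \<le> inner (B u) u" if "u \<in> D" for u
    using nn[OF that] by (auto simp: inner_eq_Re_cinner elim!: nonneg_Reals_cases)
  have acc: "m_accretive D B"
    by (rule self_adjoint_imp_m_accretive[OF self_adjoint_complex_imp_real[OF sa] nonneg])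
  have cacc: "complex_m_accretive D B"
    unfolding complex_m_accretive_def complex_m_accretive_axioms_def
    using acc sa re by (simp add: self_adjoint_operator_def)
  interpret complex_m_accretive D B by (rule cacc)
  have "\<exists>y. norm y = 1 \<and> (\<forall>v\<in>D. \<bar>inner v y\<bar> \<le> (1 / real (Suc n)) * (norm v + norm (B v)))" for n
    by (rule exists_almost_orthogonal[OF lin]) (use inf compact_resolvent_net[OF comp] in auto)
  then obtain y where y: "\<And>n. norm (y n) = 1"
    "\<And>n v. v \<in> D \<Longrightarrow> \<bar>inner v (y n)\<bar> \<le> (1 / real (Suc n)) * (norm v + norm (B v))" by metis
  note notin = staircase_notin_closure[OF y]
  show "closed_operator scaleC (A_domain D B) (A_operator B)" by (rule closed_operator_A_scaleC[OF cacc])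
  show "\<exists>\<omega> \<phi> M. sectorial_estimates (A_domain D B) (A_operator B) \<omega> \<phi> M" using sectorial_A by blast
  show "closure (A_domain D B) \<noteq> UNIV" using notin by blast
  show "\<exists>u\<^sub>0. \<forall>\<omega> \<phi> M \<gamma>. sectorial_estimates (A_domain D B) (A_operator B) \<omega> \<phi> M \<and> semigroup_contour (A_domain D B) (A_operator B) \<omega> \<phi> \<gamma> \<longrightarrow>
      (\<forall>t>0. semigroup_integrand (A_domain D B) (A_operator B) \<gamma> t integrable_on UNIV) \<and>
      \<not> continuous (at 0 within {0..}) (\<lambda>t. blinfun_apply (operator_semigroup (A_domain D B) (A_operator B) \<gamma> t) u\<^sub>0)"
    using semigroup_discontinuous[OF cacc notin] by blast
qed

theorem proposition1p4:
  fixes D :: "'y::{real_inner, banach, second_countable_topology} set"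
    and B :: "'y \<Rightarrow> 'y"
    and D' :: "'z::{complex_inner, banach, second_countable_topology} set"
    and B' :: "'z \<Rightarrow> 'z"
  defines "A_dom \<equiv> A_domain D B"
    and "A \<equiv> A_operator B"
    and "A\<^sub>C_dom \<equiv> A_domain (complexified_domain D) (complexified_operator B)"
    and "A\<^sub>C \<equiv> A_operator (complexified_operator B)"
    and "A'_dom \<equiv> A_domain D' B'"
    and "A' \<equiv> A_operator B'"
  shows
    "((\<forall>S :: 'y set. finite S \<longrightarrow> span S \<noteq> UNIV) \<and>
      self_adjoint_operator scaleR inner D B \<and>
      positive_operator inner D B \<and>
      compact_resolvent (complexified_domain D) (complexified_operator B)
      \<longrightarrow>
      closed_operator scaleR A_dom A \<and>
      (\<exists>\<omega> \<phi> M. sectorial_estimates A\<^sub>C_dom A\<^sub>C \<omega> \<phi> M) \<and>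
      closure A_dom \<noteq> UNIV \<and>
      (\<exists>u\<^sub>0. \<forall>\<omega> \<phi> M \<gamma>.
         sectorial_estimates A\<^sub>C_dom A\<^sub>C \<omega> \<phi> M \<and> semigroup_contour A\<^sub>C_dom A\<^sub>C \<omega> \<phi> \<gamma> \<longrightarrow>
         (\<forall>t>0. semigroup_integrand A\<^sub>C_dom A\<^sub>C \<gamma> t integrable_on UNIV) \<and>
         \<not> continuous (at 0 within {0..})
             (\<lambda>t. blinfun_apply (operator_semigroup A\<^sub>C_dom A\<^sub>C \<gamma> t) (complexify_l2uls u\<^sub>0))))
     \<and>
     ((\<forall>S :: 'z set. finite S \<longrightarrow> span S \<noteq> UNIV) \<and>
      self_adjoint_operator scaleC cinner D' B' \<and>
      positive_operator cinner D' B' \<and>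
      compact_resolvent D' B'
      \<longrightarrow>
      closed_operator scaleC A'_dom A' \<and>
      (\<exists>\<omega> \<phi> M. sectorial_estimates A'_dom A' \<omega> \<phi> M) \<and>
      closure A'_dom \<noteq> UNIV \<and>
      (\<exists>u\<^sub>0. \<forall>\<omega> \<phi> M \<gamma>.
         sectorial_estimates A'_dom A' \<omega> \<phi> M \<and> semigroup_contour A'_dom A' \<omega> \<phi> \<gamma> \<longrightarrow>
         (\<forall>t>0. semigroup_integrand A'_dom A' \<gamma> t integrable_on UNIV) \<and>
         \<not> continuous (at 0 within {0..})
             (\<lambda>t. blinfun_apply (operator_semigroup A'_dom A' \<gamma> t) u\<^sub>0)))"
  unfolding A_dom_def A_def A\<^sub>C_dom_def A\<^sub>C_def A'_dom_def A'_def
  by (intro conjI impI; elim conjE; (rule A_on_real_space A_on_complex_space; assumption))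

end
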